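(* Let $k$ be a perfect field of characteristic $p>0$, and let $C, D$ be connected graded cocommutative $k$-coalgebras of finite type. Then the following are equivalent: (a) $\bar C \simeq \bar D$ as $V$-modules; (b) $J(C) \simeq J(D)$ as graded coalgebras; (c) $J(C) \simeq J(D)$ as graded Hopf algebras.
   Context: Graded vector spaces $M=\{M_n\}_{n\ge 0}$ are non-negatively graded over $k$ and of finite type (each $M_n$ finite dimensional); $\bar M$ denotes the positive degree part, and $M$ is reduced if $M_0=0$. The tensor product is the graded one, with braiding $x\otimes y\mapsto (-1)^{|x||y|}y\otimes x$, so "cocommutative" means graded cocommutative. "Connected" means the degree $0$ part is $k$. A $V$-module is a reduced graded $k$-vector space $M$ of finite type with maps $V:M_{pn}\to M_n$, for all $n$ if $p=2$ and for even $n$ if $p$ is odd, such that $V(x+y)=V(x)+V(y)$ and $V(\lambda x)=\lambda^{1/p}V(x)$ for $\lambda\in k$; morphisms are degree preserving linear maps commuting with $V$. For a connected cocommutative graded coalgebra $C$ of finite type, $\bar C$ is a $V$-module with $V$ dual to the $p$-th power map of the dual commutative algebra $C^\vee$: $\langle a,V(c)\rangle^p=\langle a^p,c\rangle$. $\mathcal C_*(k)$ is the category of connected cocommutative graded coalgebras of finite type, and $\mathcal H_*(k)$ is the category of connected cocommutative graded Hopf algebras of finite type. $J:\mathcal C_*(k)\to\mathcal H_*(k)$ is the left adjoint of the forgetful functor. Explicitly, $J(C)$ is, as an algebra, the tensor algebra $\bigoplus_{r\ge0}\bar C^{\otimes r}$, and its coproduct is the unique algebra map $J(C)\to J(C)\otimes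 J(C)$ extending $\bar C\xrightarrow{\Delta_C}\overline{C\otimes C}\hookrightarrow J(C)\otimes J(C)$. *)

theory Defs
  imports Complex_Main "HOL-Library.Function_Algebras"
begin

section \<open>Vector spaces and tensor products\<close>

text \<open>
  A vector space is given as a subspace of an ambient type with a scalar multiplication. A graded
  vector space is literally a family indexed by the degree, of type \<open>nat \<Rightarrow> ('k, 'a) vspace\<close>; only
  the members of the family matter, not how they sit in the ambient type. A map of graded objects is
  a family \<open>f n\<close> as well, and maps are compared on the carriers only.
\<close>

record ('k, 'a) vspace =
  carr :: "'a set"
  smul :: "'k \<Rightarrow> 'a \<Rightarrow> 'a"

definition fin_dim_space :: "('k::field, 'a::ab_group_add) vspace \<Rightarrow> bool" where
  "fin_dim_space V \<longleftrightarrow> vector_space (smul V) \<and> module.subspace (smul V) (carr V) \<and>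
     (\<exists>B. finite B \<and> carr V = module.span (smul V) B)"

definition lin_map :: "('k::field, 'a::ab_group_add) vspace \<Rightarrow> ('k, 'b::ab_group_add) vspace
    \<Rightarrow> ('a \<Rightarrow> 'b) \<Rightarrow> bool" where
  "lin_map V W f \<longleftrightarrow> (\<forall>x\<in>carr V. f x \<in> carr W) \<and>
     (\<forall>x\<in>carr V. \<forall>y\<in>carr V. f (x + y) = f x + f y) \<and>
     (\<forall>a. \<forall>x\<in>carr V. f (smul V a x) = smul W a (f x))"

definition lin_iso :: "('k::field, 'a::ab_group_add) vspace \<Rightarrow> ('k, 'b::ab_group_add) vspace
    \<Rightarrow> ('a \<Rightarrow> 'b) \<Rightarrow> bool" where
  "lin_iso V W f \<longleftrightarrow> lin_map V W f \<and> bij_betw f (carr V) (carr W)"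

definition ground :: "('k::field, 'k) vspace" where
  "ground = \<lparr>carr = UNIV, smul = (*)\<rparr>"

definition dual_space :: "('k::field, 'a::ab_group_add) vspace \<Rightarrow> ('a \<Rightarrow> 'k) set" where
  "dual_space V = {a. lin_map V ground a}"

definition fscale :: "'k \<Rightarrow> ('x \<Rightarrow> 'k) \<Rightarrow> 'x \<Rightarrow> 'k::field" where
  "fscale a f = (\<lambda>x. a * f x)"

definition bilin_forms :: "('k::field, 'a::ab_group_add) vspace \<Rightarrow> ('k, 'b::ab_group_add) vspace
    \<Rightarrow> ('a \<times> 'b \<Rightarrow> 'k) set" where
  "bilin_forms V W = {\<beta>. (\<forall>x\<in>carr V. (\<lambda>y. \<beta> (x, y)) \<in> dual_space W) \<and>
                         (\<forall>y\<in>carr W. (\<lambda>x. \<beta> (x, y)) \<in> dual_space V)}"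

text \<open>
  The tensor product over a field, realised inside the dual of the space of bilinear forms: the
  elementary tensor of \<open>x\<close> and \<open>y\<close> is evaluation of bilinear forms at \<open>(x, y)\<close>. Two sums of
  elementary tensors are equal iff every bilinear form takes the same value on them, which is
  equality in the usual tensor product because linear functionals separate points. To keep
  elements extensional, they are \<open>0\<close> on arguments that are not bilinear forms. A map out of the
  tensor product is obtained by pulling back bilinear forms.
\<close>

type_synonym ('k, 'a, 'b) tensor = "('a \<times> 'b \<Rightarrow> 'k) \<Rightarrow> 'k"

definition tens :: "('k::field, 'a::ab_group_add) vspace \<Rightarrow> ('k, 'b::ab_group_add) vspace
    \<Rightarrow> 'a \<Rightarrow> 'b \<Rightarrow> ('k, 'a, 'b) tensor" where
  "tens V W x y = (\<lambda>\<beta>. if \<beta> \<in> bilin_forms V W then \<beta> (x, y) else 0)"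

definition tensor_space :: "('k::field, 'a::ab_group_add) vspace \<Rightarrow> ('k, 'b::ab_group_add) vspace
    \<Rightarrow> ('k, ('k, 'a, 'b) tensor) vspace" where
  "tensor_space V W =
     \<lparr>carr = module.span fscale {tens V W x y | x y. x \<in> carr V \<and> y \<in> carr W}, smul = fscale\<rparr>"

text \<open>The map \<open>f \<otimes> g\<close> with values in the tensor product of \<open>V\<close> and \<open>W\<close>.\<close>

definition tensor_map :: "('k::field, 'b::ab_group_add) vspace \<Rightarrow> ('k, 'd::ab_group_add) vspace
    \<Rightarrow> ('a \<Rightarrow> 'b) \<Rightarrow> ('c \<Rightarrow> 'd) \<Rightarrow> ('k, 'a, 'c) tensor \<Rightarrow> ('k, 'b, 'd) tensor" where
  "tensor_map V W f g t =
     (\<lambda>\<beta>. if \<beta> \<in> bilin_forms V W then t (\<lambda>(x, y). \<beta> (f x, g y)) else 0)"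

text \<open>The associativity map sending \<open>(x \<otimes> y) \<otimes> z\<close> to \<open>x \<otimes> (y \<otimes> z)\<close>.\<close>

definition tensor_assoc :: "('k::field, 'a::ab_group_add) vspace \<Rightarrow> ('k, 'b::ab_group_add) vspace
    \<Rightarrow> ('k, 'c::ab_group_add) vspace
    \<Rightarrow> ('k, ('k, 'a, 'b) tensor, 'c) tensor \<Rightarrow> ('k, 'a, ('k, 'b, 'c) tensor) tensor" where
  "tensor_assoc U V W t =
     (\<lambda>\<beta>. if \<beta> \<in> bilin_forms U (tensor_space V W)
          then t (\<lambda>(s, z). s (\<lambda>(x, y). \<beta> (x, tens V W y z))) else 0)"

text \<open>The braiding on elements \<open>x \<otimes> y\<close> with \<open>x \<in> M i\<close> and \<open>y \<in> M j\<close>.\<close>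

definition braiding :: "(nat \<Rightarrow> ('k::field, 'a::ab_group_add) vspace) \<Rightarrow> nat \<Rightarrow> nat
    \<Rightarrow> ('k, 'a, 'a) tensor \<Rightarrow> ('k, 'a, 'a) tensor" where
  "braiding M i j t =
     (\<lambda>\<beta>. if \<beta> \<in> bilin_forms (M j) (M i) then (- 1) ^ (i * j) * t (\<lambda>(x, y). \<beta> (y, x)) else 0)"


section \<open>Graded coalgebras\<close>

text \<open>
  The degree \<open>n\<close> part of the graded tensor product is the direct sum of the tensor products of
  \<open>C i\<close> and \<open>C j\<close> over \<open>i + j = n\<close>, so a coproduct is the family of its components
  \<open>comult C i j\<close> from degree \<open>i + j\<close> to the tensor product of degrees \<open>i\<close> and \<open>j\<close>.
  The counit is determined by its restriction to degree \<open>0\<close>; connectedness says that this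
  restriction identifies the degree \<open>0\<close> part with the ground field.
\<close>

record ('k, 'a) gcoalg =
  part :: "nat \<Rightarrow> ('k, 'a) vspace"
  comult :: "nat \<Rightarrow> nat \<Rightarrow> 'a \<Rightarrow> ('k, 'a, 'a) tensor"
  counit :: "'a \<Rightarrow> 'k"

abbreviation cpart :: "('k, 'a, 'z) gcoalg_scheme \<Rightarrow> nat \<Rightarrow> 'a set" where
  "cpart C n \<equiv> carr (part C n)"

definition graded_coalgebra :: "('k::field, 'a::ab_group_add) gcoalg \<Rightarrow> bool" where
  "graded_coalgebra C \<longleftrightarrow>
     (\<forall>n. fin_dim_space (part C n)) \<and>
     (\<forall>i j. lin_map (part C (i + j)) (tensor_space (part C i) (part C j)) (comult C i j)) \<and>
     lin_map (part C 0) ground (counit C) \<and>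
     (\<forall>i j l. \<forall>c\<in>cpart C (i + j + l).
        tensor_assoc (part C i) (part C j) (part C l)
          (tensor_map (tensor_space (part C i) (part C j)) (part C l)
             (comult C i j) id (comult C (i + j) l c)) =
        tensor_map (part C i) (tensor_space (part C j) (part C l))
             id (comult C j l) (comult C i (j + l) c)) \<and>
     (\<forall>n. \<forall>c\<in>cpart C n.
        tensor_map ground (part C n) (counit C) id (comult C 0 n c) = tens ground (part C n) 1 c \<and>
        tensor_map (part C n) ground id (counit C) (comult C n 0 c) = tens (part C n) ground c 1)"

definition cocommutative :: "('k::field, 'a::ab_group_add) gcoalg \<Rightarrow> bool" where
  "cocommutative C \<longleftrightarrow>
     (\<forall>i j. \<forall>c\<in>cpart C (i + j). braiding (part C) i j (comult C i j c) = comult C j i c)"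

definition connected_coalgebra :: "('k::field, 'a::ab_group_add) gcoalg \<Rightarrow> bool" where
  "connected_coalgebra C \<longleftrightarrow> lin_iso (part C 0) ground (counit C)"

definition coalgebra_iso :: "('k::field, 'a::ab_group_add, 'y) gcoalg_scheme
    \<Rightarrow> ('k, 'b::ab_group_add, 'z) gcoalg_scheme \<Rightarrow> (nat \<Rightarrow> 'a \<Rightarrow> 'b) \<Rightarrow> bool" where
  "coalgebra_iso C D f \<longleftrightarrow>
     (\<forall>n. lin_iso (part C n) (part D n) (f n)) \<and>
     (\<forall>i j. \<forall>c\<in>cpart C (i + j).
        comult D i j (f (i + j) c) =
        tensor_map (part D i) (part D j) (f i) (f j) (comult C i j c)) \<and>
     (\<forall>c\<in>cpart C 0. counit D (f 0 c) = counit C c)"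

definition coalgebra_isomorphic :: "('k::field, 'a::ab_group_add, 'y) gcoalg_scheme
    \<Rightarrow> ('k, 'b::ab_group_add, 'z) gcoalg_scheme \<Rightarrow> bool" where
  "coalgebra_isomorphic C D \<longleftrightarrow> (\<exists>f. coalgebra_iso C D f)"


section \<open>V-modules\<close>

record ('k, 'a) vmodule =
  vpart :: "nat \<Rightarrow> ('k, 'a) vspace"
  vmap :: "nat \<Rightarrow> 'a \<Rightarrow> 'a"

text \<open>The map \<open>vmap M n\<close> goes from degree \<open>p * n\<close> to degree \<open>n\<close>.\<close>

definition v_degree :: "nat \<Rightarrow> nat \<Rightarrow> bool" where
  "v_degree p n \<longleftrightarrow> p = 2 \<or> even n"

definition pth_root :: "nat \<Rightarrow> 'k::field \<Rightarrow> 'k" where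
  "pth_root p x = (THE y. y ^ p = x)"

definition v_module :: "nat \<Rightarrow> ('k::field, 'a::ab_group_add) vmodule \<Rightarrow> bool" where
  "v_module p M \<longleftrightarrow>
     (\<forall>n. fin_dim_space (vpart M n)) \<and> carr (vpart M 0) = {0} \<and>
     (\<forall>n. v_degree p n \<longrightarrow>
        (\<forall>x\<in>carr (vpart M (p * n)). vmap M n x \<in> carr (vpart M n)) \<and>
        (\<forall>x\<in>carr (vpart M (p * n)). \<forall>y\<in>carr (vpart M (p * n)).
           vmap M n (x + y) = vmap M n x + vmap M n y) \<and>
        (\<forall>a. \<forall>x\<in>carr (vpart M (p * n)).
           vmap M n (smul (vpart M (p * n)) a x) = smul (vpart M n) (pth_root p a) (vmap M n x)))"

definition v_module_iso :: "nat \<Rightarrow> ('k::field, 'a::ab_group_add) vmodule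
    \<Rightarrow> ('k, 'b::ab_group_add) vmodule \<Rightarrow> (nat \<Rightarrow> 'a \<Rightarrow> 'b) \<Rightarrow> bool" where
  "v_module_iso p M N f \<longleftrightarrow>
     (\<forall>n. lin_iso (vpart M n) (vpart N n) (f n)) \<and>
     (\<forall>n. v_degree p n \<longrightarrow> (\<forall>x\<in>carr (vpart M (p * n)). f n (vmap M n x) = vmap N n (f (p * n) x)))"

definition v_module_isomorphic :: "nat \<Rightarrow> ('k::field, 'a::ab_group_add) vmodule
    \<Rightarrow> ('k, 'b::ab_group_add) vmodule \<Rightarrow> bool" where
  "v_module_isomorphic p M N \<longleftrightarrow> v_module p M \<and> v_module p N \<and> (\<exists>f. v_module_iso p M N f)"

text \<open>
  The \<open>m\<close>-th power, in the dual algebra, of a functional \<open>a\<close> on degree \<open>n\<close>: a functional on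
  degree \<open>m * n\<close>. No sign convention enters where this is used, as \<open>p = 2\<close> or \<open>n\<close> is even.
\<close>

primrec dual_power :: "('k::field, 'a) gcoalg \<Rightarrow> nat \<Rightarrow> ('a \<Rightarrow> 'k) \<Rightarrow> nat \<Rightarrow> 'a \<Rightarrow> 'k" where
  "dual_power C n a 0 = counit C"
| "dual_power C n a (Suc m) =
     (\<lambda>c. comult C n (m * n) c (\<lambda>(x, y). a x * dual_power C n a m y))"

definition verschiebung :: "('k::field, 'a::ab_group_add) gcoalg \<Rightarrow> nat \<Rightarrow> nat \<Rightarrow> 'a \<Rightarrow> 'a" where
  "verschiebung C p n c =
     (THE v. v \<in> cpart C n \<and> (\<forall>a\<in>dual_space (part C n). a v ^ p = dual_power C n a p c))"

definition positive_part :: "('k::field, 'a::ab_group_add) gcoalg \<Rightarrow> nat \<Rightarrow> ('k, 'a) vmodule" where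
  "positive_part C p =
     \<lparr>vpart = (\<lambda>n. if n = 0 then (part C 0)\<lparr>carr := {0}\<rparr> else part C n), vmap = verschiebung C p\<rparr>"


section \<open>The Hopf algebra \<open>J C\<close>\<close>

record ('k, 'a) ghopf = "('k, 'a) gcoalg" +
  mult :: "'a \<Rightarrow> 'a \<Rightarrow> 'a"
  unit :: 'a

text \<open>
  Isomorphisms of the bialgebra structure; these commute with antipodes automatically.
\<close>

definition hopf_iso :: "('k::field, 'a::ab_group_add) ghopf
    \<Rightarrow> ('k, 'b::ab_group_add) ghopf \<Rightarrow> (nat \<Rightarrow> 'a \<Rightarrow> 'b) \<Rightarrow> bool" where
  "hopf_iso H K f \<longleftrightarrow> coalgebra_iso H K f \<and> f 0 (unit H) = unit K \<and>
     (\<forall>m n. \<forall>x\<in>cpart H m. \<forall>y\<in>cpart H n. f (m + n) (mult H x y) = mult K (f m x) (f n y))"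

definition hopf_isomorphic :: "('k::field, 'a::ab_group_add) ghopf
    \<Rightarrow> ('k, 'b::ab_group_add) ghopf \<Rightarrow> bool" where
  "hopf_isomorphic H K \<longleftrightarrow> (\<exists>f. hopf_iso H K f)"

text \<open>
  The tensor algebra on the positive degree part of \<open>C\<close>, realised like the tensor product above.
  A word is a list of positive degree elements of \<open>C\<close>, each tagged with its degree; the elementary
  tensor of a word is evaluation at that word of the functions that are multilinear on words with
  given degrees. The tags make words with different degree sequences independent.
\<close>

definition words :: "('k, 'a) gcoalg \<Rightarrow> (nat \<times> 'a) list set" where
  "words C = {w. \<forall>(d, x)\<in>set w. 0 < d \<and> x \<in> cpart C d}"

definition word_degree :: "(nat \<times> 'a) list \<Rightarrow> nat" where
  "word_degree w = sum_list (map fst w)"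

definition multilin_forms :: "('k::field, 'a::ab_group_add) gcoalg \<Rightarrow> ((nat \<times> 'a) list \<Rightarrow> 'k) set" where
  "multilin_forms C =
     {\<beta>. \<forall>u\<in>words C. \<forall>v\<in>words C. \<forall>d>0. (\<lambda>x. \<beta> (u @ (d, x) # v)) \<in> dual_space (part C d)}"

type_synonym ('k, 'a) tensor_alg = "((nat \<times> 'a) list \<Rightarrow> 'k) \<Rightarrow> 'k"

definition word :: "('k::field, 'a::ab_group_add) gcoalg \<Rightarrow> (nat \<times> 'a) list \<Rightarrow> ('k, 'a) tensor_alg" where
  "word C w = (\<lambda>\<beta>. if \<beta> \<in> multilin_forms C then \<beta> w else 0)"

definition J_part :: "('k::field, 'a::ab_group_add) gcoalg \<Rightarrow> nat \<Rightarrow> ('k, ('k, 'a) tensor_alg) vspace" where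
  "J_part C n =
     \<lparr>carr = module.span fscale {word C w | w. w \<in> words C \<and> word_degree w = n}, smul = fscale\<rparr>"

text \<open>Concatenation of words, extended bilinearly.\<close>

definition J_mult :: "('k::field, 'a::ab_group_add) gcoalg
    \<Rightarrow> ('k, 'a) tensor_alg \<Rightarrow> ('k, 'a) tensor_alg \<Rightarrow> ('k, 'a) tensor_alg" where
  "J_mult C s t = (\<lambda>\<beta>. if \<beta> \<in> multilin_forms C then s (\<lambda>u. t (\<lambda>v. \<beta> (u @ v))) else 0)"

definition J_unit :: "('k::field, 'a::ab_group_add) gcoalg \<Rightarrow> ('k, 'a) tensor_alg" where
  "J_unit C = word C []"

definition J_counit :: "('k::field, 'a) tensor_alg \<Rightarrow> 'k" where
  "J_counit t = t (\<lambda>w. if w = [] then 1 else 0)"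

text \<open>The inclusion of \<open>C\<close>, identifying its degree \<open>0\<close> part with the ground field.\<close>

definition J_incl :: "('k::field, 'a::ab_group_add) gcoalg \<Rightarrow> nat \<Rightarrow> 'a \<Rightarrow> ('k, 'a) tensor_alg" where
  "J_incl C n c = (if n = 0 then fscale (counit C c) (J_unit C) else word C [(n, c)])"

text \<open>
  The product of the graded tensor square of \<open>J C\<close>, for \<open>s\<close> in bidegree \<open>(i, j)\<close> and \<open>t\<close> in
  bidegree \<open>(k, l)\<close>: the product of \<open>x \<otimes> y\<close> and \<open>x' \<otimes> y'\<close> is \<open>x x' \<otimes> y y'\<close> with the Koszul
  sign for moving \<open>x'\<close> past \<open>y\<close>.
\<close>

definition JJ_mult :: "('k::field, 'a::ab_group_add) gcoalg \<Rightarrow> nat \<Rightarrow> nat \<Rightarrow> nat \<Rightarrow> nat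
    \<Rightarrow> ('k, ('k, 'a) tensor_alg, ('k, 'a) tensor_alg) tensor
    \<Rightarrow> ('k, ('k, 'a) tensor_alg, ('k, 'a) tensor_alg) tensor
    \<Rightarrow> ('k, ('k, 'a) tensor_alg, ('k, 'a) tensor_alg) tensor" where
  "JJ_mult C i j k l s t =
     (\<lambda>\<beta>. if \<beta> \<in> bilin_forms (J_part C (i + k)) (J_part C (j + l))
          then (- 1) ^ (j * k) *
               s (\<lambda>(x, y). t (\<lambda>(x', y'). \<beta> (J_mult C x x', J_mult C y y'))) else 0)"

text \<open>
  The coproduct is the algebra map extending the coproduct of \<open>C\<close>: the coproduct of a word
  \<open>c\<^sub>1 \<dots> c\<^sub>r\<close> is the product of the images of the coproducts of the letters. First its component
  in bidegree \<open>(i, j)\<close> on words, then extended linearly.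
\<close>

primrec word_comult :: "('k::field, 'a::ab_group_add) gcoalg \<Rightarrow> (nat \<times> 'a) list \<Rightarrow> nat \<Rightarrow> nat
    \<Rightarrow> ('k, ('k, 'a) tensor_alg, ('k, 'a) tensor_alg) tensor" where
  "word_comult C [] = (\<lambda>i j.
     if i = 0 \<and> j = 0 then tens (J_part C 0) (J_part C 0) (J_unit C) (J_unit C) else 0)"
| "word_comult C (c # w) = (\<lambda>i j.
     \<Sum>(a, b) | a + b = fst c \<and> a \<le> i \<and> b \<le> j.
       JJ_mult C a b (i - a) (j - b)
         (tensor_map (J_part C a) (J_part C b) (J_incl C a) (J_incl C b) (comult C a b (snd c)))
         (word_comult C w (i - a) (j - b)))"

definition J_comult :: "('k::field, 'a::ab_group_add) gcoalg \<Rightarrow> nat \<Rightarrow> nat \<Rightarrow> ('k, 'a) tensor_alg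
    \<Rightarrow> ('k, ('k, 'a) tensor_alg, ('k, 'a) tensor_alg) tensor" where
  "J_comult C i j t =
     (\<lambda>\<beta>. if \<beta> \<in> bilin_forms (J_part C i) (J_part C j) then t (\<lambda>w. word_comult C w i j \<beta>) else 0)"

definition J :: "('k::field, 'a::ab_group_add) gcoalg \<Rightarrow> ('k, ('k, 'a) tensor_alg) ghopf" where
  "J C = \<lparr>part = J_part C, comult = J_comult C, counit = J_counit, mult = J_mult C, unit = J_unit C\<rparr>"

end

theory Submission
  imports Defs "HOL-Computational_Algebra.Primes" "HOL-Library.Multiset"
begin

text \<open>
  Over a perfect field the \<open>p\<close>-th power map of the dual algebra of \<open>C\<close> is semilinear, so the positive
  part of this algebra has a homogeneous basis that it permutes up to zeros: take sets that are maximal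
  among those staying independent, up to zeros, under all iterates. Dually, an isomorphism of V-modules
  gives bases of \<open>C\<close> and \<open>D\<close> with the same letters and the same partial injection \<open>F\<close> describing
  the \<open>p\<close>-th powers.

  The dual of \<open>J D\<close> is a quasi-shuffle algebra on words. Its leading part with respect to word length is
  the shuffle algebra, where a set \<open>N\<close> of words that the \<open>p\<close>-th power map permutes up to zeros is a basis
  modulo decomposables. The monomials in \<open>N\<close> with exponents less than \<open>p\<close> (at most \<open>1\<close> in odd degrees
  for odd \<open>p\<close>) are a basis of both algebras: derivations give independence in the shuffle algebra, the
  length filtration transfers it. So the quasi-shuffle algebra is presented by \<open>N\<close> with relations
  \<open>x\<^sup>p = F x\<close> or \<open>x\<^sup>p = 0\<close>. The letters satisfy the same relations in the dual of \<open>C\<close>; sending them to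
  themselves and the longer generators to \<open>0\<close> defines an algebra map, that is, a coalgebra map from \<open>C\<close>
  to \<open>J D\<close>. Its multiplicative extension to \<open>J C\<close> is unitriangular with respect to word length, hence
  an isomorphism of Hopf algebras.

  Conversely, the \<open>p\<close>-th power map of the dual of \<open>J C\<close> acts on words by \<open>F\<close> letterwise, so the kernel of
  its \<open>j\<close>-th iterate counts the words with all letters in the domain of \<open>F\<^sup>j\<close>. By induction on the degree
  this determines the number of such letters in each degree, and these numbers determine \<open>F\<close> up to
  bijection, hence the V-module.
\<close>

section \<open>Coalgebras in coordinates\<close>

text \<open>A V-module isomorphism need not come from a coalgebra map between \<open>C\<close> and
  \<open>D\<close>, because \<open>V\<close> forgets most of the coproduct. Statement (a) suffices
  because the dual of \<open>J D\<close> has no relations besides graded commutativity and the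
  Frobenius relations, so an algebra map out of it may be prescribed on generators. The obstacle is
  to find generators that contain all letters and are stable under \<open>p\<close>-th powers.
  Indecomposables of the quasi-shuffle product are hard to control; those of the shuffle product are
  graded by word length, and there the letterwise action of \<open>F\<close> is undone by a linear
  multiplicative map \<open>psi\<close>, which preserves decomposables.

  The converse needs all iterates of the Frobenius map: chains of \<open>F\<close> may have any
  length, even infinite, and a single kernel would not tell them apart.

  All algebra is done in coordinates, with a coalgebra given by functionals \<open>cop x\<close> on
  matrices. Tensor products, words and iterated coproducts then become nested finite sums, and the
  tensor spaces of the definitions are met only when coordinates are introduced and removed.\<close>

definition sg :: "nat \<Rightarrow> 'k::comm_ring_1" where "sg n = (- 1) ^ n"

definition dlt :: "'i \<Rightarrow> 'i \<Rightarrow> 'k::zero_neq_one" where "dlt i = (\<lambda>x. if x = i then 1 else 0)"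

lemma sg_0 [simp]: "sg 0 = 1" by (simp add: sg_def)
lemma sg_add: "sg (m + n) = sg m * sg n" by (simp add: sg_def power_add)
lemma sg_sq [simp]: "sg n * sg n = (1::'k::comm_ring_1)" by (simp add: sg_def flip: power_mult_distrib)
lemma sg_even: "even n \<Longrightarrow> sg n = 1" by (simp add: sg_def)
lemma sg_odd: "odd n \<Longrightarrow> sg n = - 1" by (simp add: sg_def)
lemma sg_nz [simp]: "sg n \<noteq> (0::'k::field)" by (simp add: sg_def)

lemma dlt_same [simp]: "dlt x x = 1" by (simp add: dlt_def)
lemma dlt_other [simp]: "x \<noteq> y \<Longrightarrow> dlt x y = 0" by (simp add: dlt_def)

lemma sum_dlt: "finite A \<Longrightarrow> a \<in> A \<Longrightarrow> (\<Sum>y\<in>A. g y * dlt y a) = (g a :: 'k::field)"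
proof -
  assume "finite A" "a \<in> A"
  have "(\<Sum>y\<in>A. g y * dlt y a) = (\<Sum>y\<in>A. if a = y then g y else 0)"
    by (rule sum.cong) (auto simp: dlt_def)
  then show ?thesis using \<open>finite A\<close> \<open>a \<in> A\<close> by simp
qed

lemma sum_fun_app: "(\<Sum>i\<in>I. f i) x = (\<Sum>i\<in>I. f i x)"
  by (induction I rule: infinite_finite_induct) simp_all

lemma fscale_add: "fscale a (f + g) = fscale a f + fscale a g"
  by (simp add: fscale_def fun_eq_iff distrib_left)

lemma fscale_0 [simp]: "fscale 0 f = 0" "fscale a 0 = 0"
  by (simp_all add: fscale_def fun_eq_iff)

lemma fscale_1 [simp]: "fscale 1 f = f"
  by (simp add: fscale_def)

lemma fscale_fscale: "fscale a (fscale b f) = fscale (a * b) f"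
  by (simp add: fscale_def mult.assoc)

text \<open>Each coalgebra axiom is stated at a single basis element and tested on all matrices. The
  pointwise shape lets an axiom at a word \<open>x # w\<close> be deduced from the axioms at
  \<open>x\<close> and at \<open>w\<close>.\<close>

definition coassoc_at :: "('i \<Rightarrow> ('i \<Rightarrow> 'i \<Rightarrow> 'k::field) \<Rightarrow> 'k) \<Rightarrow> 'i \<Rightarrow> bool" where
  "coassoc_at cop x \<longleftrightarrow> (\<forall>\<Theta>. cop x (\<lambda>v t. cop v (\<lambda>y z. \<Theta> y z t)) = cop x (\<lambda>y v. cop v (\<lambda>z t. \<Theta> y z t)))"

definition cocomm_at :: "('i \<Rightarrow> nat) \<Rightarrow> ('i \<Rightarrow> ('i \<Rightarrow> 'i \<Rightarrow> 'k::field) \<Rightarrow> 'k) \<Rightarrow> 'i \<Rightarrow> bool" where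
  "cocomm_at deg cop x \<longleftrightarrow> (\<forall>\<Theta>. cop x \<Theta> = cop x (\<lambda>y z. sg (deg y * deg z) * \<Theta> z y))"

definition counit_at :: "'i \<Rightarrow> ('i \<Rightarrow> ('i \<Rightarrow> 'i \<Rightarrow> 'k::field) \<Rightarrow> 'k) \<Rightarrow> 'i \<Rightarrow> bool" where
  "counit_at one cop x \<longleftrightarrow> (\<forall>\<Theta>. cop x (\<lambda>y z. if y = one then \<Theta> z else 0) = \<Theta> x) \<and>
     (\<forall>\<Theta>. cop x (\<lambda>y z. if z = one then \<Theta> y else 0) = \<Theta> x)"

text \<open>
  \<open>cop x \<Theta>\<close> is the value of the bilinear form with matrix \<open>\<Theta>\<close> on the coproduct of the basis
  element \<open>x\<close>; \<open>one\<close> is the basis element of degree \<open>0\<close>.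
\<close>

locale precoalg =
  fixes Y :: "'i set" and deg :: "'i \<Rightarrow> nat" and cop :: "'i \<Rightarrow> ('i \<Rightarrow> 'i \<Rightarrow> 'k::field) \<Rightarrow> 'k"
    and one :: 'i
  assumes fin: "finite {y\<in>Y. deg y \<le> n}"
    and one_in: "one \<in> Y" and deg_one: "deg one = 0" and deg_0: "y \<in> Y \<Longrightarrow> deg y = 0 \<Longrightarrow> y = one"
    and cop_add: "cop x (\<lambda>y z. \<Theta> y z + \<Theta>' y z) = cop x \<Theta> + cop x \<Theta>'"
    and cop_scale: "cop x (\<lambda>y z. a * \<Theta> y z) = a * cop x \<Theta>"
    and cop_cong0: "(\<And>y z. y \<in> Y \<Longrightarrow> z \<in> Y \<Longrightarrow> deg y + deg z = deg x \<Longrightarrow> \<Theta> y z = \<Theta>' y z)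
      \<Longrightarrow> cop x \<Theta> = cop x \<Theta>'"
begin

lemmas cop_cong = cop_cong0

definition upto :: "nat \<Rightarrow> 'i set" where "upto n = {y\<in>Y. deg y \<le> n}"

lemma finite_upto [simp]: "finite (upto n)" by (simp add: upto_def fin)

lemma finite_degree [simp]: "finite {y\<in>Y. deg y = n}"
  by (rule finite_subset[OF _ fin[of n]]) auto

lemma cop_0 [simp]: "cop x (\<lambda>y z. 0) = 0"
  using cop_scale[of x 0 "\<lambda>y z. 0"] by simp

lemma cop_scale_right: "cop x (\<lambda>y z. \<Theta> y z * a) = cop x \<Theta> * a"
  using cop_scale[of x a \<Theta>] by (simp add: mult.commute)

lemma cop_sum: "cop x (\<lambda>y z. \<Sum>i\<in>I. \<Theta> i y z) = (\<Sum>i\<in>I. cop x (\<Theta> i))"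
  by (induction I rule: infinite_finite_induct) (simp_all add: cop_add)

lemma cop_lin: "cop x (\<lambda>y z. \<Sum>i\<in>I. a i * \<Theta> i y z) = (\<Sum>i\<in>I. a i * cop x (\<Theta> i))"
  by (simp add: cop_sum cop_scale)

lemma cop_diff: "cop x (\<lambda>y z. \<Theta> y z - \<Theta>' y z) = cop x \<Theta> - cop x \<Theta>'"
  using cop_add[of x \<Theta> "\<lambda>y z. - 1 * \<Theta>' y z"] cop_scale[of x "- 1" \<Theta>'] by simp

lemma cop_eq_0: "(\<And>y z. y \<in> Y \<Longrightarrow> z \<in> Y \<Longrightarrow> deg y + deg z = deg x \<Longrightarrow> \<Theta> y z = 0) \<Longrightarrow> cop x \<Theta> = 0"
  using cop_cong[of x \<Theta> "\<lambda>y z. 0"] by simp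

definition coef :: "'i \<Rightarrow> 'i \<Rightarrow> 'i \<Rightarrow> 'k" where "coef x y z = cop x (\<lambda>a b. dlt y a * dlt z b)"

lemma cop_expand:
  assumes "finite A" "upto (deg x) \<subseteq> A"
  shows "cop x \<Theta> = (\<Sum>y\<in>A. \<Sum>z\<in>A. coef x y z * \<Theta> y z)"
proof -
  have "cop x \<Theta> = cop x (\<lambda>a b. \<Sum>y\<in>A. \<Sum>z\<in>A. \<Theta> y z * (dlt y a * dlt z b))"
  proof (rule cop_cong)
    fix a b assume ab: "a \<in> Y" "b \<in> Y" "deg a + deg b = deg x"
    then have "a \<in> A" "b \<in> A" using assms by (auto simp: upto_def)
    then show "\<Theta> a b = (\<Sum>y\<in>A. \<Sum>z\<in>A. \<Theta> y z * (dlt y a * dlt z b))"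
      using assms(1) by (simp add: sum_dlt mult.assoc[symmetric])
  qed
  also have "\<dots> = (\<Sum>y\<in>A. \<Sum>z\<in>A. coef x y z * \<Theta> y z)"
    by (simp add: cop_sum cop_scale coef_def mult.commute)
  finally show ?thesis .
qed

lemma coef_eq_0: "y \<in> Y \<Longrightarrow> z \<in> Y \<Longrightarrow> deg y + deg z \<noteq> deg x \<Longrightarrow> coef x y z = 0"
  unfolding coef_def by (rule cop_eq_0) (auto simp: dlt_def)

text \<open>The convolution product of the dual algebra. The cut-off outside \<open>Y\<close> turns
  its laws into equations of total functions; the unit laws then need arguments supported in
  \<open>Y\<close>, which \<open>hom\<close> provides.\<close>

definition conv :: "('i \<Rightarrow> 'k) \<Rightarrow> ('i \<Rightarrow> 'k) \<Rightarrow> 'i \<Rightarrow> 'k" where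
  "conv f g = (\<lambda>x. if x \<in> Y then cop x (\<lambda>y z. f y * g z) else 0)"

definition hom :: "nat \<Rightarrow> ('i \<Rightarrow> 'k) \<Rightarrow> bool" where
  "hom n f \<longleftrightarrow> (\<forall>x. f x \<noteq> 0 \<longrightarrow> x \<in> Y \<and> deg x = n)"

primrec pw :: "('i \<Rightarrow> 'k) \<Rightarrow> nat \<Rightarrow> 'i \<Rightarrow> 'k" where
  "pw f 0 = dlt one"
| "pw f (Suc n) = conv f (pw f n)"

lemma hom_0 [simp]: "hom n 0" "hom n (\<lambda>x. 0)" by (simp_all add: hom_def)
lemma hom_add: "hom n f \<Longrightarrow> hom n g \<Longrightarrow> hom n (f + g)" by (auto simp: hom_def) (metis add.right_neutral)+
lemma hom_scale: "hom n f \<Longrightarrow> hom n (fscale a f)" by (auto simp: hom_def fscale_def)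
lemma hom_sum: "(\<And>i. i \<in> I \<Longrightarrow> hom n (f i)) \<Longrightarrow> hom n (sum f I)"
  by (induction I rule: infinite_finite_induct) (auto intro: hom_add)
lemma hom_dlt: "y \<in> Y \<Longrightarrow> hom (deg y) (dlt y)" by (auto simp: hom_def dlt_def)
lemma hom_one: "hom 0 (dlt one)" using hom_dlt[OF one_in] deg_one by simp

lemma conv_add_left: "conv (f + g) h = conv f h + conv g h"
  by (auto simp: conv_def fun_eq_iff distrib_right cop_add)
lemma conv_add_right: "conv h (f + g) = conv h f + conv h g"
  by (auto simp: conv_def fun_eq_iff distrib_left cop_add)
lemma conv_scale_left: "conv (fscale a f) g = fscale a (conv f g)"
  by (auto simp: conv_def fun_eq_iff fscale_def mult.assoc cop_scale)
lemma conv_scale_right: "conv f (fscale a g) = fscale a (conv f g)"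
  by (auto simp: conv_def fun_eq_iff fscale_def mult.left_commute cop_scale)
lemma conv_0_left [simp]: "conv 0 f = 0" "conv (\<lambda>x. 0) f = 0" by (auto simp: conv_def fun_eq_iff)
lemma conv_0_right [simp]: "conv f 0 = 0" "conv f (\<lambda>x. 0) = 0" by (auto simp: conv_def fun_eq_iff)
lemma conv_sum_right: "conv g (sum f I) = (\<Sum>i\<in>I. conv g (f i))"
proof (induction I rule: infinite_finite_induct)
  case (insert x F)
  then show ?case by (simp only: sum.insert[OF insert(1,2)] conv_add_right)
qed simp_all

lemma hom_conv:
  assumes "hom m f" "hom n g"
  shows "hom (m + n) (conv f g)"
  unfolding hom_def
proof (intro allI impI)
  fix x assume nz: "conv f g x \<noteq> 0"
  then have x: "x \<in> Y" by (auto simp: conv_def split: if_splits)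
  have "deg x = m + n"
  proof (rule ccontr)
    assume "deg x \<noteq> m + n"
    then have "cop x (\<lambda>y z. f y * g z) = 0"
      using assms by (intro cop_eq_0) (auto simp: hom_def)
    with nz x show False by (simp add: conv_def)
  qed
  with x show "x \<in> Y \<and> deg x = m + n" by simp
qed

lemma hom_pw: "hom n f \<Longrightarrow> hom (m * n) (pw f m)"
  by (induction m) (auto intro: hom_one hom_conv)

lemma hom_eq_sum: 
  assumes "hom n f"
  shows "f = (\<Sum>x\<in>{x\<in>Y. deg x = n}. fscale (f x) (dlt x))"
proof
  fix z
  have "(\<Sum>x\<in>{x\<in>Y. deg x = n}. fscale (f x) (dlt x)) z = (\<Sum>x\<in>{x\<in>Y. deg x = n}. if z = x then f x else 0)"
    unfolding sum_fun_app by (rule sum.cong) (auto simp: fscale_def dlt_def)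
  also have "\<dots> = f z" using assms by (auto simp: hom_def)
  finally show "f z = (\<Sum>x\<in>{x\<in>Y. deg x = n}. fscale (f x) (dlt x)) z" by simp
qed

end

locale gcoalg_coords = precoalg +
  assumes coassoc: "x \<in> Y \<Longrightarrow> coassoc_at cop x"
    and cocomm: "x \<in> Y \<Longrightarrow> cocomm_at deg cop x"
    and counit: "x \<in> Y \<Longrightarrow> counit_at one cop x"
begin

lemma conv_assoc: "conv (conv f g) h = conv f (conv g h)"
proof
  fix x
  show "conv (conv f g) h x = conv f (conv g h) x"
  proof (cases "x \<in> Y")
    case True
    have "conv (conv f g) h x = cop x (\<lambda>v t. cop v (\<lambda>y z. f y * g z * h t))"
      using True by (auto simp: conv_def cop_scale_right intro!: cop_cong)
    also have "\<dots> = cop x (\<lambda>y v. cop v (\<lambda>z t. f y * g z * h t))"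
      using coassoc[OF True] unfolding coassoc_at_def by fast
    also have "\<dots> = conv f (conv g h) x"
      using True by (auto simp: conv_def cop_scale mult.assoc intro!: cop_cong)
    finally show ?thesis .
  qed (simp add: conv_def)
qed

lemma conv_comm:
  assumes "hom m f" "hom n g"
  shows "conv f g = fscale (sg (m * n)) (conv g f)"
proof
  fix x
  show "conv f g x = fscale (sg (m * n)) (conv g f) x"
  proof (cases "x \<in> Y")
    case True
    have "conv f g x = cop x (\<lambda>y z. sg (deg y * deg z) * (f z * g y))"
      using cocomm[OF True] True unfolding cocomm_at_def conv_def by auto
    also have "\<dots> = cop x (\<lambda>y z. sg (m * n) * (g y * f z))"
      using assms by (intro cop_cong) (auto simp: hom_def mult.commute)
    finally show ?thesis using True by (simp add: fscale_def conv_def cop_scale)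
  qed (simp add: conv_def fscale_def)
qed

lemma conv_one_left:
  assumes "hom n f" shows "conv (dlt one) f = f"
proof
  fix x
  show "conv (dlt one) f x = f x"
  proof (cases "x \<in> Y")
    case True
    have "conv (dlt one) f x = cop x (\<lambda>y z. if y = one then f z else 0)"
      using True by (auto simp: conv_def dlt_def intro!: cop_cong)
    also have "\<dots> = f x" using counit[OF True] by (simp add: counit_at_def)
    finally show ?thesis .
  qed (use assms in \<open>auto simp: conv_def hom_def\<close>)
qed

lemma conv_one_right:
  assumes "hom n f" shows "conv f (dlt one) = f"
proof
  fix x
  show "conv f (dlt one) x = f x"
  proof (cases "x \<in> Y")
    case True
    have "conv f (dlt one) x = cop x (\<lambda>y z. if z = one then f y else 0)"
      using True by (auto simp: conv_def dlt_def intro!: cop_cong)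
    also have "\<dots> = f x" using counit[OF True] by (simp add: counit_at_def)
    finally show ?thesis .
  qed (use assms in \<open>auto simp: conv_def hom_def\<close>)
qed

end

subsection \<open>The Frobenius map of the dual algebra\<close>

text \<open>The degrees in which no sign obstructs the Frobenius map: elements commute and
  \<open>p\<close>-th powers are additive. In the remaining degrees squares vanish.\<close>

definition good :: "nat \<Rightarrow> nat \<Rightarrow> bool" where "good p n \<longleftrightarrow> p = 2 \<or> even n"

locale char_coords = gcoalg_coords Y deg cop one
  for Y :: "'i set" and deg and cop :: "'i \<Rightarrow> ('i \<Rightarrow> 'i \<Rightarrow> 'k::field) \<Rightarrow> 'k" and one +
  fixes p :: nat
  assumes char_p: "CHAR('k) = p" and p_prime: "prime p"
begin

lemma of_nat_p [simp]: "(of_nat p :: 'k) = 0" using of_nat_CHAR[where 'a='k] char_p by simp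

lemma p_pos [simp]: "p > 0" using p_prime prime_gt_0_nat by blast
lemma p_gt_1: "p > 1" using p_prime prime_gt_1_nat by blast

lemma sg_good: "good p n \<Longrightarrow> sg (n * m) = (1::'k)"
proof (cases "p = 2")
  case True
  then have "(1::'k) + 1 = 0" using of_nat_p by simp
  then have "(1::'k) = - 1" by (simp only: eq_neg_iff_add_eq_0)
  then show ?thesis unfolding sg_def by (metis power_one)
qed (auto simp: good_def sg_even)

lemma conv_comm_good: "hom m f \<Longrightarrow> hom n g \<Longrightarrow> good p m \<Longrightarrow> conv f g = conv g f"
  using conv_comm[of m f n g] sg_good[of m n] by (simp add: fscale_def)

text \<open>Graded commutativity gives \<open>conv f f = - conv f f\<close> in odd degree, and 2 is
  invertible because \<open>p\<close> is an odd prime.\<close>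

lemma conv_self_bad: 
  assumes "hom n f" "\<not> good p n"
  shows "conv f f = 0"
proof -
  have p: "p \<noteq> 2" "odd n" using assms(2) by (auto simp: good_def)
  have two: "(2::'k) \<noteq> 0"
  proof
    assume "(2::'k) = 0"
    then have "p dvd 2" using char_p of_nat_eq_0_iff_char_dvd[where 'a='k, of 2] by simp
    then show False using p p_gt_1 by (meson primes_dvd_imp_eq p_prime two_is_prime_nat)
  qed
  show ?thesis
  proof
    fix x
    have "sg (n * n) = (- 1 :: 'k)" using p by (simp add: sg_odd)
    then have "conv f f x = - 1 * conv f f x"
      using fun_cong[OF conv_comm[OF assms(1,1)], of x] unfolding fscale_def by metis
    then have "2 * conv f f x = 0" by (simp only: mult_2 mult_minus1 eq_neg_iff_add_eq_0)
    then show "conv f f x = 0 x" using two by (simp only: mult_eq_0_iff zero_fun_apply simp_thms)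
  qed
qed

text \<open>The binomial theorem: \<open>g\<close> has to be moved past powers of \<open>f\<close>,
  which costs no sign in a good degree.\<close>

lemma pw_add:
  assumes f: "hom n f" and g: "hom n g" and good: "good p n"
  shows "pw (f + g) m = (\<Sum>k\<le>m. fscale (of_nat (m choose k)) (conv (pw f k) (pw g (m - k))))"
proof (induction m)
  case 0
  then show ?case by (simp add: conv_one_left[OF hom_one] fscale_def)
next
  case (Suc m)
  let ?t = "\<lambda>a b. conv (pw f a) (pw g b)"
  have f_mul: "conv f (?t a b) = ?t (Suc a) b" for a b
    by (simp add: conv_assoc)
  have "conv g (pw f a) = conv (pw f a) g" for a
    by (rule conv_comm_good[OF g hom_pw[OF f] good])
  then have g_swap: "conv g (?t a b) = ?t a (Suc b)" for a b
    by (metis conv_assoc pw.simps(2))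
  have fs: "fscale (a + b) h = fscale a h + fscale b h" for a b :: 'k and h :: "'i \<Rightarrow> 'k"
    by (simp add: fscale_def fun_eq_iff distrib_right)
  have "pw (f + g) (Suc m) =
      (\<Sum>k\<le>m. fscale (of_nat (m choose k)) (?t (Suc k) (m - k))) +
      (\<Sum>k\<le>m. fscale (of_nat (m choose k)) (?t k (Suc (m - k))))"
    by (simp only: pw.simps Suc conv_add_left conv_sum_right conv_scale_right f_mul g_swap
        sum.distrib[symmetric] fscale_add)
  also have "(\<Sum>k\<le>m. fscale (of_nat (m choose k)) (?t (Suc k) (m - k))) =
      (\<Sum>k\<in>{1..Suc m}. fscale (of_nat (m choose (k - 1))) (?t k (Suc m - k)))"
    by (rule sum.reindex_bij_witness[of _ "\<lambda>k. k - 1" Suc]) auto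
  also have "(\<Sum>k\<le>m. fscale (of_nat (m choose k)) (?t k (Suc (m - k)))) =
      (\<Sum>k\<le>Suc m. fscale (of_nat (m choose k)) (?t k (Suc m - k)))"
    by (simp add: Suc_diff_le binomial_eq_0 del: pw.simps)
  also have "(\<Sum>k\<in>{1..Suc m}. fscale (of_nat (m choose (k - 1))) (?t k (Suc m - k))) =
      (\<Sum>k\<le>Suc m. fscale (if k = 0 then 0 else of_nat (m choose (k - 1))) (?t k (Suc m - k)))"
    by (rule sum.mono_neutral_cong_left) (auto simp: fscale_def)
  also have "\<dots> + (\<Sum>k\<le>Suc m. fscale (of_nat (m choose k)) (?t k (Suc m - k))) =
     (\<Sum>k\<le>Suc m. fscale (of_nat (Suc m choose k)) (?t k (Suc m - k)))"
    unfolding sum.distrib[symmetric] fs[symmetric]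
    by (rule sum.cong) (auto simp: neq0_conv gr0_conv_Suc)
  finally show ?case .
qed

lemma Frobenius_add:
  assumes f: "hom n f" and g: "hom n g" and good: "good p n"
  shows "pw (f + g) p = pw f p + pw g p"
proof -
  have "pw (f + g) p = (\<Sum>k\<le>p. fscale (of_nat (p choose k)) (conv (pw f k) (pw g (p - k))))"
    by (rule pw_add[OF assms])
  also have "\<dots> = (\<Sum>k\<in>{0,p}. fscale (of_nat (p choose k)) (conv (pw f k) (pw g (p - k))))"
  proof (rule sum.mono_neutral_right)
    show "\<forall>i\<in>{..p} - {0, p}. fscale (of_nat (p choose i)) (conv (pw f i) (pw g (p - i))) = 0"
    proof
      fix i assume "i \<in> {..p} - {0, p}"
      then have "p dvd (p choose i)" using p_prime by (intro dvd_choose_prime) auto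
      then have "(of_nat (p choose i) :: 'k) = 0" using char_p of_nat_eq_0_iff_char_dvd by blast
      then show "fscale (of_nat (p choose i)) (conv (pw f i) (pw g (p - i))) = 0"
        by (simp add: fscale_def fun_eq_iff)
    qed
  qed auto
  also have "\<dots> = pw g p + pw f p" using p_pos
    by (simp add: conv_one_left[OF hom_pw[OF g]] conv_one_right[OF hom_pw[OF f]] fscale_def)
  finally show ?thesis by (simp add: add.commute)
qed

lemma pw_scale: "pw (fscale a f) m = fscale (a ^ m) (pw f m)"
  by (induction m) (simp_all add: conv_scale_left conv_scale_right, simp_all add: fscale_def mult_ac fun_eq_iff)

lemma pw_p_0: "pw 0 p = 0"
  using p_pos by (cases p) auto

lemma Frobenius_sum:
  assumes "\<And>i. i \<in> I \<Longrightarrow> hom n (f i)" and good: "good p n"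
  shows "pw (\<Sum>i\<in>I. fscale (a i) (f i)) p = (\<Sum>i\<in>I. fscale (a i ^ p) (pw (f i) p))"
  using assms(1)
proof (induction I rule: infinite_finite_induct)
  case (insert x F)
  have "hom n (\<Sum>i\<in>F. fscale (a i) (f i))" using insert.prems by (intro hom_sum hom_scale) auto
  then show ?case using insert
    by (simp only: sum.insert[OF insert(1,2)] Frobenius_add[OF hom_scale _ good] pw_scale insertI1 insertI2)
qed (auto simp: pw_p_0)

end

section \<open>Tensor products and words\<close>

lemma sg_cong: "(even a \<longleftrightarrow> even b) \<Longrightarrow> sg a = sg b"
  by (auto simp: sg_def minus_one_power_iff)

text \<open>Finite combinations of evaluations can be pulled through a coproduct, see
  \<open>cop_exchange\<close>. Coproducts themselves and the later \<open>pull\<close> are of this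
  kind.\<close>

definition finite_functional :: "(('x \<Rightarrow> 'k) \<Rightarrow> 'k::field) \<Rightarrow> bool" where
  "finite_functional L \<longleftrightarrow> (\<exists>I a. finite I \<and> (\<forall>G. L G = (\<Sum>i\<in>I. a i * G i)))"

context precoalg
begin

lemma finite_functional_cop: "finite_functional (\<lambda>G. cop x (\<lambda>y z. G (y, z)))"
  unfolding finite_functional_def
proof (intro exI conjI allI)
  show "finite (upto (deg x) \<times> upto (deg x))" by simp
  show "cop x (\<lambda>y z. G (y, z)) =
    (\<Sum>i\<in>upto (deg x) \<times> upto (deg x). (\<lambda>(y, z). coef x y z) i * G i)" for G
    by (subst cop_expand[OF finite_upto order_refl]) (simp add: sum.cartesian_product case_prod_beta)
qed

lemma cop_exchange:
  "finite_functional L \<Longrightarrow> cop x (\<lambda>y z. L (\<lambda>i. G y z i)) = L (\<lambda>i. cop x (\<lambda>y z. G y z i))"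
  unfolding finite_functional_def by (auto simp: cop_lin)

end

text \<open>The coproduct of a tensor product of coalgebras; the sign comes from interchanging
  \<open>z\<close> and \<open>y'\<close>.\<close>

definition tcop :: "('i \<Rightarrow> nat) \<Rightarrow> ('j \<Rightarrow> nat) \<Rightarrow> ('i \<Rightarrow> ('i \<Rightarrow> 'i \<Rightarrow> 'k::field) \<Rightarrow> 'k)
    \<Rightarrow> ('j \<Rightarrow> ('j \<Rightarrow> 'j \<Rightarrow> 'k) \<Rightarrow> 'k) \<Rightarrow> 'i \<times> 'j \<Rightarrow> ('i \<times> 'j \<Rightarrow> 'i \<times> 'j \<Rightarrow> 'k) \<Rightarrow> 'k" where
  "tcop deg deg' cop cop' x \<Theta> =
     cop (fst x) (\<lambda>y z. cop' (snd x) (\<lambda>y' z'. sg (deg z * deg' y') * \<Theta> (y, y') (z, z')))"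

locale two_precoalg = A: precoalg Y deg cop one + B: precoalg Y' deg' cop' one'
  for Y :: "'i set" and deg and cop :: "'i \<Rightarrow> ('i \<Rightarrow> 'i \<Rightarrow> 'k::field) \<Rightarrow> 'k" and one
    and Y' :: "'j set" and deg' and cop' :: "'j \<Rightarrow> ('j \<Rightarrow> 'j \<Rightarrow> 'k) \<Rightarrow> 'k" and one'
begin

abbreviation "tc \<equiv> tcop deg deg' cop cop'"
abbreviation "tdeg \<equiv> \<lambda>x. deg (fst x) + deg' (snd x)"

lemma exchange: "cop x (\<lambda>y z. cop' x' (\<lambda>y' z'. G y z y' z')) = cop' x' (\<lambda>y' z'. cop x (\<lambda>y z. G y z y' z'))"
  using A.cop_exchange[OF B.finite_functional_cop, of x x' "\<lambda>y z (y', z'). G y z y' z'"] by simp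

lemma tensor_precoalg: "precoalg (Y \<times> Y') tdeg tc (one, one')"
proof
  fix n
  have "{y\<in>Y \<times> Y'. tdeg y \<le> n} \<subseteq> A.upto n \<times> B.upto n" by (auto simp: A.upto_def B.upto_def)
  then show "finite {y\<in>Y \<times> Y'. tdeg y \<le> n}" by (rule finite_subset) simp
next
  fix x and \<Theta> \<Theta>' :: "'i \<times> 'j \<Rightarrow> 'i \<times> 'j \<Rightarrow> 'k"
  assume "\<And>y z. y \<in> Y \<times> Y' \<Longrightarrow> z \<in> Y \<times> Y' \<Longrightarrow> tdeg y + tdeg z = tdeg x \<Longrightarrow> \<Theta> y z = \<Theta>' y z"
  then show "tc x \<Theta> = tc x \<Theta>'" unfolding tcop_def
    by (intro A.cop_cong B.cop_cong arg_cong2[of _ _ _ _ "(*)"]) auto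
next
  show "tc x (\<lambda>y z. \<Theta> y z + \<Theta>' y z) = tc x \<Theta> + tc x \<Theta>'" for x \<Theta> \<Theta>'
    by (simp add: tcop_def distrib_left A.cop_add B.cop_add)
  show "tc x (\<lambda>y z. a * \<Theta> y z) = a * tc x \<Theta>" for x a \<Theta>
    by (simp add: tcop_def mult.left_commute[of _ a] A.cop_scale B.cop_scale)
  show "(one, one') \<in> Y \<times> Y'" using A.one_in B.one_in by simp
  show "tdeg (one, one') = 0" using A.deg_one B.deg_one by simp
  fix y assume "y \<in> Y \<times> Y'" "tdeg y = 0"
  then show "y = (one, one')" using A.deg_0[of "fst y"] B.deg_0[of "snd y"] by (auto simp: prod_eq_iff)
qed

lemma tensor_coassoc:
  assumes "coassoc_at cop (fst x)" "coassoc_at cop' (snd x)"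
  shows "coassoc_at tc x"
  unfolding coassoc_at_def
proof
  fix \<Theta> :: "'i \<times> 'j \<Rightarrow> 'i \<times> 'j \<Rightarrow> 'i \<times> 'j \<Rightarrow> 'k"
  let ?T = "\<lambda>y z t y' z' t'. \<Theta> (y, y') (z, z') (t, t')"
  \<comment> \<open>Sorting \<open>y z t y' z' t'\<close> into \<open>y y' z z' t t'\<close> moves
    \<open>y'\<close> past \<open>z\<close> and \<open>t\<close>, and \<open>z'\<close> past
    \<open>t\<close>. Both bracketings produce this sign once
    \<open>deg' v' = deg' y' + deg' z'\<close>, respectively \<open>deg v = deg z + deg t\<close>,
    is inserted.\<close>
  let ?S = "\<lambda>y z t y' z' t'. sg (deg t * (deg' y' + deg' z')) * (sg (deg z * deg' y') * ?T y z t y' z' t')"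
  have "tc x (\<lambda>v t. tc v (\<lambda>y z. \<Theta> y z t)) =
    cop (fst x) (\<lambda>v t. cop' (snd x) (\<lambda>v' t'. cop v (\<lambda>y z. cop' v' (\<lambda>y' z'.
       sg (deg t * deg' v') * (sg (deg z * deg' y') * ?T y z t y' z' t')))))"
    by (simp add: tcop_def A.cop_scale B.cop_scale)
  also have "\<dots> = cop (fst x) (\<lambda>v t. cop v (\<lambda>y z. cop' (snd x) (\<lambda>v' t'. cop' v' (\<lambda>y' z'.
       sg (deg t * deg' v') * (sg (deg z * deg' y') * ?T y z t y' z' t')))))"
    by (simp add: exchange)
  also have "\<dots> = cop (fst x) (\<lambda>v t. cop v (\<lambda>y z. cop' (snd x) (\<lambda>v' t'. cop' v' (\<lambda>y' z'.
       ?S y z t y' z' t'))))"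
    by (intro A.cop_cong B.cop_cong) simp
  also have "\<dots> = cop (fst x) (\<lambda>v t. cop v (\<lambda>y z. cop' (snd x) (\<lambda>y' v'. cop' v' (\<lambda>z' t'.
       ?S y z t y' z' t'))))"
    using assms(2) unfolding coassoc_at_def by simp
  also have "\<dots> = cop (fst x) (\<lambda>y v. cop v (\<lambda>z t. cop' (snd x) (\<lambda>y' v'. cop' v' (\<lambda>z' t'.
       ?S y z t y' z' t'))))"
    using assms(1) unfolding coassoc_at_def by fast
  also have "\<dots> = cop (fst x) (\<lambda>y v. cop v (\<lambda>z t. cop' (snd x) (\<lambda>y' v'. cop' v' (\<lambda>z' t'.
       sg (deg v * deg' y') * (sg (deg t * deg' z') * ?T y z t y' z' t')))))"
  proof (intro A.cop_cong B.cop_cong)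
    fix y v z t y' v' z' t' assume "deg z + deg t = deg v"
    then have v: "deg v = deg z + deg t" by simp
    have "sg (deg v * deg' y') * sg (deg t * deg' z') =
        (sg (deg t * (deg' y' + deg' z')) * sg (deg z * deg' y') :: 'k)"
      unfolding sg_add[symmetric] v by (intro sg_cong) (auto simp: distrib_left)
    then show "?S y z t y' z' t' = sg (deg v * deg' y') * (sg (deg t * deg' z') * ?T y z t y' z' t')"
      by (simp flip: mult.assoc)
  qed
  also have "\<dots> = cop (fst x) (\<lambda>y v. cop' (snd x) (\<lambda>y' v'. cop v (\<lambda>z t. cop' v' (\<lambda>z' t'.
       sg (deg v * deg' y') * (sg (deg t * deg' z') * ?T y z t y' z' t')))))"
    by (simp add: exchange)
  also have "\<dots> = tc x (\<lambda>y v. tc v (\<lambda>z t. \<Theta> y z t))"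
    by (simp add: tcop_def A.cop_scale B.cop_scale)
  finally show "tc x (\<lambda>v t. tc v (\<lambda>y z. \<Theta> y z t)) = tc x (\<lambda>y v. tc v (\<lambda>z t. \<Theta> y z t))" .
qed

lemma tensor_cocomm:
  assumes "cocomm_at deg cop (fst x)" "cocomm_at deg' cop' (snd x)"
  shows "cocomm_at tdeg tc x"
  unfolding cocomm_at_def
proof
  fix \<Theta>
  have "tc x \<Theta> = cop (fst x) (\<lambda>y z. sg (deg y * deg z) *
      cop' (snd x) (\<lambda>y' z'. sg (deg y * deg' y') * \<Theta> (z, y') (y, z')))"
    using assms(1) unfolding cocomm_at_def tcop_def by fast
  also have "\<dots> = cop (fst x) (\<lambda>y z. sg (deg y * deg z) *
      cop' (snd x) (\<lambda>y' z'. sg (deg' y' * deg' z') * (sg (deg y * deg' z') * \<Theta> (z, z') (y, y'))))"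
    using assms(2) unfolding cocomm_at_def by simp
  also have "\<dots> = cop (fst x) (\<lambda>y z. cop' (snd x) (\<lambda>y' z'. (sg (deg y * deg z) *
      (sg (deg' y' * deg' z') * sg (deg y * deg' z'))) * \<Theta> (z, z') (y, y')))"
    by (simp add: B.cop_scale mult.assoc)
  also have "\<dots> = cop (fst x) (\<lambda>y z. cop' (snd x) (\<lambda>y' z'. (sg (deg z * deg' y') *
      sg ((deg y + deg' y') * (deg z + deg' z'))) * \<Theta> (z, z') (y, y')))"
    unfolding sg_add[symmetric]
    by (intro A.cop_cong B.cop_cong arg_cong2[of _ _ _ _ "(*)"] sg_cong) (auto simp: distrib_left)
  also have "\<dots> = tc x (\<lambda>y z. sg (tdeg y * tdeg z) * \<Theta> z y)"
    by (simp add: tcop_def mult.assoc)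
  finally show "tc x \<Theta> = tc x (\<lambda>y z. sg (tdeg y * tdeg z) * \<Theta> z y)" .
qed

lemma tensor_counit:
  assumes "counit_at one cop (fst x)" "counit_at one' cop' (snd x)"
  shows "counit_at (one, one') tc x"
  unfolding counit_at_def
proof (intro conjI allI)
  fix \<Theta>
  have "tc x (\<lambda>y z. if y = (one, one') then \<Theta> z else 0) =
    cop (fst x) (\<lambda>y z. if y = one then cop' (snd x) (\<lambda>y' z'. if y' = one' then \<Theta> (z, z') else 0) else 0)"
    unfolding tcop_def by (intro A.cop_cong) (auto intro!: B.cop_cong B.cop_eq_0 simp: B.deg_one)
  then show "tc x (\<lambda>y z. if y = (one, one') then \<Theta> z else 0) = \<Theta> x"
    using assms by (simp add: counit_at_def)
  have "tc x (\<lambda>y z. if z = (one, one') then \<Theta> y else 0) =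
    cop (fst x) (\<lambda>y z. if z = one then cop' (snd x) (\<lambda>y' z'. if z' = one' then \<Theta> (y, y') else 0) else 0)"
    unfolding tcop_def by (intro A.cop_cong) (auto intro!: B.cop_cong B.cop_eq_0 simp: A.deg_one)
  then show "tc x (\<lambda>y z. if z = (one, one') then \<Theta> y else 0) = \<Theta> x"
    using assms by (simp add: counit_at_def)
qed

end

section \<open>The bialgebra of words in the positive degree letters\<close>

definition wdeg :: "('i \<Rightarrow> nat) \<Rightarrow> 'i list \<Rightarrow> nat" where "wdeg deg w = sum_list (map deg w)"

text \<open>The basis element \<open>one\<close> spans degree \<open>0\<close> and acts as the unit
  of the tensor algebra, so as a letter it disappears.\<close>

definition pre :: "'i \<Rightarrow> 'i \<Rightarrow> 'i list \<Rightarrow> 'i list" where "pre one y u = (if y = one then u else y # u)"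

lemma wdeg_simps [simp]: "wdeg deg [] = 0" "wdeg deg (x # w) = deg x + wdeg deg w"
  "wdeg deg (u @ w) = wdeg deg u + wdeg deg w"
  by (simp_all add: wdeg_def)

lemma pre_one [simp]: "pre one one u = u" by (simp add: pre_def)
lemma pre_append: "pre one y u @ v = pre one y (u @ v)" by (simp add: pre_def)

text \<open>The algebra map extending the coproduct of letters: the coproducts of \<open>x\<close>
  and \<open>w\<close> are multiplied, with the Koszul sign for \<open>z\<close> passing
  \<open>a\<close>. The product that it induces on functions of words is the quasi-shuffle
  product.\<close>

primrec wcop :: "'i \<Rightarrow> ('i \<Rightarrow> nat) \<Rightarrow> ('i \<Rightarrow> ('i \<Rightarrow> 'i \<Rightarrow> 'k::field) \<Rightarrow> 'k) \<Rightarrow> 'i list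
    \<Rightarrow> ('i list \<Rightarrow> 'i list \<Rightarrow> 'k) \<Rightarrow> 'k" where
  "wcop one deg cop [] = (\<lambda>\<Theta>. \<Theta> [] [])"
| "wcop one deg cop (x # w) = (\<lambda>\<Theta>. cop x (\<lambda>y z. wcop one deg cop w
     (\<lambda>a b. sg (deg z * wdeg deg a) * \<Theta> (pre one y a) (pre one z b))))"

locale letters = gcoalg_coords Y deg cop one
  for Y :: "'i set" and deg and cop :: "'i \<Rightarrow> ('i \<Rightarrow> 'i \<Rightarrow> 'k::field) \<Rightarrow> 'k" and one
begin

definition X where "X = Y - {one}"

abbreviation "wd \<equiv> wdeg deg"
abbreviation "wc \<equiv> wcop one deg cop"

lemma deg_X: "x \<in> X \<Longrightarrow> deg x > 0" using deg_0 by (auto simp: X_def)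

lemma length_le_wdeg: "w \<in> lists X \<Longrightarrow> length w \<le> wd w"
proof (induction w)
  case (Cons x w)
  then show ?case using deg_X[of x] by auto
qed simp

lemma wdeg_pre [simp]: "wd (pre one y u) = deg y + wd u" by (simp add: pre_def deg_one)

lemma pre_lists: "y \<in> Y \<Longrightarrow> u \<in> lists X \<Longrightarrow> pre one y u \<in> lists X" by (auto simp: pre_def X_def)

lemma letter_le_wdeg: "x \<in> set w \<Longrightarrow> deg x \<le> wd w"
  by (induction w) auto

lemma precoalg_words: "precoalg (lists X) wd wc []"
proof
  fix n
  have "{w\<in>lists X. wd w \<le> n} \<subseteq> {w. set w \<subseteq> upto n \<and> length w \<le> n}"
    using length_le_wdeg letter_le_wdeg by (force simp: upto_def X_def)
  then show "finite {w\<in>lists X. wd w \<le> n}"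
    by (rule finite_subset) (simp add: finite_lists_length_le)
next
  fix w \<Theta> \<Theta>'
  show "wc w (\<lambda>y z. \<Theta> y z + \<Theta>' y z) = wc w \<Theta> + wc w \<Theta>'"
    by (induction w arbitrary: \<Theta> \<Theta>') (simp_all add: distrib_left cop_add)
  show "wc w (\<lambda>y z. a * \<Theta> y z) = a * wc w \<Theta>" for a
    by (induction w arbitrary: \<Theta>) (simp_all add: mult.left_commute[of _ a] cop_scale)
  assume "\<And>y z. y \<in> lists X \<Longrightarrow> z \<in> lists X \<Longrightarrow> wd y + wd z = wd w \<Longrightarrow> \<Theta> y z = \<Theta>' y z"
  then show "wc w \<Theta> = wc w \<Theta>'"
  proof (induction w arbitrary: \<Theta> \<Theta>')
    case (Cons x w)
    show ?case unfolding wcop.simps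
      by (intro cop_cong Cons.IH arg_cong2[of _ _ _ _ "(*)"] Cons.prems pre_lists) auto
  qed simp
next
  fix y assume "y \<in> lists X" "wd y = 0"
  then show "y = []" using length_le_wdeg[of y] by simp
qed auto

lemma cop_one: "cop one \<Theta> = \<Theta> one one"
proof -
  have "cop one \<Theta> = cop one (\<lambda>y z. if y = one then \<Theta> one z else 0)"
    by (rule cop_cong) (use deg_0 in \<open>auto simp: deg_one\<close>)
  then show ?thesis using counit[OF one_in] by (simp add: counit_at_def)
qed

end

sublocale letters \<subseteq> W: precoalg "lists X" "wdeg deg" "wcop one deg cop" "[]"
  by (rule precoalg_words)

sublocale letters \<subseteq> T: two_precoalg Y deg cop one "lists X" "wdeg deg" "wcop one deg cop" "[]" ..

context letters
begin

text \<open>Multiplication by a letter, \<open>one\<close> allowed, is a coalgebra map from letters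
  tensor words to words. Through it the coalgebra axioms for words reduce to those of a tensor
  product.\<close>

lemma wcop_pre:
  "wc (pre one (fst v) (snd v)) \<Theta> = T.tc v (\<lambda>y z. \<Theta> (pre one (fst y) (snd y)) (pre one (fst z) (snd z)))"
  by (cases "fst v = one") (simp_all add: tcop_def cop_one deg_one, simp add: pre_def)

lemma wcop_Cons: "wc (x # w) \<Theta> = T.tc (x, w) (\<lambda>y z. \<Theta> (pre one (fst y) (snd y)) (pre one (fst z) (snd z)))"
  by (simp add: tcop_def)

lemma words_coassoc: "w \<in> lists X \<Longrightarrow> coassoc_at wc w"
proof (induction w)
  case (Cons x w)
  let ?p = "\<lambda>v. pre one (fst v) (snd v)"
  have co: "coassoc_at T.tc (x, w)"
    using Cons coassoc[of x] by (intro T.tensor_coassoc) (auto simp: X_def)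
  show ?case unfolding coassoc_at_def
  proof
    fix \<Theta>
    have "wc (x # w) (\<lambda>v t. wc v (\<lambda>y z. \<Theta> y z t)) =
        T.tc (x, w) (\<lambda>v t. T.tc v (\<lambda>y z. \<Theta> (?p y) (?p z) (?p t)))"
      by (simp only: wcop_Cons wcop_pre)
    also have "\<dots> = T.tc (x, w) (\<lambda>y v. T.tc v (\<lambda>z t. \<Theta> (?p y) (?p z) (?p t)))"
      using co unfolding coassoc_at_def by fast
    also have "\<dots> = wc (x # w) (\<lambda>y v. wc v (\<lambda>z t. \<Theta> y z t))"
      by (simp only: wcop_Cons wcop_pre)
    finally show "wc (x # w) (\<lambda>v t. wc v (\<lambda>y z. \<Theta> y z t)) = wc (x # w) (\<lambda>y v. wc v (\<lambda>z t. \<Theta> y z t))" .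
  qed
qed (simp add: coassoc_at_def)

lemma words_cocomm: "w \<in> lists X \<Longrightarrow> cocomm_at wd wc w"
proof (induction w)
  case (Cons x w)
  have co: "cocomm_at T.tdeg T.tc (x, w)"
    using Cons cocomm[of x] by (intro T.tensor_cocomm) (auto simp: X_def)
  show ?case unfolding cocomm_at_def
  proof
    fix \<Theta>
    show "wc (x # w) \<Theta> = wc (x # w) (\<lambda>y z. sg (wd y * wd z) * \<Theta> z y)"
      using co[unfolded cocomm_at_def, rule_format, of "\<lambda>y z. \<Theta> (pre one (fst y) (snd y)) (pre one (fst z) (snd z))"]
      by (simp only: wcop_Cons wdeg_pre)
  qed
qed (simp add: cocomm_at_def)

lemma pre_eq_Nil: "pre one y a = [] \<longleftrightarrow> y = one \<and> a = []" by (simp add: pre_def)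

lemma words_counit: "w \<in> lists X \<Longrightarrow> counit_at [] wc w"
proof (induction w)
  case (Cons x w)
  have co: "counit_at (one, []) T.tc (x, w)"
    using Cons counit[of x] by (intro T.tensor_counit) (auto simp: X_def)
  have x: "x \<noteq> one" using Cons by (auto simp: X_def)
  have pre_eq: "(pre one (fst y) (snd y) = []) = (y = (one, []))" for y
    by (cases y) (simp add: pre_eq_Nil)
  show ?case unfolding counit_at_def
  proof (intro conjI allI)
    fix \<Theta> :: "'i list \<Rightarrow> 'k"
    let ?\<Theta> = "\<lambda>y. \<Theta> (pre one (fst y) (snd y))"
    show "wc (x # w) (\<lambda>y z. if y = [] then \<Theta> z else 0) = \<Theta> (x # w)"
      using co[unfolded counit_at_def, THEN conjunct1, rule_format, of ?\<Theta>] x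
      by (simp only: wcop_Cons pre_eq) (simp add: pre_def)
    show "wc (x # w) (\<lambda>y z. if z = [] then \<Theta> y else 0) = \<Theta> (x # w)"
      using co[unfolded counit_at_def, THEN conjunct2, rule_format, of ?\<Theta>] x
      by (simp only: wcop_Cons pre_eq) (simp add: pre_def)
  qed
qed (simp add: counit_at_def)

end

sublocale letters \<subseteq> W: gcoalg_coords "lists X" "wdeg deg" "wcop one deg cop" "[]"
  by unfold_locales (auto intro: words_coassoc words_cocomm words_counit)

context letters
begin

text \<open>Compatibility of concatenation with the coproduct. It will make left multiplication by a
  primitive element dual to a derivation.\<close>

lemma wcop_append:
  "wc (u @ v) \<Theta> = wc u (\<lambda>a b. wc v (\<lambda>a' b'. sg (wd b * wd a') * \<Theta> (a @ a') (b @ b')))"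
proof (induction u arbitrary: \<Theta>)
  case (Cons x u)
  have sg_eq: "sg (wd b * wd a') * (sg (deg z * (wd a + wd a')) * \<Theta>') =
     sg (deg z * wd a) * (sg ((deg z + wd b) * wd a') * \<Theta>')" for a b a' z and \<Theta>' :: 'k
    unfolding mult.assoc[symmetric] sg_add[symmetric]
    by (intro arg_cong2[of _ _ _ _ "(*)"] sg_cong) (auto simp: distrib_left distrib_right)
  show ?case
    by (simp add: Cons sg_eq pre_append W.cop_scale)
qed simp

end

sublocale letters \<subseteq> TT: gcoalg_coords "Y \<times> lists X" "\<lambda>x. deg (fst x) + wdeg deg (snd x)"
    "tcop deg (wdeg deg) cop (wcop one deg cop)" "(one, [])"
proof -
  interpret T': precoalg "Y \<times> lists X" "\<lambda>x. deg (fst x) + wdeg deg (snd x)"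
    "tcop deg (wdeg deg) cop (wcop one deg cop)" "(one, [])" by (rule T.tensor_precoalg)
  show "gcoalg_coords (Y \<times> lists X) (\<lambda>x. deg (fst x) + wdeg deg (snd x))
    (tcop deg (wdeg deg) cop (wcop one deg cop)) (one, [])"
    by unfold_locales (auto intro!: T.tensor_coassoc T.tensor_cocomm T.tensor_counit
      coassoc cocomm counit words_coassoc words_cocomm words_counit simp: mem_Times_iff)
qed

interpretation fs: vector_space "fscale :: 'k::field \<Rightarrow> ('x \<Rightarrow> 'k) \<Rightarrow> _"
  by unfold_locales (simp_all add: fscale_def fun_eq_iff algebra_simps)

text \<open>\<open>P n\<close> describes partial choices in degree \<open>n\<close>,
  \<open>Q n\<close> complete ones, and \<open>G\<close> transports a complete choice to degree
  \<open>p * n\<close>. A positive degree receives constraints from at most one other degree, its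
  quotient by \<open>p\<close>, so the choices can be made recursively. This serves for bases of the
  dual algebra, for generators and for matching letters.\<close>

lemma degree_recursion:
  fixes P Q :: "nat \<Rightarrow> 'a set \<Rightarrow> bool"
  assumes p: "p > 1"
    and start: "\<And>n. n > 0 \<Longrightarrow> P n {}"
    and step: "\<And>n S. n > 0 \<Longrightarrow> Q n S \<Longrightarrow> P (p * n) (G n S)"
    and extend: "\<And>n T. n > 0 \<Longrightarrow> P n T \<Longrightarrow> \<exists>S. T \<subseteq> S \<and> Q n S"
  shows "\<exists>B. \<forall>n>0. Q n (B n) \<and> G n (B n) \<subseteq> B (p * n)"
proof -
  define pick where "pick n T = (SOME S. T \<subseteq> S \<and> Q n S)" for n T
  have pick: "T \<subseteq> pick n T \<and> Q n (pick n T)" if "n > 0" "P n T" for n T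
    unfolding pick_def by (rule someI_ex) (rule extend[OF that])
  \<comment> \<open>The recursion refers to \<open>n div p\<close>, which is smaller only for
    \<open>n > 0\<close>; degrees not divisible by \<open>p\<close> start afresh from
    \<open>{}\<close>.\<close>
  define H where "H = (\<lambda>B n. pick n (if n > 0 \<and> p dvd n then G (n div p) (B (n div p)) else {}))"
  define B where "B = wfrec less_than H"
  have B: "B n = pick n (if n > 0 \<and> p dvd n then G (n div p) (B (n div p)) else {})" for n
  proof -
    have "B n = H (cut B less_than n) n"
      unfolding B_def by (rule wfrec) (rule wf_less_than)
    also have "\<dots> = pick n (if n > 0 \<and> p dvd n then G (n div p) (B (n div p)) else {})"
      using p by (auto simp: H_def cut_apply)
    finally show ?thesis .
  qed
  have Q: "n > 0 \<Longrightarrow> Q n (B n)" for n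
  proof (induction n rule: less_induct)
    case (less n)
    have "P n (if n > 0 \<and> p dvd n then G (n div p) (B (n div p)) else {})"
    proof (cases "p dvd n")
      case True
      then have "n div p > 0" "n div p < n" "p * (n div p) = n" using p less.prems by (auto elim!: dvdE)
      then show ?thesis using step[of "n div p"] less True by auto
    qed (use start less.prems in auto)
    then show ?case using pick less.prems B[of n] by metis
  qed
  have "G n (B n) \<subseteq> B (p * n)" if "n > 0" for n
  proof -
    have n: "p * n > 0" "p dvd p * n" "p * n div p = n" using p that by auto
    then have "P (p * n) (G n (B n))" using step Q that by blast
    then show ?thesis using pick n B[of "p * n"] by metis
  qed
  with Q show ?thesis by blast
qed

section \<open>Coalgebras with adapted bases\<close>

text \<open>All positive degree letters become primitive, so the induced product on functions of
  words is the shuffle product. The value off \<open>Y\<close> is \<open>0\<close> because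
  \<open>precoalg\<close> constrains \<open>cop x\<close> for every \<open>x\<close>: it may depend
  only on matrix entries indexed by \<open>Y\<close>.\<close>

definition cop0 :: "'i set \<Rightarrow> 'i \<Rightarrow> 'i \<Rightarrow> ('i \<Rightarrow> 'i \<Rightarrow> 'k::field) \<Rightarrow> 'k" where
  "cop0 Y one x \<Theta> = (if x \<notin> Y then 0 else if x = one then \<Theta> one one else \<Theta> x one + \<Theta> one x)"

lemma (in letters) letters_trivial:  "letters Y deg (cop0 Y one :: 'i \<Rightarrow> ('i \<Rightarrow> 'i \<Rightarrow> 'k) \<Rightarrow> 'k) one"
proof
  fix x assume x: "x \<in> Y"
  let ?c = "cop0 Y one :: 'i \<Rightarrow> ('i \<Rightarrow> 'i \<Rightarrow> 'k) \<Rightarrow> 'k"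
  show "coassoc_at ?c x" "cocomm_at deg ?c x" "counit_at one ?c x"
    using x one_in by (auto simp: coassoc_at_def cocomm_at_def counit_at_def cop0_def deg_one add_ac)
next
  fix x and \<Theta> \<Theta>' :: "'i \<Rightarrow> 'i \<Rightarrow> 'k"
  assume *: "\<And>y z. y \<in> Y \<Longrightarrow> z \<in> Y \<Longrightarrow> deg y + deg z = deg x \<Longrightarrow> \<Theta> y z = \<Theta>' y z"
  then show "cop0 Y one x \<Theta> = cop0 Y one x \<Theta>'"
    using *[of x one] *[of one x] *[of one one] one_in by (cases "x = one") (simp_all add: cop0_def deg_one)
qed (simp_all add: one_in deg_one fin cop0_def distrib_left, rule deg_0)

definition odlt :: "'i option \<Rightarrow> 'i \<Rightarrow> 'k::field" where
  "odlt z = (case z of Some y \<Rightarrow> dlt y | None \<Rightarrow> 0)"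

lemma odlt_simps [simp]: "odlt (Some y) = dlt y" "odlt None = 0" by (simp_all add: odlt_def)

text \<open>
  The letters are dual to a basis of the dual algebra that the \<open>p\<close>-th power map permutes up to zeros;
  \<open>F\<close> is the partial injection of letters describing it.
\<close>

locale adapted = letters Y deg cop one + char_coords Y deg cop one p
  for Y :: "'i set" and deg and cop :: "'i \<Rightarrow> ('i \<Rightarrow> 'i \<Rightarrow> 'k::field) \<Rightarrow> 'k" and one and p +
  fixes F :: "'i \<Rightarrow> 'i option"
  assumes F_dom: "F x = Some y \<Longrightarrow> x \<in> X \<and> y \<in> X \<and> deg y = p * deg x \<and> good p (deg x)"
    and F_inj: "F x = Some z \<Longrightarrow> F y = Some z \<Longrightarrow> x = y"
    and F_pw: "x \<in> X \<Longrightarrow> good p (deg x) \<Longrightarrow> pw (dlt x) p = odlt (F x)"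

sublocale adapted \<subseteq> W: char_coords "lists X" "wdeg deg" "wcop one deg cop" "[]" p
  by unfold_locales (auto simp: char_p p_prime)

sublocale adapted \<subseteq> TT: char_coords "Y \<times> lists X" "\<lambda>x. deg (fst x) + wdeg deg (snd x)"
    "tcop deg (wdeg deg) cop (wcop one deg cop)" "(one, [])" p
  by unfold_locales (auto simp: char_p p_prime)

definition wF :: "('i \<Rightarrow> 'i option) \<Rightarrow> 'i list \<Rightarrow> 'i list option" where
  "wF F w = (if \<forall>x\<in>set w. F x \<noteq> None then Some (map (the \<circ> F) w) else None)"

lemma wF_Nil [simp]: "wF F [] = Some []" by (simp add: wF_def)
lemma wF_Cons: "wF F (x # w) = (case F x of None \<Rightarrow> None | Some y \<Rightarrow>
    (case wF F w of None \<Rightarrow> None | Some w' \<Rightarrow> Some (y # w')))"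
  by (auto simp: wF_def split: option.splits)

lemma wF_length: "wF F w = Some w' \<Longrightarrow> length w' = length w"
  by (auto simp: wF_def split: if_splits)

section \<open>The Frobenius map on words\<close>

context letters
begin

definition tens2 :: "('i \<Rightarrow> 'k) \<Rightarrow> ('i list \<Rightarrow> 'k) \<Rightarrow> 'i \<times> 'i list \<Rightarrow> 'k" where
  "tens2 f g = (\<lambda>x. f (fst x) * g (snd x))"

text \<open>The pullback of a function of words along \<open>pre\<close>. Since \<open>pre\<close>
  is a coalgebra map, \<open>split2\<close> is multiplicative, so powers of words can be computed on
  letters tensor words, where they factor.\<close>

definition split2 :: "('i list \<Rightarrow> 'k) \<Rightarrow> 'i \<times> 'i list \<Rightarrow> 'k" where
  "split2 f = (\<lambda>x. if x \<in> Y \<times> lists X then f (pre one (fst x) (snd x)) else 0)"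

lemma hom_tens2: "hom m f \<Longrightarrow> W.hom n g \<Longrightarrow> TT.hom (m + n) (tens2 f g)"
  by (auto simp: hom_def W.hom_def TT.hom_def tens2_def mem_Times_iff)

lemma conv_tens2:
  assumes "hom m f'" "W.hom n g"
  shows "TT.conv (tens2 f g) (tens2 f' g') = fscale (sg (m * n)) (tens2 (conv f f') (W.conv g g'))"
proof
  fix x
  show "TT.conv (tens2 f g) (tens2 f' g') x = fscale (sg (m * n)) (tens2 (conv f f') (W.conv g g')) x"
  proof (cases "x \<in> Y \<times> lists X")
    case True
    have "TT.conv (tens2 f g) (tens2 f' g') x = cop (fst x) (\<lambda>y z. wc (snd x) (\<lambda>a b.
        (sg (m * n) * (f y * f' z)) * (g a * g' b)))"
      unfolding TT.conv_def tcop_def if_P[OF True] 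
      by (intro cop_cong W.cop_cong) (use assms in \<open>auto simp: tens2_def hom_def W.hom_def\<close>)
    also have "\<dots> = sg (m * n) * (cop (fst x) (\<lambda>y z. f y * f' z) * wc (snd x) (\<lambda>a b. g a * g' b))"
      unfolding W.cop_scale cop_scale_right cop_scale by (simp only: mult.assoc)
    finally show ?thesis using True
      by (simp add: fscale_def tens2_def conv_def W.conv_def mem_Times_iff)
  qed (auto simp: TT.conv_def fscale_def tens2_def conv_def W.conv_def mem_Times_iff)
qed

lemma conv_split2: "TT.conv (split2 f) (split2 g) = split2 (W.conv f g)"
proof
  fix x
  show "TT.conv (split2 f) (split2 g) x = split2 (W.conv f g) x"
  proof (cases "x \<in> Y \<times> lists X")
    case True
    then have x: "pre one (fst x) (snd x) \<in> lists X" by (intro pre_lists) (simp_all add: mem_Times_iff)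
    have "TT.conv (split2 f) (split2 g) x = T.tc x (\<lambda>y z. f (pre one (fst y) (snd y)) * g (pre one (fst z) (snd z)))"
      unfolding TT.conv_def if_P[OF True] by (rule TT.cop_cong) (simp add: split2_def)
    then show ?thesis using True x by (auto simp: split2_def W.conv_def wcop_pre)
  qed (auto simp: TT.conv_def split2_def)
qed

lemma pw_split2: "TT.pw (split2 f) n = split2 (W.pw f n)"
proof (induction n)
  case 0
  then show ?case by (auto simp: split2_def dlt_def fun_eq_iff pre_eq_Nil one_in)
qed (simp add: conv_split2)

text \<open>A word \<open>y # w\<close> arises either by prepending \<open>y\<close> to
  \<open>w\<close> or by prepending the silent letter \<open>one\<close> to the whole word.\<close>

lemma split2_dlt:
  assumes "y \<in> X" "w \<in> lists X"
  shows "split2 (dlt (y # w)) = tens2 (dlt y) (dlt w) + tens2 (dlt one) (dlt (y # w))"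
  using assms one_in by (auto simp: fun_eq_iff split2_def tens2_def dlt_def pre_def X_def)

end

context adapted
begin

lemma wF_props:
  assumes "wF F w = Some w'"
  shows "w \<in> lists X" "w' \<in> lists X" "wd w' = p * wd w" "good p (wd w)"
  using assms
  by (induction w arbitrary: w') (auto simp: wF_Cons good_def distrib_left dest: F_dom split: option.splits)

lemma wF_inj: "wF F u = Some w \<Longrightarrow> wF F v = Some w \<Longrightarrow> u = v"
proof (induction u arbitrary: v w)
  case Nil
  then show ?case using wF_length[of F v w] by simp
next
  case (Cons x u)
  then obtain y w' where w: "F x = Some y" "wF F u = Some w'" "w = y # w'"
    by (auto simp: wF_Cons split: option.splits)
  then obtain x' v' where "v = x' # v'" using Cons.prems(2) by (cases v) auto
  then show ?case using Cons.IH[of w' v'] Cons.prems(2) w F_inj[of x y x']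
    by (auto simp: wF_Cons split: option.splits)
qed

lemma pw_tens2:
  assumes f: "hom m f" and g: "W.hom n g" and good: "good p m"
  shows "TT.pw (tens2 f g) j = tens2 (pw f j) (W.pw g j)"
proof (induction j)
  case 0
  then show ?case by (auto simp: tens2_def dlt_def fun_eq_iff)
next
  case (Suc j)
  have "sg (j * m * n) = (1::'k)" using sg_good[OF good, of "j * n"] by (simp add: mult_ac)
  then show ?case using conv_tens2[OF hom_pw[OF f] g] by (simp add: Suc)
qed

text \<open>Already the square vanishes, by \<open>conv_self_bad\<close> in the first
  factor.\<close>

lemma pw_tens2_bad:
  assumes f: "hom m f" and g: "W.hom n g" and bad: "\<not> good p m"
  shows "TT.pw (tens2 f g) p = 0"
proof -
  have q: "p = Suc (Suc (p - 2))" using p_gt_1 by simp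
  have "TT.conv (tens2 f g) (tens2 f g) = 0"
    by (simp add: conv_tens2[OF f g] conv_self_bad[OF f bad]) (simp add: fscale_def tens2_def fun_eq_iff)
  then show ?thesis by (subst q) (simp add: TT.conv_assoc[symmetric])
qed

text \<open>Induction on the word through \<open>split2\<close>: the Frobenius map is additive on
  the two summands of \<open>split2_dlt\<close>, and evaluation at a pair with first entry different
  from \<open>one\<close> isolates the power of \<open>dlt y\<close> tensor \<open>dlt w\<close>,
  which factors. In effect only the terms survive in which all \<open>p\<close> copies merge letter
  by letter.\<close>

theorem pw_dlt_word:
  assumes "w \<in> lists X" "good p (wd w)"
  shows "W.pw (dlt w) p = odlt (wF F w)"
  using assms
proof (induction w)
  case Nil
  have "W.pw (dlt []) n = dlt []" for n
    by (induction n) (simp_all add: W.conv_one_left[OF W.hom_one])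
  then show ?case by simp
next
  case (Cons y w)
  let ?R = "odlt (wF F (y # w)) :: 'i list \<Rightarrow> 'k"
  have y: "y \<in> X" "w \<in> lists X" using Cons by auto
  have homy: "hom (deg y) (dlt y)" using y hom_dlt by (auto simp: X_def)
  have homw: "W.hom (wd w) (dlt w)" using y W.hom_dlt by auto
  have homyw: "W.hom (wd (y # w)) (dlt (y # w))" using y by (intro W.hom_dlt) auto
  have R_out: "?R v = 0" if "v \<notin> lists X \<or> v = []" for v
    using that y wF_props(2)[of "y # w"] by (auto simp: dlt_def wF_Cons split: option.splits)
  show ?case
  proof
    fix v
    show "W.pw (dlt (y # w)) p v = ?R v"
    proof (cases "v \<in> lists X \<and> v \<noteq> []")
      \<comment> \<open>The power is supported on words of degree \<open>p * wd (y # w) > 0\<close>,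
        which excludes the empty word.\<close>
      case False
      have "W.pw (dlt (y # w)) p v = 0"
      proof (rule ccontr)
        assume "W.pw (dlt (y # w)) p v \<noteq> 0"
        then have "v \<in> lists X \<and> wd v = p * wd (y # w)"
          using W.hom_pw[OF homyw, of p] by (auto simp: W.hom_def)
        with False show False using deg_X[OF y(1)] p_gt_1 by auto
      qed
      with R_out False show ?thesis by auto
    next
      case True
      then obtain x v' where v: "v = x # v'" "x \<in> X" "v' \<in> lists X" by (cases v) auto
      have xo: "x \<noteq> one" "x \<in> Y" using v by (auto simp: X_def)
      have "W.pw (dlt (y # w)) p v = split2 (W.pw (dlt (y # w)) p) (x, v')"
        using v xo by (simp add: split2_def pre_def)
      also have "\<dots> = TT.pw (tens2 (dlt y) (dlt w) + tens2 (dlt one) (dlt (y # w))) p (x, v')"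
        by (simp only: pw_split2[symmetric] split2_dlt[OF y])
      also have "TT.pw (tens2 (dlt y) (dlt w) + tens2 (dlt one) (dlt (y # w))) p =
          TT.pw (tens2 (dlt y) (dlt w)) p + TT.pw (tens2 (dlt one) (dlt (y # w))) p"
        using hom_tens2[OF homy homw] hom_tens2[OF hom_one homyw] Cons.prems
        by (intro TT.Frobenius_add) auto
      also have "TT.pw (tens2 (dlt one) (dlt (y # w))) p = tens2 (pw (dlt one) p) (W.pw (dlt (y # w)) p)"
        by (rule pw_tens2[OF hom_one homyw]) (simp add: good_def)
      \<comment> \<open>Powers of \<open>dlt one\<close> stay in degree \<open>0\<close>, hence
        vanish at the letter \<open>x\<close>, which is not \<open>one\<close>.\<close>
      also have "(TT.pw (tens2 (dlt y) (dlt w)) p + \<dots>) (x, v') = TT.pw (tens2 (dlt y) (dlt w)) p (x, v')"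
        using hom_pw[OF hom_one, of p] xo by (auto simp: tens2_def hom_def dest: deg_0)
      also have "\<dots> = ?R v"
      proof (cases "good p (deg y)")
        case good: True
        then have "good p (wd w)" using Cons.prems by (auto simp: good_def)
        then have IH: "W.pw (dlt w) p = odlt (wF F w)"
          using Cons y by simp
        show ?thesis
          unfolding pw_tens2[OF homy homw good] IH F_pw[OF y(1) good] wF_Cons v
          unfolding tens2_def by (auto simp: dlt_def split: option.splits)
      next
        \<comment> \<open>A word of good degree may contain letters of bad degree. There
          \<open>F\<close> is \<open>None\<close>, and the square of that factor is already
          zero.\<close>
        case bad: False
        then have "F y = None" using F_dom[of y] by (cases "F y") auto
        then show ?thesis unfolding pw_tens2_bad[OF homy homw bad] by (simp add: wF_Cons)
      qed
      finally show ?thesis .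
    qed
  qed
qed

end

section \<open>The shuffle algebra\<close>

sublocale adapted \<subseteq> S: letters Y deg "cop0 Y one :: 'i \<Rightarrow> ('i \<Rightarrow> 'i \<Rightarrow> 'k) \<Rightarrow> 'k" one
  by (rule letters_trivial)

text \<open>No letter disappears from both halves, since positive degree excludes
  \<open>y = z = one\<close>. So the coproduct of \<open>w\<close> involves only pairs of total
  length at least \<open>length w\<close>; dually, a product of words contains no word longer than
  the sum of their lengths.\<close>

lemma (in letters) wcop_low:
  assumes "w \<in> lists X" "\<And>a b. length w \<le> length a + length b \<Longrightarrow> \<Theta> a b = 0"
  shows "wc w \<Theta> = 0"
  using assms
proof (induction w arbitrary: \<Theta> rule: list.induct)
  case (Cons x w)
  have x: "deg x > 0" using Cons.prems deg_X by auto
  show ?case unfolding wcop.simps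
  proof (rule cop_eq_0)
    fix y z assume "deg y + deg z = deg x"
    with x have "y \<noteq> one \<or> z \<noteq> one" by (auto simp: deg_one)
    then have "length a + length b < length (pre one y a) + length (pre one z b)" for a b
      by (auto simp: pre_def)
    then have *: "length w \<le> length a + length b \<Longrightarrow> length (x # w) \<le> length (pre one y a) + length (pre one z b)" for a b
      by (metis Suc_leI length_Cons less_le_trans not_less not_less_eq)
    show "wc w (\<lambda>a b. sg (deg z * wd a) * \<Theta> (pre one y a) (pre one z b)) = 0"
      using Cons.prems(1) by (intro Cons.IH) (auto simp: Cons.prems(2)[OF *])
  qed
qed simp

context adapted
begin

lemma S_wcop_Cons:
  assumes "x \<in> X"
  shows "S.wc (x # w) \<Theta> = S.wc w (\<lambda>a b. \<Theta> (x # a) b) + S.wc w (\<lambda>a b. sg (deg x * wd a) * \<Theta> a (x # b))"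
  using assms by (simp add: X_def cop0_def pre_def deg_one)

text \<open>A primitive letter goes to exactly one half, so the shuffle product is graded by
  length.\<close>

lemma S_wcop_low:
  assumes "w \<in> lists X" "\<And>a b. length a + length b = length w \<Longrightarrow> \<Theta> a b = 0"
  shows "S.wc w \<Theta> = 0"
  using assms
proof (induction w arbitrary: \<Theta> rule: list.induct)
  case (Cons x w)
  then have "x \<in> X" by auto
  moreover have "S.wc w (\<lambda>a b. \<Theta> (x # a) b) = 0" "S.wc w (\<lambda>a b. sg (deg x * wd a) * \<Theta> a (x # b)) = 0"
    using Cons.prems(1) by (auto intro!: Cons.IH Cons.prems(2))
  ultimately show ?case by (simp add: S_wcop_Cons del: wcop.simps)
qed simp

text \<open>A letter that splits properly contributes to both factors, so it makes the result shorter.\<close>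

lemma wcop_top:
  assumes "w \<in> lists X" "\<And>a b. length w < length a + length b \<Longrightarrow> \<Theta> a b = 0"
  shows "wc w \<Theta> = S.wc w \<Theta>"
  using assms
proof (induction w arbitrary: \<Theta> rule: list.induct)
  case (Cons x w)
  have x: "x \<in> X" "x \<in> Y" "x \<noteq> one" "deg x > 0" and w: "w \<in> lists X"
    using Cons.prems deg_X by (auto simp: X_def)
  let ?G = "\<lambda>y z. wc w (\<lambda>a b. sg (deg z * wd a) * \<Theta> (pre one y a) (pre one z b))"
  have G: "?G y z = 0" if "y \<noteq> one" "z \<noteq> one" for y z
    using that w by (intro wcop_low) (auto simp: pre_def intro!: Cons.prems(2))
  have "wc (x # w) \<Theta> = cop x (\<lambda>y z. (if z = one then ?G y one else 0) + (if y = one then ?G one z else 0))"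
    unfolding wcop.simps using x G by (intro cop_cong) (auto simp: deg_one)
  also have "\<dots> = ?G x one + ?G one x"
    using counit[OF x(2)] unfolding cop_add counit_at_def by simp
  also have "?G x one = S.wc w (\<lambda>a b. \<Theta> (x # a) b)"
    using x w by (subst Cons.IH[symmetric]) (auto simp: pre_def deg_one intro!: Cons.prems(2))
  also have "?G one x = S.wc w (\<lambda>a b. sg (deg x * wd a) * \<Theta> a (x # b))"
    using x w by (subst Cons.IH[symmetric]) (auto simp: pre_def deg_one intro!: Cons.prems(2))
  finally show ?case using x by (simp add: S_wcop_Cons del: wcop.simps)
qed simp

section \<open>Bases modulo shuffle decomposables, stable under \<open>F\<close>\<close>

definition Wset :: "nat \<Rightarrow> nat \<Rightarrow> 'i list set" where
  "Wset d r = {w \<in> lists X. wd w = d \<and> length w = r}"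

lemma finite_Wset [simp]: "finite (Wset d r)"
  by (rule finite_subset[OF _ W.finite_degree[of d]]) (auto simp: Wset_def)

text \<open>Decomposables are taken for the shuffle product, where they split by degree and length;
  the quasi-shuffle product is only filtered by length.\<close>

definition Dec :: "nat \<Rightarrow> nat \<Rightarrow> ('i list \<Rightarrow> 'k) set" where
  "Dec d r = fs.span {S.W.conv (dlt u) (dlt v) | u v. u \<in> lists X \<and> v \<in> lists X \<and> u \<noteq> [] \<and> v \<noteq> [] \<and>
     wd u + wd v = d \<and> length u + length v = r}"

definition pullF :: "('i list \<Rightarrow> 'i list \<Rightarrow> 'k) \<Rightarrow> 'i list \<Rightarrow> 'i list \<Rightarrow> 'k" where
  "pullF \<Theta> a b = (case wF F a of None \<Rightarrow> 0 | Some a' \<Rightarrow> (case wF F b of None \<Rightarrow> 0 | Some b' \<Rightarrow> \<Theta> a' b'))"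

text \<open>The shuffle coproduct only distributes letters over two halves, so it commutes with
  replacing letters by their \<open>F\<close>-values; a letter outside the domain of
  \<open>F\<close> kills the half that contains it. Signs agree because letters in the domain have
  good degree.\<close>

lemma S_wcop_pullF:
  "w \<in> lists X \<Longrightarrow> S.wc w (pullF \<Theta>) = (case wF F w of None \<Rightarrow> 0 | Some w' \<Rightarrow> S.wc w' \<Theta>)"
proof (induction w arbitrary: \<Theta> rule: list.induct)
  case (Cons x w)
  then have x: "x \<in> X" and w: "w \<in> lists X" by auto
  show ?case
  proof (cases "F x")
    case None
    then have "pullF \<Theta> (x # a) b = 0" "pullF \<Theta> a (x # b) = 0" for a b
      by (auto simp: pullF_def wF_Cons split: option.splits)
    then show ?thesis using None x by (simp add: S_wcop_Cons wF_Cons del: wcop.simps)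
  next
    case (Some y)
    note y = F_dom[OF Some]
    have "(\<lambda>a b. pullF \<Theta> (x # a) b) = pullF (\<lambda>a b. \<Theta> (y # a) b)"
      by (auto simp: pullF_def wF_Cons Some fun_eq_iff split: option.splits)
    moreover have "(\<lambda>a b. sg (deg x * wd a) * pullF \<Theta> a (x # b)) = pullF (\<lambda>a b. sg (deg y * wd a) * \<Theta> a (y # b))"
    proof -
      have "good p (deg y)" using y by (auto simp: good_def)
      then show ?thesis using y
        by (auto simp: pullF_def wF_Cons Some fun_eq_iff sg_good split: option.splits)
    qed
    ultimately show ?thesis using x y
      by (simp add: S_wcop_Cons Cons.IH[OF w] wF_Cons Some del: wcop.simps split: option.split)
  qed
qed (simp add: pullF_def)

text \<open>The transpose of the letterwise action of \<open>F\<close>: it sends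
  \<open>dlt w'\<close> back to \<open>dlt w\<close> when \<open>wF F w = Some w'\<close>. Unlike
  the Frobenius map it is linear, and it is multiplicative for the shuffle product, so it carries
  decomposables to decomposables.\<close>

definition psi :: "('i list \<Rightarrow> 'k) \<Rightarrow> 'i list \<Rightarrow> 'k" where
  "psi f w = (case wF F w of None \<Rightarrow> 0 | Some w' \<Rightarrow> f w')"

lemma linear_psi: "Vector_Spaces.linear fscale fscale psi"
  by unfold_locales (auto simp: psi_def fscale_def fun_eq_iff algebra_simps split: option.split)

lemma psi_conv: "psi (S.W.conv f g) = S.W.conv (psi f) (psi g)"
proof
  fix w
  have *: "(\<lambda>a b. psi f a * psi g b) = pullF (\<lambda>a b. f a * g b)"
    by (auto simp: psi_def pullF_def fun_eq_iff split: option.split)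
  show "psi (S.W.conv f g) w = S.W.conv (psi f) (psi g) w"
  proof (cases "w \<in> lists X")
    case True
    have "S.W.conv (psi f) (psi g) w = S.wc w (pullF (\<lambda>a b. f a * g b))"
      using True by (simp only: S.W.conv_def * if_True)
    then show ?thesis using True wF_props(2)[of w]
      by (auto simp: S.W.conv_def S_wcop_pullF psi_def split: option.split)
  next
    case False
    then have "wF F w = None" using wF_props(1)[of w] by (cases "wF F w") auto
    then show ?thesis using False by (auto simp: S.W.conv_def psi_def)
  qed
qed

lemma psi_dlt_Some: "wF F w = Some w' \<Longrightarrow> psi (dlt w') = dlt w"
  by (auto simp: psi_def dlt_def fun_eq_iff dest: wF_inj split: option.split)

lemma psi_dlt_None: "(\<And>w. wF F w \<noteq> Some w') \<Longrightarrow> psi (dlt w') = 0"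
  by (auto simp: psi_def dlt_def fun_eq_iff split: option.split)

lemma psi_Dec:
  assumes "f \<in> Dec (p * d) r" shows "psi f \<in> Dec d r"
proof -
  interpret lp: Vector_Spaces.linear "fscale :: 'k \<Rightarrow> _" fscale psi by (rule linear_psi)
  show ?thesis using assms unfolding Dec_def[of "p * d"]
  proof (induction rule: fs.span_induct_alt)
    case (step c x y)
    then obtain u v where uv: "x = S.W.conv (dlt u) (dlt v)" "u \<in> lists X" "v \<in> lists X" "u \<noteq> []" "v \<noteq> []"
      "wd u + wd v = p * d" "length u + length v = r" by auto
    have "psi x \<in> Dec d r"
    proof (cases "\<exists>u' v'. wF F u' = Some u \<and> wF F v' = Some v")
      case True
      then obtain u' v' where *: "wF F u' = Some u" "wF F v' = Some v" by auto
      have "p * (wd u' + wd v') = p * d" using uv(6) wF_props(3)[OF *(1)] wF_props(3)[OF *(2)]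
        by (simp add: distrib_left)
      then have "wd u' + wd v' = d" using p_gt_1 by simp
      moreover have "u' \<noteq> []" "v' \<noteq> []" "length u' + length v' = r"
        using * wF_length[OF *(1)] wF_length[OF *(2)] uv by auto
      ultimately show ?thesis unfolding uv psi_conv psi_dlt_Some[OF *(1)] psi_dlt_Some[OF *(2)] Dec_def
        using wF_props(1)[OF *(1)] wF_props(1)[OF *(2)] by (intro fs.span_base) blast
    next
      case False
      then have "psi (dlt u) = 0 \<or> psi (dlt v) = 0" using psi_dlt_None by blast
      then have "psi x = 0" unfolding uv psi_conv by (metis S.W.conv_0_left(1) S.W.conv_0_right(1))
      then show ?thesis by (simp add: Dec_def fs.span_zero)
    qed
    then show ?case using step unfolding lp.add lp.scale Dec_def by (intro fs.span_add fs.span_scale) auto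
  qed (simp only: lp.zero Dec_def fs.span_zero)
qed

definition relind :: "nat \<Rightarrow> nat \<Rightarrow> 'i list set \<Rightarrow> bool" where
  "relind d r S \<longleftrightarrow> S \<subseteq> Wset d r \<and>
     (\<forall>k. (\<Sum>w\<in>S. fscale (k w) (dlt w)) \<in> Dec d r \<longrightarrow> (\<forall>w\<in>S. k w = 0))"

definition relbasis :: "nat \<Rightarrow> nat \<Rightarrow> 'i list set \<Rightarrow> bool" where
  "relbasis d r S \<longleftrightarrow> relind d r S \<and> (\<forall>w\<in>Wset d r. dlt w \<in> fs.span (dlt ` S \<union> Dec d r))"

text \<open>By finiteness of \<open>Wset d r\<close> a maximal independent extension exists.
  Maximality gives a relation involving any further word, and dividing by the coefficient of that
  word gives the spanning property.\<close>

lemma relind_extend: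
  assumes "relind d r T" shows "\<exists>S. T \<subseteq> S \<and> relbasis d r S"
proof -
  have fin: "finite {S. T \<subseteq> S \<and> relind d r S}"
    by (rule finite_subset[of _ "Pow (Wset d r)"]) (auto simp: relind_def)
  obtain S where S: "T \<subseteq> S" "relind d r S" "\<And>S'. T \<subseteq> S' \<Longrightarrow> relind d r S' \<Longrightarrow> S \<subseteq> S' \<Longrightarrow> S = S'"
    using finite_has_maximal2[OF fin, of T] assms by auto
  have finS: "finite S" using S(2) finite_subset[OF _ finite_Wset] by (auto simp: relind_def)
  have "dlt w \<in> fs.span (dlt ` S \<union> Dec d r)" if w: "w \<in> Wset d r" for w
  proof (cases "w \<in> S")
    case False
    then have "\<not> relind d r (insert w S)" using S by blast
    then obtain k where k: "(\<Sum>v\<in>insert w S. fscale (k v) (dlt v)) \<in> Dec d r" "\<exists>v\<in>insert w S. k v \<noteq> 0"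
      using w S(2) unfolding relind_def by blast
    have sum: "(\<Sum>v\<in>insert w S. fscale (k v) (dlt v)) = fscale (k w) (dlt w) + (\<Sum>v\<in>S. fscale (k v) (dlt v))"
      using False finS by (rule sum.insert[rotated])
    have kw: "k w \<noteq> 0"
    proof
      assume "k w = 0"
      then have "(\<Sum>v\<in>S. fscale (k v) (dlt v)) \<in> Dec d r" using k(1) sum by simp
      then show False using S(2) k(2) \<open>k w = 0\<close> unfolding relind_def by blast
    qed
    let ?U = "fs.span (dlt ` S \<union> Dec d r)"
    have "(\<Sum>v\<in>insert w S. fscale (k v) (dlt v)) \<in> ?U" using k(1) by (intro fs.span_base) auto
    moreover have "(\<Sum>v\<in>S. fscale (k v) (dlt v)) \<in> ?U"
      by (intro fs.span_sum fs.span_scale fs.span_base) auto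
    ultimately have "(\<Sum>v\<in>insert w S. fscale (k v) (dlt v)) - (\<Sum>v\<in>S. fscale (k v) (dlt v)) \<in> ?U"
      by (rule fs.span_diff)
    then have "fscale (k w) (dlt w) \<in> ?U" unfolding sum add_diff_cancel_right' .
    then have "fscale (inverse (k w)) (fscale (k w) (dlt w)) \<in> ?U" by (rule fs.span_scale)
    then show ?thesis using kw by (simp add: fscale_fscale)
  qed (auto intro: fs.span_base)
  with S(1,2) show ?thesis unfolding relbasis_def by blast
qed

text \<open>\<open>psi\<close> maps a relation modulo decomposables in degree \<open>p * d\<close>
  to one in degree \<open>d\<close>; by injectivity of \<open>wF\<close> the coefficients stay the
  same.\<close>

lemma relind_step:
  assumes "relind d r S" shows "relind (p * d) r {w'. \<exists>w\<in>S. wF F w = Some w'}"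
  unfolding relind_def
proof (intro conjI allI impI ballI)
  let ?S' = "{w'. \<exists>w\<in>S. wF F w = Some w'}"
  interpret lp: Vector_Spaces.linear "fscale :: 'k \<Rightarrow> _" fscale psi by (rule linear_psi)
  have SW: "S \<subseteq> Wset d r" using assms by (simp add: relind_def)
  then have finS: "finite S" using finite_subset finite_Wset by blast
  show "?S' \<subseteq> Wset (p * d) r"
    using SW wF_props(2,3) wF_length by (fastforce simp: Wset_def)
  fix k w' assume k: "(\<Sum>w\<in>?S'. fscale (k w) (dlt w)) \<in> Dec (p * d) r" and w': "w' \<in> ?S'"
  let ?S0 = "{w\<in>S. wF F w \<noteq> None}" and ?f = "\<lambda>w. the (wF F w)"
  have img: "?S' = ?f ` ?S0" by force
  have inj: "inj_on ?f ?S0" by (auto intro!: inj_onI dest: wF_inj)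
  let ?k = "\<lambda>w. case wF F w of None \<Rightarrow> 0 | Some w' \<Rightarrow> k w'"
  have "psi (\<Sum>w\<in>?S'. fscale (k w) (dlt w)) = (\<Sum>w\<in>?S'. fscale (k w) (psi (dlt w)))"
    by (simp add: lp.sum lp.scale)
  also have "\<dots> = (\<Sum>w\<in>{w\<in>S. wF F w \<noteq> None}. fscale (?k w) (dlt w))"
    unfolding img sum.reindex[OF inj] by (rule sum.cong) (auto simp: psi_dlt_Some)
  also have "\<dots> = (\<Sum>w\<in>S. fscale (?k w) (dlt w))"
    using finS by (intro sum.mono_neutral_left) (auto split: option.splits)
  finally have "(\<Sum>w\<in>S. fscale (?k w) (dlt w)) \<in> Dec d r" using psi_Dec[OF k] by simp
  then have "\<forall>w\<in>S. ?k w = 0"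
    using assms[unfolded relind_def, THEN conjunct2, rule_format, of ?k] by blast
  then show "k w' = 0" using w' by force
qed

end

section \<open>Monomials\<close>

text \<open>
  Rewriting of products of generators: transpositions with their sign, \<open>p\<close>-th powers and, in bad
  degrees, squares. The scalar is part of the relation because the same rewriting steps are applied in
  two different algebras.
\<close>

inductive red :: "('n \<Rightarrow> nat) \<Rightarrow> nat \<Rightarrow> ('n \<Rightarrow> 'n option) \<Rightarrow> 'n list \<Rightarrow> 'k::field \<Rightarrow> 'n list \<Rightarrow> bool"
  for dg p Fn where
  base: "red dg p Fn l 1 l"
| swap: "red dg p Fn (u @ y # x # v) s l \<Longrightarrow> red dg p Fn (u @ x # y # v) (sg (dg x * dg y) * s) l"
| contract: "good p (dg x) \<Longrightarrow> Fn x = Some y \<Longrightarrow> red dg p Fn (u @ y # v) s l \<Longrightarrow>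
    red dg p Fn (u @ replicate p x @ v) s l"
| vanish: "good p (dg x) \<Longrightarrow> Fn x = None \<Longrightarrow> red dg p Fn (u @ replicate p x @ v) 0 l"
| square: "\<not> good p (dg x) \<Longrightarrow> red dg p Fn (u @ x # x # v) 0 l"

text \<open>The first exponent that can be rewritten: a \<open>p\<close>-th power in good degrees, a
  square in the others.\<close>

definition bound :: "('n \<Rightarrow> nat) \<Rightarrow> nat \<Rightarrow> 'n \<Rightarrow> nat" where
  "bound dg p x = (if good p (dg x) then p else 2)"

definition admissible :: "('n \<Rightarrow> nat) \<Rightarrow> nat \<Rightarrow> 'n multiset \<Rightarrow> bool" where
  "admissible dg p m \<longleftrightarrow> (\<forall>x. count m x < bound dg p x)"

text \<open>Reordering the factors of a monomial changes it by a sign only, so any arrangement of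
  the multiset will do.\<close>

definition listing :: "'n multiset \<Rightarrow> 'n list" where "listing m = (SOME l. mset l = m)"

lemma mset_listing [simp]: "mset (listing m) = m"
  unfolding listing_def by (rule someI_ex) (rule ex_mset)

lemma set_listing [simp]: "set (listing m) = set_mset m"
  by (metis mset_listing set_mset_mset)

text \<open>The scalar is chosen before the continuation \<open>t\<close>, \<open>l\<close>, because
  it depends only on the letters that are moved. So the step can be put in front of any later
  rewriting.\<close>

lemma red_move:
  "\<exists>s::'k::field. s \<noteq> 0 \<and> (\<forall>t l. red dg p Fn (u @ a @ x # b) t l \<longrightarrow> red dg p Fn (u @ x # a @ b) (s * t) (l :: 'n list))"
proof (induction a arbitrary: u)
  case Nil
  show ?case by (rule exI[of _ 1]) simp
next
  case (Cons y a)
  obtain s :: 'k where s: "s \<noteq> 0" "\<And>t l. red dg p Fn ((u @ [y]) @ a @ x # b) t l \<Longrightarrow> red dg p Fn ((u @ [y]) @ x # a @ b) (s * t) l"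
    using Cons[of "u @ [y]"] by blast
  have "red dg p Fn (u @ x # (y # a) @ b) (sg (dg x * dg y) * s * t) l"
    if "red dg p Fn (u @ (y # a) @ x # b) t l" for t l
    using red.swap[of dg p Fn u y x "a @ b" "s * t" l] s(2)[of t l] that by (simp add: mult.assoc)
  with s(1) show ?case by (intro exI[of _ "sg (dg x * dg y) * s"]) simp
qed

lemma red_perm0:
  assumes "mset l = mset l'"
  shows "\<exists>s::'k::field. s \<noteq> 0 \<and> (\<forall>t m. red dg p Fn (u @ l') t m \<longrightarrow> red dg p Fn (u @ l) (s * t) m)"
  using assms
proof (induction l arbitrary: u l')
  case Nil
  then show ?case by (intro exI[of _ 1]) simp
next
  case (Cons x l)
  have "x \<in> set l'" using Cons.prems by (metis list.set_intros(1) mset_eq_setD)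
  then obtain a b where l': "l' = a @ x # b" by (meson split_list)
  then have "mset l = mset (a @ b)" using Cons.prems by simp
  then obtain s :: 'k where s: "s \<noteq> 0"
    "\<And>t m. red dg p Fn ((u @ [x]) @ a @ b) t m \<Longrightarrow> red dg p Fn ((u @ [x]) @ l) (s * t) m"
    using Cons.IH[of "a @ b" "u @ [x]"] by blast
  obtain s' :: 'k where s': "s' \<noteq> 0"
    "\<And>t m. red dg p Fn (u @ a @ x # b) t m \<Longrightarrow> red dg p Fn (u @ x # a @ b) (s' * t) m"
    using red_move[of dg p Fn u a x b] by blast
  have "red dg p Fn (u @ x # l) (s * s' * t) m" if "red dg p Fn (u @ l') t m" for t m
    using s(2)[of "s' * t" m] s'(2)[of t m] that l' by (simp add: mult.assoc)
  then show ?case using s(1) s'(1) by (intro exI[of _ "s * s'"]) simp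
qed

lemma red_perm:
  assumes "mset l = mset l'"
  obtains s :: "'k::field" where "s \<noteq> 0" "\<And>t m. red dg p Fn l' t m \<Longrightarrow> red dg p Fn l (s * t) m"
  using red_perm0[OF assms, of dg p Fn "[]"] by auto

text \<open>Termination by length: a permutation, at the cost of a nonzero scalar, brings an
  excessive power to the front; a contraction then replaces \<open>p\<close> factors by one, and the
  two other rules end with scalar \<open>0\<close>.\<close>

lemma red_normal:
  assumes p: "p > 1" and closed: "\<And>x y. x \<in> NN \<Longrightarrow> Fn x = Some y \<Longrightarrow> y \<in> NN"
    and "set l \<subseteq> NN"
  shows "\<exists>(s :: 'k::field) m. admissible dg p m \<and> set_mset m \<subseteq> NN \<and> red dg p Fn l s (listing m)"
  using assms(3)
proof (induction "length l" arbitrary: l rule: less_induct)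
  case less
  show ?case
  proof (cases "admissible dg p (mset l)")
    case True
    obtain s :: 'k where "red dg p Fn l (s * 1) (listing (mset l))"
      using red_perm[of l "listing (mset l)" dg p Fn] red.base by (metis mset_listing)
    then show ?thesis using True less.prems by (intro exI[of _ s] exI[of _ "mset l"]) auto
  next
    case False
    then obtain x where x: "count (mset l) x \<ge> bound dg p x" by (auto simp: admissible_def not_less)
    let ?b = "bound dg p x"
    have b: "?b > 1" using p by (simp add: bound_def)
    then have "x \<in> set l" using x by (metis count_greater_zero_iff le_0_eq not_gr_zero not_less_zero set_mset_mset)
    then have xN: "x \<in> NN" using less.prems by auto
    obtain v where v: "mset l = replicate_mset ?b x + mset v"
      using x ex_mset by (metis count_le_replicate_mset_subset_eq subset_mset.add_diff_inverse)
    have vN: "set v \<subseteq> NN" using v less.prems by (metis Un_subset_iff set_mset_mset set_mset_union)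
    have len: "length v + ?b = length l" using arg_cong[OF v, of size] by simp
    obtain s :: 'k where s: "s \<noteq> 0" "\<And>t m. red dg p Fn (replicate ?b x @ v) t m \<Longrightarrow> red dg p Fn l (s * t) m"
      using red_perm[of l "replicate ?b x @ v" dg p Fn] v by auto
    \<comment> \<open>With scalar \<open>0\<close> every target is allowed; the empty monomial is
      admissible.\<close>
    have vanishing: ?thesis if "\<And>m. red dg p Fn (replicate ?b x @ v) (0::'k) m"
      using s(2)[OF that[of "listing {#}"]] p by (intro exI[of _ "s * 0"] exI[of _ "{#}"]) (auto simp: admissible_def bound_def)
    show ?thesis
    proof (cases "good p (dg x)")
      case good: True
      show ?thesis
      proof (cases "Fn x")
        case None
        then have "red dg p Fn (replicate ?b x @ v) (0::'k) m" for m
          using red.vanish[of p dg x Fn "[]" v m] good by (simp add: bound_def)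
        then show ?thesis by (rule vanishing)
      next
        case (Some y)
        have "length (y # v) < length l" "set (y # v) \<subseteq> NN" using len b vN closed[OF xN Some] by auto
        then obtain t :: 'k and m where m: "admissible dg p m" "set_mset m \<subseteq> NN" "red dg p Fn (y # v) t (listing m)"
          using less.hyps by blast
        have "red dg p Fn (replicate ?b x @ v) t (listing m)"
          using red.contract[of p dg x Fn y "[]" v t "listing m"] m(3) good Some by (simp add: bound_def)
        then show ?thesis using s(2) m(1,2) by blast
      qed
    next
      case bad: False
      then have "red dg p Fn (replicate ?b x @ v) (0::'k) m" for m
        using red.square[of p dg x Fn "[]" v m] by (simp add: bound_def numeral_2_eq_2)
      then show ?thesis by (rule vanishing)
    qed
  qed
qed

context gcoalg_coords
begin

definition mon :: "('n \<Rightarrow> 'a \<Rightarrow> 'b) \<Rightarrow> 'n list \<Rightarrow> 'a \<Rightarrow> 'b" where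
  "mon g l = foldr (\<lambda>n f. conv (g n) f) l (dlt one)"

lemma mon_simps [simp]: "mon g [] = dlt one" "mon g (n # l) = conv (g n) (mon g l)"
  by (simp_all add: mon_def)

lemma hom_mon:
  assumes "\<And>n. n \<in> set l \<Longrightarrow> hom (dg n) (g n)"
  shows "hom (sum_list (map dg l)) (mon g l)"
  using assms by (induction l) (auto intro: hom_one hom_conv)

lemma mon_append:
  assumes "\<And>n. n \<in> set (u @ v) \<Longrightarrow> hom (dg n) (g n)"
  shows "mon g (u @ v) = conv (mon g u) (mon g v)"
  using assms
proof (induction u)
  case Nil
  then show ?case using conv_one_left[OF hom_mon[of v dg g]] by simp
qed (simp add: conv_assoc)

lemma mon_replicate: "mon g (replicate k n) = pw (g n) k"
  by (induction k) simp_all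

end

text \<open>Every rule of \<open>red\<close> is an identity in any graded commutative algebra whose
  elements \<open>g n\<close> have the prescribed \<open>p\<close>-th powers. Hence one derivation
  yields the same scalar in all such algebras.\<close>

lemma (in char_coords) red_mon:
  assumes hom_g: "\<And>n. n \<in> NN \<Longrightarrow> hom (dg n) (g n)"
    and g_pw: "\<And>n. n \<in> NN \<Longrightarrow> good p (dg n) \<Longrightarrow> pw (g n) p = (case Fn n of Some m \<Rightarrow> g m | None \<Rightarrow> 0)"
    and closed: "\<And>x y. x \<in> NN \<Longrightarrow> Fn x = Some y \<Longrightarrow> y \<in> NN"
    and "red dg p Fn l s l'" "set l \<subseteq> NN"
  shows "mon g l = fscale s (mon g l')"
proof -
  have app: "mon g (u @ v) = conv (mon g u) (mon g v)" if "set u \<subseteq> NN" "set v \<subseteq> NN" for u v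
    using that hom_g by (intro mon_append[of _ _ dg]) auto
  show ?thesis using assms(4,5)
  proof (induction rule: red.induct)
    case (base l)
    then show ?case by simp
  next
    case (swap u y x v s l)
    then have *: "set u \<subseteq> NN" "set v \<subseteq> NN" "x \<in> NN" "y \<in> NN" by auto
    have "mon g (x # y # v) = fscale (sg (dg x * dg y)) (mon g (y # x # v))"
      using conv_comm[OF hom_g[OF *(3)] hom_g[OF *(4)]] conv_assoc
      by (simp add: conv_scale_left) (metis conv_assoc conv_scale_left)
    then have "mon g (u @ x # y # v) = fscale (sg (dg x * dg y)) (mon g (u @ y # x # v))"
      using * app[of u "x # y # v"] app[of u "y # x # v"] by (simp only: set_simps insert_subset conv_scale_right simp_thms)
    then show ?case using swap by (simp add: fscale_fscale)
  next
    case (contract x y u v s l)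
    then have *: "set u \<subseteq> NN" "set v \<subseteq> NN" "x \<in> NN" using p_gt_1 by auto
    have y: "y \<in> NN" using closed contract * by blast
    have "mon g (replicate p x @ v) = mon g (y # v)"
      using app[of "replicate p x" v] * g_pw[OF *(3)] contract by (auto simp: mon_replicate set_replicate_conv_if)
    then have "mon g (u @ replicate p x @ v) = mon g (u @ y # v)"
      using app[of u "replicate p x @ v"] app[of u "y # v"] * y by (auto simp: set_replicate_conv_if)
    then show ?case using contract * y by auto
  next
    case (vanish x u v l)
    then have *: "set u \<subseteq> NN" "set v \<subseteq> NN" "x \<in> NN" using p_gt_1 by auto
    have "mon g (replicate p x @ v) = 0"
      using app[of "replicate p x" v] * g_pw[OF *(3)] vanish by (auto simp: mon_replicate set_replicate_conv_if)
    then have "mon g (u @ replicate p x @ v) = 0"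
      using app[of u "replicate p x @ v"] * by (auto simp: set_replicate_conv_if)
    then show ?case by simp
  next
    case (square x u v l)
    then have *: "set u \<subseteq> NN" "set v \<subseteq> NN" "x \<in> NN" by auto
    have "mon g (x # x # v) = 0"
      using conv_self_bad[OF hom_g[OF *(3)] square(1)] by (simp flip: conv_assoc)
    then show ?case using app[of u "x # x # v"] * by auto
  qed
qed

section \<open>Generators of the quasi-shuffle algebra\<close>

lemma dlt_eq_0_iff: "dlt i x = (0 :: 'k::zero_neq_one) \<longleftrightarrow> x \<noteq> i"
  by (simp add: dlt_def)

lemma separating_functional:
  fixes x :: "'x \<Rightarrow> 'k::field"
  assumes "x \<notin> fs.span U"
  shows "\<exists>g. Vector_Spaces.linear fscale (*) g \<and> g x = 1 \<and> (\<forall>u\<in>U. g u = 0)"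
proof -
  interpret kk: vector_space "(*) :: 'k \<Rightarrow> 'k \<Rightarrow> 'k" by unfold_locales (simp_all add: algebra_simps)
  interpret vp: vector_space_pair "fscale :: 'k \<Rightarrow> ('x \<Rightarrow> 'k) \<Rightarrow> _" "(*) :: 'k \<Rightarrow> 'k \<Rightarrow> 'k" ..
  obtain B where B: "B \<subseteq> U" "fs.independent B" "U \<subseteq> fs.span B"
    using fs.maximal_independent_subset[of U] by blast
  have "x \<notin> fs.span B" using assms fs.span_mono[OF B(1)] by blast
  then have "fs.independent (insert x B)" using B by (intro fs.independent_insertI)
  then obtain g where g: "Vector_Spaces.linear fscale (*) g" "\<forall>v\<in>insert x B. g v = (if v = x then 1 else 0)"
    using vp.linear_independent_extend[of "insert x B" "\<lambda>v. if v = x then 1 else 0"] by auto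
  interpret lg: Vector_Spaces.linear fscale "(*) :: 'k \<Rightarrow> 'k \<Rightarrow> 'k" g by (rule g(1))
  have "g u = 0" if "u \<in> fs.span B" for u
    using that
  proof (induction rule: fs.span_induct_alt)
    case base
    show ?case by (rule lg.zero)
  next
    case (step c v y)
    have "v \<noteq> x" using step(1) \<open>x \<notin> fs.span B\<close> fs.span_base by blast
    then show ?case using step g(2) unfolding lg.add lg.scale by simp
  qed
  then have "\<forall>u\<in>U. g u = 0" using B(3) by blast
  moreover have "g x = 1" using g(2) by simp
  ultimately show ?thesis using g(1) by (intro exI[of _ g]) simp
qed

context adapted
begin

text \<open>For each length \<open>r\<close> separately, bases modulo decomposables are chosen with
  \<open>degree_recursion\<close>; this is possible because \<open>wF\<close> multiplies degrees by
  \<open>p\<close> and preserves length.\<close>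

lemma exists_generators:
  "\<exists>N. N \<subseteq> lists X - {[]} \<and> (\<forall>w w'. w \<in> N \<longrightarrow> wF F w = Some w' \<longrightarrow> w' \<in> N) \<and>
     (\<forall>d>0. \<forall>r>0. relbasis d r (N \<inter> Wset d r))"
proof -
  have "\<exists>B. \<forall>n>0. relbasis n r (B n) \<and> {w'. \<exists>w\<in>B n. wF F w = Some w'} \<subseteq> B (p * n)" for r
    by (rule degree_recursion[where P = "\<lambda>d. relind d r"])
      (use p_gt_1 relind_step relind_extend in \<open>auto simp: relbasis_def\<close>, simp add: relind_def)
  then obtain B where "\<forall>r. \<forall>n>0. relbasis n r (B r n) \<and> {w'. \<exists>w\<in>B r n. wF F w = Some w'} \<subseteq> B r (p * n)"
    using choice[of "\<lambda>r B. \<forall>n>0. relbasis n r (B n) \<and> {w'. \<exists>w\<in>B n. wF F w = Some w'} \<subseteq> B (p * n)"]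
    by blast
  then have B: "\<And>r n. n > 0 \<Longrightarrow> relbasis n r (B r n)"
    "\<And>r n. n > 0 \<Longrightarrow> {w'. \<exists>w\<in>B r n. wF F w = Some w'} \<subseteq> B r (p * n)" by auto
  define N where "N = (\<Union>d\<in>{0<..}. \<Union>r\<in>{0<..}. B r d)"
  have BW: "B r d \<subseteq> Wset d r" if "d > 0" for r d using B(1)[OF that] by (auto simp: relbasis_def relind_def)
  have NW: "N \<inter> Wset d r = B r d" if "d > 0" "r > 0" for d r
  proof
    show "N \<inter> Wset d r \<subseteq> B r d"
    proof
      fix w assume "w \<in> N \<inter> Wset d r"
      then obtain d' r' where "w \<in> B r' d'" "d' > 0" "w \<in> Wset d r" by (auto simp: N_def)
      moreover from this have "w \<in> Wset d' r'" using BW by blast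
      ultimately show "w \<in> B r d" by (auto simp: Wset_def)
    qed
  qed (use BW that in \<open>auto simp: N_def\<close>)
  have "N \<subseteq> lists X - {[]}"
  proof
    fix w assume "w \<in> N"
    then obtain d r where "w \<in> B r d" "d > 0" "r > 0" by (auto simp: N_def)
    then have "w \<in> Wset d r" "r > 0" using BW by auto
    then show "w \<in> lists X - {[]}" by (auto simp: Wset_def)
  qed
  moreover have "w' \<in> N" if "w \<in> N" "wF F w = Some w'" for w w'
  proof -
    obtain d r where dr: "w \<in> B r d" "d > 0" "r > 0" using \<open>w \<in> N\<close> by (auto simp: N_def)
    then have "w' \<in> B r (p * d)" using B(2)[of d r] that by blast
    then show ?thesis using dr p_pos unfolding N_def by (metis UN_I greaterThan_iff nat_0_less_mult_iff)
  qed
  ultimately show ?thesis using NW B(1) by (intro exI[of _ N] conjI allI impI) auto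
qed

section \<open>Derivations of the shuffle algebra\<close>

lemma S_conv_length:
  assumes "S.W.conv f g w \<noteq> 0" "\<And>u. f u \<noteq> 0 \<Longrightarrow> length u = r" "\<And>u. g u \<noteq> 0 \<Longrightarrow> length u = s"
  shows "length w = r + s"
proof (rule ccontr)
  assume "length w \<noteq> r + s"
  then have "S.wc w (\<lambda>a b. f a * g b) = 0" if "w \<in> lists X"
    using that assms(2,3) by (intro S_wcop_low) (auto, metis)
  with assms(1) show False by (auto simp: S.W.conv_def split: if_splits)
qed

lemma Dec_support:
  assumes "f \<in> Dec d r" "f w \<noteq> 0" shows "w \<in> Wset d r"
proof -
  have "\<forall>w. f w \<noteq> 0 \<longrightarrow> w \<in> Wset d r" using assms(1) unfolding Dec_def
  proof (induction rule: fs.span_induct_alt)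
    case (step c x y)
    then obtain u v where uv: "x = S.W.conv (dlt u) (dlt v)" "u \<in> lists X" "v \<in> lists X"
      "wd u + wd v = d" "length u + length v = r" by auto
    have "w \<in> Wset d r" if "x w \<noteq> 0" for w
    proof -
      have "w \<in> lists X \<and> wd w = d"
        using S.W.hom_conv[OF S.W.hom_dlt[OF uv(2)] S.W.hom_dlt[OF uv(3)]] that uv
        by (auto simp: S.W.hom_def)
      moreover have "length w = length u + length v"
        using that unfolding uv(1) by (rule S_conv_length) (simp_all add: dlt_eq_0_iff)
      then have "length w = r" using uv(5) by simp
      ultimately show ?thesis by (simp add: Wset_def)
    qed
    moreover have "x w \<noteq> 0 \<or> y w \<noteq> 0" if "(fscale c x + y) w \<noteq> 0" for w
      using that by (auto simp: fscale_def)
    ultimately show ?case using step by blast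
  qed simp
  with assms(2) show ?thesis by blast
qed

text \<open>The transpose of left multiplication by the element of the tensor algebra with
  coordinates \<mu>.\<close>

definition der :: "('i list \<Rightarrow> 'k) \<Rightarrow> nat \<Rightarrow> nat \<Rightarrow> ('i list \<Rightarrow> 'k) \<Rightarrow> 'i list \<Rightarrow> 'k" where
  "der \<mu> d r f = (\<lambda>v. \<Sum>u\<in>Wset d r. \<mu> u * f (u @ v))"

lemma der_add: "der \<mu> d r (f + g) = der \<mu> d r f + der \<mu> d r g"
  by (simp add: der_def fun_eq_iff distrib_left sum.distrib)
lemma der_scale: "der \<mu> d r (fscale a f) = fscale a (der \<mu> d r f)"
  by (simp add: der_def fun_eq_iff fscale_def sum_distrib_left mult.left_commute)
lemma der_0 [simp]: "der \<mu> d r 0 = 0"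
  by (simp add: der_def fun_eq_iff)
lemma der_sum: "der \<mu> d r (sum f I) = (\<Sum>i\<in>I. der \<mu> d r (f i))"
proof (induction I rule: infinite_finite_induct)
  case (insert x F)
  then show ?case by (simp only: sum.insert[OF insert(1,2)] der_add)
qed (simp_all del: zero_fun_apply)

text \<open>If \<mu> annihilates the decomposables, the element with coordinates \<mu> is primitive
  for the shuffle coproduct, and left multiplication by a primitive element is dual to a graded
  derivation.\<close>

lemma der_conv:
  assumes "d > 0" and \<mu>: "\<And>f. f \<in> Dec d r \<Longrightarrow> (\<Sum>u\<in>Wset d r. \<mu> u * f u) = 0"
  shows "der \<mu> d r (S.W.conv f g) =
    S.W.conv (der \<mu> d r f) g + S.W.conv (\<lambda>w. sg (d * wd w) * f w) (der \<mu> d r g)"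
proof
  fix v
  \<comment> \<open>The coefficient of a pair of nonempty words in the coproduct of that element is
    the value of \<mu> on their shuffle product.\<close>
  have kill: "(\<Sum>u\<in>Wset d r. \<mu> u * S.W.coef u a b) = 0"
    if ab: "a \<in> lists X" "b \<in> lists X" "a \<noteq> []" "b \<noteq> []" for a b
  proof -
    have "(\<Sum>u\<in>Wset d r. \<mu> u * S.W.coef u a b) = (\<Sum>u\<in>Wset d r. \<mu> u * S.W.conv (dlt a) (dlt b) u)"
      by (rule sum.cong) (auto simp: S.W.coef_def S.W.conv_def Wset_def)
    also have "\<dots> = 0"
    proof (cases "wd a + wd b = d \<and> length a + length b = r")
      case True
      then show ?thesis using ab unfolding Dec_def by (intro \<mu>) (auto simp: Dec_def intro!: fs.span_base)
    next
      case False
      have "S.W.conv (dlt a) (dlt b) u = 0" if "u \<in> Wset d r" for u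
      proof (rule ccontr)
        assume "S.W.conv (dlt a) (dlt b) u \<noteq> 0"
        then have "u \<in> Wset (wd a + wd b) (length a + length b)" using ab
          by (intro Dec_support[of "S.W.conv (dlt a) (dlt b)"]) (auto simp: Dec_def intro!: fs.span_base)
        with that False show False by (auto simp: Wset_def)
      qed
      then show ?thesis by simp
    qed
    finally show ?thesis .
  qed
  \<comment> \<open>Primitivity: only the two extreme terms of the coproduct survive. Below,
    \<Theta> is the proper part of \<Xi>.\<close>
  have prim: "(\<Sum>u\<in>Wset d r. \<mu> u * S.wc u \<Xi>) = (\<Sum>u\<in>Wset d r. \<mu> u * (\<Xi> u [] + \<Xi> [] u))" for \<Xi>
  proof -
    define \<Theta> where "\<Theta> a b = (if a = [] \<or> b = [] then 0 else \<Xi> a b)" for a b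
    have "S.wc u \<Xi> = (\<Xi> u [] + \<Xi> [] u) + S.wc u \<Theta>" if u: "u \<in> Wset d r" for u
    proof -
      have "S.wc u \<Xi> = S.wc u (\<lambda>a b. ((if b = [] then \<Xi> a [] else 0) + (if a = [] then \<Xi> [] b else 0)) + \<Theta> a b)"
        using u assms(1) by (intro S.W.cop_cong) (auto simp: \<Theta>_def Wset_def)
      then show ?thesis using S.W.counit[of u] u
        unfolding S.W.cop_add counit_at_def by (simp add: Wset_def)
    qed
    then have "(\<Sum>u\<in>Wset d r. \<mu> u * S.wc u \<Xi>) =
        (\<Sum>u\<in>Wset d r. \<mu> u * (\<Xi> u [] + \<Xi> [] u)) + (\<Sum>u\<in>Wset d r. \<mu> u * S.wc u \<Theta>)"
      unfolding sum.distrib[symmetric] by (intro sum.cong) (simp_all only: distrib_left)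
    also have "(\<Sum>u\<in>Wset d r. \<mu> u * S.wc u \<Theta>) =
        (\<Sum>u\<in>Wset d r. \<Sum>a\<in>S.W.upto d. \<Sum>b\<in>S.W.upto d. \<mu> u * S.W.coef u a b * \<Theta> a b)"
    proof (rule sum.cong[OF refl])
      fix u assume "u \<in> Wset d r"
      then have "S.wc u \<Theta> = (\<Sum>a\<in>S.W.upto d. \<Sum>b\<in>S.W.upto d. S.W.coef u a b * \<Theta> a b)"
        by (intro S.W.cop_expand) (auto simp: Wset_def)
      then show "\<mu> u * S.wc u \<Theta> = (\<Sum>a\<in>S.W.upto d. \<Sum>b\<in>S.W.upto d. \<mu> u * S.W.coef u a b * \<Theta> a b)"
        by (simp add: sum_distrib_left mult.assoc)
    qed
    also have "\<dots> = (\<Sum>a\<in>S.W.upto d. \<Sum>b\<in>S.W.upto d. (\<Sum>u\<in>Wset d r. \<mu> u * S.W.coef u a b) * \<Theta> a b)"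
      by (subst sum.swap) (simp only: sum_distrib_right sum.swap[of _ _ "Wset d r"])
    also have "\<dots> = 0"
      by (intro sum.neutral ballI) (auto simp: \<Theta>_def S.W.upto_def kill)
    finally show ?thesis by simp
  qed
  show "der \<mu> d r (S.W.conv f g) v =
    (S.W.conv (der \<mu> d r f) g + S.W.conv (\<lambda>w. sg (d * wd w) * f w) (der \<mu> d r g)) v"
  proof (cases "v \<in> lists X")
    case False
    then show ?thesis by (simp add: der_def S.W.conv_def)
  next
    case True
    define \<Xi> where "\<Xi> a b = S.wc v (\<lambda>a' b'. sg (wd b * wd a') * (f (a @ a') * g (b @ b')))" for a b
    have \<Xi>: "\<Xi> = (\<lambda>a b. S.wc v (\<lambda>a' b'. sg (wd b * wd a') * (f (a @ a') * g (b @ b'))))"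
      by (intro ext) (simp add: \<Xi>_def)
    \<comment> \<open>By \<open>wcop_append\<close> the coproduct of \<open>u @ v\<close> is one of
      \<open>u\<close> followed by one of \<open>v\<close>; \<open>prim\<close> is applied to the
      outer one.\<close>
    have "der \<mu> d r (S.W.conv f g) v = (\<Sum>u\<in>Wset d r. \<mu> u * S.wc u \<Xi>)"
      unfolding der_def using True by (intro sum.cong) (auto simp: S.W.conv_def Wset_def S.wcop_append \<Xi>)
    also have "\<dots> = (\<Sum>u\<in>Wset d r. \<mu> u * \<Xi> u []) + (\<Sum>u\<in>Wset d r. \<mu> u * \<Xi> [] u)"
      unfolding prim by (simp add: distrib_left sum.distrib)
    also have "(\<Sum>u\<in>Wset d r. \<mu> u * \<Xi> u []) = S.W.conv (der \<mu> d r f) g v"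
      using True by (simp add: \<Xi>_def S.W.conv_def der_def sum_distrib_right S.W.cop_lin[symmetric] mult.assoc)
    also have "(\<Sum>u\<in>Wset d r. \<mu> u * \<Xi> [] u) = S.W.conv (\<lambda>w. sg (d * wd w) * f w) (der \<mu> d r g) v"
    proof -
      have "(\<Sum>u\<in>Wset d r. \<mu> u * \<Xi> [] u) =
          S.wc v (\<lambda>a' b'. \<Sum>u\<in>Wset d r. \<mu> u * (sg (wd u * wd a') * (f a' * g (u @ b'))))"
        by (simp add: \<Xi>_def S.W.cop_lin)
      also have "\<dots> = S.wc v (\<lambda>a' b'. sg (d * wd a') * f a' * (\<Sum>u\<in>Wset d r. \<mu> u * g (u @ b')))"
        unfolding sum_distrib_left
        by (intro S.W.cop_cong sum.cong) (auto simp: Wset_def mult_ac)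
      finally show ?thesis using True by (simp add: S.W.conv_def der_def)
    qed
    finally show ?thesis by simp
  qed
qed

end

lemma span_dlt_support:
  assumes "a \<in> fs.span (dlt ` T)" "v \<notin> T" shows "a v = (0::'k::field)"
  using assms(1)
proof (induction rule: fs.span_induct_alt)
  case (step c x y)
  then have "x v = 0" using assms(2) by (auto simp: dlt_eq_0_iff)
  then show ?case using step by (simp add: fscale_def)
qed simp

lemma finite_support_sum:
  assumes "finite T" "\<And>v. v \<notin> T \<Longrightarrow> a v = (0::'k::field)"
  shows "a = (\<Sum>w\<in>T. fscale (a w) (dlt w))"
proof
  fix v
  have "(\<Sum>w\<in>T. fscale (a w) (dlt w)) v = (\<Sum>w\<in>T. if v = w then a w else 0)"
    unfolding sum_fun_app by (rule sum.cong) (auto simp: fscale_def dlt_def)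
  also have "\<dots> = a v" using assms by auto
  finally show "a v = (\<Sum>w\<in>T. fscale (a w) (dlt w)) v" by simp
qed

locale gens = adapted Y deg cop one p F
  for Y :: "'i set" and deg and cop :: "'i \<Rightarrow> ('i \<Rightarrow> 'i \<Rightarrow> 'k::field) \<Rightarrow> 'k" and one and p and F +
  fixes N :: "'i list set"
  assumes N_sub: "N \<subseteq> lists X - {[]}"
    and N_F: "w \<in> N \<Longrightarrow> wF F w = Some w' \<Longrightarrow> w' \<in> N"
    and N_basis: "d > 0 \<Longrightarrow> r > 0 \<Longrightarrow> relbasis d r (N \<inter> Wset d r)"
begin

lemma N_pos: "n \<in> N \<Longrightarrow> n \<in> lists X \<and> n \<noteq> [] \<and> length n > 0 \<and> wd n > 0"
  using N_sub length_le_wdeg[of n] by fastforce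

lemma N_Wset: "n \<in> N \<Longrightarrow> n \<in> N \<inter> Wset (wd n) (length n)"
  using N_pos by (auto simp: Wset_def)

text \<open>Two nonempty words have total length at least two, so there are no decomposables of
  length one, and a basis drawn from words must contain every letter.\<close>

lemma letter_in_N:
  assumes "x \<in> X" shows "[x] \<in> N"
proof (rule ccontr)
  assume not: "[x] \<notin> N"
  have W: "[x] \<in> Wset (deg x) 1" using assms by (simp add: Wset_def)
  have "{S.W.conv (dlt u) (dlt v) :: 'i list \<Rightarrow> 'k | u v. u \<in> lists X \<and> v \<in> lists X \<and> u \<noteq> [] \<and> v \<noteq> [] \<and>
     wd u + wd v = deg x \<and> length u + length v = 1} = {}"
  proof -
    have "length u + length v \<noteq> 1" if "u \<noteq> []" "v \<noteq> []" for u v :: "'i list"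
      using that by (cases u; cases v) auto
    then show ?thesis by blast
  qed
  then have D: "Dec (deg x) 1 = {0}" by (simp only: Dec_def fs.span_empty)
  have "dlt [x] \<in> fs.span (dlt ` (N \<inter> Wset (deg x) 1) \<union> Dec (deg x) 1)"
    using N_basis[of "deg x" 1] deg_X[OF assms] W by (auto simp: relbasis_def)
  also have "\<dots> = fs.span (dlt ` (N \<inter> Wset (deg x) 1))"
    unfolding D by (metis Un_insert_right fs.span_insert_0 sup_bot_right)
  finally have "dlt [x] [x] = (0::'k)" using span_dlt_support not by fastforce
  then show False by simp
qed

text \<open>Modulo decomposables \<open>n0\<close> is independent of the other generators of its
  degree and length, so a functional separates it from their span.\<close>

lemma functional_exists:
  assumes n0: "n0 \<in> N"
  shows "\<exists>\<mu>. (\<forall>f\<in>Dec (wd n0) (length n0). (\<Sum>u\<in>Wset (wd n0) (length n0). \<mu> u * f u) = 0) \<and>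
     (\<forall>n\<in>N \<inter> Wset (wd n0) (length n0). \<mu> n = (if n = n0 then 1 else 0))"
proof -
  let ?W = "Wset (wd n0) (length n0)" and ?D = "Dec (wd n0) (length n0)"
  let ?S = "N \<inter> ?W"
  let ?U = "dlt ` (?S - {n0}) \<union> ?D"
  have ind: "relind (wd n0) (length n0) ?S"
    using N_basis[of "wd n0" "length n0"] N_pos[OF n0] by (simp add: relbasis_def)
  have finS: "finite ?S" by simp
  have "dlt n0 \<notin> fs.span ?U"
  proof
    assume "dlt n0 \<in> fs.span ?U"
    then obtain a b where ab: "a \<in> fs.span (dlt ` (?S - {n0}))" "b \<in> fs.span ?D" "dlt n0 = a + b"
      unfolding fs.span_Un by auto
    have b: "b \<in> ?D" using ab(2) unfolding Dec_def fs.span_span .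
    \<comment> \<open>A decomposable combination of generators whose coefficient at
      \<open>n0\<close> is \<open>1\<close>, which contradicts relative independence.\<close>
    define q where "q = dlt n0 - a"
    have "q \<in> ?D" using ab(3) b by (simp add: q_def)
    moreover have "q = (\<Sum>w\<in>?S. fscale (q w) (dlt w))"
      using finS span_dlt_support[OF ab(1)] N_Wset[OF n0]
      by (intro finite_support_sum) (auto simp: q_def dlt_def)
    ultimately have "(\<Sum>w\<in>?S. fscale (q w) (dlt w)) \<in> ?D" by simp
    then have "q n0 = 0" using ind N_Wset[OF n0] unfolding relind_def by blast
    moreover have "a n0 = 0" using span_dlt_support[OF ab(1)] by blast
    ultimately show False by (simp add: q_def)
  qed
  from separating_functional[OF this] obtain g where
    g: "Vector_Spaces.linear fscale (*) g" "g (dlt n0) = 1" "\<forall>u\<in>?U. g u = 0" by blast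
  interpret lg: Vector_Spaces.linear fscale "(*) :: 'k \<Rightarrow> 'k \<Rightarrow> 'k" g by (rule g(1))
  have "(\<Sum>u\<in>?W. g (dlt u) * f u) = 0" if f: "f \<in> ?D" for f
  proof -
    have "f = (\<Sum>u\<in>?W. fscale (f u) (dlt u))"
      using Dec_support[OF f] by (intro finite_support_sum) auto
    then have "g f = (\<Sum>u\<in>?W. f u * g (dlt u))" by (metis (no_types, lifting) lg.sum lg.scale sum.cong)
    then show ?thesis using g(3) f by (simp add: mult.commute)
  qed
  moreover have "g (dlt n) = (if n = n0 then 1 else 0)" if "n \<in> ?S" for n
    using g that by auto
  ultimately show ?thesis by (intro exI[of _ "\<lambda>u. g (dlt u)"]) auto
qed

abbreviation "adm \<equiv> admissible (wdeg deg) p"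

lemma S_hom_mon: "set l \<subseteq> N \<Longrightarrow> S.W.hom (sum_list (map wd l)) (S.W.mon dlt l)"
  using N_pos by (intro S.W.hom_mon S.W.hom_dlt) auto

text \<open>On monomials in generators of degree at most \<open>wd n0\<close>, the derivation acts
  as the partial derivative in \<open>n0\<close>. The degree bound matters because
  \<open>der\<close> strips prefixes of degree \<open>wd n0\<close>, and a generator of larger
  degree could leave a nonempty remainder. The sign in the Leibniz rule is the reason for
  \<open>e \<le> 1\<close> in bad degrees.\<close>

lemma der_mon:
  assumes n0: "n0 \<in> N"
    and \<mu>: "\<And>f. f \<in> Dec (wd n0) (length n0) \<Longrightarrow> (\<Sum>u\<in>Wset (wd n0) (length n0). \<mu> u * f u) = 0"
      "\<And>n. n \<in> N \<inter> Wset (wd n0) (length n0) \<Longrightarrow> \<mu> n = (if n = n0 then 1 else 0)"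
  defines "D \<equiv> der \<mu> (wd n0) (length n0)"
  shows "n \<in> N \<Longrightarrow> wd n \<le> wd n0 \<Longrightarrow> D (dlt n) = (if n = n0 then dlt [] else 0)"
    and "set l \<subseteq> N \<Longrightarrow> (\<And>n. n \<in> set l \<Longrightarrow> wd n \<le> wd n0 \<and> n \<noteq> n0) \<Longrightarrow> D (S.W.mon dlt l) = 0"
    and "set l \<subseteq> N \<Longrightarrow> (\<And>n. n \<in> set l \<Longrightarrow> wd n \<le> wd n0 \<and> n \<noteq> n0) \<Longrightarrow> good p (wd n0) \<or> e \<le> 1 \<Longrightarrow>
      D (S.W.mon dlt (replicate e n0 @ l)) = fscale (of_nat e) (S.W.mon dlt (replicate (e - 1) n0 @ l))"
proof -
  have pos: "wd n0 > 0" using N_pos[OF n0] by simp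
  let ?W = "Wset (wd n0) (length n0)"
  have D_conv: "D (S.W.conv f g) = S.W.conv (D f) g + S.W.conv (\<lambda>w. sg (wd n0 * wd w) * f w) (D g)" for f g
    unfolding D_def by (rule der_conv[OF pos \<mu>(1)])
  show D_dlt: "D (dlt n) = (if n = n0 then dlt [] else 0)" if n: "n \<in> N" "wd n \<le> wd n0" for n
  proof
    fix v
    \<comment> \<open>If \<open>n = u @ v\<close>, then \<open>wd n \<le> wd n0 = wd u\<close>
      leaves no room for letters in \<open>v\<close>.\<close>
    have zero: "\<mu> u * dlt n (u @ v) = 0" if u: "u \<in> ?W" "\<not> (u = n \<and> v = [])" for u
    proof (rule ccontr)
      assume "\<mu> u * dlt n (u @ v) \<noteq> 0"
      then have nv: "n = u @ v" by (auto simp: dlt_eq_0_iff)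
      then have "wd v = 0" using u n by (simp add: Wset_def)
      moreover have "v \<in> lists X" using nv N_pos[OF n(1)] by auto
      ultimately have "v = []" using length_le_wdeg[of v] by simp
      with u nv show False by simp
    qed
    show "D (dlt n) v = (if n = n0 then dlt [] else 0) v"
    proof (cases "n \<in> ?W \<and> v = []")
      case True
      have "D (dlt n) v = (\<Sum>u\<in>?W. if u = n then \<mu> n else 0)"
        unfolding D_def der_def using True zero by (intro sum.cong) (auto simp: dlt_def)
      also have "\<dots> = \<mu> n" using True by simp
      finally show ?thesis using True \<mu>(2)[of n] n by simp
    next
      case False
      have "D (dlt n) v = 0" unfolding D_def der_def using False zero by (intro sum.neutral) auto
      then show ?thesis using False N_Wset[OF n0] by (auto simp: dlt_def)
    qed
  qed
  have D_one: "D (dlt []) = 0"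
    unfolding D_def der_def using pos by (intro ext) (auto simp: dlt_def Wset_def intro!: sum.neutral)
  show D_rest: "D (S.W.mon dlt l) = 0"
    if "set l \<subseteq> N" "\<And>n. n \<in> set l \<Longrightarrow> wd n \<le> wd n0 \<and> n \<noteq> n0" for l
    using that
  proof (induction l)
    case (Cons n l)
    then have "D (dlt n) = 0" "D (S.W.mon dlt l) = 0" using D_dlt[of n] by auto
    then show ?case by (simp only: S.W.mon_simps D_conv S.W.conv_0_left(1) S.W.conv_0_right(1) add_0_left)
  qed (simp only: S.W.mon_simps D_one)
  show "D (S.W.mon dlt (replicate e n0 @ l)) = fscale (of_nat e) (S.W.mon dlt (replicate (e - 1) n0 @ l))"
    if l: "set l \<subseteq> N" "\<And>n. n \<in> set l \<Longrightarrow> wd n \<le> wd n0 \<and> n \<noteq> n0" and ge: "good p (wd n0) \<or> e \<le> 1" for e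
    using ge
  proof (induction e)
    case 0
    then show ?case by (simp add: D_rest[OF l] del: zero_fun_apply)
  next
    case (Suc e)
    let ?M = "\<lambda>e. S.W.mon dlt (replicate e n0 @ l)"
    have one: "S.W.conv (dlt []) (?M e) = ?M e"
      using l n0 by (intro S.W.conv_one_left[OF S_hom_mon]) auto
    have tail: "S.W.conv (\<lambda>w. sg (wd n0 * wd w) * dlt n0 w) (D (?M e)) = fscale (of_nat e) (?M e)"
    proof (cases e)
      case 0
      then show ?thesis by (simp only: replicate_0 append_Nil D_rest[OF l] S.W.conv_0_right of_nat_0 fscale_0)
    next
      case (Suc e')
      then have good: "good p (wd n0)" using Suc.prems by auto
      then have "(\<lambda>w. sg (wd n0 * wd w) * dlt n0 w) = (dlt n0 :: 'i list \<Rightarrow> 'k)"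
        by (simp add: sg_good)
      then show ?thesis using Suc.IH good Suc by (simp add: S.W.conv_scale_right)
    qed
    have "D (?M (Suc e)) = ?M e + fscale (of_nat e) (?M e)"
      using D_dlt[OF n0] by (simp add: D_conv one tail del: plus_fun_apply)
    then show ?case by (simp add: fscale_def fun_eq_iff algebra_simps)
  qed
qed

end

lemma (in gcoalg_coords) mon_perm:
  assumes "mset l = mset l'" "\<And>n. n \<in> set l \<Longrightarrow> hom (dg n) (g n)"
  shows "\<exists>s. s \<noteq> 0 \<and> mon g l = fscale s (mon g l')"
  using assms
proof (induction l arbitrary: l')
  case Nil
  then show ?case by (intro exI[of _ 1]) simp
next
  case (Cons x l)
  have "x \<in> set l'" using Cons.prems(1) by (metis list.set_intros(1) mset_eq_setD)
  then obtain a b where l': "l' = a @ x # b" by (meson split_list)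
  then have ms: "mset l = mset (a @ b)" using Cons.prems(1) by simp
  have hm: "hom (dg n) (g n)" if "n \<in> set (x # a @ b)" for n
    using that Cons.prems(2) mset_eq_setD[OF ms] by auto
  obtain s where s: "s \<noteq> 0" "mon g l = fscale s (mon g (a @ b))"
    using Cons.IH[OF ms] Cons.prems(2) by auto
  let ?d = "sum_list (map dg a)"
  have "mon g (x # a @ b) = conv (conv (g x) (mon g a)) (mon g b)"
    using mon_append[of a b dg g] hm by (simp add: conv_assoc)
  also have "conv (g x) (mon g a) = fscale (sg (dg x * ?d)) (conv (mon g a) (g x))"
    using hm by (intro conv_comm hom_mon) auto
  also have "conv (fscale (sg (dg x * ?d)) (conv (mon g a) (g x))) (mon g b) =
      fscale (sg (dg x * ?d)) (mon g l')"
    using mon_append[of a "x # b" dg g] hm unfolding l' by (simp add: conv_assoc conv_scale_left)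
  finally have "mon g (x # l) = fscale (s * sg (dg x * ?d)) (mon g l')"
    using s(2) by (simp add: conv_scale_right fscale_fscale)
  then show ?case using s(1) by (intro exI[of _ "s * sg (dg x * ?d)"]) simp
qed

section \<open>Admissible monomials form a basis of both algebras\<close>

context gens
begin

definition MM :: "'i list multiset set" where "MM = {m. adm m \<and> set_mset m \<subseteq> N}"

text \<open>The exponent \<open>e\<close> of \<open>n0\<close> is less than \<open>p\<close>, hence
  invertible in the field. This is where the truncation of exponents enters.\<close>

lemma der_monomial:
  assumes m: "m \<in> MM" and n0: "n0 \<in># m" and max: "\<And>n. n \<in># m \<Longrightarrow> wd n \<le> wd n0"
    and \<mu>: "\<And>f. f \<in> Dec (wd n0) (length n0) \<Longrightarrow> (\<Sum>u\<in>Wset (wd n0) (length n0). \<mu> u * f u) = 0"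
      "\<And>n. n \<in> N \<inter> Wset (wd n0) (length n0) \<Longrightarrow> \<mu> n = (if n = n0 then 1 else 0)"
  shows "\<exists>t. t \<noteq> 0 \<and> der \<mu> (wd n0) (length n0) (S.W.mon dlt (listing m)) = fscale t (S.W.mon dlt (listing (m - {#n0#})))"
proof -
  have mN: "set_mset m \<subseteq> N" and cnt: "count m n0 < bound wd p n0"
    using m by (auto simp: MM_def admissible_def)
  have n0N: "n0 \<in> N" using mN n0 by auto
  define e where "e = count m n0"
  have e: "e > 0" using n0 by (simp add: e_def)
  define l where "l = listing (filter_mset (\<lambda>n. n \<noteq> n0) m)"
  have l: "set l \<subseteq> N" "\<And>n. n \<in> set l \<Longrightarrow> wd n \<le> wd n0 \<and> n \<noteq> n0"
    using mN max by (auto simp: l_def)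
  have ml: "m = replicate_mset e n0 + mset l"
    by (rule multiset_eqI) (simp add: l_def e_def)
  have homg: "S.W.hom (wd n) (dlt n)" if "n \<in> N" for n
    using that N_pos by (intro S.W.hom_dlt) auto
  obtain s where s: "s \<noteq> 0" "S.W.mon dlt (listing m) = fscale s (S.W.mon dlt (replicate e n0 @ l))"
    using S.W.mon_perm[of "listing m" "replicate e n0 @ l" wd dlt] ml mN homg by auto
  have "mset (replicate (e - 1) n0 @ l) = mset (listing (m - {#n0#}))"
    using e arg_cong[OF ml, of "\<lambda>m. m - {#n0#}"] by (cases e) auto
  moreover have "S.W.hom (wd n) (dlt n)" if "n \<in> set (replicate (e - 1) n0 @ l)" for n
    using that l(1) n0N homg by (auto split: if_splits)
  ultimately obtain s' where s': "s' \<noteq> 0"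
    "S.W.mon dlt (replicate (e - 1) n0 @ l) = fscale s' (S.W.mon dlt (listing (m - {#n0#})))"
    using S.W.mon_perm by blast
  have ge: "good p (wd n0) \<or> e \<le> 1" using cnt by (auto simp: bound_def e_def split: if_splits)
  have "e < p"
    using cnt p_gt_1 by (auto simp: bound_def e_def split: if_splits)
  then have "(of_nat e :: 'k) \<noteq> 0"
    using e char_p of_nat_eq_0_iff_char_dvd[where 'a='k, of e] by (auto dest: dvd_imp_le)
  moreover have "der \<mu> (wd n0) (length n0) (S.W.mon dlt (replicate e n0 @ l)) =
      fscale (of_nat e) (S.W.mon dlt (replicate (e - 1) n0 @ l))"
    by (rule der_mon(3)[OF n0N \<mu>(1) \<mu>(2) l(1) l(2) ge])
  ultimately show ?thesis
    using s(1) s'(1)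
    by (intro exI[of _ "s * (of_nat e * s')"])
      (simp only: s(2) der_scale s'(2) fscale_fscale mult_eq_0_iff simp_thms)
qed

text \<open>Induction on the total number of factors. Differentiating in a generator of largest
  degree kills the monomials without it and removes one factor from the others, injectively; the
  resulting smaller relation forces the coefficients of the monomials containing the generator to
  vanish. What remains is again a smaller relation.\<close>

lemma S_independent:
  assumes "finite \<M>" "\<M> \<subseteq> MM" "(\<Sum>m\<in>\<M>. fscale (c m) (S.W.mon dlt (listing m))) = 0"
  shows "\<forall>m\<in>\<M>. c m = 0"
  using assms
proof (induction "\<Sum>m\<in>\<M>. size m" arbitrary: \<M> c rule: less_induct)
  case less
  note fin = less.prems(1)
  let ?G = "\<Union>m\<in>\<M>. set_mset m"
  show ?case
  proof (cases "?G = {}")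
    case True
    then have M: "\<M> \<subseteq> {{#}}" by auto
    show ?thesis
    proof
      fix m assume "m \<in> \<M>"
      then have M': "\<M> = {{#}}" and m: "m = {#}" using M by auto
      have "listing ({#} :: 'i list multiset) = []" using mset_listing[of "{#}"] by (simp only: mset_zero_iff)
      then have "fscale (c {#}) (dlt []) = (0 :: 'i list \<Rightarrow> 'k)"
        using less.prems(3) M' by (simp only: sum.insert finite.emptyI empty_iff not_False_eq_True
            sum.empty add_0_right S.W.mon_simps(1))
      from fun_cong[OF this, of "[]"] show "c m = 0" using m by (simp add: fscale_def)
    qed
  next
    case False
    have finG: "finite ?G" using fin by simp
    obtain n0 where n0: "n0 \<in> ?G" "wd n0 = Max (wd ` ?G)"
      using Max_in[of "wd ` ?G"] finG False by (metis (no_types, lifting) finite_imageI imageE image_is_empty)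
    have max: "wd n \<le> wd n0" if "n \<in> ?G" for n unfolding n0(2) using finG that by (intro Max_ge) auto
    have MN: "set_mset m \<subseteq> N" if "m \<in> \<M>" for m using that less.prems(2) by (auto simp: MM_def)
    have n0N: "n0 \<in> N" using n0(1) MN by auto
    obtain \<mu> where \<mu>: "\<And>f. f \<in> Dec (wd n0) (length n0) \<Longrightarrow> (\<Sum>u\<in>Wset (wd n0) (length n0). \<mu> u * f u) = 0"
      "\<And>n. n \<in> N \<inter> Wset (wd n0) (length n0) \<Longrightarrow> \<mu> n = (if n = n0 then 1 else 0)"
      using functional_exists[OF n0N] by blast
    define D where "D = der \<mu> (wd n0) (length n0)"
    let ?mon = "\<lambda>m. S.W.mon dlt (listing m) :: 'i list \<Rightarrow> 'k"
    define M1 where "M1 = {m\<in>\<M>. n0 \<in># m}"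
    have M1: "M1 \<subseteq> \<M>" "finite M1" "M1 \<noteq> {}" using fin n0(1) by (auto simp: M1_def)
    have "\<exists>t. t \<noteq> 0 \<and> D (?mon m) = fscale t (?mon (m - {#n0#}))" if "m \<in> M1" for m
      unfolding D_def using that less.prems(2) max by (intro der_monomial[OF _ _ _ \<mu>]) (auto simp: M1_def)
    then obtain t where t: "\<And>m. m \<in> M1 \<Longrightarrow> t m \<noteq> 0"
      "\<And>m. m \<in> M1 \<Longrightarrow> D (?mon m) = fscale (t m) (?mon (m - {#n0#}))"
      by metis
    have D0: "D (?mon m) = 0" if "m \<in> \<M> - M1" for m
    proof -
      have "wd n \<le> wd n0 \<and> n \<noteq> n0" if "n \<in> set (listing m)" for n
        using that max[of n] \<open>m \<in> \<M> - M1\<close> by (auto simp: M1_def)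
      moreover have "set (listing m) \<subseteq> N" using MN that by simp
      ultimately show ?thesis unfolding D_def by (intro der_mon(2)[OF n0N \<mu>]) blast+
    qed
    let ?r = "\<lambda>m. m - {#n0#}"
    have inj: "inj_on ?r M1"
      by (rule inj_onI) (metis (mono_tags, lifting) M1_def mem_Collect_eq insert_DiffM)
    have "0 = D (\<Sum>m\<in>\<M>. fscale (c m) (?mon m))" using less.prems(3) by (simp add: D_def)
    also have "\<dots> = (\<Sum>m\<in>\<M>. fscale (c m) (D (?mon m)))"
      by (simp add: D_def der_sum der_scale)
    also have "\<dots> = (\<Sum>m\<in>M1. fscale (c m) (D (?mon m)))"
      using fin M1(1) D0 by (intro sum.mono_neutral_right) auto
    \<comment> \<open>Coefficients are written as functions of \<open>m - {#n0#}\<close> so that the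
      sum can be reindexed.\<close>
    also have "\<dots> = (\<Sum>m\<in>M1. fscale (c (add_mset n0 (?r m)) * t (add_mset n0 (?r m))) (?mon (?r m)))"
      by (rule sum.cong) (auto simp: t(2) fscale_fscale M1_def)
    also have "\<dots> = (\<Sum>m\<in>?r ` M1. fscale (c (add_mset n0 m) * t (add_mset n0 m)) (?mon m))"
      by (simp add: sum.reindex[OF inj])
    finally have sum0: "(\<Sum>m\<in>?r ` M1. fscale (c (add_mset n0 m) * t (add_mset n0 m)) (?mon m)) = 0" ..
    have sub: "?r ` M1 \<subseteq> MM"
    proof
      fix m assume "m \<in> ?r ` M1"
      then obtain m' where m': "m' \<in> M1" "m = ?r m'" by auto
      then have "m' \<in> MM" using M1 less.prems(2) by auto
      then show "m \<in> MM" using m'(2)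
        by (auto simp: MM_def admissible_def dest: in_diffD intro: le_less_trans[OF diff_le_self])
    qed
    have "(\<Sum>m\<in>?r ` M1. size m) = (\<Sum>m\<in>M1. size m - 1)"
      unfolding sum.reindex[OF inj] by (rule sum.cong) (auto simp: M1_def size_Diff_singleton)
    also have "\<dots> < (\<Sum>m\<in>M1. size m)"
      using M1(2,3) by (intro sum_strict_mono) (auto simp: M1_def nonempty_has_size[symmetric] intro!: diff_less)
    also have "\<dots> \<le> (\<Sum>m\<in>\<M>. size m)" using fin M1(1) by (intro sum_mono2) auto
    finally have less1: "(\<Sum>m\<in>?r ` M1. size m) < (\<Sum>m\<in>\<M>. size m)" .
    have c1: "c m = 0" if "m \<in> M1" for m
    proof -
      have "\<forall>m\<in>?r ` M1. c (add_mset n0 m) * t (add_mset n0 m) = 0"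
        using M1(2) by (intro less.hyps[OF less1 _ sub sum0]) auto
      then have "c (add_mset n0 (?r m)) * t (add_mset n0 (?r m)) = 0" using that by blast
      moreover have "add_mset n0 (?r m) = m" using that by (auto simp: M1_def)
      ultimately show ?thesis using t(1)[OF that] by simp
    qed
    have "(\<Sum>m\<in>\<M> - M1. size m) < (\<Sum>m\<in>\<M>. size m)"
    proof -
      have "(\<Sum>m\<in>\<M>. size m) = (\<Sum>m\<in>\<M> - M1. size m) + (\<Sum>m\<in>M1. size m)"
        using fin M1(1) by (rule sum.subset_diff[rotated])
      moreover have "(\<Sum>m\<in>M1. size m) > 0"
        using M1(2,3) by (intro sum_pos) (auto simp: M1_def nonempty_has_size[symmetric])
      ultimately show ?thesis by linarith
    qed
    moreover have "(\<Sum>m\<in>\<M> - M1. fscale (c m) (?mon m)) = 0"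
    proof -
      have "(\<Sum>m\<in>\<M> - M1. fscale (c m) (?mon m)) = (\<Sum>m\<in>\<M>. fscale (c m) (?mon m))"
        using fin c1 by (intro sum.mono_neutral_left) (auto simp only: fscale_0)
      then show ?thesis using less.prems(3) by simp
    qed
    ultimately have "\<forall>m\<in>\<M> - M1. c m = 0" using fin less.prems(2) by (intro less.hyps) auto
    then show ?thesis using c1 by blast
  qed
qed

text \<open>The longest part of a quasi-shuffle monomial is the corresponding shuffle monomial.
  Comparing longest parts needs the length bound for the tail, so the three claims share one
  induction.\<close>

lemma mon_top:
  assumes "set l \<subseteq> lists X"
  shows "W.mon dlt l w \<noteq> 0 \<Longrightarrow> length w \<le> sum_list (map length l)"
    and "S.W.mon dlt l w \<noteq> 0 \<Longrightarrow> length w = sum_list (map length l)"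
    and "length w = sum_list (map length l) \<Longrightarrow> W.mon dlt l w = S.W.mon dlt l w"
  using assms
proof (induction l arbitrary: w)
  case (Cons n l)
  let ?r = "sum_list (map length l)" and ?f = "W.mon dlt l" and ?g = "S.W.mon dlt l"
  {
    case 1
    show ?case
    proof (rule ccontr)
      assume *: "\<not> length w \<le> sum_list (map length (n # l))"
      have "wc w (\<lambda>a b. dlt n a * ?f b) = 0" if "w \<in> lists X"
      proof (rule wcop_low[OF that])
        fix a b :: "'i list" assume ab: "length w \<le> length a + length b"
        have "\<not> length b \<le> ?r" if "a = n" using ab * that by simp
        then have "?f b = 0" if "a = n" using Cons.IH(1)[of b] that 1 by auto
        then show "dlt n a * ?f b = 0" by (cases "a = n") auto
      qed
      with 1 show False by (auto simp: W.conv_def split: if_splits)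
    qed
  next
    case 2
    then have "length w = length n + ?r"
      using Cons.IH(2) by (intro S_conv_length[of "dlt n" ?g]) (auto simp: dlt_eq_0_iff)
    then show ?case by simp
  next
    case 3
    show ?case
    proof (cases "w \<in> lists X")
      case True
      have "wc w (\<lambda>a b. dlt n a * ?f b) = S.wc w (\<lambda>a b. dlt n a * ?f b)"
      proof (rule wcop_top[OF True])
        fix a b :: "'i list" assume ab: "length w < length a + length b"
        have "\<not> length b \<le> ?r" if "a = n" using ab 3 that by simp
        then have "?f b = 0" if "a = n" using Cons.IH(1)[of b] 3 that by auto
        then show "dlt n a * ?f b = 0" by (cases "a = n") auto
      qed
      moreover have "S.wc w (\<lambda>a b. dlt n a * ?f b - dlt n a * ?g b) = 0"
      proof (rule S_wcop_low[OF True])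
        fix a b :: "'i list" assume ab: "length a + length b = length w"
        have "length b = ?r" if "a = n" using ab 3 that by simp
        then have "?f b = ?g b" if "a = n" using Cons.IH(3)[of b] 3 that by auto
        then show "dlt n a * ?f b - dlt n a * ?g b = 0" by (cases "a = n") auto
      qed
      ultimately show ?thesis using True by (simp add: W.conv_def S.W.conv_def S.W.cop_diff)
    qed (simp add: W.conv_def S.W.conv_def)
  }
qed (auto simp: dlt_def split: if_splits)

text \<open>Among the monomials with nonzero coefficient those of maximal total length
  \<open>R\<close> are singled out. On words of length \<open>R\<close> the relation becomes one
  between their shuffle monomials.\<close>

lemma Q_independent:
  assumes fin: "finite \<M>" and M: "\<M> \<subseteq> MM" and "(\<Sum>m\<in>\<M>. fscale (c m) (W.mon dlt (listing m))) = 0"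
  shows "\<forall>m\<in>\<M>. c m = 0"
proof (rule ccontr)
  assume neg: "\<not> (\<forall>m\<in>\<M>. c m = 0)"
  define tl where "tl m = sum_list (map length (listing m))" for m :: "'i list multiset"
  define M' where "M' = {m\<in>\<M>. c m \<noteq> 0}"
  have M': "finite M'" "M' \<noteq> {}" using fin neg by (auto simp: M'_def)
  define R where "R = Max (tl ` M')"
  define M2 where "M2 = {m\<in>M'. tl m = R}"
  have "R \<in> tl ` M'" unfolding R_def using M' by (intro Max_in) auto
  then have M2: "M2 \<noteq> {}" "M2 \<subseteq> MM" "M2 \<subseteq> M'" using M by (auto simp: M2_def M'_def)
  have finM2: "finite M2" using M2(3) M'(1) by (rule finite_subset)
  have tlR: "tl m \<le> R" if "m \<in> M'" for m unfolding R_def using M' that by (intro Max_ge) auto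
  have setX: "set (listing m) \<subseteq> lists X" if "m \<in> MM" for m
    using that N_sub by (auto simp: MM_def)
  have "(\<Sum>m\<in>M2. fscale (c m) (S.W.mon dlt (listing m))) = 0"
  proof
    fix w
    show "(\<Sum>m\<in>M2. fscale (c m) (S.W.mon dlt (listing m))) w = 0 w"
    proof (cases "length w = R")
      case True
      have "0 = (\<Sum>m\<in>\<M>. c m * W.mon dlt (listing m) w)"
        using fun_cong[OF assms(3), of w] by (simp add: sum_fun_app fscale_def)
      also have "\<dots> = (\<Sum>m\<in>M2. c m * W.mon dlt (listing m) w)"
      proof (rule sum.mono_neutral_right)
        show "\<forall>m\<in>\<M> - M2. c m * W.mon dlt (listing m) w = 0"
        proof
          fix m assume m: "m \<in> \<M> - M2"
          show "c m * W.mon dlt (listing m) w = 0"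
          proof (rule ccontr)
            assume "c m * W.mon dlt (listing m) w \<noteq> 0"
            then have nz: "c m \<noteq> 0" "W.mon dlt (listing m) w \<noteq> 0" by auto
            then have "m \<in> M'" using m by (auto simp: M'_def)
            then have "tl m < R" using m tlR[of m] by (auto simp: M2_def)
            moreover have "m \<in> MM" using m M by auto
            then have "length w \<le> tl m" using mon_top(1)[OF setX nz(2)] by (simp add: tl_def)
            ultimately show False using True by simp
          qed
        qed
      qed (use fin in \<open>auto simp: M2_def M'_def\<close>)
      also have "\<dots> = (\<Sum>m\<in>M2. c m * S.W.mon dlt (listing m) w)"
      proof (rule sum.cong[OF HOL.refl])
        fix m assume "m \<in> M2"
        then have "m \<in> MM" "length w = sum_list (map length (listing m))"
          using M2 True by (auto simp: M2_def tl_def)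
        then show "c m * W.mon dlt (listing m) w = c m * S.W.mon dlt (listing m) w"
          using mon_top(3)[OF setX] by simp
      qed
      finally show ?thesis by (simp add: sum_fun_app fscale_def)
    next
      case False
      have "S.W.mon dlt (listing m) w = 0" if "m \<in> M2" for m
        using mon_top(2)[OF setX, of m w] that M2 False by (auto simp: M2_def tl_def)
      then show ?thesis by (simp add: sum_fun_app fscale_def)
    qed
  qed
  then have "\<forall>m\<in>M2. c m = 0" by (rule S_independent[OF finM2 M2(2)])
  then show False using M2(1) by (auto simp: M2_def M'_def)
qed

end

lemma (in letters) wdeg_pos: "w \<in> lists X \<Longrightarrow> w \<noteq> [] \<Longrightarrow> wd w > 0"
  using length_le_wdeg[of w] length_greater_0_conv[of w] by linarith

context gens
begin

definition Sp :: "nat \<Rightarrow> ('i list \<Rightarrow> 'k) set" where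
  "Sp d = fs.span {W.mon dlt l | l. set l \<subseteq> N \<and> sum_list (map wd l) = d}"

lemma mon_in_Sp: "set l \<subseteq> N \<Longrightarrow> W.mon dlt l \<in> Sp (sum_list (map wd l))"
  unfolding Sp_def by (intro fs.span_base) auto

lemma Sp_conv:
  assumes "f \<in> Sp d" "g \<in> Sp e" shows "W.conv f g \<in> Sp (d + e)"
  using assms(1) unfolding Sp_def[of d]
proof (induction rule: fs.span_induct_alt)
  case base
  show ?case unfolding W.conv_0_left Sp_def by (rule fs.span_zero)
next
  case (step c x y)
  then obtain l where l: "set l \<subseteq> N" "sum_list (map wd l) = d" "x = W.mon dlt l" by auto
  have "W.conv x g \<in> Sp (d + e)" using assms(2) unfolding Sp_def[of e]
  proof (induction rule: fs.span_induct_alt)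
    case base
    show ?case unfolding W.conv_0_right Sp_def by (rule fs.span_zero)
  next
    case (step c z y)
    then obtain l' where l': "set l' \<subseteq> N" "sum_list (map wd l') = e" "z = W.mon dlt l'" by auto
    have "W.conv x z = W.mon dlt (l @ l')"
      unfolding l l' using l(1) l'(1) N_pos by (intro W.mon_append[symmetric, of _ _ wd] W.hom_dlt) auto
    then have "W.conv x z \<in> Sp (d + e)" using mon_in_Sp[of "l @ l'"] l l' by simp
    then show ?case using step unfolding W.conv_add_right W.conv_scale_right Sp_def
      by (intro fs.span_add fs.span_scale) auto
  qed
  then show ?case using step unfolding W.conv_add_left W.conv_scale_left Sp_def
    by (intro fs.span_add fs.span_scale) auto
qed

text \<open>Induction on the degree and, inside it, on the length. Modulo shuffle products a word is
  a combination of generators. The factors of such a product have smaller degree, and passing to the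
  quasi-shuffle product introduces only shorter words of the same degree.\<close>

lemma words_spanned: "w \<in> lists X \<Longrightarrow> dlt w \<in> Sp (wd w)"
proof (induction "wd w" arbitrary: w rule: less_induct)
  case (less w)
  \<comment> \<open>The hypothesis on smaller degrees has to become a premise of the inner induction
    on the length.\<close>
  note outer = less.hyps
  show ?case using less.prems outer
  proof (induction "length w" arbitrary: w rule: less_induct)
    case (less w)
    show ?case
    proof (cases "w = []")
      case True
      then show ?thesis using mon_in_Sp[of "[]"] by simp
    next
      case False
      define d r where "d = wd w" and "r = length w"
      have "length w > 0" using False by simp
      then have pos: "d > 0" "r > 0" using length_le_wdeg[OF less.prems(1)] unfolding d_def r_def by linarith+
      have w: "w \<in> Wset d r" using less.prems(1) by (simp add: Wset_def d_def r_def)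
      have "dlt w \<in> fs.span (dlt ` (N \<inter> Wset d r) \<union> Dec d r)"
        using N_basis[OF pos] w by (auto simp: relbasis_def)
      also have "\<dots> \<subseteq> Sp d"
        unfolding Sp_def
      proof (rule fs.span_minimal)
        show "dlt ` (N \<inter> Wset d r) \<union> Dec d r \<subseteq> fs.span {W.mon dlt l |l. set l \<subseteq> N \<and> sum_list (map wd l) = d}"
        proof (rule Un_least)
          show "dlt ` (N \<inter> Wset d r) \<subseteq> fs.span {W.mon dlt l |l. set l \<subseteq> N \<and> sum_list (map wd l) = d}"
          proof
            fix f :: "'i list \<Rightarrow> 'k" assume "f \<in> dlt ` (N \<inter> Wset d r)"
            then obtain n where n: "n \<in> N" "n \<in> lists X" "wd n = d" "f = dlt n" by (auto simp: Wset_def)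
            have "W.mon dlt [n] = dlt n" using W.conv_one_right[OF W.hom_dlt[OF n(2)]] by simp
            then show "f \<in> fs.span {W.mon dlt l |l. set l \<subseteq> N \<and> sum_list (map wd l) = d}"
              using mon_in_Sp[of "[n]"] n by (simp add: Sp_def)
          qed
          show "Dec d r \<subseteq> fs.span {W.mon dlt l |l. set l \<subseteq> N \<and> sum_list (map wd l) = d}"
            unfolding Dec_def
          proof (rule fs.span_minimal)
            show "{S.W.conv (dlt u) (dlt v) |u v. u \<in> lists X \<and> v \<in> lists X \<and> u \<noteq> [] \<and> v \<noteq> [] \<and>
                wd u + wd v = d \<and> length u + length v = r}
              \<subseteq> fs.span {W.mon dlt l |l. set l \<subseteq> N \<and> sum_list (map wd l) = d}"
            proof
              fix f :: "'i list \<Rightarrow> 'k"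
              assume "f \<in> {S.W.conv (dlt u) (dlt v) |u v. u \<in> lists X \<and> v \<in> lists X \<and> u \<noteq> [] \<and> v \<noteq> [] \<and>
                wd u + wd v = d \<and> length u + length v = r}"
              then obtain u v where uv: "f = S.W.conv (dlt u) (dlt v)" "u \<in> lists X" "v \<in> lists X"
                "u \<noteq> []" "v \<noteq> []" "wd u + wd v = d" "length u + length v = r" by auto
              have "wd u > 0" "wd v > 0" using uv wdeg_pos by auto
              then have "wd u < wd w" "wd v < wd w" using uv(6) by (auto simp: d_def)
              then have "dlt u \<in> Sp (wd u)" "dlt v \<in> Sp (wd v)" using less.prems(2) uv by auto
              from Sp_conv[OF this] have Q: "W.conv (dlt u) (dlt v) \<in> Sp d" using uv by simp
              \<comment> \<open>The difference of the two products; it is supported on words of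
                length less than \<open>r\<close>.\<close>
              define q where "q = W.conv (dlt u) (dlt v) - S.W.conv (dlt u) (dlt v)"
              have monQ: "W.conv (dlt u) (dlt v) = W.mon dlt [u, v]" "S.W.conv (dlt u) (dlt v) = S.W.mon dlt [u, v]"
                using W.conv_one_right[OF W.hom_dlt[OF uv(3)]] S.W.conv_one_right[OF S.W.hom_dlt[OF uv(3)]] by auto
              have hq: "W.hom d (W.conv (dlt u) (dlt v))" "S.W.hom d (S.W.conv (dlt u) (dlt v))"
                using W.hom_conv[OF W.hom_dlt[OF uv(2)] W.hom_dlt[OF uv(3)]]
                  S.W.hom_conv[OF S.W.hom_dlt[OF uv(2)] S.W.hom_dlt[OF uv(3)]] uv(6) by auto
              let ?T = "{w \<in> lists X. wd w = d \<and> length w < r}"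
              have supp: "q w' = 0" if "w' \<notin> ?T" for w'
              proof (rule ccontr)
                assume nz: "q w' \<noteq> 0"
                then have "W.conv (dlt u) (dlt v) w' \<noteq> 0 \<or> S.W.conv (dlt u) (dlt v) w' \<noteq> 0" by (auto simp: q_def)
                then have "w' \<in> lists X" "wd w' = d" "length w' \<le> r"
                  using hq mon_top(1,2)[of "[u, v]" w'] uv unfolding monQ by (auto simp: W.hom_def S.W.hom_def)
                moreover have "length w' \<noteq> r"
                  using mon_top(3)[of "[u, v]" w'] uv nz unfolding q_def monQ by auto
                ultimately show False using that by simp
              qed
              have "finite ?T" by (rule finite_subset[OF _ W.finite_degree[of d]]) auto
              then have "q = (\<Sum>w'\<in>?T. fscale (q w') (dlt w'))" using supp by (rule finite_support_sum)
              also have "\<dots> \<in> Sp d"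
                unfolding Sp_def
              proof (intro fs.span_sum fs.span_scale)
                fix w' assume "w' \<in> ?T"
                then have w': "w' \<in> lists X" "wd w' = wd w" "length w' < length w"
                  by (simp_all add: r_def d_def)
                have "dlt w' \<in> Sp (wd w')"
                  by (rule less.hyps[OF w'(3,1)]) (rule less.prems(2), simp_all add: w'(2))
                then show "dlt w' \<in> fs.span {W.mon dlt l |l. set l \<subseteq> N \<and> sum_list (map wd l) = d}"
                  using \<open>w' \<in> ?T\<close> by (simp add: Sp_def)
              qed
              finally have "q \<in> Sp d" .
              moreover have "f = W.conv (dlt u) (dlt v) - q" by (simp add: q_def uv(1))
              ultimately show "f \<in> fs.span {W.mon dlt l |l. set l \<subseteq> N \<and> sum_list (map wd l) = d}"
                using Q unfolding Sp_def by (metis (no_types, lifting) fs.span_diff)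
            qed
          qed (rule fs.subspace_span)
        qed
      qed (rule fs.subspace_span)
      finally show ?thesis by (simp add: d_def)
    qed
  qed
qed

lemma listing_inj: "inj_on (\<lambda>m. W.mon dlt (listing m)) MM"
proof (rule inj_onI, rule ccontr)
  fix m m' assume *: "m \<in> MM" "m' \<in> MM" "W.mon dlt (listing m) = W.mon dlt (listing m')" "m \<noteq> m'"
  let ?c = "\<lambda>x. if x = m then 1 else - 1 :: 'k"
  have "(\<Sum>x\<in>{m, m'}. fscale (?c x) (W.mon dlt (listing x))) =
      fscale 1 (W.mon dlt (listing m)) + fscale (- 1) (W.mon dlt (listing m'))"
    using *(4) by simp
  also have "\<dots> = 0" by (simp add: *(3) fscale_def fun_eq_iff)
  finally have "\<forall>x\<in>{m, m'}. ?c x = 0" using * by (intro Q_independent) auto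
  then show False by simp
qed

lemma monomials_independent: "fs.independent ((\<lambda>m. W.mon dlt (listing m)) ` MM)"
  unfolding fs.independent_explicit_finite_subsets
proof (intro allI impI)
  fix S u assume S: "S \<subseteq> (\<lambda>m. W.mon dlt (listing m)) ` MM" "finite S" and sum: "(\<Sum>v\<in>S. fscale (u v) v) = 0"
  obtain \<M> where M: "\<M> \<subseteq> MM" "finite \<M>" "S = (\<lambda>m. W.mon dlt (listing m)) ` \<M>"
    using finite_subset_image[OF S(2,1)] by metis
  have inj: "inj_on (\<lambda>m. W.mon dlt (listing m)) \<M>" using listing_inj M(1) by (rule inj_on_subset)
  have "(\<Sum>m\<in>\<M>. fscale (u (W.mon dlt (listing m))) (W.mon dlt (listing m))) = 0"
    using sum unfolding M(3) sum.reindex[OF inj] by (simp only: o_def)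
  from Q_independent[OF M(2,1) this] show "\<forall>v\<in>S. u v = 0" unfolding M(3) by blast
qed

end

section \<open>Lifting morphisms of V-modules to coalgebra maps\<close>

text \<open>Both coalgebras are written over the same letters with the same \<open>F\<close>, which
  is the form that an isomorphism of V-modules takes in coordinates. The coproducts
  \<open>cop\<close> of \<open>D\<close> and \<open>cop'\<close> of \<open>C\<close> may differ
  otherwise.\<close>

locale two_adapted = D: gens Y deg cop one p F N + C: adapted Y deg cop' one p F
  for Y :: "'i set" and deg and cop :: "'i \<Rightarrow> ('i \<Rightarrow> 'i \<Rightarrow> 'k::field) \<Rightarrow> 'k" and one and p and F and N
    and cop' :: "'i \<Rightarrow> ('i \<Rightarrow> 'i \<Rightarrow> 'k::field) \<Rightarrow> 'k"
begin

definition h :: "'i list \<Rightarrow> 'i \<Rightarrow> 'k" where "h n = (case n of [x] \<Rightarrow> dlt x | _ \<Rightarrow> 0)"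

lemma h_simps [simp]: "h [x] = dlt x" "h (x # y # l) = 0" "h [] = 0"
  by (simp_all add: h_def)

lemma hom_h: "n \<in> N \<Longrightarrow> C.hom (wdeg deg n) (h n)"
proof -
  assume "n \<in> N"
  then have n: "n \<in> lists D.X" using D.N_pos by blast
  show ?thesis
  proof (cases "\<exists>x. n = [x]")
    case True
    then show ?thesis using n C.hom_dlt by (auto simp: D.X_def)
  next
    case False
    then have "h n = 0" by (auto simp: h_def split: list.splits)
    then show ?thesis by (simp only: C.hom_0)
  qed
qed

text \<open>\<open>wF\<close> preserves length, so the power relations of generators become those of
  letters, or trivial ones between zeros.\<close>

lemma h_pw:
  assumes "n \<in> N" "good p (wdeg deg n)"
  shows "C.pw (h n) p = (case wF F n of Some m \<Rightarrow> h m | None \<Rightarrow> 0)"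
proof (cases "\<exists>x. n = [x]")
  case True
  then obtain x where x: "n = [x]" by blast
  then have "x \<in> C.X" using D.N_pos[OF assms(1)] by auto
  then have "C.pw (dlt x) p = odlt (F x)" using C.F_pw assms(2) x by simp
  then show ?thesis unfolding x by (simp add: wF_Cons split: option.split)
next
  case False
  then have "length n \<noteq> 1" by (auto simp: length_Suc_conv)
  then have "h m = 0" if "wF F n = Some m" for m
    using wF_length[OF that] by (auto simp: h_def split: list.splits)
  moreover have "h n = 0" using False by (auto simp: h_def split: list.splits)
  ultimately show ?thesis by (auto simp: C.pw_p_0 split: option.split simp del: zero_fun_apply)
qed

text \<open>\<Phi> is prescribed on the basis of admissible monomials. It has the expected value on
  every monomial because one derivation in \<open>red\<close> normalises that monomial in both
  algebras with the same scalar. Multiplicativity is claimed on \<open>Sp\<close> only: outside the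
  span of the monomials the linear extension is arbitrary.\<close>

theorem algebra_map_exists:
  "\<exists>\<Phi>. Vector_Spaces.linear fscale fscale \<Phi> \<and>
     (\<forall>d. \<forall>f\<in>D.Sp d. C.hom d (\<Phi> f)) \<and>
     (\<forall>d e. \<forall>f\<in>D.Sp d. \<forall>g\<in>D.Sp e. \<Phi> (D.W.conv f g) = C.conv (\<Phi> f) (\<Phi> g)) \<and>
     \<Phi> (dlt []) = dlt one \<and> (\<forall>x\<in>D.X. \<Phi> (dlt [x]) = dlt x)"
proof -
  interpret vp: vector_space_pair "fscale :: 'k \<Rightarrow> ('i list \<Rightarrow> 'k) \<Rightarrow> _" "fscale :: 'k \<Rightarrow> ('i \<Rightarrow> 'k) \<Rightarrow> _" ..
  let ?f = "\<lambda>m. D.W.mon dlt (listing m)"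
  \<comment> \<open>The monomial can be recovered from its function by
    \<open>listing_inj\<close>.\<close>
  define g where "g b = C.mon h (listing (THE m. m \<in> D.MM \<and> ?f m = b))" for b
  obtain \<Phi> where \<Phi>: "Vector_Spaces.linear fscale fscale \<Phi>" "\<forall>b\<in>?f ` D.MM. \<Phi> b = g b"
    using vp.linear_independent_extend[OF D.monomials_independent] by blast
  interpret l\<Phi>: Vector_Spaces.linear "fscale :: 'k \<Rightarrow> _" "fscale :: 'k \<Rightarrow> _" \<Phi> by (rule \<Phi>(1))
  have basis: "\<Phi> (?f m) = C.mon h (listing m)" if m: "m \<in> D.MM" for m
  proof -
    have "(THE m'. m' \<in> D.MM \<and> ?f m' = ?f m) = m"
      using m inj_onD[OF D.listing_inj] by (intro the_equality) blast+
    then have "g (?f m) = C.mon h (listing m)" unfolding g_def by simp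
    then show ?thesis using \<Phi>(2) m by simp
  qed
  have all: "\<Phi> (D.W.mon dlt l) = C.mon h l" if l: "set l \<subseteq> N" for l
  proof -
    obtain s :: 'k and m where m: "admissible (wdeg deg) p m" "set_mset m \<subseteq> N"
      "red (wdeg deg) p (wF F) l s (listing m)"
      using red_normal[OF D.p_gt_1 _ l, of "wF F" "wdeg deg"] D.N_F by blast
    have "D.W.mon dlt l = fscale s (D.W.mon dlt (listing m))"
    proof (rule D.W.red_mon[OF _ _ _ m(3) l])
      show "D.W.hom (wdeg deg n) (dlt n)" if "n \<in> N" for n using that D.N_pos by (intro D.W.hom_dlt) auto
      show "D.W.pw (dlt n) p = (case wF F n of Some m \<Rightarrow> dlt m | None \<Rightarrow> 0)"
        if "n \<in> N" "good p (wdeg deg n)" for n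
        using D.pw_dlt_word[of n] that D.N_pos by (simp add: odlt_def)
    qed (use D.N_F in blast)
    moreover have "C.mon h l = fscale s (C.mon h (listing m))"
      using D.N_F by (intro C.red_mon[OF hom_h h_pw _ m(3) l]) blast+
    moreover have "\<Phi> (?f m) = C.mon h (listing m)" using m by (intro basis) (simp add: D.MM_def)
    ultimately show ?thesis by (simp only: l\<Phi>.scale)
  qed
  have hom: "C.hom d (\<Phi> f)" if "f \<in> D.Sp d" for d f
    using that unfolding D.Sp_def
  proof (induction rule: fs.span_induct_alt)
    case base
    show ?case by (simp only: l\<Phi>.zero C.hom_0)
  next
    case (step c x y)
    then obtain l where l: "set l \<subseteq> N" "sum_list (map (wdeg deg) l) = d" "x = D.W.mon dlt l" by auto
    have "C.hom d (\<Phi> x)" unfolding l(3) all[OF l(1)] using C.hom_mon[of l "wdeg deg" h] hom_h l by auto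
    then show ?case using step unfolding l\<Phi>.add l\<Phi>.scale by (intro C.hom_add C.hom_scale) auto
  qed
  have conv: "\<Phi> (D.W.conv f g) = C.conv (\<Phi> f) (\<Phi> g)" if "f \<in> D.Sp d" "g \<in> D.Sp e" for f g d e
    using that(1) unfolding D.Sp_def[of d]
  proof (induction rule: fs.span_induct_alt)
    case base
    show ?case by (simp only: l\<Phi>.zero D.W.conv_0_left C.conv_0_left)
  next
    case (step c x y)
    then obtain l where l: "set l \<subseteq> N" "sum_list (map (wdeg deg) l) = d" "x = D.W.mon dlt l" by auto
    have "\<Phi> (D.W.conv x g) = C.conv (\<Phi> x) (\<Phi> g)" using that(2) unfolding D.Sp_def[of e]
    proof (induction rule: fs.span_induct_alt)
      case base
      show ?case by (simp only: l\<Phi>.zero D.W.conv_0_right C.conv_0_right)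
    next
      case (step c z y)
      then obtain l' where l': "set l' \<subseteq> N" "sum_list (map (wdeg deg) l') = e" "z = D.W.mon dlt l'" by auto
      have "D.W.conv x z = D.W.mon dlt (l @ l')"
        unfolding l l' using l(1) l'(1) D.N_pos
        by (intro D.W.mon_append[symmetric, of _ _ "wdeg deg"] D.W.hom_dlt) auto
      moreover have "C.mon h (l @ l') = C.conv (C.mon h l) (C.mon h l')"
        using l(1) l'(1) hom_h by (intro C.mon_append[of _ _ "wdeg deg"]) auto
      ultimately have "\<Phi> (D.W.conv x z) = C.conv (\<Phi> x) (\<Phi> z)"
        using all[of "l @ l'"] all[OF l(1)] all[OF l'(1)] l l' by simp
      then show ?case using step
        by (simp only: D.W.conv_add_right D.W.conv_scale_right l\<Phi>.add l\<Phi>.scale C.conv_add_right C.conv_scale_right)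
    qed
    then show ?case using step
      by (simp only: D.W.conv_add_left D.W.conv_scale_left l\<Phi>.add l\<Phi>.scale C.conv_add_left C.conv_scale_left)
  qed
  have "\<Phi> (dlt []) = dlt one" using all[of "[]"] by simp
  moreover have "\<Phi> (dlt [x]) = dlt x" if x: "x \<in> D.X" for x
  proof -
    have "D.W.mon dlt [[x]] = dlt [x]" using D.W.conv_one_right[OF D.W.hom_dlt[of "[x]"]] x by simp
    moreover have "C.mon h [[x]] = dlt x" using C.conv_one_right[OF C.hom_dlt[of x]] x by (simp add: D.X_def)
    ultimately show ?thesis using all[of "[[x]]"] D.letter_in_N[OF x] by simp
  qed
  ultimately show ?thesis using \<Phi>(1) hom conv by blast
qed

end

section \<open>Extending a coalgebra map to a Hopf map\<close>

definition Wn :: "'i set \<Rightarrow> ('i \<Rightarrow> nat) \<Rightarrow> nat \<Rightarrow> 'i list set" where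
  "Wn X deg n = {w \<in> lists X. wdeg deg w = n}"

text \<open>
  The matrix \<open>\<phi>\<close> describes a linear map from letters to words; \<open>pull X deg \<phi> w f\<close> is the value of
  \<open>f\<close> at the image of the word \<open>w\<close> under its multiplicative extension.
\<close>

primrec pull :: "'i set \<Rightarrow> ('i \<Rightarrow> nat) \<Rightarrow> ('i \<Rightarrow> 'i list \<Rightarrow> 'k::field) \<Rightarrow> 'i list \<Rightarrow> ('i list \<Rightarrow> 'k) \<Rightarrow> 'k" where
  "pull X deg \<phi> [] = (\<lambda>f. f [])"
| "pull X deg \<phi> (x # w) = (\<lambda>f. \<Sum>a\<in>Wn X deg (deg x). \<phi> x a * pull X deg \<phi> w (\<lambda>b. f (a @ b)))"

lemma pull_append: "pull X deg \<phi> (v @ w) f = pull X deg \<phi> v (\<lambda>a. pull X deg \<phi> w (\<lambda>b. f (a @ b)))"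
  by (induction v arbitrary: f) simp_all

lemma pull_add: "pull X deg \<phi> w (\<lambda>u. f u + g u) = pull X deg \<phi> w f + pull X deg \<phi> w g"
  by (induction w arbitrary: f g) (simp_all add: distrib_left sum.distrib)

lemma pull_scale: "pull X deg \<phi> w (\<lambda>u. c * f u) = c * pull X deg \<phi> w f"
  by (induction w arbitrary: f) (simp_all add: sum_distrib_left mult.left_commute)

lemma pull_0: "pull X deg \<phi> w (\<lambda>u. 0) = 0"
  using pull_scale[of X deg \<phi> w 0 "\<lambda>u. 0"] by simp

lemma pull_lin: "pull X deg \<phi> w (\<lambda>u. \<Sum>i\<in>I. c i * f i u) = (\<Sum>i\<in>I. c i * pull X deg \<phi> w (f i))"
  by (induction I rule: infinite_finite_induct) (simp_all add: pull_add pull_scale pull_0)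

lemma pull_cong:
  assumes "\<And>u. u \<in> Wn X deg (wdeg deg w) \<Longrightarrow> f u = g u"
  shows "pull X deg \<phi> w f = pull X deg \<phi> w g"
  using assms
proof (induction w arbitrary: f g)
  case (Cons x w)
  have "pull X deg \<phi> w (\<lambda>b. f (a @ b)) = pull X deg \<phi> w (\<lambda>b. g (a @ b))" if "a \<in> Wn X deg (deg x)" for a
    using that by (intro Cons.IH Cons.prems) (auto simp: Wn_def)
  then show ?case by simp
qed (simp add: Wn_def)

context letters
begin

abbreviation "WX \<equiv> Wn X deg"

lemma finite_WX [simp]: "finite (WX n)"
  unfolding Wn_def by (rule W.finite_degree)

lemma WX_0: "WX 0 = {[]}"
proof -
  have "w = []" if "w \<in> lists X" "wd w = 0" for w using length_le_wdeg[OF that(1)] that(2) by simp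
  then show ?thesis by (auto simp: Wn_def)
qed

lemma pull_expand: "pull X deg \<phi> w f = (\<Sum>u\<in>WX (wd w). pull X deg \<phi> w (dlt u) * f u)"
proof -
  have "pull X deg \<phi> w f = pull X deg \<phi> w (\<lambda>v. \<Sum>u\<in>WX (wd w). f u * dlt u v)"
    by (rule pull_cong) (simp add: sum_dlt)
  also have "\<dots> = (\<Sum>u\<in>WX (wd w). f u * pull X deg \<phi> w (dlt u))" by (rule pull_lin)
  finally show ?thesis by (simp only: mult.commute)
qed

lemma finite_functional_pull: "finite_functional (pull X deg \<phi> w)"
  unfolding finite_functional_def
  by (intro exI[of _ "WX (wd w)"] exI[of _ "\<lambda>u. pull X deg \<phi> w (dlt u)"]) (simp add: pull_expand[symmetric])

end

text \<open>The data of a coalgebra map from \<open>C\<close> to words over \<open>D\<close>: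
  \<open>\<phi> x a\<close> is the coefficient of the word \<open>a\<close> in the image of
  \<open>x\<close>. By \<open>\<phi>_letter\<close> its part of length one is the identity.\<close>

locale lifting = two_adapted Y deg cop one p F N cop'
  for Y :: "'i set" and deg and cop :: "'i \<Rightarrow> ('i \<Rightarrow> 'i \<Rightarrow> 'k::field) \<Rightarrow> 'k" and one and p and F and N
    and cop' :: "'i \<Rightarrow> ('i \<Rightarrow> 'i \<Rightarrow> 'k::field) \<Rightarrow> 'k" +
  fixes \<phi> :: "'i \<Rightarrow> 'i list \<Rightarrow> 'k"
  assumes \<phi>_one: "\<phi> one = dlt []"
    and \<phi>_letter: "x \<in> D.X \<Longrightarrow> y \<in> D.X \<Longrightarrow> \<phi> x [y] = dlt y x"
    and \<phi>_comult: "x \<in> Y \<Longrightarrow> (\<Sum>a\<in>D.WX (deg x). \<phi> x a * D.wc a \<Theta>) =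
      cop' x (\<lambda>y z. \<Sum>a\<in>D.WX (deg y). \<phi> y a * (\<Sum>b\<in>D.WX (deg z). \<phi> z b * \<Theta> a b))"
begin

abbreviation "pl \<equiv> pull D.X deg \<phi>"

lemma pull_pre: "pl (pre one y u) f = (\<Sum>s\<in>D.WX (deg y). \<phi> y s * pl u (\<lambda>b. f (s @ b)))"
  by (simp add: pre_def D.deg_one D.WX_0 \<phi>_one)

text \<open>A multiplicative extension respects coproducts as soon as it does so on letters, because
  the coproduct of words is multiplicative too. The induction peels off one letter and uses
  \<open>\<phi>_comult\<close> for it.\<close>

theorem pull_comult:
  assumes "w \<in> lists D.X"
  shows "pl w (\<lambda>w'. D.wc w' \<Theta>) = C.wc w (\<lambda>a b. pl a (\<lambda>a'. pl b (\<lambda>b'. \<Theta> a' b')))"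
  using assms
proof (induction w arbitrary: \<Theta> rule: list.induct)
  case (Cons x w)
  then have x: "x \<in> Y" and w: "w \<in> lists D.X" by (auto simp: D.X_def)
  let ?wd = "wdeg deg"
  let ?\<Xi> = "\<lambda>s t. C.wc w (\<lambda>u v. pl u (\<lambda>s'. pl v (\<lambda>t'. sg (?wd t * ?wd s') * \<Theta> (s @ s') (t @ t'))))"
  have "pl (x # w) (\<lambda>w'. D.wc w' \<Theta>) = (\<Sum>a\<in>D.WX (deg x). \<phi> x a * pl w (\<lambda>b. D.wc a (\<lambda>s t.
      D.wc b (\<lambda>s' t'. sg (?wd t * ?wd s') * \<Theta> (s @ s') (t @ t')))))"
    by (simp add: D.wcop_append)
  also have "\<dots> = (\<Sum>a\<in>D.WX (deg x). \<phi> x a * D.wc a (\<lambda>s t. pl w (\<lambda>b.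
      D.wc b (\<lambda>s' t'. sg (?wd t * ?wd s') * \<Theta> (s @ s') (t @ t')))))"
    by (simp add: D.W.cop_exchange[OF D.finite_functional_pull])
  also have "\<dots> = (\<Sum>a\<in>D.WX (deg x). \<phi> x a * D.wc a ?\<Xi>)"
    by (simp add: Cons.IH[OF w])
  also have "\<dots> = cop' x (\<lambda>y z. \<Sum>s\<in>D.WX (deg y). \<phi> y s * (\<Sum>t\<in>D.WX (deg z). \<phi> z t * ?\<Xi> s t))"
    by (rule \<phi>_comult[OF x])
  also have "\<dots> = cop' x (\<lambda>y z. C.wc w (\<lambda>u v. sg (deg z * ?wd u) *
      pl (pre one y u) (\<lambda>a'. pl (pre one z v) (\<lambda>b'. \<Theta> a' b'))))"
  proof (rule C.cop_cong)
    fix y z assume "y \<in> Y" "z \<in> Y"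
    have "(\<Sum>s\<in>D.WX (deg y). \<phi> y s * (\<Sum>t\<in>D.WX (deg z). \<phi> z t * ?\<Xi> s t)) =
      C.wc w (\<lambda>u v. \<Sum>s\<in>D.WX (deg y). \<phi> y s * (\<Sum>t\<in>D.WX (deg z). \<phi> z t *
        pl u (\<lambda>s'. pl v (\<lambda>t'. sg (?wd t * ?wd s') * \<Theta> (s @ s') (t @ t')))))"
      by (simp only: C.W.cop_lin)
    also have "\<dots> = C.wc w (\<lambda>u v. sg (deg z * ?wd u) *
      pl (pre one y u) (\<lambda>a'. pl (pre one z v) (\<lambda>b'. \<Theta> a' b')))"
    proof (rule C.W.cop_cong)
      fix u v
      \<comment> \<open>Images have the degree of their arguments, so the sign is constant on the
        words that occur and can be pulled out.\<close>
      have "pl u (\<lambda>s'. pl v (\<lambda>t'. sg (?wd t * ?wd s') * \<Theta> (s @ s') (t @ t'))) =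
          sg (deg z * ?wd u) * pl u (\<lambda>s'. pl v (\<lambda>t'. \<Theta> (s @ s') (t @ t')))" if "t \<in> D.WX (deg z)" for s t
      proof -
        have "pl u (\<lambda>s'. pl v (\<lambda>t'. sg (?wd t * ?wd s') * \<Theta> (s @ s') (t @ t'))) =
          pl u (\<lambda>s'. sg (deg z * ?wd u) * pl v (\<lambda>t'. \<Theta> (s @ s') (t @ t')))"
          using that by (simp only: pull_scale[of _ _ _ v], intro pull_cong) (simp add: Wn_def)
        then show ?thesis by (simp add: pull_scale)
      qed
      then show "(\<Sum>s\<in>D.WX (deg y). \<phi> y s * (\<Sum>t\<in>D.WX (deg z). \<phi> z t *
        pl u (\<lambda>s'. pl v (\<lambda>t'. sg (?wd t * ?wd s') * \<Theta> (s @ s') (t @ t'))))) =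
        sg (deg z * ?wd u) * pl (pre one y u) (\<lambda>a'. pl (pre one z v) (\<lambda>b'. \<Theta> a' b'))"
        by (simp add: pull_pre pull_lin sum_distrib_left mult.left_commute) (rule sum.swap)
    qed
    finally show "(\<Sum>s\<in>D.WX (deg y). \<phi> y s * (\<Sum>t\<in>D.WX (deg z). \<phi> z t * ?\<Xi> s t)) =
      C.wc w (\<lambda>u v. sg (deg z * ?wd u) * pl (pre one y u) (\<lambda>a'. pl (pre one z v) (\<lambda>b'. \<Theta> a' b')))" .
  qed
  also have "\<dots> = C.wc (x # w) (\<lambda>a b. pl a (\<lambda>a'. pl b (\<lambda>b'. \<Theta> a' b')))" by simp
  finally show ?case .
qed simp

text \<open>The image of a letter is that letter plus longer words, hence the image of
  \<open>w\<close> is \<open>w\<close> plus longer words.\<close>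

lemma pull_triangular:
  assumes "w \<in> lists D.X" "\<And>u. length w < length u \<Longrightarrow> f u = 0"
  shows "pl w f = f w"
  using assms
proof (induction w arbitrary: f rule: list.induct)
  case (Cons x w)
  then have x: "x \<in> D.X" and w: "w \<in> lists D.X" by auto
  have short: "pl w (\<lambda>b. f (a @ b)) = (if a = [x] then f (x # w) else 0) \<or> \<phi> x a = 0" if a: "a \<in> D.WX (deg x)" for a
  proof -
    have ne: "a \<noteq> []" using a D.deg_X[OF x] by (auto simp: Wn_def)
    show ?thesis
    proof (cases "length a = 1")
      case True
      then obtain y where y: "a = [y]" by (auto simp: length_Suc_conv)
      then have "y \<in> D.X" using a by (auto simp: Wn_def)
      then have "\<phi> x a = dlt y x" using \<phi>_letter[OF x] y by simp
      moreover have "pl w (\<lambda>b. f (a @ b)) = f (a @ w)"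
        using y by (intro Cons.IH[OF w] Cons.prems(2)) auto
      ultimately show ?thesis using y by (cases "x = y") auto
    next
      case False
      then have "length a \<ge> 2" using ne by (cases a) (auto simp: Suc_le_eq)
      then have "pl w (\<lambda>b. f (a @ b)) = f (a @ w)" "f (a @ w) = 0"
        by (intro Cons.IH[OF w] Cons.prems(2), simp)+
      then show ?thesis using False by auto
    qed
  qed
  have "pl (x # w) f = (\<Sum>a\<in>D.WX (deg x). if a = [x] then f (x # w) else 0)"
    unfolding pull.simps
  proof (rule sum.cong[OF HOL.refl])
    fix a assume a: "a \<in> D.WX (deg x)"
    show "\<phi> x a * pl w (\<lambda>b. f (a @ b)) = (if a = [x] then f (x # w) else 0)"
      using short[OF a] \<phi>_letter[OF x x] by (cases "a = [x]") auto
  qed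
  also have "\<dots> = f (x # w)" using x by (simp add: Wn_def)
  finally show ?case .
qed simp

end

context two_adapted
begin

text \<open>\<phi> is the transpose of the algebra map \<Phi>; since all degree parts are finite,
  transposing multiplicativity gives the comultiplication rule.\<close>

theorem lifting_exists: "\<exists>\<phi>. lifting Y deg cop one p F N cop' \<phi>"
proof -
  obtain \<Phi> where lin: "Vector_Spaces.linear fscale fscale \<Phi>"
    and hom: "\<And>d f. f \<in> D.Sp d \<Longrightarrow> C.hom d (\<Phi> f)"
    and conv: "\<And>d e f g. f \<in> D.Sp d \<Longrightarrow> g \<in> D.Sp e \<Longrightarrow> \<Phi> (D.W.conv f g) = C.conv (\<Phi> f) (\<Phi> g)"
    and one: "\<Phi> (dlt []) = dlt one" and letter: "\<And>x. x \<in> D.X \<Longrightarrow> \<Phi> (dlt [x]) = dlt x"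
    using algebra_map_exists by metis
  interpret l\<Phi>: Vector_Spaces.linear "fscale :: 'k \<Rightarrow> _" "fscale :: 'k \<Rightarrow> _" \<Phi> by (rule lin)
  let ?wd = "wdeg deg"
  define \<phi> where "\<phi> x u = (if u \<in> lists D.X then \<Phi> (dlt u) x else 0)" for x u
  have supp: "u \<in> lists D.X \<and> x \<in> Y \<and> deg x = ?wd u" if "\<phi> x u \<noteq> 0" for x u
    using that hom[OF D.words_spanned[of u]] by (auto simp: \<phi>_def C.hom_def split: if_splits)
  have \<phi>u: "\<phi> x u = \<Phi> (dlt u) x" if "u \<in> lists D.X" for x u using that by (simp add: \<phi>_def)
  have "lifting Y deg cop one p F N cop' \<phi>"
  proof
    show "\<phi> one = dlt []"
    proof
      fix u
      show "\<phi> one u = dlt [] u"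
      proof (cases "u = []")
        case True
        then show ?thesis by (simp add: \<phi>_def one)
      next
        case False
        have "\<phi> one u = 0"
        proof (rule ccontr)
          assume "\<phi> one u \<noteq> 0"
          from supp[OF this] have "u \<in> D.WX 0" by (auto simp: Wn_def D.deg_one)
          with False show False by (simp add: D.WX_0)
        qed
        then show ?thesis using False by simp
      qed
    qed
    show "\<phi> x [y] = dlt y x" if "x \<in> D.X" "y \<in> D.X" for x y
      using that by (simp add: \<phi>_def letter)
    fix x \<Theta> assume x: "x \<in> Y"
    let ?W = "D.WX (deg x)" and ?U = "D.W.upto (deg x)"
    \<comment> \<open>Multiplicativity of \<Phi> on \<open>dlt u\<close> and \<open>dlt v\<close>,
      evaluated at \<open>x\<close>, is the comultiplication rule for the matrix with single entry
      at \<open>(u, v)\<close>. A general \<Theta> is handled below as a combination of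
      these.\<close>
    have coef: "(\<Sum>a\<in>?W. \<phi> x a * D.W.coef a u v) = cop' x (\<lambda>y z. \<phi> y u * \<phi> z v)"
      if u: "u \<in> lists D.X" and v: "v \<in> lists D.X" for u v
    proof (cases "?wd u + ?wd v = deg x")
      case True
      have "D.W.hom (deg x) (D.W.conv (dlt u) (dlt v))"
        using D.W.hom_conv[OF D.W.hom_dlt[OF u] D.W.hom_dlt[OF v]] True by simp
      then have "D.W.conv (dlt u) (dlt v) = (\<Sum>a\<in>?W. fscale (D.W.conv (dlt u) (dlt v) a) (dlt a))"
        unfolding Wn_def by (rule D.W.hom_eq_sum)
      also have "\<dots> = (\<Sum>a\<in>?W. fscale (D.W.coef a u v) (dlt a))"
        by (rule sum.cong) (auto simp: D.W.conv_def D.W.coef_def Wn_def)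
      finally have "\<Phi> (D.W.conv (dlt u) (dlt v)) = (\<Sum>a\<in>?W. fscale (D.W.coef a u v) (\<Phi> (dlt a)))"
        by (metis (no_types, lifting) l\<Phi>.sum l\<Phi>.scale sum.cong)
      then have "C.conv (\<Phi> (dlt u)) (\<Phi> (dlt v)) x = (\<Sum>a\<in>?W. D.W.coef a u v * \<Phi> (dlt a) x)"
        unfolding conv[OF D.words_spanned[OF u] D.words_spanned[OF v]] by (simp add: sum_fun_app fscale_def)
      also have "\<dots> = (\<Sum>a\<in>?W. \<phi> x a * D.W.coef a u v)"
        by (rule sum.cong) (auto simp: \<phi>_def Wn_def)
      finally show ?thesis using x u v by (simp add: C.conv_def \<phi>u)
    next
      case False
      have "D.W.coef a u v = 0" if "a \<in> ?W" for a
        using D.W.coef_eq_0[OF u v] False that by (auto simp: Wn_def)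
      moreover have "cop' x (\<lambda>y z. \<phi> y u * \<phi> z v) = 0"
        using False supp by (intro C.cop_eq_0) fastforce
      ultimately show ?thesis by simp
    qed
    have U: "finite ?U" "?U \<subseteq> lists D.X" by (rule D.W.finite_upto) (auto simp: D.W.upto_def)
    have WU: "D.WX n \<subseteq> ?U" if "n \<le> deg x" for n using that by (auto simp: Wn_def D.W.upto_def)
    have "(\<Sum>a\<in>?W. \<phi> x a * D.wc a \<Theta>) = (\<Sum>a\<in>?W. \<Sum>u\<in>?U. \<Sum>v\<in>?U. \<phi> x a * D.W.coef a u v * \<Theta> u v)"
    proof (rule sum.cong[OF HOL.refl])
      fix a assume "a \<in> ?W"
      then have "D.wc a \<Theta> = (\<Sum>u\<in>?U. \<Sum>v\<in>?U. D.W.coef a u v * \<Theta> u v)"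
        by (intro D.W.cop_expand) (auto simp: Wn_def)
      then show "\<phi> x a * D.wc a \<Theta> = (\<Sum>u\<in>?U. \<Sum>v\<in>?U. \<phi> x a * D.W.coef a u v * \<Theta> u v)"
        by (simp add: sum_distrib_left mult.assoc)
    qed
    also have "\<dots> = (\<Sum>u\<in>?U. \<Sum>v\<in>?U. (\<Sum>a\<in>?W. \<phi> x a * D.W.coef a u v) * \<Theta> u v)"
      by (subst sum.swap) (simp only: sum_distrib_right sum.swap[of _ _ ?W])
    also have "\<dots> = (\<Sum>u\<in>?U. \<Sum>v\<in>?U. cop' x (\<lambda>y z. \<phi> y u * \<phi> z v) * \<Theta> u v)"
      using U(2) by (intro sum.cong refl arg_cong2[of _ _ _ _ "(*)"] coef) auto
    also have "\<dots> = cop' x (\<lambda>y z. \<Sum>u\<in>?U. \<Sum>v\<in>?U. \<phi> y u * \<phi> z v * \<Theta> u v)"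
      by (simp add: C.cop_sum C.cop_scale_right)
    also have "\<dots> = cop' x (\<lambda>y z. \<Sum>a\<in>D.WX (deg y). \<phi> y a * (\<Sum>b\<in>D.WX (deg z). \<phi> z b * \<Theta> a b))"
    proof (rule C.cop_cong)
      fix y z assume "deg y + deg z = deg x"
      then have le: "deg y \<le> deg x" "deg z \<le> deg x" by auto
      have "(\<Sum>b\<in>?U. \<phi> z b * \<Theta> a b) = (\<Sum>b\<in>D.WX (deg z). \<phi> z b * \<Theta> a b)" for a
        using U(1) WU[OF le(2)] supp by (intro sum.mono_neutral_right) (auto simp: Wn_def)
      then have "(\<Sum>u\<in>?U. \<Sum>v\<in>?U. \<phi> y u * \<phi> z v * \<Theta> u v) =
          (\<Sum>a\<in>?U. \<phi> y a * (\<Sum>b\<in>D.WX (deg z). \<phi> z b * \<Theta> a b))"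
        by (simp add: sum_distrib_left[symmetric] mult.assoc)
      also have "\<dots> = (\<Sum>a\<in>D.WX (deg y). \<phi> y a * (\<Sum>b\<in>D.WX (deg z). \<phi> z b * \<Theta> a b))"
        using U(1) WU[OF le(1)] supp by (intro sum.mono_neutral_right) (auto simp: Wn_def)
      finally show "(\<Sum>u\<in>?U. \<Sum>v\<in>?U. \<phi> y u * \<phi> z v * \<Theta> u v) =
        (\<Sum>a\<in>D.WX (deg y). \<phi> y a * (\<Sum>b\<in>D.WX (deg z). \<phi> z b * \<Theta> a b))" .
    qed
    finally show "(\<Sum>a\<in>?W. \<phi> x a * D.wc a \<Theta>) =
      cop' x (\<lambda>y z. \<Sum>a\<in>D.WX (deg y). \<phi> y a * (\<Sum>b\<in>D.WX (deg z). \<phi> z b * \<Theta> a b))" .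
  qed
  then show ?thesis by blast
qed

end

section \<open>Bases and tensor products\<close>

text \<open>Finite dimension is omitted so that tensor products and the parts of \<open>J\<close>
  are covered before bases of them are known.\<close>

definition vs :: "('k::field, 'a::ab_group_add) vspace \<Rightarrow> bool" where
  "vs V \<longleftrightarrow> vector_space (smul V) \<and> module.subspace (smul V) (carr V)"

lemma vs_fin_dim: "fin_dim_space V \<Longrightarrow> vs V" by (simp add: vs_def fin_dim_space_def)

lemma vs_closed:
  assumes "vs V"
  shows "0 \<in> carr V" "x \<in> carr V \<Longrightarrow> y \<in> carr V \<Longrightarrow> x + y \<in> carr V"
    "x \<in> carr V \<Longrightarrow> smul V c x \<in> carr V"
    "(\<And>i. i \<in> I \<Longrightarrow> f i \<in> carr V) \<Longrightarrow> sum f I \<in> carr V"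
proof -
  interpret v: vector_space "smul V" using assms by (simp add: vs_def)
  have s: "v.subspace (carr V)" using assms by (simp add: vs_def)
  show "0 \<in> carr V" "x \<in> carr V \<Longrightarrow> y \<in> carr V \<Longrightarrow> x + y \<in> carr V"
    "x \<in> carr V \<Longrightarrow> smul V c x \<in> carr V"
    "(\<And>i. i \<in> I \<Longrightarrow> f i \<in> carr V) \<Longrightarrow> sum f I \<in> carr V"
    using s v.subspace_0 v.subspace_add v.subspace_scale v.subspace_sum by blast+
qed

lemma ground_simps [simp]: "carr ground = UNIV" "smul ground = (*)" by (simp_all add: ground_def)

lemma vs_ground: "vs (ground :: ('k::field, 'k) vspace)"
proof -
  interpret kk: vector_space "(*) :: 'k \<Rightarrow> 'k \<Rightarrow> 'k" by unfold_locales (simp_all add: algebra_simps)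
  show ?thesis by (simp add: vs_def kk.vector_space_axioms)
qed

lemma dual_space_iff: "\<alpha> \<in> dual_space V \<longleftrightarrow> (\<forall>x\<in>carr V. \<forall>y\<in>carr V. \<alpha> (x + y) = \<alpha> x + \<alpha> y) \<and>
   (\<forall>c. \<forall>x\<in>carr V. \<alpha> (smul V c x) = c * \<alpha> x)"
  by (simp add: dual_space_def lin_map_def)

lemma lin_map_sum:
  assumes V: "vs V" and W: "vs W" and f: "lin_map V W f" and x: "\<And>i. i \<in> I \<Longrightarrow> x i \<in> carr V"
  shows "f (\<Sum>i\<in>I. smul V (c i) (x i)) = (\<Sum>i\<in>I. smul W (c i) (f (x i)))"
proof -
  have f0: "f 0 = 0"
    using f vs_closed(1)[OF V] unfolding lin_map_def by (metis add.right_neutral add_left_cancel)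
  show ?thesis using x
  proof (induction I rule: infinite_finite_induct)
    case (insert i I)
    have "(\<Sum>i\<in>I. smul V (c i) (x i)) \<in> carr V" "smul V (c i) (x i) \<in> carr V"
      using insert.prems by (auto intro!: vs_closed[OF V])
    then show ?case using insert f by (simp add: lin_map_def)
  qed (simp_all add: f0)
qed

lemma dual_sum:
  assumes "vs V" "\<alpha> \<in> dual_space V" "\<And>i. i \<in> I \<Longrightarrow> x i \<in> carr V"
  shows "\<alpha> (\<Sum>i\<in>I. smul V (c i) (x i)) = (\<Sum>i\<in>I. c i * \<alpha> (x i))"
  using lin_map_sum[OF assms(1) vs_ground _ assms(3), of \<alpha>] assms(2) by (simp add: dual_space_def)

text \<open>The index set has a type of its own, so that bases of two different spaces can be
  labelled by the same set.\<close>

definition dual_basis :: "('k::field, 'a::ab_group_add) vspace \<Rightarrow> 'i set \<Rightarrow> ('i \<Rightarrow> 'a) \<Rightarrow> ('i \<Rightarrow> 'a \<Rightarrow> 'k) \<Rightarrow> bool" where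
  "dual_basis V I e a \<longleftrightarrow> vs V \<and> finite I \<and> (\<forall>i\<in>I. e i \<in> carr V) \<and> (\<forall>i\<in>I. a i \<in> dual_space V) \<and>
     (\<forall>i\<in>I. \<forall>j\<in>I. a i (e j) = (if i = j then 1 else 0)) \<and>
     (\<forall>x\<in>carr V. x = (\<Sum>i\<in>I. smul V (a i x) (e i)))"

lemma dual_basisD:
  assumes "dual_basis V I e a"
  shows "vs V" "finite I" "i \<in> I \<Longrightarrow> e i \<in> carr V" "i \<in> I \<Longrightarrow> a i \<in> dual_space V"
    "i \<in> I \<Longrightarrow> j \<in> I \<Longrightarrow> a i (e j) = (if i = j then 1 else 0)"
    "x \<in> carr V \<Longrightarrow> (\<Sum>i\<in>I. smul V (a i x) (e i)) = x"
  using assms by (auto simp: dual_basis_def)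

lemma dual_basis_functional:
  assumes "dual_basis V I e a" "\<alpha> \<in> dual_space V" "x \<in> carr V"
  shows "\<alpha> x = (\<Sum>i\<in>I. a i x * \<alpha> (e i))"
  using dual_sum[OF dual_basisD(1)[OF assms(1)] assms(2), of I e "\<lambda>i. a i x"]
    dual_basisD(3)[OF assms(1)] dual_basisD(6)[OF assms(1,3)] by simp

lemma dual_basis_lin_map:
  assumes "dual_basis V I e a" "vs W" "lin_map V W f" "x \<in> carr V"
  shows "f x = (\<Sum>i\<in>I. smul W (a i x) (f (e i)))"
  using lin_map_sum[OF dual_basisD(1)[OF assms(1)] assms(2,3), of I e "\<lambda>i. a i x"]
    dual_basisD(3)[OF assms(1)] dual_basisD(6)[OF assms(1,4)] by simp

lemma dual_basis_exists:
  assumes "fin_dim_space V"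
  shows "\<exists>B a. dual_basis V B id a"
proof -
  interpret v: vector_space "smul V" using assms by (simp add: fin_dim_space_def)
  have sub: "v.subspace (carr V)" using assms by (simp add: fin_dim_space_def)
  obtain S where S: "finite S" "carr V = v.span S" using assms by (auto simp: fin_dim_space_def)
  obtain B where B: "B \<subseteq> carr V" "v.independent B" "carr V \<subseteq> v.span B"
    using v.maximal_independent_subset by blast
  have finB: "finite B" using v.independent_span_bound[OF S(1) B(2)] B(1) S(2) by auto
  have span: "carr V = v.span B" using B(1,3) sub v.span_minimal by blast
  have rep: "(\<Sum>b\<in>B. smul V (v.representation B x b) b) = x" if "x \<in> carr V" for x
    using that span by (intro v.sum_representation_eq[OF B(2) _ finB]) auto
  have "dual_basis V B id (\<lambda>b x. v.representation B x b)"
    unfolding dual_basis_def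
  proof (intro conjI ballI)
    fix b assume b: "b \<in> B"
    show "(\<lambda>x. v.representation B x b) \<in> dual_space V"
      using v.representation_add[OF B(2)] v.representation_scale[OF B(2)] span
      by (auto simp: dual_space_iff)
    fix c assume "c \<in> B"
    then show "v.representation B (id c) b = (if b = c then 1 else 0)"
      using v.representation_basis[OF B(2)] by auto
  qed (use assms rep B(1) finB in \<open>auto simp: vs_fin_dim\<close>)
  then show ?thesis by blast
qed

text \<open>Bases adapted to \<open>p\<close>-th powers are found in the dual; this turns a basis of
  the dual space into one of the space itself.\<close>

lemma dual_basis_of_functionals:
  assumes db: "dual_basis V I0 e0 a0" and fin: "finite I" and a: "\<And>i. i \<in> I \<Longrightarrow> a i \<in> dual_space V"
    and spans: "\<And>j. j \<in> I0 \<Longrightarrow> \<exists>c. \<forall>x\<in>carr V. a0 j x = (\<Sum>i\<in>I. c i * a i x)"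
    and indep: "\<And>c. (\<And>x. x \<in> carr V \<Longrightarrow> (\<Sum>i\<in>I. c i * a i x) = 0) \<Longrightarrow> \<forall>i\<in>I. c i = 0"
  shows "\<exists>e. dual_basis V I e a"
proof -
  note V = dual_basisD(1)[OF db]
  obtain c where c: "\<And>j x. j \<in> I0 \<Longrightarrow> x \<in> carr V \<Longrightarrow> a0 j x = (\<Sum>i\<in>I. c j i * a i x)"
    using spans by metis
  define e where "e i = (\<Sum>j\<in>I0. smul V (c j i) (e0 j))" for i
  interpret v: vector_space "smul V" using V by (simp add: vs_def)
  have e: "e i \<in> carr V" for i unfolding e_def
    using dual_basisD(3)[OF db] by (intro vs_closed[OF V]) auto
  have exp: "(\<Sum>i\<in>I. smul V (a i x) (e i)) = x" if x: "x \<in> carr V" for x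
  proof -
    have "(\<Sum>i\<in>I. smul V (a i x) (e i)) = (\<Sum>j\<in>I0. \<Sum>i\<in>I. smul V (a i x * c j i) (e0 j))"
      unfolding e_def v.scale_sum_right v.scale_scale by (rule sum.swap)
    also have "\<dots> = (\<Sum>j\<in>I0. smul V (a0 j x) (e0 j))"
      using x by (simp add: v.scale_sum_left[symmetric] c mult.commute)
    finally show ?thesis using dual_basisD(6)[OF db x] by simp
  qed
  have "a i (e j) = (if i = j then 1 else 0)" if i: "i \<in> I" and j: "j \<in> I" for i j
  proof -
    \<comment> \<open>The functional \<open>a i\<close> has two expansions in the
      \<open>a l\<close>, the trivial one and the one obtained from \<open>exp\<close>; independence
      identifies their coefficients.\<close>
    have "\<forall>l\<in>I. a i (e l) - (if i = l then 1 else 0) = 0"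
    proof (rule indep)
      fix x assume x: "x \<in> carr V"
      have "a i x = (\<Sum>l\<in>I. a l x * a i (e l))"
        using dual_sum[OF V a[OF i], of I e "\<lambda>l. a l x"] e exp[OF x] by simp
      moreover have "(\<Sum>l\<in>I. (a i (e l) - (if i = l then 1 else 0)) * a l x) =
          (\<Sum>l\<in>I. a l x * a i (e l)) - (\<Sum>l\<in>I. if i = l then a l x else 0)"
        unfolding sum_subtractf[symmetric] by (rule sum.cong) (auto simp: algebra_simps)
      ultimately show "(\<Sum>l\<in>I. (a i (e l) - (if i = l then 1 else 0)) * a l x) = 0"
        using fin i by simp
    qed
    then show ?thesis using j by (auto split: if_splits)
  qed
  then show ?thesis using V fin e a exp by (intro exI[of _ e]) (auto simp: dual_basis_def)
qed

lemma bilin_formsI: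
  assumes "\<And>x y y'. x \<in> carr V \<Longrightarrow> y \<in> carr W \<Longrightarrow> y' \<in> carr W \<Longrightarrow> \<beta> (x, y + y') = \<beta> (x, y) + \<beta> (x, y')"
    "\<And>c x y. x \<in> carr V \<Longrightarrow> y \<in> carr W \<Longrightarrow> \<beta> (x, smul W c y) = c * \<beta> (x, y)"
    "\<And>x x' y. x \<in> carr V \<Longrightarrow> x' \<in> carr V \<Longrightarrow> y \<in> carr W \<Longrightarrow> \<beta> (x + x', y) = \<beta> (x, y) + \<beta> (x', y)"
    "\<And>c x y. x \<in> carr V \<Longrightarrow> y \<in> carr W \<Longrightarrow> \<beta> (smul V c x, y) = c * \<beta> (x, y)"
  shows "\<beta> \<in> bilin_forms V W"
  using assms by (simp add: bilin_forms_def dual_space_iff)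

lemma bilin_forms_prod:
  "\<alpha> \<in> dual_space V \<Longrightarrow> \<gamma> \<in> dual_space W \<Longrightarrow> (\<lambda>(x, y). \<alpha> x * \<gamma> y) \<in> bilin_forms V W"
  by (rule bilin_formsI) (auto simp: dual_space_iff algebra_simps)

lemma bilin_forms_lin:
  assumes "\<beta> \<in> bilin_forms V W"
  shows "\<And>x y y'. x \<in> carr V \<Longrightarrow> y \<in> carr W \<Longrightarrow> y' \<in> carr W \<Longrightarrow> \<beta> (x, y + y') = \<beta> (x, y) + \<beta> (x, y')"
    "\<And>c x y. x \<in> carr V \<Longrightarrow> y \<in> carr W \<Longrightarrow> \<beta> (x, smul W c y) = c * \<beta> (x, y)"
    "\<And>x x' y. x \<in> carr V \<Longrightarrow> x' \<in> carr V \<Longrightarrow> y \<in> carr W \<Longrightarrow> \<beta> (x + x', y) = \<beta> (x, y) + \<beta> (x', y)"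
    "\<And>c x y. x \<in> carr V \<Longrightarrow> y \<in> carr W \<Longrightarrow> \<beta> (smul V c x, y) = c * \<beta> (x, y)"
  using assms by (auto simp: bilin_forms_def dual_space_iff)

lemma bilin_expand:
  assumes V: "dual_basis V I e a" and W: "dual_basis W K f b" and \<beta>: "\<beta> \<in> bilin_forms V W"
    and x: "x \<in> carr V" and y: "y \<in> carr W"
  shows "\<beta> (x, y) = (\<Sum>i\<in>I. \<Sum>k\<in>K. a i x * b k y * \<beta> (e i, f k))"
proof -
  have "\<beta> (x, y) = (\<Sum>i\<in>I. a i x * \<beta> (e i, y))"
    using dual_basis_functional[OF V _ x, of "\<lambda>x. \<beta> (x, y)"] \<beta> y by (auto simp: bilin_forms_def)
  also have "\<dots> = (\<Sum>i\<in>I. a i x * (\<Sum>k\<in>K. b k y * \<beta> (e i, f k)))"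
  proof (rule sum.cong[OF HOL.refl])
    fix i assume "i \<in> I"
    then have "(\<lambda>y. \<beta> (e i, y)) \<in> dual_space W" using \<beta> dual_basisD(3)[OF V] by (auto simp: bilin_forms_def)
    from dual_basis_functional[OF W this y] show "a i x * \<beta> (e i, y) = a i x * (\<Sum>k\<in>K. b k y * \<beta> (e i, f k))"
      by simp
  qed
  finally show ?thesis by (simp add: sum_distrib_left mult.assoc)
qed

lemma smul_tensor_space [simp]: "smul (tensor_space V W) = fscale" by (simp add: tensor_space_def)

lemma vs_tensor_space: "vs (tensor_space V W)"
  unfolding vs_def tensor_space_def by (simp add: fs.vector_space_axioms)

text \<open>The values on products of coordinate functionals determine an element of the tensor
  product. All coordinate formulas for coproducts start from this.\<close>

lemma tensor_expand:
  assumes V: "dual_basis V I e a" and W: "dual_basis W K f b" and t: "t \<in> carr (tensor_space V W)"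
  shows "t \<beta> = (if \<beta> \<in> bilin_forms V W then \<Sum>i\<in>I. \<Sum>k\<in>K. t (\<lambda>(x, y). a i x * b k y) * \<beta> (e i, f k) else 0)"
proof -
  have prod: "(\<lambda>(x, y). a i x * b k y) \<in> bilin_forms V W" if "i \<in> I" "k \<in> K" for i k
    using that dual_basisD(4)[OF V] dual_basisD(4)[OF W] by (intro bilin_forms_prod)
  have "t \<in> fs.span {tens V W x y | x y. x \<in> carr V \<and> y \<in> carr W}" using t by (simp add: tensor_space_def)
  then show ?thesis
  proof (induction rule: fs.span_induct_alt)
    case base
    then show ?case by simp
  next
    case (step c s t)
    then obtain x y where xy: "s = tens V W x y" "x \<in> carr V" "y \<in> carr W" by auto
    have "s \<beta> = (if \<beta> \<in> bilin_forms V W then \<Sum>i\<in>I. \<Sum>k\<in>K. s (\<lambda>(x, y). a i x * b k y) * \<beta> (e i, f k) else 0)"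
      using bilin_expand[OF V W _ xy(2,3)] prod by (simp add: xy(1) tens_def)
    then show ?case using step(2)
      by (auto simp: fscale_def sum_distrib_left distrib_right sum.distrib mult.assoc)
  qed
qed

lemma tensor_scale_form:
  assumes V: "dual_basis V I e a" and W: "dual_basis W K f b" and t: "t \<in> carr (tensor_space V W)"
    and \<beta>: "\<beta> \<in> bilin_forms V W"
  shows "t (\<lambda>x. c * \<beta> x) = c * t \<beta>"
proof -
  have "(\<lambda>x. c * \<beta> x) \<in> bilin_forms V W"
    using bilin_forms_lin[OF \<beta>] by (intro bilin_formsI) (auto simp: algebra_simps)
  then show ?thesis using \<beta>
    by (simp add: tensor_expand[OF V W t, of \<beta>] tensor_expand[OF V W t, of "\<lambda>x. c * \<beta> x"] sum_distrib_left mult.left_commute)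
qed

section \<open>Coordinates of a coalgebra\<close>

definition struct :: "('k::field, 'a::ab_group_add, 'z) gcoalg_scheme \<Rightarrow> 'i set \<Rightarrow> ('i \<Rightarrow> nat) \<Rightarrow> ('i \<Rightarrow> 'a)
    \<Rightarrow> ('i \<Rightarrow> 'a \<Rightarrow> 'k) \<Rightarrow> 'i \<Rightarrow> 'i \<Rightarrow> 'i \<Rightarrow> 'k" where
  "struct G Y deg e a x y z = (if x \<in> Y \<and> y \<in> Y \<and> z \<in> Y \<and> deg x = deg y + deg z
     then comult G (deg y) (deg z) (e x) (\<lambda>(s, t). a y s * a z t) else 0)"

definition struct_cop :: "('k::field, 'a::ab_group_add, 'z) gcoalg_scheme \<Rightarrow> 'i set \<Rightarrow> ('i \<Rightarrow> nat) \<Rightarrow> ('i \<Rightarrow> 'a)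
    \<Rightarrow> ('i \<Rightarrow> 'a \<Rightarrow> 'k) \<Rightarrow> 'i \<Rightarrow> ('i \<Rightarrow> 'i \<Rightarrow> 'k) \<Rightarrow> 'k" where
  "struct_cop G Y deg e a x \<Theta> =
     (\<Sum>y\<in>{y\<in>Y. deg y \<le> deg x}. \<Sum>z\<in>{z\<in>Y. deg z \<le> deg x}. struct G Y deg e a x y z * \<Theta> y z)"

text \<open>Taking the counit as coordinate in degree \<open>0\<close> normalises \<open>one\<close>
  to the element of counit \<open>1\<close>, so that the counit axiom becomes
  \<open>counit_at one\<close>.\<close>

locale coalg_basis =
  fixes G :: "('k::field, 'a::ab_group_add) gcoalg"
    and Y :: "'i set" and deg :: "'i \<Rightarrow> nat" and e :: "'i \<Rightarrow> 'a" and a :: "'i \<Rightarrow> 'a \<Rightarrow> 'k" and one :: 'i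
  assumes gc: "graded_coalgebra G" and coc: "cocommutative G"
    and db: "dual_basis (part G n) {y\<in>Y. deg y = n} e a"
    and one_Y: "one \<in> Y" "deg one = 0" and one_unique: "y \<in> Y \<Longrightarrow> deg y = 0 \<Longrightarrow> y = one"
    and a_one: "a one = counit G"
begin

abbreviation "P \<equiv> part G"
abbreviation "Yd n \<equiv> {y\<in>Y. deg y = n}"
abbreviation "sc \<equiv> struct G Y deg e a"

lemma e_in: "y \<in> Y \<Longrightarrow> e y \<in> cpart G (deg y)" using dual_basisD(3)[OF db] by auto
lemma a_in: "y \<in> Y \<Longrightarrow> a y \<in> dual_space (P (deg y))" using dual_basisD(4)[OF db] by auto

lemma comult_in: "c \<in> cpart G (i + j) \<Longrightarrow> comult G i j c \<in> carr (tensor_space (P i) (P j))"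
  using gc by (auto simp: graded_coalgebra_def lin_map_def)

lemma comult_lin: "lin_map (P (i + j)) (tensor_space (P i) (P j)) (comult G i j)"
  using gc by (auto simp: graded_coalgebra_def)

lemma finY: "finite {y\<in>Y. deg y \<le> n}"
proof -
  have "{y\<in>Y. deg y \<le> n} = (\<Union>m\<in>{..n}. Yd m)" by auto
  then show ?thesis using dual_basisD(2)[OF db] by simp
qed

lemma comult_form:
  assumes "x \<in> Y" "deg x = i + j" "\<beta> \<in> bilin_forms (P i) (P j)"
  shows "comult G i j (e x) \<beta> = (\<Sum>y\<in>Yd i. \<Sum>z\<in>Yd j. sc x y z * \<beta> (e y, e z))"
proof -
  have "comult G i j (e x) \<in> carr (tensor_space (P i) (P j))"
    using e_in[OF assms(1)] assms(2) by (intro comult_in) simp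
  from tensor_expand[OF db db this, of \<beta>] assms show ?thesis by (simp add: struct_def)
qed

text \<open>The coassociativity axiom is evaluated on the form that reads off the coordinates
  \<open>y\<close>, \<open>z\<close> and \<open>t\<close>.\<close>

lemma struct_coassoc:
  assumes x: "x \<in> Y" and y: "y \<in> Y" and z: "z \<in> Y" and t: "t \<in> Y" and d: "deg x = deg y + deg z + deg t"
  shows "(\<Sum>v\<in>Yd (deg y + deg z). sc x v t * sc v y z) = (\<Sum>v\<in>Yd (deg z + deg t). sc x y v * sc v z t)"
proof -
  define i j l where "i = deg y" and "j = deg z" and "l = deg t"
  note ijl = i_def[symmetric] j_def[symmetric] l_def[symmetric]
  have ay: "a y \<in> dual_space (P i)" and az: "a z \<in> dual_space (P j)" and at: "a t \<in> dual_space (P l)"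
    using a_in y z t by (auto simp: i_def j_def l_def)
  let ?zt = "\<lambda>(p, q). a z p * a t q" and ?yz = "\<lambda>(p, q). a y p * a z q"
  have zt: "?zt \<in> bilin_forms (P j) (P l)" and yz: "?yz \<in> bilin_forms (P i) (P j)"
    using ay az at bilin_forms_prod by blast+
  define \<beta> where "\<beta> = (\<lambda>(p, s). a y p * s ?zt)"
  have \<beta>: "\<beta> \<in> bilin_forms (P i) (tensor_space (P j) (P l))"
    unfolding \<beta>_def using ay by (intro bilin_formsI) (auto simp: dual_space_iff fscale_def algebra_simps)
  define \<gamma> where "\<gamma> = (\<lambda>(s, q). a t q * s ?yz)"
  have s_form: "s (\<lambda>(p, q'). \<beta> (p, tens (P j) (P l) q' q)) = \<gamma> (s, q)"
    if s: "s \<in> carr (tensor_space (P i) (P j))" for s q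
  proof -
    have "(\<lambda>(p, q'). \<beta> (p, tens (P j) (P l) q' q)) = (\<lambda>pq. a t q * ?yz pq)"
      using zt by (auto simp: \<beta>_def tens_def fun_eq_iff)
    then show ?thesis using tensor_scale_form[OF db db s yz] by (simp add: \<gamma>_def)
  qed
  have \<gamma>_lin: "\<gamma> \<in> bilin_forms (tensor_space (P i) (P j)) (P l)"
    unfolding \<gamma>_def using at by (intro bilin_formsI) (auto simp: dual_space_iff fscale_def algebra_simps)
  \<comment> \<open>This is the form that \<open>tensor_assoc\<close> produces. It is compared with
    \<gamma> on elements of the tensor product, and its bilinearity has to be established before it
    can be used.\<close>
  let ?\<gamma>' = "\<lambda>(s, q). s (\<lambda>(p, q'). \<beta> (p, tens (P j) (P l) q' q))"
  have \<gamma>': "?\<gamma>' \<in> bilin_forms (tensor_space (P i) (P j)) (P l)"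
  proof -
    note l = bilin_forms_lin[OF \<gamma>_lin]
    note cl = vs_closed[OF vs_tensor_space[of "P i" "P j"]]
    show ?thesis
      by (rule bilin_formsI) (use l cl s_form in \<open>auto simp del: plus_fun_apply\<close>)
  qed
  have ex: "e x \<in> cpart G (i + j + l)" using e_in[OF x] d by (simp add: i_def j_def l_def)
  have "tensor_assoc (P i) (P j) (P l) (tensor_map (tensor_space (P i) (P j)) (P l) (comult G i j) id (comult G (i + j) l (e x))) \<beta> =
     comult G (i + j) l (e x) (\<lambda>(v, q). ?\<gamma>' (comult G i j v, q))"
    using \<beta> \<gamma>' by (simp add: tensor_assoc_def tensor_map_def)
  also have "\<dots> = (\<Sum>v\<in>Yd (i + j). \<Sum>q\<in>Yd l. sc x v q * \<gamma> (comult G i j (e v), e q))"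
  proof -
    have form: "(\<lambda>(v, q). ?\<gamma>' (comult G i j v, q)) \<in> bilin_forms (P (i + j)) (P l)"
      using bilin_forms_lin[OF \<gamma>'] comult_lin[of i j] comult_in[of _ i j]
      by (intro bilin_formsI) (auto simp: lin_map_def simp del: plus_fun_apply)
    have inn: "comult G i j (e v) \<in> carr (tensor_space (P i) (P j))" if "v \<in> Yd (i + j)" for v
      using that e_in[of v] by (intro comult_in) auto
    show ?thesis
      using comult_form[OF x _ form] d inn by (simp add: ijl s_form)
  qed
  also have "\<dots> = (\<Sum>v\<in>Yd (i + j). sc x v t * sc v y z)"
  proof (rule sum.cong[OF HOL.refl])
    fix v assume v: "v \<in> Yd (i + j)"
    have "(\<Sum>q\<in>Yd l. sc x v q * \<gamma> (comult G i j (e v), e q)) = (\<Sum>q\<in>Yd l. if q = t then sc x v t * sc v y z else 0)"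
      using v y z t dual_basisD(5)[OF db, of t l] by (intro sum.cong) (auto simp: \<gamma>_def struct_def i_def j_def l_def)
    then show "(\<Sum>q\<in>Yd l. sc x v q * \<gamma> (comult G i j (e v), e q)) = sc x v t * sc v y z"
      using t dual_basisD(2)[OF db] by (simp add: l_def)
  qed
  finally have L: "tensor_assoc (P i) (P j) (P l) (tensor_map (tensor_space (P i) (P j)) (P l) (comult G i j) id (comult G (i + j) l (e x))) \<beta> =
     (\<Sum>v\<in>Yd (i + j). sc x v t * sc v y z)" .
  have "tensor_map (P i) (tensor_space (P j) (P l)) id (comult G j l) (comult G i (j + l) (e x)) \<beta> =
     comult G i (j + l) (e x) (\<lambda>(p, v). \<beta> (p, comult G j l v))"
    using \<beta> by (simp add: tensor_map_def)
  also have "\<dots> = (\<Sum>p\<in>Yd i. \<Sum>v\<in>Yd (j + l). sc x p v * \<beta> (e p, comult G j l (e v)))"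
  proof -
    have form: "(\<lambda>(p, v). \<beta> (p, comult G j l v)) \<in> bilin_forms (P i) (P (j + l))"
      using bilin_forms_lin[OF \<beta>] comult_lin[of j l] comult_in[of _ j l]
      by (intro bilin_formsI) (auto simp: lin_map_def simp del: plus_fun_apply)
    show ?thesis using comult_form[OF x _ form] d by (simp add: ijl add.assoc)
  qed
  also have "\<dots> = (\<Sum>p\<in>Yd i. if p = y then \<Sum>v\<in>Yd (j + l). sc x y v * sc v z t else 0)"
    using y z t dual_basisD(5)[OF db, of y i]
    by (intro sum.cong) (auto simp: \<beta>_def struct_def i_def j_def l_def intro!: sum.cong sum.neutral)
  also have "\<dots> = (\<Sum>v\<in>Yd (j + l). sc x y v * sc v z t)"
    using y dual_basisD(2)[OF db] by (simp add: i_def)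
  finally have R: "tensor_map (P i) (tensor_space (P j) (P l)) id (comult G j l) (comult G i (j + l) (e x)) \<beta> =
     (\<Sum>v\<in>Yd (j + l). sc x y v * sc v z t)" .
  have "tensor_assoc (P i) (P j) (P l) (tensor_map (tensor_space (P i) (P j)) (P l) (comult G i j) id (comult G (i + j) l (e x))) =
     tensor_map (P i) (tensor_space (P j) (P l)) id (comult G j l) (comult G i (j + l) (e x))"
    using gc ex unfolding graded_coalgebra_def by blast
  then show ?thesis using L R by (simp add: ijl)
qed

lemma struct_cocomm: "sc x z y = sg (deg y * deg z) * sc x y z"
proof (cases "x \<in> Y \<and> y \<in> Y \<and> z \<in> Y \<and> deg x = deg y + deg z")
  case True
  let ?zy = "\<lambda>(p, q). a z p * a y q"
  have zy: "?zy \<in> bilin_forms (P (deg z)) (P (deg y))" using True a_in by (intro bilin_forms_prod) auto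
  have "e x \<in> cpart G (deg y + deg z)" using True e_in[of x] by simp
  then have "braiding P (deg y) (deg z) (comult G (deg y) (deg z) (e x)) = comult G (deg z) (deg y) (e x)"
    using coc by (simp add: cocommutative_def)
  then have "comult G (deg z) (deg y) (e x) ?zy = braiding P (deg y) (deg z) (comult G (deg y) (deg z) (e x)) ?zy"
    by simp
  also have "\<dots> = sg (deg y * deg z) * comult G (deg y) (deg z) (e x) (\<lambda>(p, q). a y p * a z q)"
    using zy by (simp add: braiding_def sg_def mult.commute)
  finally show ?thesis using True by (simp add: struct_def add.commute)
qed (auto simp: struct_def)

lemma struct_counit:
  assumes "x \<in> Y" "z \<in> Y"
  shows "sc x one z = (if x = z then 1 else 0)" "sc x z one = (if x = z then 1 else 0)"
proof -
  have l: "sc x one z = (if x = z then 1 else 0)"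
  proof (cases "deg x = deg z")
    case True
    let ?b = "\<lambda>(k, q). k * a z q"
    have b: "?b \<in> bilin_forms ground (P (deg z))"
      using a_in[OF assms(2)] by (intro bilin_formsI) (auto simp: dual_space_iff algebra_simps)
    have "e x \<in> cpart G (deg z)" using e_in[OF assms(1)] True by simp
    then have "tensor_map ground (P (deg z)) (counit G) id (comult G 0 (deg z) (e x)) ?b =
        tens ground (P (deg z)) 1 (e x) ?b"
      using gc unfolding graded_coalgebra_def by metis
    then have "comult G 0 (deg z) (e x) (\<lambda>(p, q). a one p * a z q) = a z (e x)"
      using b by (simp add: tensor_map_def tens_def a_one)
    then show ?thesis using assms True one_Y dual_basisD(5)[OF db, of z "deg z" x]
      by (auto simp: struct_def)
  qed (use one_Y in \<open>auto simp: struct_def\<close>)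
  then show "sc x one z = (if x = z then 1 else 0)" .
  show "sc x z one = (if x = z then 1 else 0)"
    using struct_cocomm[of x z one] l one_Y by simp
qed

abbreviation "cop \<equiv> struct_cop G Y deg e a"

lemma cop_superset:
  assumes "finite A" "A \<subseteq> Y" "{y\<in>Y. deg y \<le> deg x} \<subseteq> A"
  shows "cop x \<Theta> = (\<Sum>y\<in>A. \<Sum>z\<in>A. sc x y z * \<Theta> y z)"
proof -
  have "(\<Sum>z\<in>{z\<in>Y. deg z \<le> deg x}. sc x y z * \<Theta> y z) = (\<Sum>z\<in>A. sc x y z * \<Theta> y z)" for y
    using assms by (intro sum.mono_neutral_left) (auto simp: struct_def)
  then have "cop x \<Theta> = (\<Sum>y\<in>{z\<in>Y. deg z \<le> deg x}. \<Sum>z\<in>A. sc x y z * \<Theta> y z)"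
    by (simp add: struct_cop_def)
  also have "\<dots> = (\<Sum>y\<in>A. \<Sum>z\<in>A. sc x y z * \<Theta> y z)"
    using assms by (intro sum.mono_neutral_left) (auto simp: struct_def intro!: sum.neutral split: if_splits)
  finally show ?thesis .
qed

theorem coords: "gcoalg_coords Y deg cop one"
proof
  fix x and \<Theta> \<Theta>' :: "'i \<Rightarrow> 'i \<Rightarrow> 'k"
  assume *: "\<And>y z. y \<in> Y \<Longrightarrow> z \<in> Y \<Longrightarrow> deg y + deg z = deg x \<Longrightarrow> \<Theta> y z = \<Theta>' y z"
  then show "cop x \<Theta> = cop x \<Theta>'"
    unfolding struct_cop_def by (intro sum.cong) (auto simp: struct_def)
next
  fix x assume x: "x \<in> Y"
  let ?A = "{y\<in>Y. deg y \<le> deg x}"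
  note A = finY[of "deg x"]
  have sup: "cop v \<Theta> = (\<Sum>y\<in>?A. \<Sum>z\<in>?A. sc v y z * \<Theta> y z)" if "v \<in> ?A" for v \<Theta>
    using that A by (intro cop_superset) auto
  show "coassoc_at cop x" unfolding coassoc_at_def
  proof
    fix \<Theta> :: "'i \<Rightarrow> 'i \<Rightarrow> 'i \<Rightarrow> 'k"
    have "cop x (\<lambda>v t. cop v (\<lambda>y z. \<Theta> y z t)) =
        (\<Sum>v\<in>?A. \<Sum>t\<in>?A. sc x v t * cop v (\<lambda>y z. \<Theta> y z t))"
      using x by (intro sup) simp
    also have "\<dots> = (\<Sum>v\<in>?A. \<Sum>t\<in>?A. sc x v t * (\<Sum>y\<in>?A. \<Sum>z\<in>?A. sc v y z * \<Theta> y z t))"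
      by (intro sum.cong HOL.refl arg_cong2[of _ _ _ _ "(*)"] sup)
    also have "\<dots> = (\<Sum>v\<in>?A. \<Sum>t\<in>?A. \<Sum>y\<in>?A. \<Sum>z\<in>?A. sc x v t * sc v y z * \<Theta> y z t)"
      by (simp add: sum_distrib_left mult.assoc)
    also have "\<dots> = (\<Sum>t\<in>?A. \<Sum>y\<in>?A. \<Sum>z\<in>?A. \<Sum>v\<in>?A. sc x v t * sc v y z * \<Theta> y z t)"
      by (subst sum.swap, rule sum.cong[OF HOL.refl], subst sum.swap, rule sum.cong[OF HOL.refl], rule sum.swap)
    also have "\<dots> = (\<Sum>t\<in>?A. \<Sum>y\<in>?A. \<Sum>z\<in>?A. (\<Sum>v\<in>?A. sc x v t * sc v y z) * \<Theta> y z t)"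
      by (simp add: sum_distrib_right)
    also have "\<dots> = (\<Sum>t\<in>?A. \<Sum>y\<in>?A. \<Sum>z\<in>?A. (\<Sum>v\<in>?A. sc x y v * sc v z t) * \<Theta> y z t)"
    proof (rule sum.cong[OF HOL.refl], rule sum.cong[OF HOL.refl], rule sum.cong[OF HOL.refl],
        rule arg_cong2[of _ _ _ _ "(*)", OF _ HOL.refl])
      fix t y z assume *: "t \<in> ?A" "y \<in> ?A" "z \<in> ?A"
      show "(\<Sum>v\<in>?A. sc x v t * sc v y z) = (\<Sum>v\<in>?A. sc x y v * sc v z t)"
      proof (cases "deg x = deg y + deg z + deg t")
        case True
        have "(\<Sum>v\<in>?A. sc x v t * sc v y z) = (\<Sum>v\<in>Yd (deg y + deg z). sc x v t * sc v y z)"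
          using A True by (intro sum.mono_neutral_right) (auto simp: struct_def)
        moreover have "(\<Sum>v\<in>?A. sc x y v * sc v z t) = (\<Sum>v\<in>Yd (deg z + deg t). sc x y v * sc v z t)"
          using A True by (intro sum.mono_neutral_right) (auto simp: struct_def)
        ultimately show ?thesis using struct_coassoc[OF x _ _ _ True] * by auto
      next
        case False
        then show ?thesis by (intro trans[OF sum.neutral sum.neutral[symmetric]]) (auto simp: struct_def)
      qed
    qed
    also have "\<dots> = (\<Sum>t\<in>?A. \<Sum>y\<in>?A. \<Sum>z\<in>?A. \<Sum>v\<in>?A. sc x y v * sc v z t * \<Theta> y z t)"
      by (simp add: sum_distrib_right)
    also have "\<dots> = (\<Sum>y\<in>?A. \<Sum>v\<in>?A. \<Sum>z\<in>?A. \<Sum>t\<in>?A. sc x y v * sc v z t * \<Theta> y z t)"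
      by (subst sum.swap, rule sum.cong[OF HOL.refl]) (subst sum.swap, subst (2) sum.swap, subst sum.swap, rule HOL.refl)
    also have "\<dots> = (\<Sum>y\<in>?A. \<Sum>v\<in>?A. sc x y v * (\<Sum>z\<in>?A. \<Sum>t\<in>?A. sc v z t * \<Theta> y z t))"
      by (simp add: sum_distrib_left mult.assoc)
    also have "\<dots> = (\<Sum>y\<in>?A. \<Sum>v\<in>?A. sc x y v * cop v (\<lambda>z t. \<Theta> y z t))"
      by (intro sum.cong HOL.refl arg_cong2[of _ _ _ _ "(*)"] sup[symmetric])
    also have "\<dots> = cop x (\<lambda>y v. cop v (\<lambda>z t. \<Theta> y z t))"
      using x by (intro sup[symmetric]) simp
    finally show "cop x (\<lambda>v t. cop v (\<lambda>y z. \<Theta> y z t)) = cop x (\<lambda>y v. cop v (\<lambda>z t. \<Theta> y z t))" .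
  qed
  show "cocomm_at deg cop x" unfolding cocomm_at_def
  proof
    fix \<Theta> :: "'i \<Rightarrow> 'i \<Rightarrow> 'k"
    have "cop x \<Theta> = (\<Sum>z\<in>?A. \<Sum>y\<in>?A. sc x y z * \<Theta> y z)"
      unfolding struct_cop_def by (rule sum.swap)
    also have "\<dots> = cop x (\<lambda>y z. sg (deg y * deg z) * \<Theta> z y)"
      unfolding struct_cop_def
    proof (intro sum.cong HOL.refl)
      fix i j
      show "sc x j i * \<Theta> j i = sc x i j * (sg (deg i * deg j) * \<Theta> j i)"
        unfolding struct_cocomm[where x=x and z=j and y=i] by (simp only: mult_ac)
    qed
    finally show "cop x \<Theta> = cop x (\<lambda>y z. sg (deg y * deg z) * \<Theta> z y)" .
  qed
  show "counit_at one cop x" unfolding counit_at_def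
  proof (intro conjI allI)
    fix \<Theta> :: "'i \<Rightarrow> 'k"
    have oA: "one \<in> ?A" using one_Y by simp
    have "cop x (\<lambda>y z. if y = one then \<Theta> z else 0) = (\<Sum>y\<in>?A. if y = one then \<Sum>z\<in>?A. sc x one z * \<Theta> z else 0)"
      unfolding struct_cop_def by (intro sum.cong) auto
    also have "\<dots> = (\<Sum>z\<in>?A. sc x one z * \<Theta> z)" using oA A by simp
    also have "\<dots> = (\<Sum>z\<in>?A. if z = x then \<Theta> x else 0)"
      using x struct_counit(1) by (intro sum.cong) auto
    finally show "cop x (\<lambda>y z. if y = one then \<Theta> z else 0) = \<Theta> x" using x A by simp
    have "cop x (\<lambda>y z. if z = one then \<Theta> y else 0) = (\<Sum>y\<in>?A. \<Sum>z\<in>?A. if z = one then sc x y one * \<Theta> y else 0)"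
      unfolding struct_cop_def by (intro sum.cong) auto
    also have "\<dots> = (\<Sum>y\<in>?A. sc x y one * \<Theta> y)" using oA A by simp
    also have "\<dots> = (\<Sum>z\<in>?A. if z = x then \<Theta> x else 0)"
      using x struct_counit(2) by (intro sum.cong) auto
    finally show "cop x (\<lambda>y z. if z = one then \<Theta> y else 0) = \<Theta> x" using x A by simp
  qed
qed (simp_all add: finY one_Y one_unique struct_cop_def distrib_left sum.distrib sum_distrib_left mult.left_commute)

end

section \<open>The word basis of \<open>J C\<close>\<close>

sublocale coalg_basis \<subseteq> L: letters Y deg "struct_cop G Y deg e a" one
  using coords by (simp add: letters_def)

text \<open>The multilinear extension of \<open>f\<close> from basis words to words of arbitrary
  elements, evaluated by expanding the letters one at a time.\<close>

primrec wext :: "'i set \<Rightarrow> ('i \<Rightarrow> nat) \<Rightarrow> ('i \<Rightarrow> 'a \<Rightarrow> 'k::field) \<Rightarrow> (nat \<times> 'a) list \<Rightarrow> ('i list \<Rightarrow> 'k) \<Rightarrow> 'k" where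
  "wext Y deg a [] = (\<lambda>f. f [])"
| "wext Y deg a (c # v) = (\<lambda>f. \<Sum>y\<in>{y\<in>Y. deg y = fst c}. a y (snd c) * wext Y deg a v (\<lambda>u. f (y # u)))"

lemma wext_lin:
  "wext Y deg a v (\<lambda>u. f u + g u) = wext Y deg a v f + wext Y deg a v g"
  "wext Y deg a v (\<lambda>u. c * f u) = c * wext Y deg a v f"
  by (induction v arbitrary: f g) (simp_all add: distrib_left sum.distrib sum_distrib_left mult.left_commute)

lemma wext_0: "wext Y deg a v (\<lambda>u. 0) = 0"
  using wext_lin(2)[of Y deg a v 0 "\<lambda>u. 0"] by simp

lemma wext_sum: "wext Y deg a v (\<lambda>u. \<Sum>i\<in>I. c i * f i u) = (\<Sum>i\<in>I. c i * wext Y deg a v (f i))"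
  by (induction I rule: infinite_finite_induct) (simp_all add: wext_lin wext_0)

lemma words_simps [simp]: "[] \<in> words G" "(d, x) # v \<in> words G \<longleftrightarrow> d > 0 \<and> x \<in> cpart G d \<and> v \<in> words G"
  "u @ v \<in> words G \<longleftrightarrow> u \<in> words G \<and> v \<in> words G"
  by (auto simp: words_def)

lemma word_degree_simps [simp]: "word_degree [] = 0" "word_degree (c # v) = fst c + word_degree v"
  by (simp_all add: word_degree_def)

lemma multilin_append:
  assumes "\<beta> \<in> multilin_forms G" "u \<in> words G"
  shows "(\<lambda>v. \<beta> (u @ v)) \<in> multilin_forms G"
  unfolding multilin_forms_def
proof (intro CollectI ballI allI impI)
  fix u' v d assume "u' \<in> words G" "v \<in> words G" "(d::nat) > 0"
  then have "(\<lambda>x. \<beta> ((u @ u') @ (d, x) # v)) \<in> dual_space (part G d)"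
    using assms unfolding multilin_forms_def by (auto simp del: append_assoc)
  then show "(\<lambda>x. \<beta> (u @ u' @ (d, x) # v)) \<in> dual_space (part G d)" by simp
qed

lemma smul_J_part [simp]: "smul (J_part G n) = fscale" by (simp add: J_part_def)

lemma vs_J_part: "vs (J_part G n)"
  unfolding vs_def J_part_def by (simp add: fs.vector_space_axioms)

context coalg_basis
begin

abbreviation "X \<equiv> L.X"
abbreviation "wd \<equiv> wdeg deg"
abbreviation "ext v f \<equiv> wext Y deg a v f"

definition ew :: "'i list \<Rightarrow> (nat \<times> 'a) list" where "ew w = map (\<lambda>y. (deg y, e y)) w"

definition E :: "'i list \<Rightarrow> ('k, 'a) tensor_alg" where "E w = word G (ew w)"

definition Ec :: "'i list \<Rightarrow> ('k, 'a) tensor_alg \<Rightarrow> 'k" where "Ec w t = t (\<lambda>v. ext v (dlt w))"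

lemma ew_simps [simp]: "ew [] = []" "ew (y # w) = (deg y, e y) # ew w" "ew (u @ w) = ew u @ ew w"
  by (simp_all add: ew_def)

lemma ew_words: "w \<in> lists X \<Longrightarrow> ew w \<in> words G"
  using e_in L.deg_X by (induction w) (auto simp: L.X_def)

lemma ew_degree: "word_degree (ew w) = wd w"
  by (induction w) auto

lemma ext_cong:
  assumes "v \<in> words G" "\<And>u. u \<in> L.WX (word_degree v) \<Longrightarrow> f u = g u"
  shows "ext v f = ext v g"
  using assms
proof (induction v arbitrary: f g rule: list.induct)
  case (Cons c v)
  have v: "v \<in> words G" and c: "fst c > 0" using Cons.prems(1) by (cases c; simp)+
  have "ext v (\<lambda>u. f (y # u)) = ext v (\<lambda>u. g (y # u))" if "y \<in> Yd (fst c)" for y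
    using that c one_Y by (intro Cons.IH[OF v] Cons.prems(2)) (auto simp: Wn_def L.X_def)
  then show ?case by simp
qed (simp add: Wn_def)

lemma ext_expand: "v \<in> words G \<Longrightarrow> ext v g = (\<Sum>w\<in>L.WX (word_degree v). ext v (dlt w) * g w)"
proof -
  assume v: "v \<in> words G"
  have "ext v g = ext v (\<lambda>u. \<Sum>w\<in>L.WX (word_degree v). g w * dlt w u)"
    by (rule ext_cong[OF v]) (simp add: sum_dlt)
  also have "\<dots> = (\<Sum>w\<in>L.WX (word_degree v). g w * ext v (dlt w))" by (rule wext_sum)
  finally show ?thesis by (simp only: mult.commute)
qed

lemma ext_multilin: "(\<lambda>v. ext v f) \<in> multilin_forms G"
proof -
  have "(\<lambda>x. ext (u @ (d, x) # v) f) \<in> dual_space (part G d)" for u v d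
  proof (induction u arbitrary: f)
    case Nil
    have "a y \<in> dual_space (P d)" if "y \<in> Yd d" for y using a_in that by auto
    then show ?case
      by (auto simp: dual_space_iff distrib_right sum.distrib sum_distrib_left mult.assoc)
  next
    case (Cons c u)
    then show ?case
      by (auto simp: dual_space_iff distrib_left sum.distrib sum_distrib_left mult.left_commute)
  qed
  then show ?thesis by (simp add: multilin_forms_def)
qed

lemma ext_ew: "w \<in> lists Y \<Longrightarrow> ext (ew w) f = f w"
proof (induction w arbitrary: f)
  case (Cons y w)
  then have y: "y \<in> Y" by auto
  have "ext (ew (y # w)) f = (\<Sum>z\<in>Yd (deg y). if z = y then f (y # w) else 0)"
    unfolding ew_simps wext.simps using Cons dual_basisD(5)[OF db, of _ "deg y" y] by (intro sum.cong) auto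
  also have "\<dots> = f (y # w)" using y dual_basisD(2)[OF db] by simp
  finally show ?case .
qed simp

lemma X_Y: "w \<in> lists X \<Longrightarrow> w \<in> lists Y" by (auto simp: L.X_def)

lemma multilin_expand:
  assumes \<beta>: "\<beta> \<in> multilin_forms G"
  shows "v \<in> words G \<Longrightarrow> u \<in> words G \<Longrightarrow> \<beta> (u @ v) = ext v (\<lambda>w. \<beta> (u @ ew w))"
proof (induction v arbitrary: u)
  case (Cons c v)
  obtain d x where c: "c = (d, x)" by fastforce
  have dx: "d > 0" "x \<in> cpart G d" "v \<in> words G" using Cons.prems c by auto
  have dual: "(\<lambda>x. \<beta> (u @ (d, x) # v)) \<in> dual_space (P d)"
    using \<beta> dx Cons.prems by (auto simp: multilin_forms_def)
  have "\<beta> (u @ c # v) = (\<Sum>y\<in>Yd d. a y x * \<beta> (u @ (d, e y) # v))"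
    unfolding c by (rule dual_basis_functional[OF db dual dx(2)])
  also have "\<dots> = (\<Sum>y\<in>Yd d. a y x * ext v (\<lambda>w. \<beta> (u @ ew (y # w))))"
  proof (rule sum.cong[OF HOL.refl])
    fix y assume y: "y \<in> Yd d"
    then have "u @ [(d, e y)] \<in> words G" using Cons.prems dx e_in[of y] by auto
    from Cons.IH[OF dx(3) this] y show "a y x * \<beta> (u @ (d, e y) # v) = a y x * ext v (\<lambda>w. \<beta> (u @ ew (y # w)))"
      by simp
  qed
  finally show ?case by (simp add: c)
qed simp

lemma word_in: "v \<in> words G \<Longrightarrow> word G v \<in> carr (J_part G (word_degree v))"
  by (auto simp: J_part_def intro!: fs.span_base)

lemma E_in: "w \<in> lists X \<Longrightarrow> E w \<in> carr (J_part G (wd w))"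
  using word_in[of "ew w"] ew_words by (simp add: E_def ew_degree)

text \<open>Every multilinear form is, on words, the extension of its values on basis words. So an
  element of \<open>J\<close> is known from its values \<open>Ec\<close> on the extensions of
  \<open>dlt w\<close>.\<close>

lemma J_elem:
  assumes "t \<in> carr (J_part G n)"
  shows "t \<beta> = (if \<beta> \<in> multilin_forms G then \<Sum>w\<in>L.WX n. Ec w t * \<beta> (ew w) else 0)"
proof -
  have "t \<in> fs.span {word G w | w. w \<in> words G \<and> word_degree w = n}" using assms by (simp add: J_part_def)
  then show ?thesis
  proof (induction rule: fs.span_induct_alt)
    case base
    then show ?case by (simp add: Ec_def)
  next
    case (step c s t)
    then obtain v where v: "s = word G v" "v \<in> words G" "word_degree v = n" by auto
    have "s \<beta> = (if \<beta> \<in> multilin_forms G then \<Sum>w\<in>L.WX n. Ec w s * \<beta> (ew w) else 0)"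
    proof (cases "\<beta> \<in> multilin_forms G")
      case True
      have "\<beta> v = ext v (\<lambda>w. \<beta> (ew w))" using multilin_expand[OF True v(2), of "[]"] by simp
      also have "\<dots> = (\<Sum>w\<in>L.WX n. ext v (dlt w) * \<beta> (ew w))"
        unfolding v(3)[symmetric] by (rule ext_expand[OF v(2)])
      finally show ?thesis using True ext_multilin by (simp add: v(1) word_def Ec_def)
    qed (simp add: v(1) word_def)
    then show ?case using step(2)
      by (auto simp: Ec_def fscale_def sum_distrib_left distrib_right sum.distrib mult.assoc)
  qed
qed

lemma E_apply: "E w \<beta> = (if \<beta> \<in> multilin_forms G then \<beta> (ew w) else 0)"
  by (simp add: E_def word_def)

lemma Ec_E: "u \<in> lists X \<Longrightarrow> Ec w (E u) = dlt w u"
  using ext_multilin X_Y by (simp add: Ec_def E_apply ext_ew)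

lemma J_dual_basis: "dual_basis (J_part G n) {w \<in> lists X. wd w = n} E Ec"
  unfolding dual_basis_def
proof (intro conjI ballI)
  show "vs (J_part G n)" by (rule vs_J_part)
  show "finite {w \<in> lists X. wd w = n}" by (rule L.W.finite_degree)
  fix w assume w: "w \<in> {w \<in> lists X. wd w = n}"
  then show "E w \<in> carr (J_part G n)" using E_in by auto
  show "Ec w \<in> dual_space (J_part G n)" by (auto simp: dual_space_iff Ec_def fscale_def)
  fix u assume "u \<in> {w \<in> lists X. wd w = n}"
  then show "Ec w (E u) = (if w = u then 1 else 0)" using Ec_E[of u w] by (auto simp: dlt_def)
next
  fix t assume t: "t \<in> carr (J_part G n)"
  show "t = (\<Sum>w\<in>{w \<in> lists X. wd w = n}. smul (J_part G n) (Ec w t) (E w))"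
  proof
    fix \<beta>
    show "t \<beta> = (\<Sum>w\<in>{w \<in> lists X. wd w = n}. smul (J_part G n) (Ec w t) (E w)) \<beta>"
      by (subst J_elem[OF t]) (simp add: sum_fun_app fscale_def E_apply Wn_def)
  qed
qed

lemma J_mult_expand:
  assumes s: "s \<in> carr (J_part G m)" and t: "t \<in> carr (J_part G n)"
  shows "J_mult G s t = (\<Sum>u\<in>L.WX m. \<Sum>w\<in>L.WX n. fscale (Ec u s * Ec w t) (E (u @ w)))"
proof
  fix \<beta>
  show "J_mult G s t \<beta> = (\<Sum>u\<in>L.WX m. \<Sum>w\<in>L.WX n. fscale (Ec u s * Ec w t) (E (u @ w))) \<beta>"
  proof (cases "\<beta> \<in> multilin_forms G")
    case True
    have inner: "t (\<lambda>v. \<beta> (u @ v)) = (\<Sum>w\<in>L.WX n. Ec w t * \<beta> (u @ ew w))" if "u \<in> words G" for u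
      using J_elem[OF t, of "\<lambda>v. \<beta> (u @ v)"] multilin_append[OF True that] by simp
    have "(\<lambda>u. t (\<lambda>v. \<beta> (u @ v))) \<in> multilin_forms G"
      unfolding multilin_forms_def
    proof (intro CollectI ballI allI impI)
      fix u v d assume uv: "u \<in> words G" "v \<in> words G" "(d::nat) > 0"
      have "t (\<lambda>v'. \<beta> ((u @ (d, x) # v) @ v')) = (\<Sum>w\<in>L.WX n. Ec w t * \<beta> (u @ (d, x) # (v @ ew w)))"
        if "x \<in> cpart G d" for x
        using inner[of "u @ (d, x) # v"] uv that by simp
      moreover have "(\<lambda>x. \<beta> (u @ (d, x) # (v @ ew w))) \<in> dual_space (part G d)" if "w \<in> L.WX n" for w
        using True uv ew_words[of w] that unfolding multilin_forms_def by (auto simp: Wn_def)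
      ultimately show "(\<lambda>x. t (\<lambda>v'. \<beta> ((u @ (d, x) # v) @ v'))) \<in> dual_space (part G d)"
        using vs_closed(2,3)[OF dual_basisD(1)[OF db[of d]]]
        by (auto simp: dual_space_iff distrib_left sum.distrib sum_distrib_left mult.left_commute)
    qed
    from J_elem[OF s, of "\<lambda>u. t (\<lambda>v. \<beta> (u @ v))"] this
    have "s (\<lambda>u. t (\<lambda>v. \<beta> (u @ v))) = (\<Sum>u\<in>L.WX m. Ec u s * t (\<lambda>v. \<beta> (ew u @ v)))" by simp
    also have "\<dots> = (\<Sum>u\<in>L.WX m. Ec u s * (\<Sum>w\<in>L.WX n. Ec w t * \<beta> (ew u @ ew w)))"
      using inner ew_words by (intro sum.cong HOL.refl) (auto simp: Wn_def)
    finally show ?thesis using True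
      by (simp add: J_mult_def sum_fun_app fscale_def E_apply sum_distrib_left mult.assoc)
  qed (simp add: J_mult_def sum_fun_app fscale_def E_apply)
qed

lemma J_mult_in:
  assumes s: "s \<in> carr (J_part G m)" and t: "t \<in> carr (J_part G n)"
  shows "J_mult G s t \<in> carr (J_part G (m + n))"
proof -
  have "E (u @ w) \<in> carr (J_part G (m + n))" if "u \<in> L.WX m" "w \<in> L.WX n" for u w
    using that E_in[of "u @ w"] by (auto simp: Wn_def)
  then show ?thesis unfolding J_mult_expand[OF s t]
    using vs_closed(3,4)[OF vs_J_part] by (simp add: vs_closed(4)[OF vs_J_part] vs_closed(3)[OF vs_J_part, unfolded smul_J_part])
qed

lemma J_mult_E:
  assumes "u \<in> lists X" "w \<in> lists X"
  shows "J_mult G (E u) (E w) = E (u @ w)"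
proof
  fix \<beta>
  have "J_mult G (E u) (E w) \<beta> = (\<Sum>u'\<in>L.WX (wd u). \<Sum>w'\<in>L.WX (wd w). dlt u' u * dlt w' w * E (u' @ w') \<beta>)"
    using assms by (simp add: J_mult_expand[OF E_in[OF assms(1)] E_in[OF assms(2)]] sum_fun_app fscale_def Ec_E)
  also have "\<dots> = (\<Sum>u'\<in>L.WX (wd u). (\<Sum>w'\<in>L.WX (wd w). E (u' @ w') \<beta> * dlt w' w) * dlt u' u)"
    by (simp add: sum_distrib_right sum_distrib_left mult_ac)
  also have "\<dots> = E (u @ w) \<beta>"
    using assms by (simp add: sum_dlt Wn_def)
  finally show "J_mult G (E u) (E w) \<beta> = E (u @ w) \<beta>" .
qed

lemma Ec_lin: "Ec w (s + t) = Ec w s + Ec w t" "Ec w (fscale c s) = c * Ec w s"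
  by (simp_all add: Ec_def fscale_def)

lemma J_mult_bilin:
  assumes s: "s \<in> carr (J_part G m)" "s' \<in> carr (J_part G m)" and t: "t \<in> carr (J_part G n)" "t' \<in> carr (J_part G n)"
  shows "J_mult G (s + s') t = J_mult G s t + J_mult G s' t" "J_mult G s (t + t') = J_mult G s t + J_mult G s t'"
    "J_mult G (fscale c s) t = fscale c (J_mult G s t)" "J_mult G s (fscale c t) = fscale c (J_mult G s t)"
proof -
  have cs: "s + s' \<in> carr (J_part G m)" "fscale c s \<in> carr (J_part G m)"
    "t + t' \<in> carr (J_part G n)" "fscale c t \<in> carr (J_part G n)"
    using vs_closed(2,3)[OF vs_J_part] s t by (auto simp: vs_closed(3)[OF vs_J_part, unfolded smul_J_part])
  show "J_mult G (s + s') t = J_mult G s t + J_mult G s' t" "J_mult G s (t + t') = J_mult G s t + J_mult G s t'"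
    "J_mult G (fscale c s) t = fscale c (J_mult G s t)" "J_mult G s (fscale c t) = fscale c (J_mult G s t)"
    unfolding J_mult_expand[OF s(1) t(1)] J_mult_expand[OF s(2) t(1)] J_mult_expand[OF s(1) t(2)]
      J_mult_expand[OF cs(1) t(1)] J_mult_expand[OF cs(2) t(1)] J_mult_expand[OF s(1) cs(3)] J_mult_expand[OF s(1) cs(4)] Ec_lin
    by (auto simp: fun_eq_iff sum_fun_app Ec_lin fscale_def distrib_left distrib_right sum.distrib sum_distrib_left mult_ac)
qed

lemma J_incl_E: "y \<in> Y \<Longrightarrow> J_incl G (deg y) (e y) = E (pre one y [])"
proof -
  assume y: "y \<in> Y"
  show ?thesis
  proof (cases "y = one")
    case True
    then have "counit G (e y) = 1" using dual_basisD(5)[OF db, of one 0 one] one_Y a_one by simp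
    then show ?thesis using True one_Y by (simp add: J_incl_def J_unit_def E_def)
  next
    case False
    then have "deg y \<noteq> 0" using one_unique y by blast
    then show ?thesis using False by (simp add: J_incl_def E_def pre_def)
  qed
qed

lemma J_incl_lin: "lin_map (P n) (J_part G n) (J_incl G n)"
proof (cases "n = 0")
  case True
  have c: "lin_map (P 0) ground (counit G)" using gc by (simp add: graded_coalgebra_def)
  have u: "fscale k (J_unit G) \<in> carr (J_part G 0)" for k
    using vs_closed(3)[OF vs_J_part, of "J_unit G" G 0 k] word_in[of "[]"] by (simp add: J_unit_def)
  show ?thesis using c u True
    by (auto simp: lin_map_def J_incl_def fscale_def fun_eq_iff distrib_right mult.assoc)
next
  case False
  have "word G [(n, x)] \<in> carr (J_part G n)" if "x \<in> cpart G n" for x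
    using word_in[of "[(n, x)]"] that False by simp
  moreover have "word G [(n, x + y)] = word G [(n, x)] + word G [(n, y)]"
    "word G [(n, smul (P n) c x)] = fscale c (word G [(n, x)])" if "x \<in> cpart G n" "y \<in> cpart G n" for x y c
  proof -
    have d: "(\<lambda>x. \<beta> [(n, x)]) \<in> dual_space (P n)" if "\<beta> \<in> multilin_forms G" for \<beta>
    proof -
      have "\<forall>u\<in>words G. \<forall>v\<in>words G. \<forall>d>0. (\<lambda>x. \<beta> (u @ (d, x) # v)) \<in> dual_space (P d)"
        using that by (simp add: multilin_forms_def)
      from this[rule_format, of "[]" "[]" n] False show ?thesis by simp
    qed
    have "word G [(n, x + y)] \<beta> = (word G [(n, x)] + word G [(n, y)]) \<beta>"
      "word G [(n, smul (P n) c x)] \<beta> = fscale c (word G [(n, x)]) \<beta>" for \<beta>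
      using d[of \<beta>] that by (cases "\<beta> \<in> multilin_forms G"; simp add: word_def fscale_def dual_space_iff)+
    then show "word G [(n, x + y)] = word G [(n, x)] + word G [(n, y)]"
      "word G [(n, smul (P n) c x)] = fscale c (word G [(n, x)])" by blast+
  qed
  ultimately show ?thesis using False by (auto simp: lin_map_def J_incl_def)
qed

end

section \<open>The coproduct of \<open>J\<close> in word coordinates\<close>

context coalg_basis
begin

text \<open>The matrix of \<beta> in the word basis, cut down to bidegree \<open>(i, j)\<close>
  because \<open>wcop\<close> runs through all bidegrees at once.\<close>

definition bform :: "nat \<Rightarrow> nat \<Rightarrow> (('k, 'a) tensor_alg \<times> ('k, 'a) tensor_alg \<Rightarrow> 'k) \<Rightarrow> 'i list \<Rightarrow> 'i list \<Rightarrow> 'k" where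
  "bform i j \<beta> u u' = (if wd u = i \<and> wd u' = j then \<beta> (E u, E u') else 0)"

lemma ext_wcop_add:
  assumes "\<And>u u'. u \<in> lists X \<Longrightarrow> u' \<in> lists X \<Longrightarrow> \<Theta> u u' = \<Theta>1 u u' + \<Theta>2 u u'"
  shows "ext v (\<lambda>w. L.wc w \<Theta>) = ext v (\<lambda>w. L.wc w \<Theta>1) + ext v (\<lambda>w. L.wc w \<Theta>2)"
proof -
  have "L.wc w \<Theta> = L.wc w (\<lambda>u u'. \<Theta>1 u u' + \<Theta>2 u u')" for w
    by (rule L.W.cop_cong) (rule assms)
  then show ?thesis by (simp add: L.W.cop_add wext_lin)
qed

lemma ext_wcop_scale:
  assumes "\<And>u u'. u \<in> lists X \<Longrightarrow> u' \<in> lists X \<Longrightarrow> \<Theta> u u' = k * \<Theta>1 u u'"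
  shows "ext v (\<lambda>w. L.wc w \<Theta>) = k * ext v (\<lambda>w. L.wc w \<Theta>1)"
proof -
  have "L.wc w \<Theta> = L.wc w (\<lambda>u u'. k * \<Theta>1 u u')" for w
    by (rule L.W.cop_cong) (rule assms)
  then show ?thesis by (simp add: L.W.cop_scale wext_lin)
qed

lemma bilin_compose:
  assumes \<beta>: "\<beta> \<in> bilin_forms V' W'" and f: "lin_map V V' f" and g: "lin_map W W' g"
  shows "(\<lambda>(x, y). \<beta> (f x, g y)) \<in> bilin_forms V W"
  using bilin_forms_lin[OF \<beta>] f g by (intro bilin_formsI) (auto simp: lin_map_def)

text \<open>This identifies the recursion \<open>word_comult\<close> on tensor spaces with
  \<open>wcop\<close> on matrices. The induction carries all bidegrees and forms, since splitting
  off a letter evaluates the remaining word on a new form of smaller or equal bidegree.\<close>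

theorem word_comult_formula:
  "v \<in> words G \<Longrightarrow> word_comult G v i j \<beta> =
     (if \<beta> \<in> bilin_forms (J_part G i) (J_part G j) then ext v (\<lambda>w. L.wc w (bform i j \<beta>)) else 0)"
proof (induction v arbitrary: i j \<beta>)
  case Nil
  show ?case by (auto simp: bform_def tens_def J_unit_def E_def)
next
  case (Cons dc v)
  obtain d c where dc: "dc = (d, c)" by fastforce
  have d: "d > 0" and c: "c \<in> cpart G d" and v: "v \<in> words G" using Cons.prems dc by auto
  define S where "S = {(p, q). p + q = d \<and> p \<le> i \<and> q \<le> j}"
  have finS: "finite S" by (rule finite_subset[of _ "{..d} \<times> {..d}"]) (auto simp: S_def)
  show ?case
  proof (cases "\<beta> \<in> bilin_forms (J_part G i) (J_part G j)")
    case False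
    have "JJ_mult G p q (i - p) (j - q) s t \<beta> = 0" if "(p, q) \<in> S" for p q s t
      using that False by (auto simp: S_def JJ_mult_def)
    then have "word_comult G (dc # v) i j \<beta> = 0"
      unfolding word_comult.simps S_def[symmetric, unfolded] sum_fun_app dc
      by (intro sum.neutral) (auto simp: S_def)
    then show ?thesis using False by simp
  next
    case \<beta>: True
    \<comment> \<open>\<kappa> holds the coordinates of the coproduct of the first letter
      \<open>c\<close>, and \<open>H y z\<close> is what the remaining word contributes once that
      letter has split into \<open>y\<close> and \<open>z\<close>.\<close>
    define \<kappa> where "\<kappa> y z = (\<Sum>x\<in>Yd d. a x c * sc x y z)" for y z
    define H where "H y z = ext v (\<lambda>w. L.wc w (\<lambda>u u'. sg (deg z * wd u) * bform i j \<beta> (pre one y u) (pre one z u')))" for y z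
    have comp: "JJ_mult G p q (i - p) (j - q)
         (tensor_map (J_part G p) (J_part G q) (J_incl G p) (J_incl G q) (comult G p q c))
         (word_comult G v (i - p) (j - q)) \<beta> = (\<Sum>y\<in>Yd p. \<Sum>z\<in>Yd q. \<kappa> y z * H y z)"
      if pq: "(p, q) \<in> S" for p q
    proof -
      have le: "p + q = d" "p \<le> i" "q \<le> j" "p + (i - p) = i" "q + (j - q) = j" using pq by (auto simp: S_def)
      define \<gamma> where "\<gamma> x y = (\<lambda>(x', y'). \<beta> (J_mult G x x', J_mult G y y'))" for x y
      note bl = bilin_forms_lin[OF \<beta>]
      have mi: "J_mult G x x' \<in> carr (J_part G i)" if "x \<in> carr (J_part G p)" "x' \<in> carr (J_part G (i - p))" for x x'
        using J_mult_in[OF that] le by simp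
      have mj: "J_mult G x x' \<in> carr (J_part G j)" if "x \<in> carr (J_part G q)" "x' \<in> carr (J_part G (j - q))" for x x'
        using J_mult_in[OF that] le by simp
      have \<gamma>: "\<gamma> x y \<in> bilin_forms (J_part G (i - p)) (J_part G (j - q))"
        if xy: "x \<in> carr (J_part G p)" "y \<in> carr (J_part G q)" for x y
        unfolding \<gamma>_def
        by (rule bilin_formsI)
          (use xy bl mi[OF xy(1)] mj[OF xy(2)] J_mult_bilin(2,4)[OF xy(1,1)] J_mult_bilin(2,4)[OF xy(2,2)] in \<open>simp_all del: plus_fun_apply\<close>)
      \<comment> \<open>The form on which the coproduct of the first letter is tested. It must be
        bilinear before \<open>tensor_map\<close> can be evaluated; this follows from the induction
        hypothesis in the shape \<open>B_eq\<close>.\<close>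
      define B where "B = (\<lambda>(x, y). word_comult G v (i - p) (j - q) (\<gamma> x y))"
      have B_eq: "B (x, y) = ext v (\<lambda>w. L.wc w (bform (i - p) (j - q) (\<gamma> x y)))"
        if "x \<in> carr (J_part G p)" "y \<in> carr (J_part G q)" for x y
        using Cons.IH[OF v, of "i - p" "j - q" "\<gamma> x y"] \<gamma>[OF that] by (simp add: B_def)
      have Ei: "E u \<in> carr (J_part G n)" if "u \<in> lists X" "wd u = n" for u n using E_in[OF that(1)] that(2) by simp
      have B: "B \<in> bilin_forms (J_part G p) (J_part G q)"
      proof (rule bilin_formsI)
        fix x x' assume x: "x \<in> carr (J_part G p)" and x': "x' \<in> carr (J_part G p)"
        fix y y' assume y: "y \<in> carr (J_part G q)" and y': "y' \<in> carr (J_part G q)"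
        note clp = vs_closed(2,3)[OF vs_J_part, unfolded smul_J_part]
        show "B (x, y + y') = B (x, y) + B (x, y')"
          unfolding B_eq[OF x y] B_eq[OF x y'] B_eq[OF x clp(1)[OF y y']]
          by (rule ext_wcop_add)
            (simp add: bform_def \<gamma>_def J_mult_bilin(1)[OF y y' Ei Ei] bl(1) mi[OF x Ei] mj[OF y Ei] mj[OF y' Ei] del: plus_fun_apply)
        show "B (x + x', y) = B (x, y) + B (x', y)"
          unfolding B_eq[OF x y] B_eq[OF x' y] B_eq[OF clp(1)[OF x x'] y]
          by (rule ext_wcop_add)
            (simp add: bform_def \<gamma>_def J_mult_bilin(1)[OF x x' Ei Ei] bl(3) mi[OF x Ei] mi[OF x' Ei] mj[OF y Ei] del: plus_fun_apply)
        fix k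
        have sm: "fscale k (J_mult G s t) = smul (J_part G n) k (J_mult G s t)" for n s t by simp
        show "B (x, smul (J_part G q) k y) = k * B (x, y)"
          unfolding smul_J_part B_eq[OF x y] B_eq[OF x clp(2)[OF y]]
          by (rule ext_wcop_scale)
            (simp add: bform_def \<gamma>_def J_mult_bilin(3)[OF y y Ei Ei] bl(2)[unfolded smul_J_part] mi[OF x Ei] mj[OF y Ei])
        show "B (smul (J_part G p) k x, y) = k * B (x, y)"
          unfolding smul_J_part B_eq[OF x y] B_eq[OF clp(2)[OF x] y]
          by (rule ext_wcop_scale)
            (simp add: bform_def \<gamma>_def J_mult_bilin(3)[OF x x Ei Ei] bl(4)[unfolded smul_J_part] mi[OF x Ei] mj[OF y Ei])
      qed
      have cd: "c \<in> cpart G (p + q)" using c le by simp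
      have form: "(\<lambda>(x, y). B (J_incl G p x, J_incl G q y)) \<in> bilin_forms (P p) (P q)"
        by (rule bilin_compose[OF B J_incl_lin J_incl_lin])
      have \<kappa>: "comult G p q c (\<lambda>(x, y'). a y x * a z y') = \<kappa> y z" if yz: "y \<in> Yd p" "z \<in> Yd q" for y z
      proof -
        have "comult G p q c = (\<Sum>x\<in>Yd (p + q). fscale (a x c) (comult G p q (e x)))"
          using dual_basis_lin_map[OF db vs_tensor_space comult_lin cd] by simp
        then have "comult G p q c (\<lambda>(x, y'). a y x * a z y') =
            (\<Sum>x\<in>Yd (p + q). a x c * comult G p q (e x) (\<lambda>(x, y'). a y x * a z y'))"
          by (simp add: sum_fun_app fscale_def)
        also have "\<dots> = \<kappa> y z" unfolding \<kappa>_def using yz le(1)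
          by (intro sum.cong) (auto simp: struct_def)
        finally show ?thesis .
      qed
      have "JJ_mult G p q (i - p) (j - q)
         (tensor_map (J_part G p) (J_part G q) (J_incl G p) (J_incl G q) (comult G p q c))
         (word_comult G v (i - p) (j - q)) \<beta> =
         (- 1) ^ (q * (i - p)) * tensor_map (J_part G p) (J_part G q) (J_incl G p) (J_incl G q) (comult G p q c) B"
        using \<beta> le by (simp add: JJ_mult_def B_def \<gamma>_def)
      also have "\<dots> = (- 1) ^ (q * (i - p)) * comult G p q c (\<lambda>(x, y). B (J_incl G p x, J_incl G q y))"
        using B by (simp add: tensor_map_def)
      also have "comult G p q c (\<lambda>(x, y). B (J_incl G p x, J_incl G q y)) =
          (\<Sum>y\<in>Yd p. \<Sum>z\<in>Yd q. comult G p q c (\<lambda>(x, y'). a y x * a z y') * B (J_incl G p (e y), J_incl G q (e z)))"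
        by (subst tensor_expand[OF db db comult_in[OF cd]]) (simp add: form)
      also have "\<dots> = (\<Sum>y\<in>Yd p. \<Sum>z\<in>Yd q. \<kappa> y z * B (E (pre one y []), E (pre one z [])))"
      proof (intro sum.cong HOL.refl)
        fix y z assume yz: "y \<in> Yd p" "z \<in> Yd q"
        then show "comult G p q c (\<lambda>(x, y'). a y x * a z y') * B (J_incl G p (e y), J_incl G q (e z)) =
            \<kappa> y z * B (E (pre one y []), E (pre one z []))"
          using \<kappa>[OF yz] J_incl_E[of y] J_incl_E[of z] by auto
      qed
      also have "(- 1) ^ (q * (i - p)) * \<dots> = (\<Sum>y\<in>Yd p. \<Sum>z\<in>Yd q. \<kappa> y z * H y z)"
        unfolding sum_distrib_left
      proof (intro sum.cong HOL.refl)
        fix y z assume yz: "y \<in> Yd p" "z \<in> Yd q"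
        then have inX: "pre one y [] \<in> lists X" "pre one z [] \<in> lists X"
          using L.pre_lists[of y "[]"] L.pre_lists[of z "[]"] by simp_all
        have Ey: "E (pre one y []) \<in> carr (J_part G p)" "E (pre one z []) \<in> carr (J_part G q)"
          using Ei[OF inX(1)] Ei[OF inX(2)] yz by auto
        have "H y z = sg (q * (i - p)) * ext v (\<lambda>w. L.wc w (bform (i - p) (j - q) (\<gamma> (E (pre one y [])) (E (pre one z [])))))"
          unfolding H_def
        proof (rule ext_wcop_scale)
          fix u u' assume u: "u \<in> lists X" "u' \<in> lists X"
          have "\<gamma> (E (pre one y [])) (E (pre one z [])) (E u, E u') = \<beta> (E (pre one y u), E (pre one z u'))"
            using J_mult_E[OF inX(1) u(1)] J_mult_E[OF inX(2) u(2)] by (simp add: \<gamma>_def pre_append)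
          moreover have "(deg y + wd u = i) = (wd u = i - p)" "(deg z + wd u' = j) = (wd u' = j - q)"
            using yz le by auto
          ultimately show "sg (deg z * wd u) * bform i j \<beta> (pre one y u) (pre one z u') =
              sg (q * (i - p)) * bform (i - p) (j - q) (\<gamma> (E (pre one y [])) (E (pre one z []))) u u'"
            using yz by (auto simp: bform_def)
        qed
        then show "(- 1) ^ (q * (i - p)) * (\<kappa> y z * B (E (pre one y []), E (pre one z []))) = \<kappa> y z * H y z"
          unfolding B_eq[OF Ey] sg_def by (simp only: mult_ac)
      qed
      finally show ?thesis .
    qed
    define A where "A = {y\<in>Y. deg y \<le> d}"
    have finA: "finite A" using finY by (simp add: A_def)
    \<comment> \<open>Pairs of basis letters grouped by their bidegree \<open>(p, q)\<close>; the
      remaining pairs in \<open>A \<times> A\<close> contribute zero.\<close>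
    define K where "K = {(y, z). y \<in> A \<and> z \<in> A \<and> deg y + deg z = d \<and> deg y \<le> i \<and> deg z \<le> j}"
    have finK: "finite K" by (rule finite_subset[of _ "A \<times> A"]) (use finA in \<open>auto simp: K_def\<close>)
    have "word_comult G (dc # v) i j \<beta> = (\<Sum>(p, q)\<in>S. JJ_mult G p q (i - p) (j - q)
         (tensor_map (J_part G p) (J_part G q) (J_incl G p) (J_incl G q) (comult G p q c))
         (word_comult G v (i - p) (j - q)) \<beta>)"
      by (simp add: dc S_def sum_fun_app case_prod_beta)
    also have "\<dots> = (\<Sum>pq\<in>S. \<Sum>yz\<in>{k\<in>K. (\<lambda>(y, z). (deg y, deg z)) k = pq}. (\<lambda>(y, z). \<kappa> y z * H y z) yz)"
    proof (rule sum.cong[OF HOL.refl])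
      fix pq assume pq: "pq \<in> S"
      obtain p q where pqe: "pq = (p, q)" by fastforce
      have "{k\<in>K. (\<lambda>(y, z). (deg y, deg z)) k = pq} = Yd p \<times> Yd q"
        using pq unfolding pqe by (auto simp: K_def A_def S_def)
      then show "(case pq of (p, q) \<Rightarrow> JJ_mult G p q (i - p) (j - q)
         (tensor_map (J_part G p) (J_part G q) (J_incl G p) (J_incl G q) (comult G p q c))
         (word_comult G v (i - p) (j - q)) \<beta>) =
         (\<Sum>yz\<in>{k\<in>K. (\<lambda>(y, z). (deg y, deg z)) k = pq}. (\<lambda>(y, z). \<kappa> y z * H y z) yz)"
        using comp[of p q] pq pqe by (simp add: sum.cartesian_product)
    qed
    also have "\<dots> = (\<Sum>yz\<in>K. (\<lambda>(y, z). \<kappa> y z * H y z) yz)"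
      by (rule sum.group[OF finK finS]) (auto simp: K_def S_def)
    also have "\<dots> = (\<Sum>yz\<in>A \<times> A. (\<lambda>(y, z). \<kappa> y z * H y z) yz)"
    proof (rule sum.mono_neutral_left)
      show "\<forall>yz\<in>A \<times> A - K. (\<lambda>(y, z). \<kappa> y z * H y z) yz = 0"
      proof
        fix yz assume "yz \<in> A \<times> A - K"
        then obtain y z where yz: "yz = (y, z)" "\<not> (deg y + deg z = d \<and> deg y \<le> i \<and> deg z \<le> j)"
          by (auto simp: K_def)
        show "(\<lambda>(y, z). \<kappa> y z * H y z) yz = 0"
        proof (cases "deg y + deg z = d")
          case False
          then have "\<kappa> y z = 0" unfolding \<kappa>_def by (intro sum.neutral) (auto simp: struct_def)
          then show ?thesis using yz by simp
        next
          case True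
          then have "bform i j \<beta> (pre one y u) (pre one z u') = 0" for u u'
            using yz(2) by (auto simp: bform_def)
          then have "H y z = 0" by (simp add: H_def wext_0)
          then show ?thesis using yz by simp
        qed
      qed
    qed (use finA in \<open>auto simp: K_def\<close>)
    also have "\<dots> = (\<Sum>y\<in>A. \<Sum>z\<in>A. \<kappa> y z * H y z)" by (simp add: sum.cartesian_product)
    also have "\<dots> = (\<Sum>y\<in>A. \<Sum>z\<in>A. \<Sum>x\<in>Yd d. a x c * (sc x y z * H y z))"
      by (simp add: \<kappa>_def sum_distrib_right mult.assoc)
    also have "\<dots> = (\<Sum>y\<in>A. \<Sum>x\<in>Yd d. \<Sum>z\<in>A. a x c * (sc x y z * H y z))"
      by (rule sum.cong[OF HOL.refl], rule sum.swap)
    also have "\<dots> = (\<Sum>x\<in>Yd d. \<Sum>y\<in>A. \<Sum>z\<in>A. a x c * (sc x y z * H y z))"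
      by (rule sum.swap)
    also have "\<dots> = (\<Sum>x\<in>Yd d. a x c * (\<Sum>y\<in>A. \<Sum>z\<in>A. sc x y z * H y z))"
      by (simp add: sum_distrib_left)
    also have "\<dots> = (\<Sum>x\<in>Yd d. a x c * ext v (\<lambda>w. L.wc (x # w) (bform i j \<beta>)))"
    proof (rule sum.cong[OF HOL.refl])
      fix x assume "x \<in> Yd d"
      then have "L.wc (x # w) (bform i j \<beta>) = (\<Sum>y\<in>A. 1 * (\<Sum>z\<in>A. sc x y z *
          L.wc w (\<lambda>u u'. sg (deg z * wd u) * bform i j \<beta> (pre one y u) (pre one z u'))))" for w
        by (simp add: struct_cop_def A_def)
      then have "ext v (\<lambda>w. L.wc (x # w) (bform i j \<beta>)) = (\<Sum>y\<in>A. 1 * (\<Sum>z\<in>A. sc x y z * H y z))"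
        unfolding H_def by (simp only: wext_sum)
      then show "a x c * (\<Sum>y\<in>A. \<Sum>z\<in>A. sc x y z * H y z) = a x c * ext v (\<lambda>w. L.wc (x # w) (bform i j \<beta>))"
        by simp
    qed
    also have "\<dots> = ext (dc # v) (\<lambda>w. L.wc w (bform i j \<beta>))" by (simp add: dc)
    finally show ?thesis using \<beta> by simp
  qed
qed

theorem J_comult_E:
  assumes "w \<in> lists X"
  shows "J_comult G i j (E w) \<beta> =
    (if \<beta> \<in> bilin_forms (J_part G i) (J_part G j) then L.wc w (bform i j \<beta>) else 0)"
proof (cases "\<beta> \<in> bilin_forms (J_part G i) (J_part G j)")
  case True
  let ?F = "\<lambda>v. word_comult G v i j \<beta>" and ?g = "\<lambda>v. ext v (\<lambda>w. L.wc w (bform i j \<beta>))"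
  have eq: "?F v = ?g v" if "v \<in> words G" for v using word_comult_formula[OF that] True by simp
  \<comment> \<open>\<open>E w\<close> is zero on functions that are not multilinear, so the
    recursion on words must first be seen to be multilinear.\<close>
  have "?F \<in> multilin_forms G"
    unfolding multilin_forms_def
  proof (intro CollectI ballI allI impI)
    fix u v d assume uv: "u \<in> words G" "v \<in> words G" "(d::nat) > 0"
    have "(\<lambda>x. ?g (u @ (d, x) # v)) \<in> dual_space (part G d)"
      using ext_multilin uv unfolding multilin_forms_def by blast
    then show "(\<lambda>x. ?F (u @ (d, x) # v)) \<in> dual_space (part G d)"
      using eq uv vs_closed(2,3)[OF dual_basisD(1)[OF db[of d]]] by (simp add: dual_space_iff)
  qed
  then have "J_comult G i j (E w) \<beta> = ?F (ew w)" using True by (simp add: J_comult_def E_apply)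
  also have "\<dots> = L.wc w (bform i j \<beta>)" using eq[OF ew_words[OF assms]] ext_ew X_Y[OF assms] by simp
  finally show ?thesis using True by simp
qed (simp add: J_comult_def)

lemma J_counit_E: "w \<in> lists X \<Longrightarrow> J_counit (E w) = (if w = [] then 1 else 0)"
proof -
  have "(\<lambda>w. if w = [] then 1 else 0) \<in> multilin_forms G"
    by (auto simp: multilin_forms_def dual_space_iff)
  then show ?thesis by (auto simp: J_counit_def E_apply ew_def)
qed

end

section \<open>Existence of adapted bases\<close>

locale perfect_coords = char_coords +
  assumes perfect: "\<exists>y::'b. y ^ p = x"
begin

text \<open>The value \<open>0\<close> in bad degrees keeps the map semilinear on every degree, so
  iterates and kernels can be treated uniformly.\<close>

definition Fr :: "nat \<Rightarrow> ('a \<Rightarrow> 'b) \<Rightarrow> 'a \<Rightarrow> 'b" where "Fr n f = (if good p n then pw f p else 0)"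

primrec Frj :: "nat \<Rightarrow> nat \<Rightarrow> ('a \<Rightarrow> 'b) \<Rightarrow> 'a \<Rightarrow> 'b" where
  "Frj 0 n f = f"
| "Frj (Suc j) n f = Frj j (p * n) (Fr n f)"

lemma hom_Fr: "hom n f \<Longrightarrow> hom (p * n) (Fr n f)"
  using hom_pw[of n f p] by (auto simp: Fr_def simp del: zero_fun_apply)

lemma Fr_add: "hom n f \<Longrightarrow> hom n g \<Longrightarrow> Fr n (f + g) = Fr n f + Fr n g"
  using Frobenius_add[of n f g] by (auto simp: Fr_def simp del: plus_fun_apply zero_fun_apply)

lemma Fr_scale: "Fr n (fscale c f) = fscale (c ^ p) (Fr n f)"
  by (auto simp: Fr_def pw_scale simp del: zero_fun_apply)

lemma Fr_0: "Fr n 0 = 0" by (simp add: Fr_def pw_p_0 del: zero_fun_apply)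

lemma Frj_0: "Frj j n 0 = 0" by (induction j arbitrary: n) (simp_all add: Fr_0 del: zero_fun_apply)

lemma Frj_add: "hom n f \<Longrightarrow> hom n g \<Longrightarrow> Frj j n (f + g) = Frj j n f + Frj j n g"
  by (induction j arbitrary: n f g) (simp_all add: Fr_add hom_Fr del: plus_fun_apply)

lemma Frj_scale: "Frj j n (fscale c f) = fscale (c ^ p ^ j) (Frj j n f)"
  by (induction j arbitrary: n c f) (simp_all add: Fr_scale power_mult)

lemma Frj_mono:
  assumes "i \<le> j" "Frj i n f = 0" shows "Frj j n f = 0"
  using assms
proof (induction i arbitrary: j n f)
  case (Suc i)
  from Suc.prems(1) obtain j' where "j = Suc j'" "i \<le> j'" by (cases j) auto
  then show ?case using Suc.IH[of j' "p * n" "Fr n f"] Suc.prems(2) by simp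
qed (simp add: Frj_0)

text \<open>The condition says that, on the span of \<open>S\<close>, the kernel of each iterate is
  spanned by the members of \<open>S\<close> in it. The case \<open>j = 0\<close> is independence,
  which alone would not pass to images.\<close>

definition strong :: "nat \<Rightarrow> ('a \<Rightarrow> 'b) set \<Rightarrow> bool" where
  "strong n S \<longleftrightarrow> finite S \<and> 0 \<notin> S \<and> (\<forall>s\<in>S. hom n s) \<and>
     (\<forall>j c. Frj j n (\<Sum>s\<in>S. fscale (c s) s) = 0 \<longrightarrow> (\<forall>s\<in>S. c s = 0 \<or> Frj j n s = 0))"

lemma strongD:
  assumes "strong n S"
  shows "finite S" "0 \<notin> S" "s \<in> S \<Longrightarrow> hom n s"
    "Frj j n (\<Sum>s\<in>S. fscale (c s) s) = 0 \<Longrightarrow> s \<in> S \<Longrightarrow> c s = 0 \<or> Frj j n s = 0"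
  using assms unfolding strong_def by blast+

lemma strong_indep:
  assumes "strong n S" shows "fs.independent S"
proof (rule fs.independent_if_scalars_zero)
  show "finite S" using strongD(1)[OF assms] .
  fix f s assume "(\<Sum>x\<in>S. fscale (f x) x) = 0" "s \<in> S"
  then show "f s = 0" using strongD(4)[OF assms, of 0 f s] strongD(2)[OF assms] by auto
qed

lemma strong_Fr_inj:
  assumes S: "strong n S" and st: "s \<in> S" "t \<in> S" "Fr n s = Fr n t" "Fr n s \<noteq> 0"
  shows "s = t"
proof (rule ccontr)
  assume ne: "s \<noteq> t"
  \<comment> \<open>If the images agree, then \<open>s + m t\<close> is killed, although neither of
    its terms is.\<close>
  obtain m :: 'b where m: "m ^ p = - 1" using perfect by blast
  let ?c = "\<lambda>x. if x = s then 1 else if x = t then m else 0"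
  have "(\<Sum>x\<in>S. fscale (?c x) x) = (\<Sum>x\<in>{s, t}. fscale (?c x) x)"
    using strongD(1)[OF S] st by (intro sum.mono_neutral_right) (auto simp del: zero_fun_apply)
  also have "\<dots> = fscale 1 s + fscale m t" using ne by (simp del: plus_fun_apply)
  finally have "Frj 1 n (\<Sum>x\<in>S. fscale (?c x) x) = Frj 1 n (fscale 1 s + fscale m t)" by simp
  also have "\<dots> = Frj 1 n (fscale 1 s) + Frj 1 n (fscale m t)"
    using strongD(3)[OF S] st by (intro Frj_add hom_scale) auto
  also have "\<dots> = Fr n s + fscale (- 1) (Fr n t)" by (simp add: Fr_scale m del: plus_fun_apply)
  also have "\<dots> = 0" by (simp add: st(3) fscale_def fun_eq_iff)
  finally have z: "Frj 1 n (\<Sum>x\<in>S. fscale (?c x) x) = 0" .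
  have "?c s = 0 \<or> Frj 1 n s = 0" by (rule strongD(4)[where c = ?c, OF S z st(1)])
  then show False using st(4) by simp
qed

lemma Fr_sum:
  assumes "\<And>i. i \<in> I \<Longrightarrow> hom n (f i)"
  shows "Fr n (\<Sum>i\<in>I. fscale (c i) (f i)) = (\<Sum>i\<in>I. fscale (c i ^ p) (Fr n (f i)))"
  using Frobenius_sum[OF assms, of I] by (auto simp: Fr_def simp del: zero_fun_apply)

text \<open>A relation between images is the image of a combination with \<open>p\<close>-th roots
  as coefficients; the condition on \<open>S\<close> for \<open>Suc j\<close> becomes the condition
  on the images for \<open>j\<close>.\<close>

lemma strong_step:
  assumes S: "strong n S" shows "strong (p * n) (Fr n ` S - {0})"
  unfolding strong_def
proof (intro conjI ballI allI impI)
  let ?S0 = "{s\<in>S. Fr n s \<noteq> 0}"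
  have img: "Fr n ` S - {0} = Fr n ` ?S0" by auto
  have inj: "inj_on (Fr n) ?S0" using strong_Fr_inj[OF S] by (auto intro!: inj_onI)
  show "finite (Fr n ` S - {0})" "0 \<notin> Fr n ` S - {0}" using strongD(1)[OF S] by auto
  show "hom (p * n) s" if "s \<in> Fr n ` S - {0}" for s using that strongD(3)[OF S] hom_Fr by auto
  fix j c s' assume *: "Frj j (p * n) (\<Sum>s\<in>Fr n ` S - {0}. fscale (c s) s) = 0" "s' \<in> Fr n ` S - {0}"
  obtain r where r: "\<And>x :: 'b. r x ^ p = x" using perfect by metis
  let ?d = "\<lambda>s. if Fr n s = 0 then 0 else r (c (Fr n s))"
  have "(\<Sum>s\<in>Fr n ` S - {0}. fscale (c s) s) = (\<Sum>s\<in>?S0. fscale (c (Fr n s)) (Fr n s))"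
    unfolding img sum.reindex[OF inj] by simp
  also have "\<dots> = (\<Sum>s\<in>?S0. fscale (?d s ^ p) (Fr n s))"
    using r by (intro sum.cong) auto
  also have "\<dots> = (\<Sum>s\<in>S. fscale (?d s ^ p) (Fr n s))"
    using strongD(1)[OF S] by (intro sum.mono_neutral_left) (auto simp del: zero_fun_apply)
  also have "\<dots> = Fr n (\<Sum>s\<in>S. fscale (?d s) s)"
    by (rule Fr_sum[symmetric]) (rule strongD(3)[OF S])
  finally have F0: "Frj (Suc j) n (\<Sum>s\<in>S. fscale (?d s) s) = 0" using *(1) by simp
  obtain s where s: "s \<in> S" "s' = Fr n s" "Fr n s \<noteq> 0" using *(2) by auto
  then have "?d s = 0 \<or> Frj (Suc j) n s = 0" using strongD(4)[OF S F0] by blast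
  then show "c s' = 0 \<or> Frj j (p * n) s' = 0"
    using s r[of "c (Fr n s)"] p_pos by (auto simp: zero_power simp del: zero_fun_apply)
qed

text \<open>In the coset of \<open>v\<close> modulo the span of \<open>S\<close>, a representative
  killed by the earliest possible iterate is chosen. If an iterate kills a combination that involves
  it, then that iterate kills an element of the coset, and hence the representative.\<close>

lemma strong_insert:
  assumes S: "strong n S" and v: "hom n v" "v \<notin> fs.span S"
  shows "\<exists>v'. v' \<notin> S \<and> strong n (insert v' S)"
proof -
  define Q where "Q j \<longleftrightarrow> (\<exists>u. hom n u \<and> u - v \<in> fs.span S \<and> Frj j n u = 0)" for j
  have "\<exists>v'. hom n v' \<and> v' - v \<in> fs.span S \<and> (\<forall>j. Q j \<longrightarrow> Frj j n v' = 0)"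
  proof (cases "\<exists>j. Q j")
    case True
    then have "Q (LEAST j. Q j)" by (rule LeastI_ex)
    then obtain u where u: "hom n u" "u - v \<in> fs.span S" "Frj (LEAST j. Q j) n u = 0"
      unfolding Q_def[of "LEAST j. Q j"] by blast
    then have "Frj j n u = 0" if "Q j" for j using Frj_mono[OF Least_le[of Q j, OF that]] by blast
    with u show ?thesis by blast
  next
    case False
    then show ?thesis using v by (intro exI[of _ v]) (auto simp: fs.span_zero)
  qed
  then obtain v' where v': "hom n v'" "v' - v \<in> fs.span S" "\<And>j. Q j \<Longrightarrow> Frj j n v' = 0" by blast
  have v'S: "v' \<notin> fs.span S"
  proof
    assume "v' \<in> fs.span S"
    then have "v' - (v' - v) \<in> fs.span S" using v'(2) by (rule fs.span_diff)
    then show False using v(2) by simp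
  qed
  then have nS: "v' \<notin> S" "v' \<noteq> 0" using fs.span_base fs.span_zero by auto
  have "strong n (insert v' S)"
    unfolding strong_def
  proof (intro conjI allI impI)
    show "finite (insert v' S)" "0 \<notin> insert v' S" "\<forall>s\<in>insert v' S. hom n s"
      using strongD(1,2,3)[OF S] nS v'(1) by auto
    fix j c assume "Frj j n (\<Sum>s\<in>insert v' S. fscale (c s) s) = 0"
    moreover have sum: "(\<Sum>s\<in>insert v' S. fscale (c s) s) = fscale (c v') v' + (\<Sum>s\<in>S. fscale (c s) s)"
      using strongD(1)[OF S] nS(1) by (rule sum.insert)
    moreover have homS: "hom n (\<Sum>s\<in>S. fscale (c s) s)"
      using strongD(3)[OF S] by (intro hom_sum hom_scale) auto
    ultimately have F: "Frj j n (fscale (c v') v') + Frj j n (\<Sum>s\<in>S. fscale (c s) s) = 0"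
      using Frj_add[OF hom_scale[OF v'(1)] homS] by metis
    have v'0: "c v' = 0 \<or> Frj j n v' = 0"
    proof (cases "c v' = 0")
      case c: False
      \<comment> \<open>Dividing by the coefficient of \<open>v'\<close> brings the combination back
        into the coset of \<open>v\<close>.\<close>
      define u where "u = v' + fscale (inverse (c v')) (\<Sum>s\<in>S. fscale (c s) s)"
      have "fscale (c v') u = fscale (c v') v' + (\<Sum>s\<in>S. fscale (c s) s)"
        unfolding u_def fscale_add fscale_fscale using c by simp
      then have "Frj j n (fscale (c v') u) = 0"
        using F Frj_add[OF hom_scale[OF v'(1)] homS] by simp
      then have "fscale (c v' ^ p ^ j) (Frj j n u) = 0" by (simp only: Frj_scale)
      then have "Frj j n u = 0" using c by (simp add: fs.scale_eq_0_iff)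
      moreover have "hom n u" unfolding u_def using v'(1) homS by (intro hom_add hom_scale)
      moreover have "u - v \<in> fs.span S"
      proof -
        have "u - v = (v' - v) + fscale (inverse (c v')) (\<Sum>s\<in>S. fscale (c s) s)"
          by (simp add: u_def)
        also have "\<dots> \<in> fs.span S"
          by (intro fs.span_add[OF v'(2)] fs.span_scale fs.span_sum fs.span_base)
        finally show ?thesis .
      qed
      ultimately have "Q j" unfolding Q_def by blast
      then show ?thesis using v'(3) by blast
    qed simp
    then have "Frj j n (fscale (c v') v') = 0"
      unfolding Frj_scale using p_pos by (auto simp: fs.scale_eq_0_iff)
    then have "Frj j n (\<Sum>s\<in>S. fscale (c s) s) = 0" using F by simp
    then show "\<forall>s\<in>insert v' S. c s = 0 \<or> Frj j n s = 0" using strongD(4)[OF S] v'0 by blast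
  qed
  then show ?thesis using nS(1) by blast
qed

text \<open>Strong sets are independent, so their size is bounded by the number of basis elements of
  degree \<open>n\<close>. A largest one spans, by \<open>strong_insert\<close>.\<close>

lemma strong_extend:
  assumes T: "strong n T"
  shows "\<exists>S. T \<subseteq> S \<and> strong n S \<and> (\<forall>f. hom n f \<longrightarrow> f \<in> fs.span S)"
proof -
  let ?B = "dlt ` {y\<in>Y. deg y = n} :: ('a \<Rightarrow> 'b) set"
  have bound: "card S \<le> card ?B" if "strong n S" for S
  proof -
    have "S \<subseteq> fs.span ?B"
    proof
      fix f assume "f \<in> S"
      then have "f = (\<Sum>x\<in>{x\<in>Y. deg x = n}. fscale (f x) (dlt x))"
        using strongD(3)[OF that] by (intro hom_eq_sum) auto
      also have "\<dots> \<in> fs.span ?B" by (intro fs.span_sum fs.span_scale fs.span_base) auto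
      finally show "f \<in> fs.span ?B" .
    qed
    then show ?thesis using fs.independent_span_bound[of ?B S] strong_indep[OF that] by auto
  qed
  have "\<exists>S. (T \<subseteq> S \<and> strong n S) \<and> (\<forall>S'. T \<subseteq> S' \<and> strong n S' \<longrightarrow> card S' \<le> card S)"
    by (rule ex_has_greatest_nat[of _ T _ "Suc (card ?B)"]) (use T bound in \<open>auto simp: less_Suc_eq_le\<close>)
  then obtain S where S: "T \<subseteq> S \<and> strong n S" "\<And>S'. T \<subseteq> S' \<and> strong n S' \<Longrightarrow> card S' \<le> card S"
    by blast
  have "f \<in> fs.span S" if f: "hom n f" for f
  proof (rule ccontr)
    assume "f \<notin> fs.span S"
    then obtain v' where v': "v' \<notin> S" "strong n (insert v' S)" using strong_insert[OF _ f] S(1) by blast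
    then have "card (insert v' S) \<le> card S" using S by blast
    then show False using v'(1) strongD(1)[of n S] S(1) by simp
  qed
  then show ?thesis using S(1) by blast
qed

theorem adapted_family:
  "\<exists>B. \<forall>n>0. (strong n (B n) \<and> (\<forall>f. hom n f \<longrightarrow> f \<in> fs.span (B n))) \<and> Fr n ` B n - {0} \<subseteq> B (p * n)"
  by (rule degree_recursion[where P = strong])
    (use p_gt_1 strong_step strong_extend in blast, simp add: strong_def Frj_0, use strong_step in blast, use strong_extend in blast)

end

section \<open>The Verschiebung in coordinates, and adapted bases of a coalgebra\<close>

locale perfect_coalg = coalg_basis G Y deg e a one
  for G :: "('k::field, 'a::ab_group_add) gcoalg" and Y :: "'i set" and deg e a one +
  fixes p :: nat
  assumes CHAR_p: "CHAR('k) = p" and prime_p: "prime p" and perfect_p: "\<exists>y::'k. y ^ p = x"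

sublocale perfect_coalg \<subseteq> A: perfect_coords Y deg "struct_cop G Y deg e a" one p
  using CHAR_p prime_p perfect_p by unfold_locales auto

context perfect_coalg
begin

definition restr :: "nat \<Rightarrow> ('a \<Rightarrow> 'k) \<Rightarrow> 'i \<Rightarrow> 'k" where
  "restr n \<alpha> y = (if y \<in> Yd n then \<alpha> (e y) else 0)"

lemma restr_y: "y \<in> Yd n \<Longrightarrow> restr n \<alpha> y = \<alpha> (e y)" by (simp add: restr_def)

lemma hom_restr: "L.hom n (restr n \<alpha>)" by (auto simp: L.hom_def restr_def)

lemma dual_power_props:
  assumes \<alpha>: "\<alpha> \<in> dual_space (P n)"
  shows "dual_power G n \<alpha> m \<in> dual_space (P (m * n)) \<and>
    (\<forall>x\<in>Yd (m * n). dual_power G n \<alpha> m (e x) = L.pw (restr n \<alpha>) m x)"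
proof (induction m)
  case 0
  have "lin_map (P 0) ground (counit G)" using gc by (simp add: graded_coalgebra_def)
  moreover have "counit G (e x) = dlt one x" if "x \<in> Yd 0" for x
    using that one_unique[of x] dual_basisD(5)[OF db, of one 0 one] one_Y a_one by simp
  ultimately show ?case by (simp add: dual_space_def)
next
  case (Suc m)
  let ?\<beta> = "\<lambda>(x, y). \<alpha> x * dual_power G n \<alpha> m y"
  have \<beta>: "?\<beta> \<in> bilin_forms (P n) (P (m * n))"
    using \<alpha> Suc by (intro bilin_forms_prod) auto
  have lin: "lin_map (P (n + m * n)) (tensor_space (P n) (P (m * n))) (comult G n (m * n))"
    by (rule comult_lin)
  have "dual_power G n \<alpha> (Suc m) \<in> dual_space (P (Suc m * n))"
    using lin by (auto simp: dual_space_iff lin_map_def fscale_def)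
  moreover have "dual_power G n \<alpha> (Suc m) (e x) = L.pw (restr n \<alpha>) (Suc m) x" if x: "x \<in> Yd (Suc m * n)" for x
  proof -
    have xd: "x \<in> Y" "deg x = n + m * n" using x by auto
    let ?A = "{y\<in>Y. deg y \<le> deg x}"
    have "dual_power G n \<alpha> (Suc m) (e x) = (\<Sum>y\<in>Yd n. \<Sum>z\<in>Yd (m * n). sc x y z * (\<alpha> (e y) * dual_power G n \<alpha> m (e z)))"
      using comult_form[OF xd \<beta>] by simp
    also have "\<dots> = (\<Sum>y\<in>Yd n. \<Sum>z\<in>Yd (m * n). sc x y z * (restr n \<alpha> y * L.pw (restr n \<alpha>) m z))"
    proof (intro sum.cong HOL.refl)
      fix y z assume "y \<in> Yd n" "z \<in> Yd (m * n)"
      then show "sc x y z * (\<alpha> (e y) * dual_power G n \<alpha> m (e z)) =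
          sc x y z * (restr n \<alpha> y * L.pw (restr n \<alpha>) m z)"
        using Suc restr_y[of y n \<alpha>] by simp
    qed
    also have "\<dots> = (\<Sum>y\<in>Yd n. \<Sum>z\<in>?A. sc x y z * (restr n \<alpha> y * L.pw (restr n \<alpha>) m z))"
      using xd finY by (intro sum.cong HOL.refl sum.mono_neutral_left) (auto simp: struct_def)
    also have "\<dots> = (\<Sum>y\<in>?A. \<Sum>z\<in>?A. sc x y z * (restr n \<alpha> y * L.pw (restr n \<alpha>) m z))"
      using xd finY by (intro sum.mono_neutral_left) (auto simp: restr_def)
    also have "\<dots> = L.pw (restr n \<alpha>) (Suc m) x"
      using xd by (simp add: L.conv_def struct_cop_def)
    finally show ?thesis .
  qed
  ultimately show ?case by blast
qed

lemma dual_power_expand: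
  assumes \<alpha>: "\<alpha> \<in> dual_space (P n)" and c: "c \<in> cpart G (p * n)"
  shows "dual_power G n \<alpha> p c = (\<Sum>x\<in>Yd (p * n). a x c * L.pw (restr n \<alpha>) p x)"
  using dual_basis_functional[OF db _ c, of "dual_power G n \<alpha> p"] dual_power_props[OF \<alpha>, of p] by simp

lemma restr_expand: "restr n \<alpha> = (\<Sum>y\<in>Yd n. fscale (\<alpha> (e y)) (dlt y))"
proof -
  have "restr n \<alpha> = (\<Sum>y\<in>Yd n. fscale (restr n \<alpha> y) (dlt y))"
    by (rule L.hom_eq_sum[OF hom_restr])
  also have "\<dots> = (\<Sum>y\<in>Yd n. fscale (\<alpha> (e y)) (dlt y))"
    by (rule sum.cong) (auto simp: restr_def)
  finally show ?thesis .
qed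

lemma pth_power_inj:
  fixes x y :: 'k
  assumes "x ^ p = y ^ p" shows "x = y"
proof -
  have "(x - y + y) ^ p = (x - y) ^ p + y ^ p"
    using prime_p CHAR_p by (intro freshmans_dream) auto
  then have "(x - y) ^ p = 0" using assms by simp
  then show ?thesis by simp
qed

lemma pth_root: "pth_root p x ^ p = (x::'k)"
proof -
  have "\<exists>!y. y ^ p = x" using perfect_p[of x] pth_power_inj by metis
  then show ?thesis unfolding pth_root_def by (rule theI')
qed

lemma sum_pth_power: "(\<Sum>i\<in>I. f i) ^ p = (\<Sum>i\<in>I. f i ^ p :: 'k)"
  using prime_p CHAR_p A.p_pos
  by (induction I rule: infinite_finite_induct) (simp_all add: freshmans_dream)

lemma restr_a: "y \<in> Yd n \<Longrightarrow> restr n (a y) = dlt y"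
  using dual_basisD(5)[OF db, of y n] by (auto simp: restr_def dlt_def fun_eq_iff)

text \<open>The condition for the coordinate functionals fixes \<open>v\<close> through
  \<open>p\<close>-th roots. It extends to all \<alpha> because both sides are additive and
  Frobenius-semilinear in \<alpha>, which uses that \<open>n\<close> is good.\<close>

lemma V_exists:
  assumes n: "good p n" and c: "c \<in> cpart G (p * n)"
  shows "\<exists>!v. v \<in> cpart G n \<and> (\<forall>\<alpha>\<in>dual_space (P n). \<alpha> v ^ p = dual_power G n \<alpha> p c)"
proof
  define r where "r y = pth_root p (dual_power G n (a y) p c)" for y
  define v where "v = (\<Sum>y\<in>Yd n. smul (P n) (r y) (e y))"
  note cl = vs_closed[OF dual_basisD(1)[OF db[of n]]]
  have ein: "e y \<in> cpart G n" if "y \<in> Yd n" for y using e_in[of y] that by simp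
  have "v \<in> cpart G n" unfolding v_def using ein by (intro cl(3,4)) auto
  moreover have "\<alpha> v ^ p = dual_power G n \<alpha> p c" if \<alpha>: "\<alpha> \<in> dual_space (P n)" for \<alpha>
  proof -
    have "\<alpha> v = (\<Sum>y\<in>Yd n. r y * \<alpha> (e y))"
      unfolding v_def using ein by (intro dual_sum[OF dual_basisD(1)[OF db] \<alpha>])
    then have "\<alpha> v ^ p = (\<Sum>y\<in>Yd n. dual_power G n (a y) p c * \<alpha> (e y) ^ p)"
      by (simp add: sum_pth_power power_mult_distrib r_def pth_root)
    also have "\<dots> = (\<Sum>y\<in>Yd n. (\<Sum>x\<in>Yd (p * n). a x c * L.pw (dlt y) p x) * \<alpha> (e y) ^ p)"
    proof (rule sum.cong[OF HOL.refl])
      fix y assume y: "y \<in> Yd n"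
      then show "dual_power G n (a y) p c * \<alpha> (e y) ^ p = (\<Sum>x\<in>Yd (p * n). a x c * L.pw (dlt y) p x) * \<alpha> (e y) ^ p"
        using dual_power_expand[of "a y" n c] a_in[of y] c restr_a[OF y] by simp
    qed
    also have "\<dots> = (\<Sum>x\<in>Yd (p * n). a x c * (\<Sum>y\<in>Yd n. \<alpha> (e y) ^ p * L.pw (dlt y) p x))"
      unfolding sum_distrib_right sum_distrib_left by (subst sum.swap) (simp only: mult_ac)
    also have "\<dots> = (\<Sum>x\<in>Yd (p * n). a x c * L.pw (restr n \<alpha>) p x)"
    proof -
      have "L.pw (restr n \<alpha>) p = (\<Sum>y\<in>Yd n. fscale (\<alpha> (e y) ^ p) (L.pw (dlt y) p))"
        unfolding restr_expand using n L.hom_dlt by (intro A.Frobenius_sum) auto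
      then show ?thesis by (simp add: sum_fun_app fscale_def)
    qed
    finally show ?thesis using dual_power_expand[OF \<alpha> c] by simp
  qed
  ultimately show v: "v \<in> cpart G n \<and> (\<forall>\<alpha>\<in>dual_space (P n). \<alpha> v ^ p = dual_power G n \<alpha> p c)" by blast
  fix v' assume v': "v' \<in> cpart G n \<and> (\<forall>\<alpha>\<in>dual_space (P n). \<alpha> v' ^ p = dual_power G n \<alpha> p c)"
  have "a y v' = a y v" if "y \<in> Yd n" for y
  proof -
    have "a y \<in> dual_space (P n)" using a_in that by auto
    then have "a y v' ^ p = a y v ^ p" using v v' by simp
    then show ?thesis by (rule pth_power_inj)
  qed
  then show "v' = v"
    using dual_basisD(6)[OF db, of v' n] dual_basisD(6)[OF db, of v n] v v' by (metis (no_types, lifting) sum.cong)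
qed

lemma V_spec:
  assumes "good p n" "c \<in> cpart G (p * n)"
  shows "verschiebung G p n c \<in> cpart G n"
    "\<alpha> \<in> dual_space (P n) \<Longrightarrow> \<alpha> (verschiebung G p n c) ^ p = dual_power G n \<alpha> p c"
  using theI'[OF V_exists[OF assms]] unfolding verschiebung_def by blast+

lemma V_unique:
  assumes "good p n" "c \<in> cpart G (p * n)" "v \<in> cpart G n"
    "\<And>\<alpha>. \<alpha> \<in> dual_space (P n) \<Longrightarrow> \<alpha> v ^ p = dual_power G n \<alpha> p c"
  shows "verschiebung G p n c = v"
  using the1_equality[OF V_exists[OF assms(1,2)]] assms(3,4) unfolding verschiebung_def by blast

end

text \<open>\<open>e0\<close> is the element of counit \<open>1\<close>. Index and functions are
  left open because the result is used both for elements indexing themselves and for a prescribed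
  index.\<close>

lemma counit_dual_basis:
  fixes G :: "('k::field, 'a::ab_group_add) gcoalg"
  assumes G: "graded_coalgebra G" "connected_coalgebra G"
  shows "\<exists>e0. \<forall>(i::'i) e a. e i = e0 \<longrightarrow> a i = counit G \<longrightarrow> dual_basis (part G 0) {i} e a"
proof -
  have vs0: "vs (part G 0)" using G(1) by (intro vs_fin_dim) (simp add: graded_coalgebra_def)
  have iso: "lin_map (part G 0) ground (counit G)" "bij_betw (counit G) (cpart G 0) UNIV"
    using G(2) by (auto simp: connected_coalgebra_def lin_iso_def)
  then obtain e0 where e0: "e0 \<in> cpart G 0" "counit G e0 = 1" by (metis UNIV_I bij_betw_def imageE)
  have "x = smul (part G 0) (counit G x) e0" if "x \<in> cpart G 0" for x
  proof (rule inj_onD[OF bij_betw_imp_inj_on[OF iso(2)]])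
    show "counit G x = counit G (smul (part G 0) (counit G x) e0)" using iso(1) e0 by (simp add: lin_map_def)
    show "smul (part G 0) (counit G x) e0 \<in> cpart G 0" using e0 by (intro vs_closed(3)[OF vs0])
  qed (use that in simp)
  then show ?thesis using vs0 e0 iso(1) by (intro exI[of _ e0]) (auto simp: dual_basis_def dual_space_def)
qed

lemma exists_coalg_basis:
  fixes G :: "('k::field, 'a::ab_group_add) gcoalg"
  assumes G: "graded_coalgebra G" "cocommutative G" "connected_coalgebra G"
  shows "\<exists>(Y :: (nat \<times> 'a) set) a one. coalg_basis G Y fst snd a one"
proof -
  have fd: "fin_dim_space (part G n)" for n using G(1) by (simp add: graded_coalgebra_def)
  then have "\<forall>n. \<exists>Ba. dual_basis (part G n) (fst Ba) id (snd Ba)" using dual_basis_exists by fastforce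
  from choice[OF this] obtain Ba where Ba: "\<And>n. dual_basis (part G n) (fst (Ba n)) id (snd (Ba n))" by blast
  obtain e0 where "\<forall>(i::'a) e a. e i = e0 \<longrightarrow> a i = counit G \<longrightarrow> dual_basis (part G 0) {i} e a"
    using counit_dual_basis[OF G(1,3)] ..
  then have db0: "dual_basis (part G 0) {e0} id (\<lambda>_. counit G)" by simp
  define B where "B n = (if n = 0 then {e0} else fst (Ba n))" for n
  define a where "a y = (if fst y = 0 then counit G else snd (Ba (fst y)) (snd y))" for y :: "nat \<times> 'a"
  \<comment> \<open>The parts of different degree may overlap in the ambient type; the tag keeps
    their basis elements apart.\<close>
  define Y where "Y = {(n, b). b \<in> B n}"
  have Yn: "{y\<in>Y. fst y = n} = Pair n ` B n" for n by (auto simp: Y_def)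
  have db: "dual_basis (part G n) (B n) id (\<lambda>b. a (n, b))" for n
    using Ba[of n] db0 by (cases "n = 0") (auto simp: B_def a_def cong: dual_basis_def)
  have "dual_basis (part G n) {y\<in>Y. fst y = n} snd a" for n
    using db[of n] unfolding Yn dual_basis_def by (auto simp: sum.reindex inj_on_def o_def)
  then have "coalg_basis G Y fst snd a (0, e0)"
    using G by unfold_locales (auto simp: Y_def B_def a_def)
  then show ?thesis by blast
qed

context perfect_coalg
begin

text \<open>The new indices are pairs of a degree and a member \<open>f\<close> of the adapted
  family. \<open>a'\<close> realises \<open>f\<close> as a functional on the coalgebra, with the
  counit in degree \<open>0\<close>, and \<open>e'\<close> is the dual basis.\<close>

theorem adapted_exists:
  "\<exists>(Y' :: (nat \<times> ('i \<Rightarrow> 'k)) set) e' a' one' F'.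
     coalg_basis G Y' fst e' a' one' \<and> adapted Y' fst (struct_cop G Y' fst e' a') one' p F'"
proof -
  obtain B where "\<forall>n>0. (A.strong n (B n) \<and> (\<forall>f. L.hom n f \<longrightarrow> f \<in> fs.span (B n))) \<and> A.Fr n ` B n - {0} \<subseteq> B (p * n)"
    using A.adapted_family ..
  then have B: "\<And>n. n > 0 \<Longrightarrow> A.strong n (B n)" "\<And>n f. n > 0 \<Longrightarrow> L.hom n f \<Longrightarrow> f \<in> fs.span (B n)"
    "\<And>n. n > 0 \<Longrightarrow> A.Fr n ` B n - {0} \<subseteq> B (p * n)"
    by simp_all
  have Bhom: "L.hom n f" if "n > 0" "f \<in> B n" for n f using A.strongD(3)[OF B(1)] that by blast
  define one' where "one' = (0 :: nat, dlt one :: 'i \<Rightarrow> 'k)"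
  define Y' where "Y' = insert one' {(n, f). n > 0 \<and> f \<in> B n}"
  define a' where "a' x = (if fst x = 0 then counit G else (\<lambda>c. \<Sum>y\<in>Yd (fst x). snd x y * a y c))" for x :: "nat \<times> ('i \<Rightarrow> 'k)"
  define F' where "F' x = (if fst x > 0 \<and> snd x \<in> B (fst x) \<and> good p (fst x) \<and> A.Fr (fst x) (snd x) \<noteq> 0
     then Some (p * fst x, A.Fr (fst x) (snd x)) else None)" for x
  have Y'0: "{x\<in>Y'. fst x = 0} = {one'}" by (auto simp: Y'_def one'_def)
  have Y'n: "{x\<in>Y'. fst x = n} = Pair n ` B n" if "n > 0" for n using that by (auto simp: Y'_def one'_def)
  have a'_in: "a' x \<in> dual_space (P (fst x))" if "x \<in> Y'" "fst x > 0" for x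
  proof -
    have "a y \<in> dual_space (P (fst x))" if "y \<in> Yd (fst x)" for y using a_in[of y] that by simp
    then show ?thesis using that(2)
      by (auto simp: a'_def dual_space_iff distrib_left sum.distrib sum_distrib_left mult.left_commute)
  qed
  have a'_e: "a' (n, f) (e z) = f z" if "n > 0" "z \<in> Yd n" for n f z
  proof -
    have "a' (n, f) (e z) = (\<Sum>y\<in>Yd n. f y * a y (e z))" using that by (simp add: a'_def)
    also have "\<dots> = (\<Sum>y\<in>Yd n. if y = z then f z else 0)"
    proof (rule sum.cong[OF HOL.refl])
      fix y assume y: "y \<in> Yd n"
      show "f y * a y (e z) = (if y = z then f z else 0)"
        unfolding dual_basisD(5)[OF db y that(2)] by simp
    qed
    finally show ?thesis using that dual_basisD(2)[OF db] by simp
  qed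
  have "\<exists>e'. dual_basis (P n) {x\<in>Y'. fst x = n} e' a'" for n
  proof (cases "n = 0")
    case True
    have Yd0: "Yd 0 = {one}"
    proof (intro equalityI subsetI)
      show "y \<in> {one}" if "y \<in> Yd 0" for y using that one_unique[of y] by simp
      show "y \<in> Yd 0" if "y \<in> {one}" for y using that one_Y by simp
    qed
    have "dual_basis (P 0) {one'} (\<lambda>_. e one) a'"
      using db[of 0] unfolding Yd0 dual_basis_def by (auto simp: a'_def a_one one'_def)
    then show ?thesis using True Y'0 by auto
  next
    case False
    then have n: "n > 0" by simp
    show ?thesis
    proof (rule dual_basis_of_functionals[OF db])
      show "finite {x\<in>Y'. fst x = n}" unfolding Y'n[OF n] using A.strongD(1)[OF B(1)[OF n]] by simp
      show "a' x \<in> dual_space (P n)" if "x \<in> {x\<in>Y'. fst x = n}" for x using a'_in[of x] that n by auto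
    next
      fix y assume y: "y \<in> Yd n"
      have "dlt y \<in> fs.span (B n)" using L.hom_dlt[of y] y by (intro B(2)[OF n]) auto
      then obtain k where k: "dlt y = (\<Sum>f\<in>B n. fscale (k f) f)"
        unfolding fs.span_finite[OF A.strongD(1)[OF B(1)[OF n]]] by auto
      have "a y x = (\<Sum>i\<in>{x\<in>Y'. fst x = n}. k (snd i) * a' i x)" for x
      proof -
        have "a y x = (\<Sum>z\<in>Yd n. a z x * dlt y z)"
          using y dual_basisD(2)[OF db] by (simp add: dlt_def if_distrib if_distribR cong: if_cong)
        also have "\<dots> = (\<Sum>z\<in>Yd n. \<Sum>f\<in>B n. k f * (f z * a z x))"
          unfolding k by (simp add: sum_fun_app fscale_def sum_distrib_left mult_ac)
        also have "\<dots> = (\<Sum>f\<in>B n. k f * (\<Sum>z\<in>Yd n. f z * a z x))"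
          by (subst sum.swap) (simp add: sum_distrib_left)
        also have "\<dots> = (\<Sum>i\<in>{x\<in>Y'. fst x = n}. k (snd i) * a' i x)"
          unfolding Y'n[OF n] using n by (simp add: sum.reindex inj_on_def a'_def)
        finally show ?thesis .
      qed
      then show "\<exists>c. \<forall>x\<in>cpart G n. a y x = (\<Sum>i\<in>{x\<in>Y'. fst x = n}. c i * a' i x)"
        by (intro exI[of _ "\<lambda>i. k (snd i)"] ballI)
    next
      fix c assume c: "\<And>x. x \<in> cpart G n \<Longrightarrow> (\<Sum>i\<in>{x\<in>Y'. fst x = n}. c i * a' i x) = 0"
      have "(\<Sum>f\<in>B n. fscale (c (n, f)) f) = 0"
      proof
        fix z
        show "(\<Sum>f\<in>B n. fscale (c (n, f)) f) z = 0 z"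
        proof (cases "z \<in> Yd n")
          case True
          then have "(\<Sum>i\<in>Pair n ` B n. c i * a' i (e z)) = 0" using c[of "e z"] e_in[of z] Y'n[OF n] by auto
          then show ?thesis using a'_e[OF n True] by (simp add: sum.reindex inj_on_def sum_fun_app fscale_def)
        next
          case False
          then have "f z = 0" if "f \<in> B n" for f using Bhom[OF n that] by (auto simp: L.hom_def)
          then show ?thesis by (simp add: sum_fun_app fscale_def sum.neutral)
        qed
      qed
      then have "c (n, f) = 0" if "f \<in> B n" for f
        using A.strongD(4)[OF B(1)[OF n], of 0 "\<lambda>f. c (n, f)" f] A.strongD(2)[OF B(1)[OF n]] that by auto
      then show "\<forall>i\<in>{x\<in>Y'. fst x = n}. c i = 0" unfolding Y'n[OF n] by auto
    qed
  qed
  then have "\<forall>n. \<exists>e'. dual_basis (P n) {x\<in>Y'. fst x = n} e' a'" by blast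
  from choice[OF this] obtain en where en: "\<And>n. dual_basis (P n) {x\<in>Y'. fst x = n} (en n) a'" by blast
  define e' where "e' x = en (fst x) x" for x
  have db': "dual_basis (P n) {x\<in>Y'. fst x = n} e' a'" for n
    using en[of n] unfolding dual_basis_def by (auto simp: e'_def)
  interpret N: perfect_coalg G Y' fst e' a' one' p
  proof unfold_locales
    show "y = one'" if "y \<in> Y'" "fst y = 0" for y using Y'0 that by blast
  qed (use gc coc db' CHAR_p prime_p perfect_p in \<open>auto simp: Y'_def one'_def a'_def\<close>)
  have XI: "x \<in> N.L.X \<longleftrightarrow> fst x > 0 \<and> snd x \<in> B (fst x)" for x
    unfolding N.L.X_def by (cases x) (auto simp: Y'_def one'_def)
  have Fr_B: "A.Fr n f \<in> B (p * n)" if "n > 0" "f \<in> B n" "A.Fr n f \<noteq> 0" for n f using B(3)[OF that(1)] that by blast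
  have "adapted Y' fst (struct_cop G Y' fst e' a') one' p F'"
  proof unfold_locales
    fix x y assume "F' x = Some y"
    then have x: "fst x > 0" "snd x \<in> B (fst x)" "good p (fst x)" "A.Fr (fst x) (snd x) \<noteq> 0"
      "y = (p * fst x, A.Fr (fst x) (snd x))" by (auto simp: F'_def split: if_splits)
    then show "x \<in> N.L.X \<and> y \<in> N.L.X \<and> fst y = p * fst x \<and> good p (fst x)"
      using Fr_B[OF x(1,2,4)] A.p_gt_1 by (simp add: XI)
  next
    fix x y z assume "F' x = Some z" "F' y = Some z"
    then have *: "fst x > 0" "snd x \<in> B (fst x)" "A.Fr (fst x) (snd x) \<noteq> 0" "snd y \<in> B (fst y)"
      "p * fst x = p * fst y" "A.Fr (fst x) (snd x) = A.Fr (fst y) (snd y)"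
      by (auto simp: F'_def split: if_splits)
    then have "fst x = fst y" using A.p_gt_1 by simp
    then show "x = y" using A.strong_Fr_inj[OF B(1)[OF *(1)], of "snd x" "snd y"] * by (simp add: prod_eq_iff)
  next
    fix x assume x: "x \<in> N.L.X" and good: "good p (fst x)"
    obtain n f where nf: "x = (n, f)" by fastforce
    have n: "n > 0" "f \<in> B n" "good p n" using x good nf XI[of x] by auto
    have xY: "x \<in> Y'" using x by (simp add: N.L.X_def)
    have ax: "a' x \<in> dual_space (P n)" using a'_in[OF xY] n nf by simp
    have rN: "N.restr n (a' x) = dlt x" using xY nf by (intro N.restr_a) auto
    have rO: "restr n (a' x) = f"
    proof
      fix z
      show "restr n (a' x) z = f z"
        using a'_e[OF n(1), of z f] Bhom[OF n(1,2)] by (cases "z \<in> Yd n") (auto simp: nf restr_def L.hom_def)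
    qed
    have dp: "dual_power G n (a' x) p c = (\<Sum>z\<in>Yd (p * n). A.Fr n f z * a z c)" if "c \<in> cpart G (p * n)" for c
      using dual_power_expand[OF ax that] n(3) by (simp add: rO A.Fr_def mult.commute)
    have homN: "N.L.hom (p * n) (N.L.pw (dlt x) p)"
      using N.L.hom_pw[OF N.L.hom_dlt[OF xY], of p] nf by simp
    have on: "N.L.pw (dlt x) p y = odlt (F' x) y" if y: "y \<in> Y'" "fst y = p * n" for y
    proof -
      have ey: "e' y \<in> cpart G (p * n)" using N.e_in[OF y(1)] y(2) by simp
      \<comment> \<open>\<open>dual_power\<close> is defined without a basis and mediates between
        the old and the new coordinates.\<close>
      have "N.L.pw (dlt x) p y = dual_power G n (a' x) p (e' y)"
        using N.dual_power_props[OF ax, of p] rN y by (cases y) simp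
      also have "\<dots> = a' (p * n, A.Fr n f) (e' y)" unfolding dp[OF ey] using n(1) A.p_gt_1 by (simp add: a'_def)
      also have "\<dots> = odlt (F' x) y"
      proof (cases "A.Fr n f = 0")
        case True
        then show ?thesis using n(1) A.p_gt_1 by (simp add: a'_def F'_def nf)
      next
        case False
        then have "(p * n, A.Fr n f) \<in> Y'" using Fr_B[OF n(1,2)] n(1) A.p_gt_1 by (simp add: Y'_def)
        then show ?thesis using False n nf y dual_basisD(5)[OF db', of "(p * n, A.Fr n f)" "p * n" y]
          by (auto simp: F'_def dlt_def)
      qed
      finally show ?thesis .
    qed
    show "N.L.pw (dlt x) p = odlt (F' x)"
    proof
      fix y
      show "N.L.pw (dlt x) p y = odlt (F' x) y"
      proof (cases "y \<in> Y' \<and> fst y = p * n")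
        case True
        then show ?thesis using on by blast
      next
        case False
        then have "N.L.pw (dlt x) p y = 0" using homN unfolding N.L.hom_def by blast
        moreover have "odlt (F' x) y = (0::'k)"
          using False Fr_B[OF n(1,2)] n A.p_gt_1 by (auto simp: F'_def nf dlt_def Y'_def split: if_splits)
        ultimately show ?thesis by simp
      qed
    qed
  qed
  then show ?thesis using N.coalg_basis_axioms by blast
qed

end

section \<open>From V-modules to Hopf algebras\<close>

lemma lin_iso_inv:
  assumes "lin_iso V W h" "vs V" "y \<in> carr W"
  shows "inv_into (carr V) h y \<in> carr V" "h (inv_into (carr V) h y) = y"
  using assms by (auto simp: lin_iso_def bij_betw_def inv_into_into f_inv_into_f)

lemma dual_basis_transport:
  assumes db: "dual_basis W I e a" and iso: "lin_iso V W h" and V: "vs V"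
  shows "dual_basis V I (\<lambda>i. inv_into (carr V) h (e i)) (\<lambda>i x. a i (h x))"
proof -
  have h: "lin_map V W h" "inj_on h (carr V)" using iso by (auto simp: lin_iso_def bij_betw_def)
  have ei: "e i \<in> carr W" if "i \<in> I" for i using dual_basisD(3)[OF db that] .
  note inv = lin_iso_inv[OF iso V]
  have exp: "x = (\<Sum>i\<in>I. smul V (a i (h x)) (inv_into (carr V) h (e i)))" if x: "x \<in> carr V" for x
  proof (rule inj_onD[OF h(2)])
    have hx: "h x \<in> carr W" using h(1) x by (simp add: lin_map_def)
    have "h (\<Sum>i\<in>I. smul V (a i (h x)) (inv_into (carr V) h (e i))) =
        (\<Sum>i\<in>I. smul W (a i (h x)) (h (inv_into (carr V) h (e i))))"
      using inv(1) ei by (intro lin_map_sum[OF V dual_basisD(1)[OF db] h(1)]) auto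
    also have "\<dots> = (\<Sum>i\<in>I. smul W (a i (h x)) (e i))" using inv(2) ei by simp
    finally show "h x = h (\<Sum>i\<in>I. smul V (a i (h x)) (inv_into (carr V) h (e i)))"
      using dual_basisD(6)[OF db hx] by simp
    show "(\<Sum>i\<in>I. smul V (a i (h x)) (inv_into (carr V) h (e i))) \<in> carr V"
      using inv(1) ei by (intro vs_closed(3,4)[OF V]) auto
  qed (rule x)
  have "(\<lambda>x. a i (h x)) \<in> dual_space V" if "i \<in> I" for i
    using dual_basisD(4)[OF db that] h(1) by (auto simp: dual_space_iff lin_map_def)
  then show ?thesis using V dual_basisD(2)[OF db] inv ei dual_basisD(5)[OF db] exp
    by (auto simp: dual_basis_def)
qed

locale hopf_lift =
  BC: coalg_basis C Y deg e' a' one + BD: coalg_basis D Y deg e a one +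
  lifting Y deg "struct_cop D Y deg e a" one p F N "struct_cop C Y deg e' a'" \<phi>
  for C :: "('k::field, 'c::ab_group_add) gcoalg" and D :: "('k, 'd::ab_group_add) gcoalg"
    and Y :: "'i set" and deg and e' a' e a and one and p and F and N and \<phi>
begin

abbreviation "WW \<equiv> Wn BD.L.X deg"
abbreviation "wdg \<equiv> wdeg deg"

text \<open>The multiplicative extension of \<phi>, written with the word bases of
  \<open>J C\<close> and \<open>J D\<close>.\<close>

definition f :: "nat \<Rightarrow> ('k, 'c) tensor_alg \<Rightarrow> ('k, 'd) tensor_alg" where
  "f n t = (\<Sum>w\<in>WW n. \<Sum>u\<in>WW n. fscale (BC.Ec w t * pl w (dlt u)) (BD.E u))"

lemma WW_D: "w \<in> WW n \<Longrightarrow> w \<in> lists BD.L.X \<and> wdg w = n" by (simp add: Wn_def)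

lemma pl_exp: "w \<in> WW n \<Longrightarrow> pl w g = (\<Sum>u\<in>WW n. pl w (dlt u) * g u)"
  using BD.L.pull_expand[of \<phi> w g] WW_D[of w n] by simp

lemma f_in: "f n t \<in> carr (J_part D n)"
proof -
  have "fscale k (BD.E u) \<in> carr (J_part D n)" if "u \<in> WW n" for k u
    using vs_closed(3)[OF vs_J_part, of "BD.E u" D n k] BD.E_in[of u] WW_D[OF that] by simp
  then show ?thesis unfolding f_def by (intro vs_closed(4)[OF vs_J_part]) auto
qed

lemma f_lin: "f n (s + t) = f n s + f n t" "f n (fscale k t) = fscale k (f n t)"
  unfolding f_def BC.Ec_lin
  by (auto simp: fun_eq_iff sum_fun_app fscale_def distrib_right distrib_left sum.distrib sum_distrib_left mult_ac)

lemma lin_map_f: "lin_map (J_part C n) (J_part D n) (f n)"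
  by (simp add: lin_map_def f_in f_lin)

lemma f_E:
  assumes "w \<in> WW n"
  shows "f n (BC.E w) = (\<Sum>u\<in>WW n. fscale (pl w (dlt u)) (BD.E u))"
proof -
  have "f n (BC.E w) = (\<Sum>w'\<in>WW n. if w' = w then \<Sum>u\<in>WW n. fscale (pl w (dlt u)) (BD.E u) else 0)"
    unfolding f_def using WW_D[OF assms]
    by (intro sum.cong) (auto simp: BC.Ec_E dlt_def simp del: zero_fun_apply)
  then show ?thesis using assms by (simp del: zero_fun_apply)
qed

lemma f_E_apply:
  assumes "w \<in> WW n" shows "f n (BC.E w) \<beta> = pl w (\<lambda>u. BD.E u \<beta>)"
  using BD.L.pull_expand[of \<phi> w "\<lambda>u. BD.E u \<beta>"] WW_D[OF assms] by (simp add: f_E[OF assms] sum_fun_app fscale_def)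

lemma f_expand:
  assumes "t \<in> carr (J_part C n)"
  shows "f n t = (\<Sum>w\<in>WW n. fscale (BC.Ec w t) (f n (BC.E w)))"
  using dual_basis_lin_map[OF BC.J_dual_basis vs_J_part lin_map_f assms] by (simp add: Wn_def)

lemma Ec_f: "u \<in> WW n \<Longrightarrow> BD.Ec u (f n t) = (\<Sum>w\<in>WW n. BC.Ec w t * pl w (dlt u))"
proof -
  assume u: "u \<in> WW n"
  have "BD.Ec u (f n t) = (\<Sum>w\<in>WW n. \<Sum>v\<in>WW n. BC.Ec w t * pl w (dlt v) * BD.Ec u (BD.E v))"
    by (simp add: f_def BD.Ec_def sum_fun_app fscale_def)
  also have "\<dots> = (\<Sum>w\<in>WW n. \<Sum>v\<in>WW n. if v = u then BC.Ec w t * pl w (dlt u) else 0)"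
  proof (intro sum.cong HOL.refl)
    fix w v assume "v \<in> WW n"
    then show "BC.Ec w t * pl w (dlt v) * BD.Ec u (BD.E v) = (if v = u then BC.Ec w t * pl w (dlt u) else 0)"
      using BD.Ec_E[of v u] WW_D[of v n] by (auto simp: dlt_def)
  qed
  finally show ?thesis using u by simp
qed

lemma pl_dlt:
  assumes "w \<in> lists BD.L.X" "length u \<le> length w" shows "pl w (dlt u) = dlt u w"
  using assms by (intro pull_triangular) (auto simp: dlt_def)

text \<open>The coefficient of a shortest word in the support of \<open>t\<close> survives: other
  words of the support are at least as long, and by triangularity their images do not contain
  it.\<close>

lemma f_inj:
  assumes t: "t \<in> carr (J_part C n)" and f0: "f n t = 0"
  shows "t = 0"
proof (rule ccontr)
  assume "t \<noteq> 0"
  have exp: "t = (\<Sum>w\<in>WW n. fscale (BC.Ec w t) (BC.E w))"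
    using dual_basisD(6)[OF BC.J_dual_basis t] by (simp add: Wn_def)
  define W1 where "W1 = {w\<in>WW n. BC.Ec w t \<noteq> 0}"
  have "W1 \<noteq> {}"
  proof
    assume "W1 = {}"
    then have "(\<Sum>w\<in>WW n. fscale (BC.Ec w t) (BC.E w)) = 0"
      by (intro sum.neutral) (auto simp: W1_def simp del: zero_fun_apply)
    then show False using exp \<open>t \<noteq> 0\<close> by simp
  qed
  then obtain w where w: "w \<in> W1" "\<And>w'. w' \<in> W1 \<Longrightarrow> length w \<le> length w'"
    using ex_has_least_nat[of "\<lambda>w. w \<in> W1" _ length] by blast
  then have wW: "w \<in> WW n" by (simp add: W1_def)
  have "BD.Ec w (f n t) = (\<Sum>w'\<in>WW n. if w' = w then BC.Ec w t else 0)"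
    unfolding Ec_f[OF wW]
  proof (rule sum.cong[OF HOL.refl])
    fix w' assume w': "w' \<in> WW n"
    show "BC.Ec w' t * pl w' (dlt w) = (if w' = w then BC.Ec w t else 0)"
    proof (cases "BC.Ec w' t = 0")
      case False
      then have "length w \<le> length w'" using w' w(2) by (simp add: W1_def)
      then show ?thesis using pl_dlt[of w' w] WW_D[OF w'] by (auto simp: dlt_def)
    qed auto
  qed
  also have "\<dots> = BC.Ec w t" using wW by simp
  finally show False using f0 w(1) by (simp add: W1_def BD.Ec_def)
qed

text \<open>Downward induction on the length, which is bounded by the degree: the basis element of
  \<open>u\<close> is its own image up to longer words, which are already reached.\<close>

lemma f_surj:
  assumes "t' \<in> carr (J_part D n)" shows "t' \<in> f n ` carr (J_part C n)"
proof -
  let ?R = "f n ` carr (J_part C n)"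
  note cl = vs_closed[OF vs_J_part, unfolded smul_J_part]
  have R_add: "x + y \<in> ?R" if xy: "x \<in> ?R" "y \<in> ?R" for x y
  proof -
    obtain s t where "s \<in> carr (J_part C n)" "t \<in> carr (J_part C n)" "x = f n s" "y = f n t" using xy by auto
    then have "x + y = f n (s + t)" "s + t \<in> carr (J_part C n)" using f_lin(1) cl(2) by auto
    then show ?thesis by blast
  qed
  have R_scale: "fscale k x \<in> ?R" if x: "x \<in> ?R" for k x
  proof -
    obtain s where "s \<in> carr (J_part C n)" "x = f n s" using x by auto
    then have "fscale k x = f n (fscale k s)" "fscale k s \<in> carr (J_part C n)" using f_lin(2) cl(3) by auto
    then show ?thesis by blast
  qed
  have R_0: "0 \<in> ?R"
  proof -
    have "f n 0 = 0" by (simp add: f_def BC.Ec_def)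
    then show ?thesis using cl(1) by (metis imageI)
  qed
  have R_sum: "(\<Sum>i\<in>I. g i) \<in> ?R" if "finite I" "\<And>i. i \<in> I \<Longrightarrow> g i \<in> ?R" for I :: "'i list set" and g
    using that
  proof (induction I rule: finite_induct)
    case (insert x I)
    show ?case unfolding sum.insert[OF insert(1,2)] using insert by (intro R_add) auto
  qed (use R_0 in simp)
  have E_R: "BD.E u \<in> ?R" if "u \<in> WW n" for u
    using that
  proof (induction "n - length u" arbitrary: u rule: less_induct)
    case (less u)
    have len: "length v \<le> n" if "v \<in> WW n" for v using BD.L.length_le_wdeg[of v] WW_D[OF that] by simp
    have "f n (BC.E u) = fscale (pl u (dlt u)) (BD.E u) + (\<Sum>v\<in>WW n - {u}. fscale (pl u (dlt v)) (BD.E v))"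
      unfolding f_E[OF less.prems] by (rule sum.remove[OF BD.L.finite_WX less.prems])
    also have "pl u (dlt u) = 1" using pl_dlt[of u u] WW_D[OF less.prems] by simp
    finally have 1: "BD.E u = f n (BC.E u) + fscale (- 1) (\<Sum>v\<in>WW n - {u}. fscale (pl u (dlt v)) (BD.E v))"
      by (simp add: fun_eq_iff fscale_def)
    have 2: "f n (BC.E u) \<in> ?R" using BC.E_in[of u] WW_D[OF less.prems] by blast
    have 3: "fscale (- 1) (\<Sum>v\<in>WW n - {u}. fscale (pl u (dlt v)) (BD.E v)) \<in> ?R"
    proof (rule R_scale, rule R_sum)
      fix v assume v: "v \<in> WW n - {u}"
      show "fscale (pl u (dlt v)) (BD.E v) \<in> ?R"
      proof (cases "length v \<le> length u")
        case True
        then have "pl u (dlt v) = 0" using pl_dlt[of u v] WW_D[OF less.prems] v by auto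
        then show ?thesis using R_0 by simp
      next
        case False
        then have "BD.E v \<in> ?R" using v len[of v] by (intro less.hyps) auto
        then show ?thesis by (rule R_scale)
      qed
    qed simp
    show ?case by (subst 1) (rule R_add[OF 2 3])
  qed
  have "t' = (\<Sum>u\<in>WW n. fscale (BD.Ec u t') (BD.E u))"
    using dual_basisD(6)[OF BD.J_dual_basis assms] by (simp add: Wn_def)
  also have "\<dots> \<in> ?R" by (rule R_sum) (auto intro!: R_scale E_R)
  finally show ?thesis .
qed

lemma f_iso: "lin_iso (J_part C n) (J_part D n) (f n)"
proof -
  have "inj_on (f n) (carr (J_part C n))"
  proof (rule inj_onI)
    fix s t assume st: "s \<in> carr (J_part C n)" "t \<in> carr (J_part C n)" "f n s = f n t"
    note cl = vs_closed[OF vs_J_part, unfolded smul_J_part]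
    have "f n (s + fscale (- 1) t) = 0" unfolding f_lin st(3) by (simp add: fscale_def fun_eq_iff)
    moreover have "s + fscale (- 1) t \<in> carr (J_part C n)" using st by (intro cl(2,3))
    ultimately have "s + fscale (- 1) t = 0" by (intro f_inj)
    then show "s = t" by (simp add: fscale_def fun_eq_iff)
  qed
  moreover have "f n ` carr (J_part C n) = carr (J_part D n)" using f_in f_surj by blast
  ultimately show ?thesis using lin_map_f by (simp add: lin_iso_def bij_betw_def)
qed

text \<open>By linearity it suffices to treat basis words, where \<open>J_comult\<close> is
  \<open>wcop\<close> on the matrix of the form and \<open>pull_comult\<close> applies.\<close>

lemma f_comult:
  assumes t: "t \<in> carr (J_part C (i + j))"
  shows "J_comult D i j (f (i + j) t) = tensor_map (J_part D i) (J_part D j) (f i) (f j) (J_comult C i j t)"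
proof
  fix \<beta>
  show "J_comult D i j (f (i + j) t) \<beta> = tensor_map (J_part D i) (J_part D j) (f i) (f j) (J_comult C i j t) \<beta>"
  proof (cases "\<beta> \<in> bilin_forms (J_part D i) (J_part D j)")
    case \<beta>: True
    let ?\<gamma> = "\<lambda>(x, y). \<beta> (f i x, f j y)"
    have \<gamma>: "?\<gamma> \<in> bilin_forms (J_part C i) (J_part C j)" by (rule BC.bilin_compose[OF \<beta> lin_map_f lin_map_f])
    have comult_sum: "J_comult G i j (\<Sum>w\<in>W. fscale (k w) (g w)) = (\<Sum>w\<in>W. fscale (k w) (J_comult G i j (g w)))"
      for G :: "('k, 'g::ab_group_add) gcoalg" and W :: "'i list set" and k g
      by (auto simp: fun_eq_iff J_comult_def sum_fun_app fscale_def)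
    have wd: "BD.L.wc u (BD.bform i j \<beta>) = J_comult D i j (BD.E u) \<beta>" if "u \<in> lists BD.L.X" for u
      using BD.J_comult_E[OF that, of i j \<beta>] \<beta> by simp
    have basis: "J_comult D i j (f (i + j) (BC.E w)) \<beta> = J_comult C i j (BC.E w) ?\<gamma>" if w: "w \<in> WW (i + j)" for w
    proof -
      have wX: "w \<in> lists BD.L.X" "wdg w = i + j" using WW_D[OF w] by auto
      have "J_comult D i j (f (i + j) (BC.E w)) \<beta> = (\<Sum>u\<in>WW (i + j). pl w (dlt u) * BD.L.wc u (BD.bform i j \<beta>))"
        unfolding f_E[OF w] comult_sum
        unfolding sum_fun_app fscale_def using WW_D wd by (intro sum.cong) auto
      also have "\<dots> = pl w (\<lambda>u. BD.L.wc u (BD.bform i j \<beta>))"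
        by (rule pl_exp[OF w, symmetric])
      also have "\<dots> = BC.L.wc w (\<lambda>a b. pl a (\<lambda>a'. pl b (\<lambda>b'. BD.bform i j \<beta> a' b')))"
        by (rule pull_comult[OF wX(1)])
      also have "\<dots> = BC.L.wc w (BC.bform i j ?\<gamma>)"
      proof (rule BC.L.W.cop_cong)
        fix a b assume ab: "a \<in> lists BD.L.X" "b \<in> lists BD.L.X"
        have "pl a (\<lambda>a'. pl b (\<lambda>b'. BD.bform i j \<beta> a' b')) =
            pl a (\<lambda>a'. pl b (\<lambda>b'. if wdg a = i \<and> wdg b = j then \<beta> (BD.E a', BD.E b') else 0))"
          by (intro pull_cong) (auto simp: BD.bform_def Wn_def)
        also have "\<dots> = BC.bform i j ?\<gamma> a b"
        proof (cases "wdg a = i \<and> wdg b = j")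
          case True
          then have W: "a \<in> WW i" "b \<in> WW j" using ab by (auto simp: Wn_def)
          have Ein: "BD.E u \<in> carr (J_part D n)" if "u \<in> WW n" for u n using BD.E_in[of u] WW_D[OF that] by simp
          have dfi: "\<And>y. y \<in> carr (J_part D j) \<Longrightarrow> (\<lambda>x. \<beta> (x, y)) \<in> dual_space (J_part D i)"
            and dfj: "\<And>x. x \<in> carr (J_part D i) \<Longrightarrow> (\<lambda>y. \<beta> (x, y)) \<in> dual_space (J_part D j)"
            using \<beta> by (auto simp: bilin_forms_def)
          have "?\<gamma> (BC.E a, BC.E b) = (\<Sum>u\<in>WW i. pl a (dlt u) * \<beta> (BD.E u, f j (BC.E b)))"
            using dual_sum[OF vs_J_part dfi[OF f_in], of "WW i" BD.E "\<lambda>u. pl a (dlt u)"] Ein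
            by (simp add: f_E[OF W(1)])
          also have "\<dots> = (\<Sum>u\<in>WW i. pl a (dlt u) * (\<Sum>v\<in>WW j. pl b (dlt v) * \<beta> (BD.E u, BD.E v)))"
          proof (rule sum.cong[OF HOL.refl])
            fix u assume u: "u \<in> WW i"
            show "pl a (dlt u) * \<beta> (BD.E u, f j (BC.E b)) = pl a (dlt u) * (\<Sum>v\<in>WW j. pl b (dlt v) * \<beta> (BD.E u, BD.E v))"
              using dual_sum[OF vs_J_part dfj[OF Ein[OF u]], of "WW j" BD.E "\<lambda>v. pl b (dlt v)"] Ein
              by (simp add: f_E[OF W(2)])
          qed
          also have "\<dots> = (\<Sum>u\<in>WW i. pl a (dlt u) * pl b (\<lambda>b'. \<beta> (BD.E u, BD.E b')))"
            by (intro sum.cong HOL.refl arg_cong2[of _ _ _ _ "(*)"] pl_exp[OF W(2), symmetric])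
          also have "\<dots> = pl a (\<lambda>a'. pl b (\<lambda>b'. \<beta> (BD.E a', BD.E b')))"
            by (rule pl_exp[OF W(1), symmetric])
          finally show ?thesis using True by (simp add: BC.bform_def)
        next
          case False
          then show ?thesis by (auto simp: BC.bform_def pull_0)
        qed
        finally show "pl a (\<lambda>a'. pl b (\<lambda>b'. BD.bform i j \<beta> a' b')) = BC.bform i j ?\<gamma> a b" .
      qed
      also have "\<dots> = J_comult C i j (BC.E w) ?\<gamma>" using BC.J_comult_E[OF wX(1), of i j ?\<gamma>] \<gamma> by simp
      finally show ?thesis .
    qed
    have texp: "t = (\<Sum>w\<in>WW (i + j). fscale (BC.Ec w t) (BC.E w))"
      using dual_basisD(6)[OF BC.J_dual_basis t] by (simp add: Wn_def)
    have "J_comult D i j (f (i + j) t) \<beta> = (\<Sum>w\<in>WW (i + j). BC.Ec w t * J_comult C i j (BC.E w) ?\<gamma>)"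
      unfolding f_expand[OF t] comult_sum using basis by (simp add: sum_fun_app fscale_def)
    also have "\<dots> = (\<Sum>w\<in>WW (i + j). fscale (BC.Ec w t) (J_comult C i j (BC.E w))) ?\<gamma>"
      by (simp add: sum_fun_app fscale_def)
    also have "\<dots> = J_comult C i j t ?\<gamma>" unfolding comult_sum[symmetric] texp[symmetric] ..
    finally show ?thesis using \<beta> by (simp add: tensor_map_def)
  qed (simp add: J_comult_def tensor_map_def)
qed

text \<open>Expanded in words on both sides, this is \<open>pull_append\<close>.\<close>

lemma f_mult:
  assumes s: "s \<in> carr (J_part C m)" and t: "t \<in> carr (J_part C n)"
  shows "f (m + n) (J_mult C s t) = J_mult D (f m s) (f n t)"
proof
  fix \<beta>
  have uw: "u @ w \<in> WW (m + n)" if "u \<in> WW m" "w \<in> WW n" for u w using that by (auto simp: Wn_def)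
  have f_sum: "f k (\<Sum>i\<in>I. fscale (c i) (g i)) = (\<Sum>i\<in>I. fscale (c i) (f k (g i)))" for k I c and g :: "'i list \<times> 'i list \<Rightarrow> _"
  proof (induction I rule: infinite_finite_induct)
    case (insert x I)
    then show ?case by (simp only: sum.insert[OF insert(1,2)] f_lin)
  qed (simp_all add: f_def BC.Ec_def)
  have "J_mult C s t = (\<Sum>uw\<in>WW m \<times> WW n. fscale (BC.Ec (fst uw) s * BC.Ec (snd uw) t) (BC.E (fst uw @ snd uw)))"
    by (simp add: BC.J_mult_expand[OF s t] sum.cartesian_product case_prod_beta)
  then have "f (m + n) (J_mult C s t) \<beta> =
      (\<Sum>uw\<in>WW m \<times> WW n. BC.Ec (fst uw) s * BC.Ec (snd uw) t * f (m + n) (BC.E (fst uw @ snd uw)) \<beta>)"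
    by (simp only: f_sum sum_fun_app) (simp only: fscale_def)
  also have "\<dots> = (\<Sum>u\<in>WW m. \<Sum>w\<in>WW n. BC.Ec u s * BC.Ec w t * f (m + n) (BC.E (u @ w)) \<beta>)"
    by (simp add: sum.cartesian_product case_prod_beta)
  also have "\<dots> = (\<Sum>u\<in>WW m. \<Sum>w\<in>WW n. BC.Ec u s * BC.Ec w t *
      (\<Sum>a\<in>WW m. pl u (dlt a) * (\<Sum>b\<in>WW n. pl w (dlt b) * BD.E (a @ b) \<beta>)))"
  proof (intro sum.cong HOL.refl arg_cong2[of _ _ _ _ "(*)"])
    fix u w assume u: "u \<in> WW m" and w: "w \<in> WW n"
    have "f (m + n) (BC.E (u @ w)) \<beta> = pl u (\<lambda>a. pl w (\<lambda>b. BD.E (a @ b) \<beta>))"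
      by (simp add: f_E_apply[OF uw[OF u w]] pull_append)
    also have "\<dots> = (\<Sum>a\<in>WW m. pl u (dlt a) * pl w (\<lambda>b. BD.E (a @ b) \<beta>))" by (rule pl_exp[OF u])
    also have "\<dots> = (\<Sum>a\<in>WW m. pl u (dlt a) * (\<Sum>b\<in>WW n. pl w (dlt b) * BD.E (a @ b) \<beta>))"
      by (intro sum.cong HOL.refl arg_cong2[of _ _ _ _ "(*)"]) (rule pl_exp[OF w])
    finally show "f (m + n) (BC.E (u @ w)) \<beta> = (\<Sum>a\<in>WW m. pl u (dlt a) * (\<Sum>b\<in>WW n. pl w (dlt b) * BD.E (a @ b) \<beta>))" .
  qed
  also have "\<dots> = (\<Sum>u\<in>WW m. \<Sum>w\<in>WW n. \<Sum>a\<in>WW m. \<Sum>b\<in>WW n.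
      (BC.Ec u s * pl u (dlt a)) * (BC.Ec w t * pl w (dlt b)) * BD.E (a @ b) \<beta>)"
    by (simp add: sum_distrib_left mult_ac)
  also have "\<dots> = (\<Sum>u\<in>WW m. \<Sum>a\<in>WW m. \<Sum>w\<in>WW n. \<Sum>b\<in>WW n.
      (BC.Ec u s * pl u (dlt a)) * (BC.Ec w t * pl w (dlt b)) * BD.E (a @ b) \<beta>)"
    by (rule sum.cong[OF HOL.refl], rule sum.swap)
  also have "\<dots> = (\<Sum>a\<in>WW m. \<Sum>u\<in>WW m. \<Sum>b\<in>WW n. \<Sum>w\<in>WW n.
      (BC.Ec u s * pl u (dlt a)) * (BC.Ec w t * pl w (dlt b)) * BD.E (a @ b) \<beta>)"
    by (rule trans[OF sum.swap]) (rule sum.cong[OF HOL.refl], rule sum.cong[OF HOL.refl], rule sum.swap)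
  also have "\<dots> = (\<Sum>a\<in>WW m. \<Sum>b\<in>WW n. \<Sum>u\<in>WW m. \<Sum>w\<in>WW n.
      (BC.Ec u s * pl u (dlt a)) * (BC.Ec w t * pl w (dlt b)) * BD.E (a @ b) \<beta>)"
    by (rule sum.cong[OF HOL.refl], rule sum.swap)
  also have "\<dots> = (\<Sum>a\<in>WW m. \<Sum>b\<in>WW n. BD.Ec a (f m s) * BD.Ec b (f n t) * BD.E (a @ b) \<beta>)"
  proof (rule sum.cong[OF HOL.refl], rule sum.cong[OF HOL.refl])
    fix a b assume a: "a \<in> WW m" and b: "b \<in> WW n"
    show "(\<Sum>u\<in>WW m. \<Sum>w\<in>WW n. (BC.Ec u s * pl u (dlt a)) * (BC.Ec w t * pl w (dlt b)) * BD.E (a @ b) \<beta>) =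
      BD.Ec a (f m s) * BD.Ec b (f n t) * BD.E (a @ b) \<beta>"
      unfolding Ec_f[OF a] Ec_f[OF b] unfolding sum_product unfolding sum_distrib_right ..
  qed
  also have "\<dots> = J_mult D (f m s) (f n t) \<beta>"
    by (simp add: BD.J_mult_expand[OF f_in f_in] sum_fun_app fscale_def)
  finally show "f (m + n) (J_mult C s t) \<beta> = J_mult D (f m s) (f n t) \<beta>" .
qed

theorem hopf_iso_f: "hopf_iso (J C) (J D) f"
proof -
  have W0: "WW 0 = {[]}" by (rule BD.L.WX_0)
  have unit: "f 0 (BC.E []) = BD.E []" using f_E[of "[]" 0] by (simp add: W0)
  have units: "J_unit C = BC.E []" "J_unit D = BD.E []" by (simp_all add: J_unit_def BC.E_def BD.E_def)
  have counit: "J_counit (f 0 t) = J_counit t" if t: "t \<in> carr (J_part C 0)" for t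
  proof -
    have t': "t = fscale (BC.Ec [] t) (BC.E [])"
      using dual_basisD(6)[OF BC.J_dual_basis t] W0 by (simp add: Wn_def)
    have "f 0 t = fscale (BC.Ec [] t) (BD.E [])" by (subst t') (simp only: f_lin unit)
    then have "J_counit (f 0 t) = BC.Ec [] t * J_counit (BD.E [])" by (simp add: J_counit_def fscale_def)
    moreover have "J_counit t = BC.Ec [] t * J_counit (BC.E [])"
      by (subst t') (simp add: J_counit_def fscale_def)
    ultimately show ?thesis by (simp add: BD.J_counit_E BC.J_counit_E)
  qed
  show ?thesis
    unfolding hopf_iso_def coalgebra_iso_def
    using f_iso f_comult counit unit units f_mult by (simp add: J_def)
qed

end

context perfect_coalg
begin

lemma V_add:
  assumes n: "good p n" and x: "x \<in> cpart G (p * n)" and y: "y \<in> cpart G (p * n)"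
  shows "verschiebung G p n (x + y) = verschiebung G p n x + verschiebung G p n y"
proof (rule V_unique[OF n])
  note cl = vs_closed[OF dual_basisD(1)[OF db]]
  show "x + y \<in> cpart G (p * n)" "verschiebung G p n x + verschiebung G p n y \<in> cpart G n"
    using cl(2) x y V_spec(1)[OF n] by blast+
  fix \<alpha> assume \<alpha>: "\<alpha> \<in> dual_space (P n)"
  have d: "dual_power G n \<alpha> p \<in> dual_space (P (p * n))" using dual_power_props[OF \<alpha>] by blast
  have "(\<alpha> (verschiebung G p n x) + \<alpha> (verschiebung G p n y)) ^ p = dual_power G n \<alpha> p x + dual_power G n \<alpha> p y"
    using V_spec(2)[OF n x \<alpha>] V_spec(2)[OF n y \<alpha>] prime_p CHAR_p by (simp add: freshmans_dream)
  moreover have "\<alpha> (verschiebung G p n x + verschiebung G p n y) = \<alpha> (verschiebung G p n x) + \<alpha> (verschiebung G p n y)"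
    using \<alpha> V_spec(1)[OF n] x y by (simp add: dual_space_iff)
  ultimately show "\<alpha> (verschiebung G p n x + verschiebung G p n y) ^ p = dual_power G n \<alpha> p (x + y)"
    using d x y by (simp add: dual_space_iff)
qed

lemma V_smul:
  assumes n: "good p n" and x: "x \<in> cpart G (p * n)"
  shows "verschiebung G p n (smul (P (p * n)) c x) = smul (P n) (pth_root p c) (verschiebung G p n x)"
proof (rule V_unique[OF n])
  note cl = vs_closed[OF dual_basisD(1)[OF db]]
  show "smul (P (p * n)) c x \<in> cpart G (p * n)" "smul (P n) (pth_root p c) (verschiebung G p n x) \<in> cpart G n"
    using cl(3) x V_spec(1)[OF n x] by blast+
  fix \<alpha> assume \<alpha>: "\<alpha> \<in> dual_space (P n)"
  have d: "dual_power G n \<alpha> p \<in> dual_space (P (p * n))" using dual_power_props[OF \<alpha>] by blast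
  have "\<alpha> (smul (P n) (pth_root p c) (verschiebung G p n x)) = pth_root p c * \<alpha> (verschiebung G p n x)"
    using \<alpha> V_spec(1)[OF n x] by (simp add: dual_space_iff)
  then show "\<alpha> (smul (P n) (pth_root p c) (verschiebung G p n x)) ^ p = dual_power G n \<alpha> p (smul (P (p * n)) c x)"
    using V_spec(2)[OF n x \<alpha>] d x by (simp add: dual_space_iff power_mult_distrib pth_root)
qed

lemma v_module_positive_part: "v_module p (positive_part G p)"
proof -
  let ?M = "positive_part G p"
  have fd: "fin_dim_space (P n)" for n using gc by (simp add: graded_coalgebra_def)
  have fd0: "fin_dim_space ((P 0)\<lparr>carr := {0}\<rparr>)"
  proof -
    interpret v: vector_space "smul (P 0)" using fd[of 0] by (simp add: fin_dim_space_def)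
    show ?thesis using v.vector_space_axioms by (auto simp: fin_dim_space_def intro!: exI[of _ "{}"])
  qed
  have z: "0 \<in> cpart G n" for n using vs_closed(1)[OF dual_basisD(1)[OF db]] .
  \<comment> \<open>The V-module has \<open>{0}\<close> in degree \<open>0\<close>, so
    \<open>V\<close> must fix \<open>0\<close> there; additivity forces this.\<close>
  have "verschiebung G p 0 (0 + 0) = verschiebung G p 0 0 + verschiebung G p 0 0"
    using V_add[of 0 0 0] z by (simp add: good_def)
  then have V0: "verschiebung G p 0 0 = 0" by simp
  have sub: "carr (vpart ?M n) \<subseteq> cpart G n" for n using z by (auto simp: positive_part_def)
  have sm: "smul (vpart ?M n) = smul (P n)" for n by (simp add: positive_part_def)
  have vm: "vmap ?M = verschiebung G p" by (simp add: positive_part_def)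
  have "verschiebung G p n x \<in> carr (vpart ?M n)" if n: "v_degree p n" and x: "x \<in> carr (vpart ?M (p * n))" for n x
  proof (cases "n = 0")
    case True
    then show ?thesis using x V0 by (simp add: positive_part_def)
  next
    case False
    then have "carr (vpart ?M n) = cpart G n" by (simp add: positive_part_def)
    then show ?thesis using V_spec(1)[of n x] sub[of "p * n"] n x by (auto simp: v_degree_def good_def)
  qed
  moreover have "fin_dim_space (vpart ?M n)" "carr (vpart ?M 0) = {0}" for n
    using fd fd0 by (simp_all add: positive_part_def)
  ultimately show ?thesis unfolding v_module_def vm sm
    using V_add V_smul sub by (auto simp: v_degree_def good_def subset_iff)
qed

lemma pw_dlt_V:
  assumes n: "good p n" and x: "x \<in> Yd n" and y: "y \<in> Yd (p * n)"
  shows "L.pw (dlt x) p y = a x (verschiebung G p n (e y)) ^ p"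
proof -
  have ax: "a x \<in> dual_space (P n)" using a_in[of x] x by simp
  have ey: "e y \<in> cpart G (p * n)" using e_in[of y] y by simp
  show ?thesis using V_spec(2)[OF n ey ax] dual_power_props[OF ax, of p] y restr_a[OF x] by simp
qed

end

locale adapted_coalg = perfect_coalg G Y deg e a one p + AD: adapted Y deg "struct_cop G Y deg e a" one p F
  for G :: "('k::field, 'a::ab_group_add) gcoalg" and Y :: "'i set" and deg e a one p and F

lemma exists_adapted_coalg:
  fixes G :: "('k::field, 'a::ab_group_add) gcoalg"
  assumes "graded_coalgebra G" "cocommutative G" "connected_coalgebra G"
    and "CHAR('k) = p" "prime p" "\<And>x::'k. \<exists>y. y ^ p = x"
  shows "\<exists>(Y :: (nat \<times> (nat \<times> 'a \<Rightarrow> 'k)) set) e a one F. adapted_coalg G Y fst e a one p F"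
proof -
  obtain Y :: "(nat \<times> 'a) set" and a one where "coalg_basis G Y fst snd a one"
    using exists_coalg_basis[OF assms(1-3)] by blast
  then interpret B: coalg_basis G Y fst snd a one .
  interpret B: perfect_coalg G Y fst snd a one p using assms(4-6) by unfold_locales
  obtain Y' :: "(nat \<times> (nat \<times> 'a \<Rightarrow> 'k)) set" and e' a' one' F' where
    "coalg_basis G Y' fst e' a' one'" and ad: "adapted Y' fst (struct_cop G Y' fst e' a') one' p F'"
    using B.adapted_exists by blast
  then interpret N: coalg_basis G Y' fst e' a' one' by blast
  have "adapted_coalg G Y' fst e' a' one' p F'"
    using assms(4-6) ad unfolding adapted_coalg_def by (simp add: perfect_coalg_def perfect_coalg_axioms_def N.coalg_basis_axioms)
  then show ?thesis by blast
qed

context adapted_coalg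
begin

text \<open>The adapted basis of \<open>G\<close> is pulled back along \<open>h\<close>. By
  \<open>pw_dlt_V\<close> the \<open>p\<close>-th powers of basis functionals are determined by
  \<open>V\<close>, with which \<open>h\<close> commutes, so the same \<open>F\<close> describes
  both sides. Degree \<open>0\<close> is supplied by the counit, because \<open>h\<close> sees only
  the zero space there.\<close>

lemma transport_basis:
  fixes C :: "('k, 'c::ab_group_add) gcoalg"
  assumes C: "graded_coalgebra C" "cocommutative C" "connected_coalgebra C"
    and h: "v_module_iso p (positive_part C p) (positive_part G p) h"
  shows "\<exists>e' a'. coalg_basis C Y deg e' a' one \<and> adapted Y deg (struct_cop C Y deg e' a') one p F"
proof -
  obtain e0 where e0: "\<forall>(i::'i) e a. e i = e0 \<longrightarrow> a i = counit C \<longrightarrow> dual_basis (part C 0) {i} e a"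
    using counit_dual_basis[OF C(1,3)] ..
  define e' where "e' y = (if deg y = 0 then e0 else inv_into (cpart C (deg y)) (h (deg y)) (e y))" for y
  define a' where "a' y = (if deg y = 0 then counit C else (\<lambda>c. a y (h (deg y) c)))" for y
  have vsC: "vs (part C n)" for n using C(1) by (intro vs_fin_dim) (simp add: graded_coalgebra_def)
  have iso: "lin_iso (part C n) (P n) (h n)" if "n > 0" for n
  proof -
    have "lin_iso (vpart (positive_part C p) n) (vpart (positive_part G p) n) (h n)"
      using h unfolding v_module_iso_def by blast
    then show ?thesis using that by (simp add: positive_part_def)
  qed
  have hV: "h n (verschiebung C p n x) = verschiebung G p n (h (p * n) x)"
    if "n > 0" "good p n" "x \<in> cpart C (p * n)" for n x
  proof -
    have x: "x \<in> carr (vpart (positive_part C p) (p * n))" using that A.p_gt_1 by (simp add: positive_part_def)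
    have "v_degree p n" using that(2) by (simp add: v_degree_def good_def)
    then have "h n (vmap (positive_part C p) n x) = vmap (positive_part G p) n (h (p * n) x)"
      using h x unfolding v_module_iso_def by blast
    then show ?thesis by (simp add: positive_part_def)
  qed
  have db': "dual_basis (part C n) (Yd n) e' a'" for n
  proof (cases "n = 0")
    case True
    have "Yd n = {one}" using one_Y True by (auto dest: one_unique)
    moreover have "e' one = e0" "a' one = counit C" using one_Y(2) by (simp_all add: e'_def a'_def)
    ultimately show ?thesis using e0 True by simp
  next
    case False
    have "dual_basis (part C n) (Yd n) (\<lambda>y. inv_into (cpart C n) (h n) (e y)) (\<lambda>y c. a y (h n c))"
      using dual_basis_transport[OF db iso vsC] False by simp
    then show ?thesis using False by (simp add: dual_basis_def e'_def a'_def)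
  qed
  interpret N: coalg_basis C Y deg e' a' one
  proof unfold_locales
    show "y = one" if "y \<in> Y" "deg y = 0" for y using that by (rule one_unique)
    show "a' one = counit C" using one_Y(2) by (simp add: a'_def)
  qed (fact C(1) C(2) db' one_Y)+
  interpret N: perfect_coalg C Y deg e' a' one p
    using CHAR_p prime_p perfect_p by unfold_locales
  have he: "h n (e' y) = e y" if "n > 0" "y \<in> Yd n" for n y
    using lin_iso_inv(2)[OF iso vsC, of n "e y"] e_in[of y] that by (simp add: e'_def)
  have "adapted Y deg (struct_cop C Y deg e' a') one p F"
  proof unfold_locales
    fix x y assume "F x = Some y"
    then show "x \<in> N.L.X \<and> y \<in> N.L.X \<and> deg y = p * deg x \<and> good p (deg x)" by (rule AD.F_dom)
  next
    fix x y z assume "F x = Some z" "F y = Some z"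
    then show "x = y" by (rule AD.F_inj)
  next
    fix x assume x: "x \<in> N.L.X" and n: "good p (deg x)"
    have xY: "x \<in> Y" "deg x > 0" using x one_unique unfolding N.L.X_def by auto
    have "N.L.pw (dlt x) p y = L.pw (dlt x) p y" for y
    proof (cases "y \<in> Yd (p * deg x)")
      case True
      have ey: "e' y \<in> cpart C (p * deg x)" using N.e_in[of y] True by simp
      have "N.L.pw (dlt x) p y = a' x (verschiebung C p (deg x) (e' y)) ^ p"
        using xY True by (intro N.pw_dlt_V[OF n]) simp_all
      also have "\<dots> = a x (verschiebung G p (deg x) (h (p * deg x) (e' y))) ^ p"
        using xY hV[OF xY(2) n ey] by (simp add: a'_def)
      also have "\<dots> = a x (verschiebung G p (deg x) (e y)) ^ p"
        using he[of "p * deg x" y] True xY A.p_gt_1 by simp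
      also have "\<dots> = L.pw (dlt x) p y" using xY True by (intro pw_dlt_V[OF n, symmetric]) simp_all
      finally show ?thesis .
    next
      case False
      then have "N.L.pw (dlt x) p y = 0" "L.pw (dlt x) p y = 0"
        using N.L.hom_pw[OF N.L.hom_dlt[OF xY(1)], of p] L.hom_pw[OF L.hom_dlt[OF xY(1)], of p]
        unfolding L.hom_def N.L.hom_def by blast+
      then show ?thesis by simp
    qed
    then show "N.L.pw (dlt x) p = odlt (F x)" using AD.F_pw[OF x n] by auto
  qed
  then show ?thesis using N.coalg_basis_axioms by blast
qed

theorem hopf_isomorphic_of_V:
  fixes C :: "('k, 'c::ab_group_add) gcoalg"
  assumes C: "graded_coalgebra C" "cocommutative C" "connected_coalgebra C"
    and h: "v_module_iso p (positive_part C p) (positive_part G p) h"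
  shows "hopf_isomorphic (J C) (J G)"
proof -
  obtain e' a' where ea: "coalg_basis C Y deg e' a' one" "adapted Y deg (struct_cop C Y deg e' a') one p F"
    using transport_basis[OF assms] by blast
  obtain N where N: "N \<subseteq> lists L.X - {[]}" "\<And>w w'. w \<in> N \<Longrightarrow> wF F w = Some w' \<Longrightarrow> w' \<in> N"
    "\<And>d r. d > 0 \<Longrightarrow> r > 0 \<Longrightarrow> AD.relbasis d r (N \<inter> AD.Wset d r)"
    using AD.exists_generators by metis
  have g: "gens Y deg (struct_cop G Y deg e a) one p F N"
    using N by unfold_locales
  have tw: "two_adapted Y deg (struct_cop G Y deg e a) one p F N (struct_cop C Y deg e' a')"
    using g ea(2) by (simp add: two_adapted_def)
  obtain \<phi> where "lifting Y deg (struct_cop G Y deg e a) one p F N (struct_cop C Y deg e' a') \<phi>"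
    using two_adapted.lifting_exists[OF tw] ..
  then have lift: "hopf_lift C G Y deg e' a' e a one p F N \<phi>"
    using ea(1) coalg_basis_axioms by (simp add: hopf_lift_def)
  show ?thesis unfolding hopf_isomorphic_def by (rule exI) (rule hopf_lift.hopf_iso_f[OF lift])
qed

end

section \<open>Counting letters by words\<close>

lemma wdeg_pos:
  assumes "\<And>x. x \<in> Z \<Longrightarrow> deg x > (0::nat)" "w \<in> lists Z" "w \<noteq> []"
  shows "wdeg deg w > 0"
  using assms by (cases w) auto

lemma words_count:
  fixes deg :: "'i \<Rightarrow> nat"
  assumes pos: "\<And>x. x \<in> Z \<Longrightarrow> deg x > 0" and fin: "\<And>n. finite {x\<in>Z. deg x = n}"
    and finW: "\<And>n. finite {w\<in>lists Z. wdeg deg w = n}" and n: "n > 0"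
  shows "card {w\<in>lists Z. wdeg deg w = n} =
    (\<Sum>m\<in>{1..n}. card {x\<in>Z. deg x = m} * card {w\<in>lists Z. wdeg deg w = n - m})"
proof -
  let ?A = "\<lambda>m. {x\<in>Z. deg x = m} \<times> {w\<in>lists Z. wdeg deg w = n - m}"
  let ?c = "\<lambda>(x, w). x # w"
  have "{w\<in>lists Z. wdeg deg w = n} = ?c ` (\<Union>m\<in>{1..n}. ?A m)"
  proof (intro subset_antisym subsetI)
    fix w assume w: "w \<in> {w\<in>lists Z. wdeg deg w = n}"
    then obtain x v where "w = x # v" using n by (cases w) auto
    then show "w \<in> ?c ` (\<Union>m\<in>{1..n}. ?A m)"
      using w pos[of x] by (intro image_eqI[of _ _ "(x, v)"]) auto
  qed auto
  then have "card {w\<in>lists Z. wdeg deg w = n} = card (\<Union>m\<in>{1..n}. ?A m)"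
    by (simp only:) (rule card_image, auto simp: inj_on_def)
  also have "\<dots> = (\<Sum>m\<in>{1..n}. card (?A m))"
    using fin finW by (intro card_UN_disjoint) auto
  finally show ?thesis by (simp add: card_cartesian_product)
qed

text \<open>In the recursion by first letters, the term \<open>m = n\<close> is the number of
  letters of degree \<open>n\<close> times one, for the empty word; the other terms agree by
  induction.\<close>

lemma letters_count_eq:
  fixes deg :: "'i \<Rightarrow> nat" and deg' :: "'j \<Rightarrow> nat"
  assumes pos: "\<And>x. x \<in> Z \<Longrightarrow> deg x > 0" "\<And>x. x \<in> Z' \<Longrightarrow> deg' x > 0"
    and fin: "\<And>n. finite {x\<in>Z. deg x = n}" "\<And>n. finite {x\<in>Z'. deg' x = n}"
    and finW: "\<And>n. finite {w\<in>lists Z. wdeg deg w = n}" "\<And>n. finite {w\<in>lists Z'. wdeg deg' w = n}"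
    and eq: "\<And>n. card {w\<in>lists Z. wdeg deg w = n} = card {w\<in>lists Z'. wdeg deg' w = n}"
  shows "card {x\<in>Z. deg x = n} = card {x\<in>Z'. deg' x = n}"
proof (induction n rule: less_induct)
  case (less n)
  show ?case
  proof (cases "n = 0")
    case True
    then have "{x\<in>Z. deg x = n} = {}" "{x\<in>Z'. deg' x = n} = {}" using pos by fastforce+
    then show ?thesis by (simp only: card.empty)
  next
    case False
    let ?t = "\<lambda>m. card {x\<in>Z. deg x = m} * card {w\<in>lists Z. wdeg deg w = n - m}"
    let ?t' = "\<lambda>m. card {x\<in>Z'. deg' x = m} * card {w\<in>lists Z'. wdeg deg' w = n - m}"
    have "(\<Sum>m\<in>{1..n}. ?t m) = (\<Sum>m\<in>{1..n}. ?t' m)"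
      using words_count[OF pos(1) fin(1) finW(1), of n] words_count[OF pos(2) fin(2) finW(2), of n] eq[of n] False by simp
    moreover have "{1..n} = insert n {1..<n}" using False by auto
    moreover have "(\<Sum>m\<in>{1..<n}. ?t m) = (\<Sum>m\<in>{1..<n}. ?t' m)"
      using less eq by (intro sum.cong) auto
    ultimately have "?t n = ?t' n" by simp
    moreover have "{w\<in>lists Z. wdeg deg w = 0} = {[]}" "{w\<in>lists Z'. wdeg deg' w = 0} = {[]}"
    proof -
      have "w = []" if "w \<in> lists Z" "wdeg deg w = 0" for w using wdeg_pos[of Z deg w] pos(1) that by fastforce
      then show "{w\<in>lists Z. wdeg deg w = 0} = {[]}" by auto
      have "w = []" if "w \<in> lists Z'" "wdeg deg' w = 0" for w using wdeg_pos[of Z' deg' w] pos(2) that by fastforce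
      then show "{w\<in>lists Z'. wdeg deg' w = 0} = {[]}" by auto
    qed
    ultimately show ?thesis by simp
  qed
qed

section \<open>Matching partial injections\<close>

primrec iterF :: "('i \<Rightarrow> 'i option) \<Rightarrow> nat \<Rightarrow> 'i \<Rightarrow> 'i option" where
  "iterF f 0 x = Some x"
| "iterF f (Suc j) x = Option.bind (f x) (iterF f j)"

lemma iterF_Suc_None: "iterF f j x = None \<Longrightarrow> iterF f (Suc j) x = None"
proof (induction j arbitrary: x)
  case (Suc j)
  then show ?case by (cases "f x") (simp_all del: iterF.simps add: iterF.simps(2)[of f _ x])
qed simp

lemma iterF_mono: "iterF f j x \<noteq> None \<Longrightarrow> i \<le> j \<Longrightarrow> iterF f i x \<noteq> None"
proof (induction j)
  case (Suc j)
  then show ?case using iterF_Suc_None[of f j x] by (metis le_Suc_eq)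
qed simp

lemma iterF_inj:
  assumes "\<And>x y z. f x = Some z \<Longrightarrow> f y = Some z \<Longrightarrow> x = y"
  shows "iterF f j x = Some z \<Longrightarrow> iterF f j y = Some z \<Longrightarrow> x = y"
proof (induction j arbitrary: x y)
  case (Suc j)
  then obtain x' y' where "f x = Some x'" "f y = Some y'" "iterF f j x' = Some z" "iterF f j y' = Some z"
    by (auto simp: bind_eq_Some_conv)
  then show ?case using Suc.IH[of x' y'] assms by blast
qed simp

lemma iterF_wF: "iterF (wF F) j w \<noteq> None \<longleftrightarrow> (\<forall>x\<in>set w. iterF F j x \<noteq> None)"
proof (induction j arbitrary: w)
  case (Suc j)
  show ?case
  proof (cases "\<forall>x\<in>set w. F x \<noteq> None")
    case True
    then have "iterF (wF F) (Suc j) w = iterF (wF F) j (map (the \<circ> F) w)" by (simp add: wF_def)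
    moreover have "iterF F (Suc j) x = iterF F j (the (F x))" if "x \<in> set w" for x using True that by auto
    ultimately show ?thesis using Suc by (simp del: iterF.simps)
  next
    case False
    then obtain x where "x \<in> set w" "F x = None" by blast
    then show ?thesis by (auto simp: wF_def intro!: bexI[of _ x])
  qed
qed simp

text \<open>\<open>D j x\<close> is to be read as: \<open>x\<close> has depth at least
  \<open>j\<close>. Depths may be infinite, so they are compared by implication instead of by
  number.\<close>

lemma deepest_exists:
  fixes D :: "nat \<Rightarrow> 'a \<Rightarrow> bool"
  assumes "finite A" "A \<noteq> {}" and mono: "\<And>i j x. D j x \<Longrightarrow> i \<le> j \<Longrightarrow> D i x"
  shows "\<exists>x\<in>A. \<forall>y\<in>A. \<forall>j. D j y \<longrightarrow> D j x"
  using assms(1,2)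
proof (induction rule: finite_ne_induct)
  case (insert x A)
  then obtain y where y: "y \<in> A" "\<forall>z\<in>A. \<forall>j. D j z \<longrightarrow> D j y" by blast
  show ?case
  proof (cases "\<forall>j. D j x \<longrightarrow> D j y")
    case True
    then show ?thesis using y by auto
  next
    case False
    then obtain i where i: "D i x" "\<not> D i y" by blast
    have "D j x" if "D j y" for j using i mono that by (metis nle_le)
    then show ?thesis using y by blast
  qed
qed blast

text \<open>The equal counts force deepest elements of the two sets to have the same depth; they are
  paired off, and the counts stay equal.\<close>

lemma depth_bijection:
  fixes D :: "nat \<Rightarrow> 'a \<Rightarrow> bool" and D' :: "nat \<Rightarrow> 'b \<Rightarrow> bool"
  assumes mono: "\<And>i j x. D j x \<Longrightarrow> i \<le> j \<Longrightarrow> D i x" "\<And>i j x. D' j x \<Longrightarrow> i \<le> j \<Longrightarrow> D' i x"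
    and D0: "\<And>x. D 0 x" "\<And>x. D' 0 x"
    and "finite A" "finite A'" "\<And>j. card {x\<in>A. D j x} = card {x\<in>A'. D' j x}"
  shows "\<exists>h. bij_betw h A A' \<and> (\<forall>x\<in>A. \<forall>j. D j x \<longleftrightarrow> D' j (h x))"
  using assms(5-7)
proof (induction "card A" arbitrary: A A')
  case 0
  then have "A = {}" "A' = {}" using "0"(4)[of 0] D0 by simp_all
  then show ?case by (intro exI[of _ undefined]) (simp add: bij_betw_def)
next
  case (Suc m)
  have ne: "A \<noteq> {}" "A' \<noteq> {}" using Suc(2) Suc(5)[of 0] D0 by auto
  obtain x where x: "x \<in> A" "\<And>y j. y \<in> A \<Longrightarrow> D j y \<Longrightarrow> D j x"
    using deepest_exists[OF Suc(3) ne(1), of D] mono(1) by blast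
  obtain x' where x': "x' \<in> A'" "\<And>y j. y \<in> A' \<Longrightarrow> D' j y \<Longrightarrow> D' j x'"
    using deepest_exists[OF Suc(4) ne(2), of D'] mono(2) by blast
  have xx': "D j x \<longleftrightarrow> D' j x'" for j
  proof -
    have "D j x \<longleftrightarrow> card {y\<in>A. D j y} \<noteq> 0" using x Suc(3) by auto
    also have "\<dots> \<longleftrightarrow> card {y\<in>A'. D' j y} \<noteq> 0" using Suc(5)[of j] by simp
    also have "\<dots> \<longleftrightarrow> D' j x'" using x' Suc(4) by auto
    finally show ?thesis .
  qed
  have "card {y\<in>A - {x}. D j y} = card {y\<in>A' - {x'}. D' j y}" for j
  proof -
    have "{y\<in>A - {x}. D j y} = {y\<in>A. D j y} - {x}" "{y\<in>A' - {x'}. D' j y} = {y\<in>A'. D' j y} - {x'}" by auto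
    then show ?thesis using Suc(3,4) Suc(5)[of j] x(1) x'(1) xx'[of j] by (simp add: card_Diff_singleton_if)
  qed
  moreover have "m = card (A - {x})" "finite (A - {x})" "finite (A' - {x'})" using Suc(2-4) x(1) by simp_all
  ultimately obtain h where h: "bij_betw h (A - {x}) (A' - {x'})" "\<forall>y\<in>A - {x}. \<forall>j. D j y \<longleftrightarrow> D' j (h y)"
    using Suc(1)[of "A - {x}" "A' - {x'}"] by blast
  let ?h = "h(x := x')"
  have "bij_betw ?h (A - {x}) (A' - {x'})" using h(1) by (rule bij_betw_cong[THEN iffD1, rotated]) auto
  then have "bij_betw ?h (A - {x} \<union> {x}) (A' - {x'} \<union> {?h x})" by (intro notIn_Un_bij_betw) auto
  moreover have "A - {x} \<union> {x} = A" "A' - {x'} \<union> {?h x} = A'" using x(1) x'(1) by auto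
  ultimately have "bij_betw ?h A A'" by simp
  moreover have "\<forall>y\<in>A. \<forall>j. D j y \<longleftrightarrow> D' j (?h y)" using h(2) xx' by auto
  ultimately show ?case by blast
qed

text \<open>The matching must preserve how often \<open>F\<close> and \<open>F'\<close> can be
  applied, for only then do they carry it to degree \<open>p * n\<close>. Elements that are not yet
  matched there are treated by \<open>depth_bijection\<close>.\<close>

lemma partial_injection_matching:
  fixes deg :: "'i \<Rightarrow> nat" and deg' :: "'j \<Rightarrow> nat"
  assumes p: "p > 1"
    and pos: "\<And>x. x \<in> X \<Longrightarrow> deg x > 0" "\<And>x. x \<in> X' \<Longrightarrow> deg' x > 0"
    and fin: "\<And>n. finite {x\<in>X. deg x = n}" "\<And>n. finite {x\<in>X'. deg' x = n}"
    and F: "\<And>x y. F x = Some y \<Longrightarrow> y \<in> X \<and> deg y = p * deg x"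
    and F': "\<And>x y. F' x = Some y \<Longrightarrow> y \<in> X' \<and> deg' y = p * deg' x"
    and inj: "\<And>x y z. F x = Some z \<Longrightarrow> F y = Some z \<Longrightarrow> x = y"
    and inj': "\<And>x y z. F' x = Some z \<Longrightarrow> F' y = Some z \<Longrightarrow> x = y"
    and count: "\<And>n j. card {x\<in>X. deg x = n \<and> iterF F j x \<noteq> None} = card {x\<in>X'. deg' x = n \<and> iterF F' j x \<noteq> None}"
  shows "\<exists>g. bij_betw g X X' \<and> (\<forall>x\<in>X. deg' (g x) = deg x \<and> F' (g x) = map_option g (F x))"
proof -
  define P where "P n S \<longleftrightarrow> S \<subseteq> {x\<in>X. deg x = n} \<times> {x\<in>X'. deg' x = n} \<and> inj_on fst S \<and> inj_on snd S \<and>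
    (\<forall>s\<in>S. \<forall>j. iterF F j (fst s) \<noteq> None \<longleftrightarrow> iterF F' j (snd s) \<noteq> None)" for n and S :: "('i \<times> 'j) set"
  define Q where "Q n S \<longleftrightarrow> P n S \<and> fst ` S = {x\<in>X. deg x = n} \<and> snd ` S = {x\<in>X'. deg' x = n}" for n and S :: "('i \<times> 'j) set"
  define G where "G S = {(y, y'). \<exists>(x, x')\<in>S. F x = Some y \<and> F' x' = Some y'}" for S :: "('i \<times> 'j) set"
  have step: "P (p * n) (G S)" if "Q n S" for n S
  proof -
    have S: "S \<subseteq> {x\<in>X. deg x = n} \<times> {x\<in>X'. deg' x = n}" "inj_on fst S" "inj_on snd S"
      and S4: "\<forall>s\<in>S. \<forall>j. iterF F j (fst s) \<noteq> None \<longleftrightarrow> iterF F' j (snd s) \<noteq> None"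
      using that unfolding P_def Q_def by blast+
    have 1: "G S \<subseteq> {x\<in>X. deg x = p * n} \<times> {x\<in>X'. deg' x = p * n}"
      using S(1) F F' by (fastforce simp: G_def)
    have 2: "inj_on fst (G S)"
    proof (rule inj_onI)
      fix s t assume "s \<in> G S" "t \<in> G S" "fst s = fst t"
      then obtain x x' y y' where "(x, x') \<in> S" "(y, y') \<in> S" "F x = Some (fst s)" "F' x' = Some (snd s)"
        "F y = Some (fst s)" "F' y' = Some (snd t)" by (auto simp: G_def)
      then show "s = t" using inj[of x "fst s" y] inj_onD[OF S(2), of "(x, x')" "(y, y')"] \<open>fst s = fst t\<close>
        by (auto simp: prod_eq_iff)
    qed
    have 3: "inj_on snd (G S)"
    proof (rule inj_onI)
      fix s t assume "s \<in> G S" "t \<in> G S" "snd s = snd t"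
      then obtain x x' y y' where "(x, x') \<in> S" "(y, y') \<in> S" "F x = Some (fst s)" "F' x' = Some (snd s)"
        "F y = Some (fst t)" "F' y' = Some (snd s)" by (auto simp: G_def)
      then show "s = t" using inj'[of x' "snd s" y'] inj_onD[OF S(3), of "(x, x')" "(y, y')"] \<open>snd s = snd t\<close>
        by (auto simp: prod_eq_iff)
    qed
    have 4: "iterF F j (fst s) \<noteq> None \<longleftrightarrow> iterF F' j (snd s) \<noteq> None" if s: "s \<in> G S" for s j
    proof -
      obtain x x' where x: "(x, x') \<in> S" "F x = Some (fst s)" "F' x' = Some (snd s)"
        using s by (auto simp: G_def)
      have "iterF F (Suc j) x \<noteq> None \<longleftrightarrow> iterF F' (Suc j) x' \<noteq> None"
        using bspec[OF S4 x(1)] by (simp only: fst_conv snd_conv)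
      then show ?thesis using x(2,3) by simp
    qed
    show ?thesis unfolding P_def using 1 2 3 4 by blast
  qed
  have extend: "\<exists>S. T \<subseteq> S \<and> Q n S" if PT: "P n T" for n T
  proof -
    let ?X = "{x\<in>X. deg x = n}" and ?X' = "{x\<in>X'. deg' x = n}"
    let ?A = "?X - fst ` T" and ?A' = "?X' - snd ` T"
    have T: "T \<subseteq> ?X \<times> ?X'" "inj_on fst T" "inj_on snd T"
      "\<And>s j. s \<in> T \<Longrightarrow> iterF F j (fst s) \<noteq> None \<longleftrightarrow> iterF F' j (snd s) \<noteq> None"
      using PT unfolding P_def by blast+
    \<comment> \<open>The part already matched preserves depths, so it removes equally many elements
      of each depth on both sides.\<close>
    have cA: "card {x\<in>?A. iterF F j x \<noteq> None} = card {x\<in>?A'. iterF F' j x \<noteq> None}" for j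
    proof -
      let ?T = "{s\<in>T. iterF F j (fst s) \<noteq> None}"
      have e: "{x\<in>?A. iterF F j x \<noteq> None} = {x\<in>X. deg x = n \<and> iterF F j x \<noteq> None} - fst ` ?T"
        by auto
      have e': "{x\<in>?A'. iterF F' j x \<noteq> None} = {x\<in>X'. deg' x = n \<and> iterF F' j x \<noteq> None} - snd ` ?T"
        using T(4) by auto
      have "finite ?T" by (rule finite_subset[of _ "?X \<times> ?X'"]) (use T(1) fin in auto)
      moreover have "fst ` ?T \<subseteq> {x\<in>X. deg x = n \<and> iterF F j x \<noteq> None}" using T(1) by auto
      moreover have "snd ` ?T \<subseteq> {x\<in>X'. deg' x = n \<and> iterF F' j x \<noteq> None}"
      proof (rule image_subsetI)
        fix s assume "s \<in> ?T"
        then have s: "s \<in> T" "iterF F j (fst s) \<noteq> None" by simp_all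
        show "snd s \<in> {x\<in>X'. deg' x = n \<and> iterF F' j x \<noteq> None}"
          using subsetD[OF T(1) s(1)] T(4)[OF s(1), of j] s(2) by (simp add: mem_Times_iff)
      qed
      moreover have "card (fst ` ?T) = card ?T" "card (snd ` ?T) = card ?T"
        using T(2,3) by (intro card_image; auto intro: inj_on_subset)+
      ultimately show ?thesis unfolding e e' using count[of n j] by (simp add: card_Diff_subset)
    qed
    have "\<exists>h. bij_betw h ?A ?A' \<and> (\<forall>x\<in>?A. \<forall>j. iterF F j x \<noteq> None \<longleftrightarrow> iterF F' j (h x) \<noteq> None)"
    proof (rule depth_bijection[where D = "\<lambda>j x. iterF F j x \<noteq> None" and D' = "\<lambda>j x. iterF F' j x \<noteq> None"])
      show "finite ?A" "finite ?A'" using fin by simp_all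
    qed (use iterF_mono[of F] iterF_mono[of F'] in blast, use iterF_mono[of F'] in blast, simp, simp, rule cA)
    then obtain h where h: "bij_betw h ?A ?A'"
      and hj: "\<And>x. x \<in> ?A \<Longrightarrow> \<forall>j. iterF F j x \<noteq> None \<longleftrightarrow> iterF F' j (h x) \<noteq> None" by blast
    define S where "S = T \<union> (\<lambda>x. (x, h x)) ` ?A"
    have hA: "h ` ?A = ?A'" "inj_on h ?A" using h by (auto simp: bij_betw_def)
    have fS: "fst ` S = ?X" using T(1) unfolding S_def image_Un image_image by auto
    have sS: "snd ` S = ?X'" using T(1) hA unfolding S_def image_Un image_image snd_conv by auto
    have "fst ` T \<inter> fst ` (\<lambda>x. (x, h x)) ` ?A = {}" "snd ` T \<inter> snd ` (\<lambda>x. (x, h x)) ` ?A = {}"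
      unfolding image_image fst_conv snd_conv using hA(1) by auto
    moreover have "inj_on fst ((\<lambda>x. (x, h x)) ` ?A)" "inj_on snd ((\<lambda>x. (x, h x)) ` ?A)"
      using hA(2) by (auto simp: inj_on_def)
    ultimately have "inj_on fst S" "inj_on snd S" unfolding S_def inj_on_Un using T(2,3) by blast+
    moreover have "S \<subseteq> ?X \<times> ?X'" using fS sS by force
    moreover have "iterF F j (fst s) \<noteq> None \<longleftrightarrow> iterF F' j (snd s) \<noteq> None" if s: "s \<in> S" for s j
    proof (cases "s \<in> T")
      case False
      then obtain x where x: "x \<in> ?A" "s = (x, h x)" using s unfolding S_def by blast
      then show ?thesis using hj[OF x(1)] by (simp only: fst_conv snd_conv)
    qed (rule T(4))
    ultimately have "Q n S" unfolding Q_def P_def using fS sS by blast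
    then show ?thesis unfolding S_def by blast
  qed
  obtain B where "\<forall>n>0. Q n (B n) \<and> G (B n) \<subseteq> B (p * n)"
    using degree_recursion[of p P Q "\<lambda>_. G"] p step extend by (auto simp: P_def)
  then have B: "\<And>n. n > 0 \<Longrightarrow> Q n (B n)" "\<And>n. n > 0 \<Longrightarrow> G (B n) \<subseteq> B (p * n)" by simp_all
  have Bsub: "x \<in> X \<and> deg x = n \<and> x' \<in> X' \<and> deg' x' = n" if "(x, x') \<in> B n" "n > 0" for n x x'
    using B(1)[OF that(2)] that(1) unfolding Q_def P_def by blast
  have Binj: "inj_on fst (B n)" "inj_on snd (B n)" if "n > 0" for n
    using B(1)[OF that] unfolding Q_def P_def by blast+
  define g where "g x = (SOME x'. (x, x') \<in> B (deg x))" for x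
  have gB: "(x, g x) \<in> B (deg x)" if "x \<in> X" for x
  proof -
    have "x \<in> fst ` B (deg x)" using B(1)[OF pos(1)[OF that]] that by (auto simp: Q_def)
    then show ?thesis unfolding g_def by (intro someI_ex[of "\<lambda>x'. (x, x') \<in> B (deg x)"]) auto
  qed
  have gX: "g x \<in> X' \<and> deg' (g x) = deg x" if "x \<in> X" for x
    using Bsub[OF gB[OF that] pos(1)[OF that]] by simp
  have uniq: "g x = x'" if "(x, x') \<in> B n" "n > 0" for x x' n
  proof -
    have x: "x \<in> X" "deg x = n" using Bsub[OF that] by simp_all
    show ?thesis using inj_onD[OF Binj(1)[OF that(2)], of "(x, g x)" "(x, x')"] gB[OF x(1)] x(2) that(1) by simp
  qed
  have "inj_on g X"
  proof (rule inj_onI)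
    fix x y assume xy: "x \<in> X" "y \<in> X" "g x = g y"
    then have "(y, g x) \<in> B (deg x)" using gB[OF xy(2)] gX[OF xy(1)] gX[OF xy(2)] by simp
    then show "x = y" using inj_onD[OF Binj(2)[OF pos(1)[OF xy(1)]], of "(x, g x)" "(y, g x)"] gB[OF xy(1)] by simp
  qed
  moreover have "g ` X = X'"
  proof (intro subset_antisym subsetI)
    fix x' assume x': "x' \<in> X'"
    then have "x' \<in> snd ` B (deg' x')" using B(1)[OF pos(2)[OF x']] by (simp add: Q_def)
    then obtain x where x: "(x, x') \<in> B (deg' x')" by auto
    then have "x \<in> X" using Bsub[OF x pos(2)[OF x']] by simp
    then show "x' \<in> g ` X" using uniq[OF x pos(2)[OF x']] by blast
  qed (use gX in blast)
  moreover have "F' (g x) = map_option g (F x)" if x: "x \<in> X" for x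
  proof -
    have it: "iterF F j x \<noteq> None \<longleftrightarrow> iterF F' j (g x) \<noteq> None" for j
    proof -
      have "\<forall>s\<in>B (deg x). \<forall>j. iterF F j (fst s) \<noteq> None \<longleftrightarrow> iterF F' j (snd s) \<noteq> None"
        using B(1)[OF pos(1)[OF x]] unfolding Q_def P_def by blast
      from bspec[OF this gB[OF x]] show ?thesis by (simp only: fst_conv snd_conv)
    qed
    show ?thesis
    proof (cases "F x")
      case None
      then show ?thesis using it[of 1] by (cases "F' (g x)") simp_all
    next
      case (Some y)
      then obtain y' where y': "F' (g x) = Some y'" using it[of 1] by (cases "F' (g x)") simp_all
      then have "(y, y') \<in> G (B (deg x))" using gB[OF x] Some by (auto simp: G_def)
      then have "(y, y') \<in> B (p * deg x)" using B(2)[OF pos(1)[OF x]] by blast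
      then have "g y = y'" using uniq[of y y' "p * deg x"] pos(1)[OF x] p by simp
      then show ?thesis using Some y' by simp
    qed
  qed
  ultimately show ?thesis using gX by (intro exI[of _ g]) (auto simp: bij_betw_def)
qed

section \<open>Recovering the letters from the coalgebra\<close>

lemma (in perfect_coords) Frj_sum:
  assumes "\<And>i. i \<in> I \<Longrightarrow> hom n (f i)"
  shows "Frj j n (\<Sum>i\<in>I. fscale (c i) (f i)) = (\<Sum>i\<in>I. fscale (c i ^ p ^ j) (Frj j n (f i)))"
  using assms
proof (induction j arbitrary: n c f)
  case (Suc j)
  have "Frj (Suc j) n (\<Sum>i\<in>I. fscale (c i) (f i)) = Frj j (p * n) (\<Sum>i\<in>I. fscale (c i ^ p) (Fr n (f i)))"
    using Fr_sum[OF Suc.prems, of I] by simp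
  also have "\<dots> = (\<Sum>i\<in>I. fscale ((c i ^ p) ^ p ^ j) (Frj j (p * n) (Fr n (f i))))"
    using Suc.prems by (intro Suc.IH hom_Fr)
  finally show ?case by (simp add: power_mult)
qed simp

lemma (in perfect_coords) hom_Frj: "hom n f \<Longrightarrow> hom (p ^ j * n) (Frj j n f)"
proof (induction j arbitrary: n f)
  case (Suc j)
  then show ?case using Suc.IH[OF hom_Fr] by (simp add: mult_ac)
qed simp

sublocale adapted_coalg \<subseteq> WP: perfect_coords "lists L.X" "wdeg deg" "wcop one deg (struct_cop G Y deg e a)" "[]" p
  using perfect_p by unfold_locales

context adapted_coalg
begin

lemma Fr_dlt_word:
  assumes "w \<in> L.WX n" shows "WP.Fr n (dlt w) = odlt (wF F w)"
proof -
  have w: "w \<in> lists L.X" "L.wd w = n" using assms by (simp_all add: Wn_def)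
  show ?thesis
  proof (cases "good p n")
    case True
    then show ?thesis using AD.pw_dlt_word[OF w(1)] w(2) by (simp add: WP.Fr_def)
  next
    case False
    then have "wF F w = None" using AD.wF_props(4)[of w] w(2) by (cases "wF F w") auto
    then show ?thesis using False by (simp add: WP.Fr_def)
  qed
qed

lemma Frj_dlt_word: "w \<in> L.WX n \<Longrightarrow> WP.Frj j n (dlt w) = odlt (iterF (wF F) j w)"
proof (induction j arbitrary: n w)
  case (Suc j)
  show ?case
  proof (cases "wF F w")
    case None
    then show ?thesis using Fr_dlt_word[OF Suc.prems] by (simp add: WP.Frj_0 del: zero_fun_apply)
  next
    case (Some w')
    then have "w' \<in> L.WX (p * n)" using AD.wF_props[OF Some] Suc.prems by (simp add: Wn_def)
    then show ?thesis using Fr_dlt_word[OF Suc.prems] Suc.IH Some by simp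
  qed
qed simp

text \<open>Iterates of \<open>wF\<close> are injective where defined, so images of different words
  do not interfere and the kernel can be read off word by word.\<close>

lemma Frj_eq_0_iff:
  assumes h: "L.W.hom n h"
  shows "WP.Frj j n h = 0 \<longleftrightarrow> (\<forall>w\<in>L.WX n. iterF (wF F) j w \<noteq> None \<longrightarrow> h w = 0)"
proof -
  have hd: "L.W.hom n (dlt w :: _ \<Rightarrow> 'k)" if "w \<in> L.WX n" for w using L.W.hom_dlt[of w] that by (simp add: Wn_def)
  have "WP.Frj j n h = WP.Frj j n (\<Sum>w\<in>L.WX n. fscale (h w) (dlt w))"
    using L.W.hom_eq_sum[OF h] by (simp add: Wn_def)
  also have "\<dots> = (\<Sum>w\<in>L.WX n. fscale (h w ^ p ^ j) (WP.Frj j n (dlt w)))" using hd by (rule WP.Frj_sum)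
  also have "\<dots> = (\<Sum>w\<in>L.WX n. fscale (h w ^ p ^ j) (odlt (iterF (wF F) j w)))"
    by (rule sum.cong[OF HOL.refl]) (simp only: Frj_dlt_word)
  finally have eq: "WP.Frj j n h = (\<Sum>w\<in>L.WX n. fscale (h w ^ p ^ j) (odlt (iterF (wF F) j w)))" .
  show ?thesis
  proof (intro iffI ballI impI)
    fix w assume 0: "WP.Frj j n h = 0" and w: "w \<in> L.WX n" "iterF (wF F) j w \<noteq> None"
    then obtain z where z: "iterF (wF F) j w = Some z" by blast
    have "(0::'k) = (\<Sum>v\<in>L.WX n. h v ^ p ^ j * odlt (iterF (wF F) j v) z)"
      using fun_cong[OF eq, of z] 0 by (simp add: sum_fun_app fscale_def)
    also have "\<dots> = (\<Sum>v\<in>L.WX n. if v = w then h w ^ p ^ j else 0)"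
    proof (rule sum.cong[OF HOL.refl])
      fix v
      show "h v ^ p ^ j * odlt (iterF (wF F) j v) z = (if v = w then h w ^ p ^ j else 0)"
        using iterF_inj[where f = "wF F" and j = j and x = v and y = w and z = z, OF AD.wF_inj] z by (cases "iterF (wF F) j v") (auto simp: dlt_def)
    qed
    also have "\<dots> = h w ^ p ^ j" using w(1) by simp
    finally show "h w = 0" by simp
  next
    assume *: "\<forall>w\<in>L.WX n. iterF (wF F) j w \<noteq> None \<longrightarrow> h w = 0"
    have "fscale (h w ^ p ^ j) (odlt (iterF (wF F) j w)) = 0" if "w \<in> L.WX n" for w
      using * that A.p_gt_1 by (cases "iterF (wF F) j w") (auto simp: fscale_def fun_eq_iff power_0_left)
    then show "WP.Frj j n h = 0" unfolding eq by (rule sum.neutral[rule_format])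
  qed
qed

end

lemma dlt_independent:
  fixes c :: "'i \<Rightarrow> 'k::field"
  assumes "(\<Sum>x\<in>A. fscale (c x) (dlt x)) = 0" "x \<in> A" "finite A"
  shows "c x = 0"
  using fun_cong[OF assms(1), of x] sum_dlt[OF assms(3,2), of c] by (simp add: sum_fun_app fscale_def)

lemma card_le_of_independent:
  fixes k :: "'i \<Rightarrow> 'j \<Rightarrow> 'k::field"
  assumes fin: "finite K" "finite L"
    and supp: "\<And>i w. i \<in> K \<Longrightarrow> w \<notin> L \<Longrightarrow> k i w = 0"
    and ind: "\<And>c i. (\<Sum>i\<in>K. fscale (c i) (k i)) = 0 \<Longrightarrow> i \<in> K \<Longrightarrow> c i = 0"
  shows "card K \<le> card L"
proof -
  have inj: "inj_on k K"
  proof (rule inj_onI, rule ccontr)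
    fix i i' assume i: "i \<in> K" "i' \<in> K" "k i = k i'" "i \<noteq> i'"
    let ?c = "\<lambda>l. if l = i then 1 else if l = i' then - 1 else (0::'k)"
    have "(\<Sum>l\<in>K. fscale (?c l) (k l)) = (\<Sum>l\<in>{i, i'}. fscale (?c l) (k l))"
      using i fin(1) by (intro sum.mono_neutral_right) (auto simp: fscale_def fun_eq_iff)
    also have "\<dots> = 0" using i by (simp add: fscale_def fun_eq_iff)
    finally show False using ind[of ?c i] i(1) by simp
  qed
  have "fs.independent (k ` K)"
  proof (rule fs.independent_if_scalars_zero)
    fix c x assume "(\<Sum>x\<in>k ` K. fscale (c x) x) = 0" "x \<in> k ` K"
    then show "c x = 0" using ind[of "\<lambda>i. c (k i)"] by (auto simp: sum.reindex[OF inj] simp del: zero_fun_apply)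
  qed (use fin in simp)
  moreover have "k ` K \<subseteq> fs.span (dlt ` L)"
  proof (rule image_subsetI)
    fix i assume i: "i \<in> K"
    have "k i = (\<Sum>w\<in>L. fscale (k i w) (dlt w))"
    proof
      fix z
      have "(\<Sum>w\<in>L. k i w * dlt w z) = k i z"
      proof (cases "z \<in> L")
        case False
        then have "(\<Sum>w\<in>L. k i w * dlt w z) = 0" by (intro sum.neutral) (auto simp: dlt_def)
        then show ?thesis using supp[OF i False] by simp
      qed (rule sum_dlt[OF fin(2)])
      then show "k i z = (\<Sum>w\<in>L. fscale (k i w) (dlt w)) z" by (simp add: sum_fun_app fscale_def)
    qed
    then show "k i \<in> fs.span (dlt ` L)" by (metis (no_types, lifting) fs.span_sum fs.span_scale fs.span_base imageI)
  qed
  ultimately have "card (k ` K) \<le> card (dlt ` L :: ('j \<Rightarrow> 'k) set)"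
    using fs.independent_span_bound[of "dlt ` L" "k ` K"] fin(2) by simp
  also have "\<dots> \<le> card L" using fin(2) by (rule card_image_le)
  finally show ?thesis using card_image[OF inj] by simp
qed

lemma lin_iso_inverse:
  assumes iso: "lin_iso V W h" and V: "vs V"
  shows "lin_map W V (inv_into (carr V) h)"
proof -
  have h: "lin_map V W h" "inj_on h (carr V)" using iso by (auto simp: lin_iso_def bij_betw_def)
  note inv = lin_iso_inv[OF iso V] and cl = vs_closed[OF V]
  show ?thesis unfolding lin_map_def
  proof (intro conjI ballI allI)
    fix x y assume xy: "x \<in> carr W" "y \<in> carr W"
    have "h (inv_into (carr V) h x + inv_into (carr V) h y) = x + y"
      using h(1) inv xy by (simp add: lin_map_def)
    then show "inv_into (carr V) h (x + y) = inv_into (carr V) h x + inv_into (carr V) h y"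
      using inv_into_f_f[OF h(2), of "inv_into (carr V) h x + inv_into (carr V) h y"] cl(2) inv(1) xy by simp
  next
    fix c x assume x: "x \<in> carr W"
    have "h (smul V c (inv_into (carr V) h x)) = smul W c x" using h(1) inv x by (simp add: lin_map_def)
    then show "inv_into (carr V) h (smul W c x) = smul V c (inv_into (carr V) h x)"
      using inv_into_f_f[OF h(2), of "smul V c (inv_into (carr V) h x)"] cl(3) inv(1) x by simp
  qed (rule inv(1))
qed

section \<open>Frobenius kernels compared through a coalgebra isomorphism\<close>

locale J_coalg_iso = BC: adapted_coalg C Y deg e a one p F + BD: adapted_coalg D Y' deg' e' a' one' p F'
  for C :: "('k::field, 'c::ab_group_add) gcoalg" and Y :: "'i set" and deg e a one and p and F
    and D :: "('k, 'd::ab_group_add) gcoalg" and Y' :: "'j set" and deg' e' a' one' and F' +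
  fixes g :: "nat \<Rightarrow> ('k, 'c) tensor_alg \<Rightarrow> ('k, 'd) tensor_alg"
  assumes g: "coalgebra_iso (J C) (J D) g"
begin

abbreviation "WC \<equiv> BC.L.WX"
abbreviation "WD \<equiv> BD.L.WX"
abbreviation "homC \<equiv> BC.L.W.hom"
abbreviation "homD \<equiv> BD.L.W.hom"

lemma g_iso: "lin_iso (J_part C n) (J_part D n) (g n)"
  using g by (simp add: coalgebra_iso_def J_def)

lemma g_lin: "lin_map (J_part C n) (J_part D n) (g n)" using g_iso by (simp add: lin_iso_def)

lemma E_C: "w \<in> WC n \<Longrightarrow> BC.E w \<in> carr (J_part C n)" and E_D: "u \<in> WD n \<Longrightarrow> BD.E u \<in> carr (J_part D n)"
  using BC.E_in[of w] BD.E_in[of u] by (auto simp: Wn_def)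

lemma gE: "w \<in> WC n \<Longrightarrow> g n (BC.E w) \<in> carr (J_part D n)" using g_lin E_C by (simp add: lin_map_def)

lemma basis_C: "dual_basis (J_part C n) (WC n) BC.E BC.Ec" and basis_D: "dual_basis (J_part D n) (WD n) BD.E BD.Ec"
  using BC.J_dual_basis BD.J_dual_basis by (simp_all add: Wn_def)

text \<open>The transpose of \<open>g\<close> on functions of words.\<close>

definition T :: "nat \<Rightarrow> ('j list \<Rightarrow> 'k) \<Rightarrow> 'i list \<Rightarrow> 'k" where
  "T n h w = (if w \<in> WC n then \<Sum>u\<in>WD n. BD.Ec u (g n (BC.E w)) * h u else 0)"

lemma T_hom: "homC n (T n h)" by (auto simp: BC.L.W.hom_def T_def Wn_def)

lemma T_sum: "T n (\<Sum>i\<in>I. fscale (c i) (h i)) = (\<Sum>i\<in>I. fscale (c i) (T n (h i)))"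
proof
  fix w
  have "(\<Sum>u\<in>WD n. BD.Ec u (g n (BC.E w)) * (\<Sum>i\<in>I. c i * h i u)) =
      (\<Sum>i\<in>I. c i * (\<Sum>u\<in>WD n. BD.Ec u (g n (BC.E w)) * h i u))"
    unfolding sum_distrib_left by (subst sum.swap) (simp add: mult_ac)
  then show "T n (\<Sum>i\<in>I. fscale (c i) (h i)) w = (\<Sum>i\<in>I. fscale (c i) (T n (h i))) w"
    by (simp add: T_def sum_fun_app fscale_def)
qed

lemma T_0: "T n 0 = 0" by (simp add: T_def fun_eq_iff)

lemma comb_dual_D: "(\<lambda>t. \<Sum>u\<in>U. BD.Ec u t * h u) \<in> dual_space (J_part D n)"
  and comb_dual_C: "(\<lambda>t. \<Sum>w\<in>V. BC.Ec w t * k w) \<in> dual_space (J_part C n)"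
  by (simp_all add: dual_space_iff BD.Ec_lin BC.Ec_lin distrib_right sum.distrib sum_distrib_left mult.assoc)

lemma comb_E_D: "u \<in> WD n \<Longrightarrow> (\<Sum>v\<in>WD n. BD.Ec v (BD.E u) * h v) = h u"
  and comb_E_C: "w \<in> WC n \<Longrightarrow> (\<Sum>v\<in>WC n. BC.Ec v (BC.E w) * k v) = k w"
proof -
  assume u: "u \<in> WD n"
  have "(\<Sum>v\<in>WD n. BD.Ec v (BD.E u) * h v) = (\<Sum>v\<in>WD n. h v * dlt v u)"
    using BD.Ec_E u by (intro sum.cong HOL.refl) (simp add: Wn_def)
  then show "(\<Sum>v\<in>WD n. BD.Ec v (BD.E u) * h v) = h u" using sum_dlt[of "WD n" u h] u by simp
next
  assume w: "w \<in> WC n"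
  have "(\<Sum>v\<in>WC n. BC.Ec v (BC.E w) * k v) = (\<Sum>v\<in>WC n. k v * dlt v w)"
    using BC.Ec_E w by (intro sum.cong HOL.refl) (simp add: Wn_def)
  then show "(\<Sum>v\<in>WC n. BC.Ec v (BC.E w) * k v) = k w" using sum_dlt[of "WC n" w k] w by simp
qed

lemma T_inj:
  assumes h: "homD n h" and T: "T n h = 0"
  shows "h = 0"
proof
  fix u
  show "h u = 0 u"
  proof (cases "u \<in> WD n")
    case True
    let ?\<kappa> = "\<lambda>t. \<Sum>v\<in>WD n. BD.Ec v t * h v"
    let ?s = "inv_into (carr (J_part C n)) (g n) (BD.E u)"
    note s = lin_iso_inv[OF g_iso vs_J_part E_D[OF True]]
    have "?\<kappa> \<circ> g n \<in> dual_space (J_part C n)"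
      using comb_dual_D[where U = "WD n" and h = h and n = n] g_lin[of n] by (simp add: dual_space_iff lin_map_def)
    then have "?\<kappa> (g n ?s) = (\<Sum>w\<in>WC n. BC.Ec w ?s * ?\<kappa> (g n (BC.E w)))"
      using dual_basis_functional[OF basis_C _ s(1), of "?\<kappa> \<circ> g n"] by simp
    also have "\<dots> = (\<Sum>w\<in>WC n. BC.Ec w ?s * T n h w)" by (simp add: T_def)
    also have "\<dots> = 0" unfolding T by simp
    finally show ?thesis using comb_E_D[OF True, where h = h] s(2) by simp
  next
    case False
    then show ?thesis using h by (auto simp: BD.L.W.hom_def Wn_def)
  qed
qed

lemma T_surj:
  assumes k: "homC n k"
  shows "\<exists>h. homD n h \<and> T n h = k"
proof -
  let ?\<kappa> = "\<lambda>t. \<Sum>w\<in>WC n. BC.Ec w t * k w" and ?g = "inv_into (carr (J_part C n)) (g n)"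
  define h where "h u = (if u \<in> WD n then ?\<kappa> (?g (BD.E u)) else 0)" for u
  have "T n h w = k w" for w
  proof (cases "w \<in> WC n")
    case True
    have "?\<kappa> \<circ> ?g \<in> dual_space (J_part D n)"
      using comb_dual_C[where V = "WC n" and k = k and n = n] lin_iso_inverse[OF g_iso vs_J_part, of n] by (simp add: dual_space_iff lin_map_def)
    then have "?\<kappa> (?g (g n (BC.E w))) = (\<Sum>u\<in>WD n. BD.Ec u (g n (BC.E w)) * ?\<kappa> (?g (BD.E u)))"
      using dual_basis_functional[OF basis_D _ gE[OF True], of "?\<kappa> \<circ> ?g"] by simp
    moreover have "?g (g n (BC.E w)) = BC.E w"
      using g_iso[of n] E_C[OF True] by (intro inv_into_f_f) (auto simp: lin_iso_def bij_betw_def)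
    ultimately show ?thesis using comb_E_C[OF True, where k = k] True by (simp add: T_def h_def)
  next
    case False
    then show ?thesis using k by (auto simp: BC.L.W.hom_def T_def Wn_def)
  qed
  moreover have "homD n h" by (auto simp: BD.L.W.hom_def h_def Wn_def)
  ultimately show ?thesis by blast
qed

text \<open>A product of functions is the evaluation of the coproduct on a product form, and
  \<open>g\<close> commutes with coproducts.\<close>

lemma T_conv:
  assumes f: "homD i f" and k: "homD j k"
  shows "T (i + j) (BD.L.W.conv f k) = BC.L.W.conv (T i f) (T j k)"
proof
  fix w
  let ?\<beta> = "\<lambda>(s, t). (\<Sum>u\<in>WD i. BD.Ec u s * f u) * (\<Sum>u\<in>WD j. BD.Ec u t * k u)"
  let ?\<gamma> = "\<lambda>(s, t). ?\<beta> (g i s, g j t)"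
  have \<beta>: "?\<beta> \<in> bilin_forms (J_part D i) (J_part D j)"
    using comb_dual_D comb_dual_D by (rule bilin_forms_prod)
  have \<gamma>: "?\<gamma> \<in> bilin_forms (J_part C i) (J_part C j)" by (rule BC.bilin_compose[OF \<beta> g_lin g_lin])
  show "T (i + j) (BD.L.W.conv f k) w = BC.L.W.conv (T i f) (T j k) w"
  proof (cases "w \<in> WC (i + j)")
    case True
    have wX: "w \<in> lists BC.L.X" using True by (simp add: Wn_def)
    have convD: "BD.L.W.conv f k u = J_comult D i j (BD.E u) ?\<beta>" if u: "u \<in> WD (i + j)" for u
    proof -
      have uX: "u \<in> lists BD.L.X" using u by (simp add: Wn_def)
      have "BD.bform i j ?\<beta> a b = f a * k b" if ab: "a \<in> lists BD.L.X" "b \<in> lists BD.L.X" for a b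
      proof (cases "wdeg deg' a = i \<and> wdeg deg' b = j")
        case True
        then have "a \<in> WD i" "b \<in> WD j" using ab by (simp_all add: Wn_def)
        then show ?thesis using True comb_E_D[where u = a and n = i and h = f] comb_E_D[where u = b and n = j and h = k] by (simp add: BD.bform_def)
      next
        case False
        then show ?thesis using f k by (auto simp: BD.bform_def BD.L.W.hom_def)
      qed
      then have "BD.L.wc u (BD.bform i j ?\<beta>) = BD.L.wc u (\<lambda>a b. f a * k b)" by (intro BD.L.W.cop_cong) simp
      then show ?thesis using BD.J_comult_E[OF uX, of i j ?\<beta>] \<beta> uX by (simp add: BD.L.W.conv_def)
    qed
    have "T (i + j) (BD.L.W.conv f k) w = (\<Sum>u\<in>WD (i + j). BD.Ec u (g (i + j) (BC.E w)) * J_comult D i j (BD.E u) ?\<beta>)"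
      using True convD by (simp add: T_def)
    also have "\<dots> = J_comult D i j (\<Sum>u\<in>WD (i + j). fscale (BD.Ec u (g (i + j) (BC.E w))) (BD.E u)) ?\<beta>"
      using \<beta> by (simp add: J_comult_def sum_fun_app fscale_def)
    also have "\<dots> = J_comult D i j (g (i + j) (BC.E w)) ?\<beta>"
      using dual_basisD(6)[OF basis_D gE[OF True]] by simp
    also have "\<dots> = tensor_map (J_part D i) (J_part D j) (g i) (g j) (J_comult C i j (BC.E w)) ?\<beta>"
      using g E_C[OF True] unfolding coalgebra_iso_def J_def by simp
    also have "\<dots> = J_comult C i j (BC.E w) ?\<gamma>" using \<beta> by (simp add: tensor_map_def)
    also have "\<dots> = BC.L.wc w (BC.bform i j ?\<gamma>)" using BC.J_comult_E[OF wX, of i j ?\<gamma>] \<gamma> by simp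
    also have "\<dots> = BC.L.wc w (\<lambda>a b. T i f a * T j k b)"
    proof (rule BC.L.W.cop_cong)
      fix a b assume "a \<in> lists BC.L.X" "b \<in> lists BC.L.X"
      then show "BC.bform i j ?\<gamma> a b = T i f a * T j k b" by (simp add: BC.bform_def T_def Wn_def)
    qed
    finally show ?thesis using wX by (simp add: BC.L.W.conv_def)
  next
    case False
    then have "BC.L.W.conv (T i f) (T j k) w = 0"
      using BC.L.W.hom_conv[OF T_hom[of i f] T_hom[of j k]] unfolding BC.L.W.hom_def Wn_def by blast
    then show ?thesis using False by (simp add: T_def)
  qed
qed

lemma T_one: "T 0 (dlt []) = dlt []"
proof -
  have W: "WC 0 = {[]}" "WD 0 = {[]}" by (rule BC.L.WX_0, rule BD.L.WX_0)
  have "g 0 (BC.E []) = (\<Sum>u\<in>WD 0. fscale (BD.Ec u (g 0 (BC.E []))) (BD.E u))"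
    using dual_basisD(6)[OF basis_D[of 0] gE[of "[]" 0]] W by simp
  then have e: "g 0 (BC.E []) = fscale (BD.Ec [] (g 0 (BC.E []))) (BD.E [])" unfolding W by simp
  have "J_counit (g 0 (BC.E [])) = J_counit (BC.E [])"
    using g E_C[of "[]" 0] W unfolding coalgebra_iso_def J_def by simp
  then have "J_counit (fscale (BD.Ec [] (g 0 (BC.E []))) (BD.E [])) = 1" unfolding e[symmetric] by (simp add: BC.J_counit_E)
  moreover have "J_counit (fscale c t) = c * J_counit t" for c and t :: "('k, 'd) tensor_alg"
    by (simp add: J_counit_def fscale_def)
  ultimately have "BD.Ec [] (g 0 (BC.E [])) = 1" by (simp add: BD.J_counit_E)
  then show ?thesis using W by (auto simp: T_def dlt_def fun_eq_iff)
qed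

lemma T_pw: "homD n h \<Longrightarrow> T (m * n) (BD.L.W.pw h m) = BC.L.W.pw (T n h) m"
proof (induction m)
  case (Suc m)
  then show ?case using T_conv[OF Suc.prems BD.L.W.hom_pw[OF Suc.prems, of m]] by simp
qed (simp add: T_one)

lemma T_Frj: "homD n h \<Longrightarrow> T (p ^ j * n) (BD.WP.Frj j n h) = BC.WP.Frj j n (T n h)"
proof (induction j arbitrary: n h)
  case (Suc j)
  have "T (p * n) (BD.WP.Fr n h) = BC.WP.Fr n (T n h)"
    using T_pw[OF Suc.prems, of p] T_0 by (simp add: BD.WP.Fr_def BC.WP.Fr_def)
  then show ?case using Suc.IH[OF BD.WP.hom_Fr[OF Suc.prems]] by (simp add: mult_ac)
qed simp

text \<open>By hypothesis \<open>T\<close> restricts to an isomorphism between the functions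
  supported in \<open>K'\<close> and those supported in \<open>K\<close>; the cardinalities are the
  dimensions.\<close>

lemma card_eq_of_T:
  assumes K: "K \<subseteq> WC n" and K': "K' \<subseteq> WD n"
    and iff: "\<And>h. homD n h \<Longrightarrow> (\<forall>u\<in>WD n - K'. h u = 0) \<longleftrightarrow> (\<forall>w\<in>WC n - K. T n h w = 0)"
  shows "card K = card K'"
proof (rule antisym)
  have fK: "finite K" "finite K'" using K K' by (auto intro: finite_subset)
  have dC: "homC n (dlt w :: _ \<Rightarrow> 'k)" if "w \<in> WC n" for w using BC.L.W.hom_dlt[of w] that by (simp add: Wn_def)
  have dD: "homD n (dlt u :: _ \<Rightarrow> 'k)" if "u \<in> WD n" for u using BD.L.W.hom_dlt[of u] that by (simp add: Wn_def)
  show "card K' \<le> card K"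
  proof (rule card_le_of_independent[where k = "\<lambda>u. T n (dlt u)"])
    show "T n (dlt u) w = 0" if "u \<in> K'" "w \<notin> K" for u w
    proof (cases "w \<in> WC n")
      case True
      have "\<forall>v\<in>WD n - K'. dlt u v = (0::'k)" using that(1) by (auto simp: dlt_def)
      then show ?thesis using iffD1[OF iff[OF dD[OF subsetD[OF K' that(1)]]]] that(2) True by blast
    qed (simp add: T_def)
    show "c u = 0" if c: "(\<Sum>u\<in>K'. fscale (c u) (T n (dlt u))) = 0" and u: "u \<in> K'" for c u
    proof -
      have "homD n (\<Sum>u\<in>K'. fscale (c u) (dlt u))" using dD K' by (intro BD.L.W.hom_sum BD.L.W.hom_scale) blast
      moreover have "T n (\<Sum>u\<in>K'. fscale (c u) (dlt u)) = 0" using c by (simp only: T_sum)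
      ultimately have "(\<Sum>u\<in>K'. fscale (c u) (dlt u)) = 0" by (rule T_inj)
      then show ?thesis using u fK(2) by (rule dlt_independent)
    qed
  qed (use fK in auto)
  have "\<forall>w. \<exists>h. w \<in> K \<longrightarrow> homD n h \<and> T n h = dlt w" using T_surj dC K by blast
  then obtain h where h: "\<And>w. w \<in> K \<Longrightarrow> homD n (h w)" "\<And>w. w \<in> K \<Longrightarrow> T n (h w) = dlt w" by metis
  show "card K \<le> card K'"
  proof (rule card_le_of_independent[where k = h])
    show "h w u = 0" if "w \<in> K" "u \<notin> K'" for u w
    proof (cases "u \<in> WD n")
      case True
      have "\<forall>v\<in>WC n - K. T n (h w) v = 0" using that(1) h(2) by (auto simp: dlt_def)
      then show ?thesis using iffD2[OF iff[OF h(1)[OF that(1)]]] that(2) True by blast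
    next
      case False
      then show ?thesis using h(1)[OF that(1)] by (auto simp: BD.L.W.hom_def Wn_def)
    qed
    show "c w = 0" if c: "(\<Sum>w\<in>K. fscale (c w) (h w)) = 0" and w: "w \<in> K" for c w
    proof -
      have "(\<Sum>w\<in>K. fscale (c w) (dlt w)) = (\<Sum>w\<in>K. fscale (c w) (T n (h w)))" using h(2) by simp
      also have "\<dots> = T n (\<Sum>w\<in>K. fscale (c w) (h w))" by (simp only: T_sum)
      also have "\<dots> = 0" unfolding c by (rule T_0)
      finally show ?thesis using w fK(1) by (rule dlt_independent)
    qed
  qed (use fK in auto)
qed

text \<open>\<open>T\<close> commutes with the iterates of the Frobenius map, so it matches their
  kernels. By \<open>Frj_eq_0_iff\<close> these consist of the functions supported on words where
  the iterate of \<open>wF\<close> is undefined; complements give the claim.\<close>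

lemma word_count_eq:
  "card {w\<in>WC n. iterF (wF F) j w \<noteq> None} = card {u\<in>WD n. iterF (wF F') j u \<noteq> None}"
proof -
  let ?K = "{w\<in>WC n. iterF (wF F) j w = None}" and ?K' = "{u\<in>WD n. iterF (wF F') j u = None}"
  have "card (WC n) = card (WD n)" by (rule card_eq_of_T[of _ n]) auto
  moreover have "card ?K = card ?K'"
  proof (rule card_eq_of_T[of _ n])
    fix h assume h: "homD n h"
    have "(\<forall>u\<in>WD n - ?K'. h u = 0) \<longleftrightarrow> BD.WP.Frj j n h = 0" using BD.Frj_eq_0_iff[OF h] by auto
    also have "\<dots> \<longleftrightarrow> T (p ^ j * n) (BD.WP.Frj j n h) = 0" using T_inj[OF BD.WP.hom_Frj[OF h]] T_0 by metis
    also have "\<dots> \<longleftrightarrow> (\<forall>w\<in>WC n - ?K. T n h w = 0)" unfolding T_Frj[OF h] using BC.Frj_eq_0_iff[OF T_hom] by auto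
    finally show "(\<forall>u\<in>WD n - ?K'. h u = 0) \<longleftrightarrow> (\<forall>w\<in>WC n - ?K. T n h w = 0)" .
  qed auto
  moreover have "{w\<in>WC n. iterF (wF F) j w \<noteq> None} = WC n - ?K" "{u\<in>WD n. iterF (wF F') j u \<noteq> None} = WD n - ?K'"
    by auto
  ultimately show ?thesis by (simp add: card_Diff_subset)
qed

lemma X_pos: "x \<in> BC.L.X \<Longrightarrow> deg x > 0" "y \<in> BD.L.X \<Longrightarrow> deg' y > 0"
proof -
  show "x \<in> BC.L.X \<Longrightarrow> deg x > 0" using BC.one_unique[of x] unfolding BC.L.X_def by blast
  show "y \<in> BD.L.X \<Longrightarrow> deg' y > 0" using BD.one_unique[of y] unfolding BD.L.X_def by blast
qed

lemma finite_X: "finite {x\<in>BC.L.X. deg x = n}" "finite {x\<in>BD.L.X. deg' x = n}"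
  unfolding BC.L.X_def BD.L.X_def
  by (rule finite_subset[OF _ dual_basisD(2)[OF BC.db[of n]]], blast,
    rule finite_subset[OF _ dual_basisD(2)[OF BD.db[of n]]], blast)

text \<open>An iterate of \<open>wF\<close> is defined on a word iff that of \<open>F\<close> is
  defined on all its letters, so the words just counted are all words over the alphabet
  \<open>?Z\<close>.\<close>

lemma letter_count_eq:
  "card {x\<in>BC.L.X. deg x = n \<and> iterF F j x \<noteq> None} = card {x\<in>BD.L.X. deg' x = n \<and> iterF F' j x \<noteq> None}"
proof -
  let ?Z = "{x\<in>BC.L.X. iterF F j x \<noteq> None}" and ?Z' = "{x\<in>BD.L.X. iterF F' j x \<noteq> None}"
  have W: "{w\<in>lists ?Z. wdeg deg w = n} = {w\<in>WC n. iterF (wF F) j w \<noteq> None}"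
    "{u\<in>lists ?Z'. wdeg deg' u = n} = {u\<in>WD n. iterF (wF F') j u \<noteq> None}" for n
    unfolding iterF_wF Wn_def by auto
  have "card {x\<in>?Z. deg x = n} = card {x\<in>?Z'. deg' x = n}"
  proof (rule letters_count_eq)
    show "finite {w\<in>lists ?Z. wdeg deg w = m}" "finite {u\<in>lists ?Z'. wdeg deg' u = m}"
      "card {w\<in>lists ?Z. wdeg deg w = m} = card {u\<in>lists ?Z'. wdeg deg' u = m}" for m
      unfolding W using word_count_eq[of m] by simp_all
    show "finite {x\<in>?Z. deg x = m}" "finite {x\<in>?Z'. deg' x = m}" for m
      by (rule finite_subset[OF _ finite_X(1)[of m]], blast, rule finite_subset[OF _ finite_X(2)[of m]], blast)
  qed (use X_pos in auto)
  moreover have "{x\<in>?Z. deg x = n} = {x\<in>BC.L.X. deg x = n \<and> iterF F j x \<noteq> None}"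
    "{x\<in>?Z'. deg' x = n} = {x\<in>BD.L.X. deg' x = n \<and> iterF F' j x \<noteq> None}" by auto
  ultimately show ?thesis by (simp only:)
qed

lemma letter_matching:
  "\<exists>\<gamma>. bij_betw \<gamma> BC.L.X BD.L.X \<and> (\<forall>x\<in>BC.L.X. deg' (\<gamma> x) = deg x \<and> F' (\<gamma> x) = map_option \<gamma> (F x))"
  by (rule partial_injection_matching[OF BC.A.p_gt_1 X_pos finite_X _ _ BC.AD.F_inj BD.AD.F_inj letter_count_eq])
    (use BC.AD.F_dom BD.AD.F_dom in blast)+

end

text \<open>In adapted coordinates \<open>V\<close> is, up to \<open>p\<close>-th roots, the
  transpose of \<open>F\<close>.\<close>

lemma (in adapted_coalg) a_V:
  assumes n: "good p n" "n > 0" and x: "x \<in> Yd n" and c: "c \<in> cpart G (p * n)"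
  shows "a x (verschiebung G p n c) ^ p = (\<Sum>y\<in>Yd (p * n). a y c * odlt (F x) y)"
proof -
  have ax: "a x \<in> dual_space (P n)" using a_in[of x] x by simp
  have "x \<in> L.X" using x n(2) one_Y(2) unfolding L.X_def by auto
  then have "L.pw (dlt x) p = odlt (F x)" using AD.F_pw x n(1) by simp
  then show ?thesis using V_spec(2)[OF n(1) c ax] dual_power_expand[OF ax c] restr_a[OF x] by simp
qed

lemma lin_iso_of_bases:
  assumes V: "dual_basis V I e a" and W: "dual_basis W I' e' a'" and \<gamma>: "bij_betw \<gamma> I I'"
  defines "f \<equiv> \<lambda>c. \<Sum>i\<in>I. smul W (a i c) (e' (\<gamma> i))"
  shows "lin_iso V W f" "i \<in> I \<Longrightarrow> a' (\<gamma> i) (f c) = a i c"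
proof -
  note v = dual_basisD[OF V] and w = dual_basisD[OF W]
  interpret w: vector_space "smul W" using w(1) by (simp add: vs_def)
  have \<gamma>I: "\<gamma> i \<in> I'" if "i \<in> I" for i using \<gamma> that by (auto simp: bij_betw_def)
  have f_in: "f c \<in> carr W" for c unfolding f_def using w(3) \<gamma>I by (intro vs_closed(3,4)[OF w(1)]) auto
  show coord: "a' (\<gamma> i) (f c) = a i c" if i: "i \<in> I" for i c
  proof -
    have "a' (\<gamma> i) (f c) = (\<Sum>l\<in>I. a l c * a' (\<gamma> i) (e' (\<gamma> l)))"
      unfolding f_def using w(3) \<gamma>I by (intro dual_sum[OF w(1) w(4)[OF \<gamma>I[OF i]]]) auto
    also have "\<dots> = (\<Sum>l\<in>I. if l = i then a i c else 0)"
      using w(5) \<gamma>I \<gamma> i by (intro sum.cong HOL.refl) (auto simp: bij_betw_def inj_on_def)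
    also have "\<dots> = a i c" using v(2) i by simp
    finally show ?thesis .
  qed
  have a: "\<And>i x y. i \<in> I \<Longrightarrow> x \<in> carr V \<Longrightarrow> y \<in> carr V \<Longrightarrow> a i (x + y) = a i x + a i y"
    "\<And>i k x. i \<in> I \<Longrightarrow> x \<in> carr V \<Longrightarrow> a i (smul V k x) = k * a i x"
    using v(4) by (simp_all add: dual_space_iff)
  have "lin_map V W f" unfolding lin_map_def
  proof (intro conjI ballI allI f_in)
    show "f (x + y) = f x + f y" if "x \<in> carr V" "y \<in> carr V" for x y
      unfolding f_def using a(1)[OF _ that] by (simp add: w.scale_left_distrib sum.distrib)
    show "f (smul V k x) = smul W k (f x)" if "x \<in> carr V" for k x
      unfolding f_def using a(2)[OF _ that] by (simp add: w.scale_sum_right)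
  qed
  moreover have "inj_on f (carr V)"
  proof (rule inj_onI)
    fix x y assume xy: "x \<in> carr V" "y \<in> carr V" "f x = f y"
    then have "a i x = a i y" if "i \<in> I" for i using coord[OF that, of x] coord[OF that, of y] by simp
    then have "(\<Sum>i\<in>I. smul V (a i x) (e i)) = (\<Sum>i\<in>I. smul V (a i y) (e i))" by simp
    then show "x = y" using v(6) xy(1,2) by simp
  qed
  moreover have "y \<in> f ` carr V" if y: "y \<in> carr W" for y
  proof -
    let ?c = "\<Sum>i\<in>I. smul V (a' (\<gamma> i) y) (e i)"
    have c: "?c \<in> carr V" using v(3) by (intro vs_closed(3,4)[OF v(1)]) auto
    have "a i ?c = a' (\<gamma> i) y" if i: "i \<in> I" for i
    proof -
      have "a i ?c = (\<Sum>l\<in>I. a' (\<gamma> l) y * a i (e l))" using v(3) by (intro dual_sum[OF v(1) v(4)[OF i]])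
      also have "\<dots> = (\<Sum>l\<in>I. if l = i then a' (\<gamma> i) y else 0)" using v(5) i by (intro sum.cong HOL.refl) auto
      finally show ?thesis using v(2) i by simp
    qed
    then have "f ?c = (\<Sum>i\<in>I. smul W (a' (\<gamma> i) y) (e' (\<gamma> i)))" unfolding f_def by simp
    also have "\<dots> = (\<Sum>i\<in>I'. smul W (a' i y) (e' i))" by (rule sum.reindex_bij_betw[OF \<gamma>])
    also have "\<dots> = y" by (rule w(6)[OF y])
    finally show ?thesis using c by (intro image_eqI[of _ _ ?c]) (rule sym)
  qed
  ultimately show "lin_iso V W f" using f_in by (auto simp: lin_iso_def bij_betw_def)
qed

text \<open>The bijection of letters intertwines \<open>F\<close> and \<open>F'\<close>, which
  determine \<open>V\<close> by \<open>a_V\<close>; so the linear map that sends basis elements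
  along it commutes with \<open>V\<close>.\<close>

theorem (in J_coalg_iso) v_module_isomorphic_of_J:
  "v_module_isomorphic p (positive_part C p) (positive_part D p)"
proof -
  obtain \<gamma> where \<gamma>: "bij_betw \<gamma> BC.L.X BD.L.X" "\<And>x. x \<in> BC.L.X \<Longrightarrow> deg' (\<gamma> x) = deg x"
    "\<And>x. x \<in> BC.L.X \<Longrightarrow> F' (\<gamma> x) = map_option \<gamma> (F x)"
    using letter_matching by blast
  have Yd: "BC.Yd n = {x\<in>BC.L.X. deg x = n}" "BD.Yd n = {x\<in>BD.L.X. deg' x = n}" if "n > 0" for n
    using that BC.one_Y BD.one_Y unfolding BC.L.X_def BD.L.X_def by auto
  have bij: "bij_betw \<gamma> (BC.Yd n) (BD.Yd n)" if n: "n > 0" for n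
    unfolding bij_betw_def Yd[OF n]
  proof (intro conjI subset_antisym subsetI)
    show "inj_on \<gamma> {x\<in>BC.L.X. deg x = n}" using \<gamma>(1) by (auto simp: bij_betw_def inj_on_def)
    fix y assume y: "y \<in> {x\<in>BD.L.X. deg' x = n}"
    then obtain x where "x \<in> BC.L.X" "y = \<gamma> x" using \<gamma>(1) by (auto simp: bij_betw_def)
    then show "y \<in> \<gamma> ` {x\<in>BC.L.X. deg x = n}" using y \<gamma>(2) by auto
  qed (use \<gamma>(1,2) in \<open>auto simp: bij_betw_def\<close>)
  \<comment> \<open>In degree \<open>0\<close> the V-module is \<open>{0}\<close> although the
    coalgebra is not, hence the separate value.\<close>
  define f where "f n c = (if n = 0 then 0 else \<Sum>x\<in>BC.Yd n. smul (part D n) (a x c) (e' (\<gamma> x)))" for n c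
  have iso: "lin_iso (part C n) (part D n) (f n)" and coord: "x \<in> BC.Yd n \<Longrightarrow> a' (\<gamma> x) (f n c) = a x c"
    if "n > 0" for n x c
    using lin_iso_of_bases[OF BC.db BD.db bij[OF that]] that unfolding f_def by simp_all
  have f_in: "f n c \<in> cpart D n" if "n > 0" "c \<in> cpart C n" for n c
    using iso[OF that(1)] that(2) by (simp add: lin_iso_def lin_map_def)
  have V: "f n (verschiebung C p n c) = verschiebung D p n (f (p * n) c)"
    if n: "good p n" "n > 0" and c: "c \<in> cpart C (p * n)" for n c
  proof -
    have pn: "p * n > 0" using n(2) BC.A.p_gt_1 by simp
    note fc = f_in[OF pn c]
    have "a' (\<gamma> x) (f n (verschiebung C p n c)) = a' (\<gamma> x) (verschiebung D p n (f (p * n) c))" if x: "x \<in> BC.Yd n" for x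
    proof (rule BC.pth_power_inj)
      have xX: "x \<in> BC.L.X" using x Yd(1)[OF n(2)] by blast
      have gx: "\<gamma> x \<in> BD.Yd n" using bij[OF n(2)] x unfolding bij_betw_def by blast
      have "odlt (F' (\<gamma> x)) (\<gamma> z) = (odlt (F x) z :: 'k)" if z: "z \<in> BC.Yd (p * n)" for z
      proof (cases "F x")
        case (Some y)
        have "y \<in> BC.L.X" "z \<in> BC.L.X" using BC.AD.F_dom[OF Some] z Yd(1)[OF pn] by blast+
        then have "\<gamma> z = \<gamma> y \<longleftrightarrow> z = y" using \<gamma>(1) by (auto simp: bij_betw_def inj_on_def)
        then show ?thesis using \<gamma>(3)[OF xX] Some by (simp add: dlt_def)
      qed (simp add: \<gamma>(3)[OF xX])
      then have "(\<Sum>z\<in>BC.Yd (p * n). a z c * odlt (F x) z) =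
          (\<Sum>z\<in>BC.Yd (p * n). a' (\<gamma> z) (f (p * n) c) * odlt (F' (\<gamma> x)) (\<gamma> z))"
        using coord[OF pn] by (intro sum.cong HOL.refl) (simp only:)
      also have "\<dots> = (\<Sum>y\<in>BD.Yd (p * n). a' y (f (p * n) c) * odlt (F' (\<gamma> x)) y)"
        by (rule sum.reindex_bij_betw[OF bij[OF pn]])
      finally show "a' (\<gamma> x) (f n (verschiebung C p n c)) ^ p = a' (\<gamma> x) (verschiebung D p n (f (p * n) c)) ^ p"
        unfolding coord[OF n(2) x] BC.a_V[OF n x c] BD.a_V[OF n gx fc] .
    qed
    moreover have "BD.Yd n = \<gamma> ` BC.Yd n" using bij[OF n(2)] by (simp only: bij_betw_def)
    ultimately have "a' y (f n (verschiebung C p n c)) = a' y (verschiebung D p n (f (p * n) c))" if "y \<in> BD.Yd n" for y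
      using that by (auto simp only: image_iff)
    then have "(\<Sum>y\<in>BD.Yd n. smul (part D n) (a' y (f n (verschiebung C p n c))) (e' y)) =
        (\<Sum>y\<in>BD.Yd n. smul (part D n) (a' y (verschiebung D p n (f (p * n) c))) (e' y))"
      by (intro sum.cong HOL.refl) (simp only:)
    then show ?thesis
      unfolding dual_basisD(6)[OF BD.db f_in[OF n(2) BC.V_spec(1)[OF n(1) c]]] dual_basisD(6)[OF BD.db BD.V_spec(1)[OF n(1) fc]] .
  qed
  note vm = BC.v_module_positive_part BD.v_module_positive_part
  have "v_module_iso p (positive_part C p) (positive_part D p) f"
    unfolding v_module_iso_def
  proof (intro conjI allI impI ballI)
    fix n
    show "lin_iso (vpart (positive_part C p) n) (vpart (positive_part D p) n) (f n)"
    proof (cases "n = 0")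
      case True
      interpret d: vector_space "smul (part D 0)" using dual_basisD(1)[OF BD.db[of 0]] by (simp add: vs_def)
      have "0 \<in> cpart C 0" by (rule vs_closed(1)[OF dual_basisD(1)[OF BC.db]])
      then show ?thesis using True by (auto simp: lin_iso_def lin_map_def positive_part_def f_def bij_betw_def)
    next
      case False
      then show ?thesis using iso by (simp add: positive_part_def)
    qed
  next
    fix n c assume n: "v_degree p n" and c: "c \<in> carr (vpart (positive_part C p) (p * n))"
    show "f n (vmap (positive_part C p) n c) = vmap (positive_part D p) n (f (p * n) c)"
    proof (cases "n = 0")
      case True
      have "0 \<in> carr (vpart (positive_part D p) (p * 0))" "v_degree p 0"
        by (simp_all add: positive_part_def v_degree_def)
      then have "vmap (positive_part D p) 0 0 \<in> carr (vpart (positive_part D p) 0)"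
        using vm(2) unfolding v_module_def by blast
      then show ?thesis using True by (simp add: positive_part_def f_def)
    next
      case False
      then show ?thesis using V[of n c] n c BC.A.p_gt_1
        by (simp add: positive_part_def v_degree_def good_def)
    qed
  qed
  then show ?thesis using vm unfolding v_module_isomorphic_def by blast
qed

theorem theorem1p12:
  fixes C :: "('k::field, 'c::ab_group_add) gcoalg"
    and D :: "('k, 'd::ab_group_add) gcoalg"
    and p :: nat
  assumes char: "CHAR('k) = p" "p > 0"
    and perfect: "\<forall>x::'k. \<exists>y. y ^ p = x"
    and C: "graded_coalgebra C" "cocommutative C" "connected_coalgebra C"
    and D: "graded_coalgebra D" "cocommutative D" "connected_coalgebra D"
  shows "(v_module_isomorphic p (positive_part C p) (positive_part D p) \<longleftrightarrow>
            coalgebra_isomorphic (J C) (J D)) \<and>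
         (coalgebra_isomorphic (J C) (J D) \<longleftrightarrow> hopf_isomorphic (J C) (J D))"
proof -
  \<comment> \<open>A nonzero characteristic of a field is prime.\<close>
  have p: "prime p" using prime_CHAR_semidom[where 'a = 'k] char by simp
  obtain Y :: "(nat \<times> (nat \<times> 'c \<Rightarrow> 'k)) set" and e a one F where AC: "adapted_coalg C Y fst e a one p F"
    using exists_adapted_coalg[OF C char(1) p spec[OF perfect]] by blast
  obtain Y' :: "(nat \<times> (nat \<times> 'd \<Rightarrow> 'k)) set" and e' a' one' F' where AD: "adapted_coalg D Y' fst e' a' one' p F'"
    using exists_adapted_coalg[OF D char(1) p spec[OF perfect]] by blast
  have "hopf_isomorphic (J C) (J D)" if "v_module_isomorphic p (positive_part C p) (positive_part D p)"
    using that adapted_coalg.hopf_isomorphic_of_V[OF AD C] unfolding v_module_isomorphic_def by blast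
  moreover have "coalgebra_isomorphic (J C) (J D)" if "hopf_isomorphic (J C) (J D)"
    using that unfolding hopf_isomorphic_def coalgebra_isomorphic_def hopf_iso_def by blast
  moreover have "v_module_isomorphic p (positive_part C p) (positive_part D p)"
    if iso: "coalgebra_isomorphic (J C) (J D)"
  proof -
    obtain g where "coalgebra_iso (J C) (J D) g" using iso unfolding coalgebra_isomorphic_def by blast
    then have "J_coalg_iso C Y fst e a one p F D Y' fst e' a' one' F' g"
      using AC AD by (simp add: J_coalg_iso_def J_coalg_iso_axioms_def)
    then show ?thesis by (rule J_coalg_iso.v_module_isomorphic_of_J)
  qed
  ultimately show ?thesis by blast
qed

end
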